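(* Let $\Omega,T,u_{\rm ini},f,q^I,q^P,\vec v$ satisfy the data assumptions listed in the context. Then any weak solution $\bar u$ of the linear advection problem satisfies $$\frac12\int_0^T\!\!\int_\Omega\bar u(x,t)^2\,dx\,dt+\frac12\int_0^T(T-t)\int_\Omega\big(q^I(x,t)+q^P(x,t)\big)\bar u(x,t)^2\,dx\,dt$$ $$=\frac T2\int_\Omega u_{\rm ini}(x)^2\,dx+\int_0^T(T-t)\int_\Omega f(x,t)\,q^I(x,t)\,\bar u(x,t)\,dx\,dt.$$
   Context: **Data assumptions.** $\Omega$ is an open bounded connected polyhedral subset of $\mathbb R^d$, $d\ge 1$, $T>0$; $u_{\rm ini}\in L^2(\Omega)$, $f\in L^2(\Omega\times(0,T))$; $q^I,q^P\in L^\infty(\Omega\times(0,T))$ with $q^I\ge0$ and $q^P\ge 0$ a.e.; $\vec v\in W^{1,\infty}(\Omega\times(0,T))^d$ satisfies $\vec v\cdot\boldsymbol n=0$ on $\partial\Omega\times(0,T)$ ($\boldsymbol n$ the outer normal to $\partial\Omega$) and $\operatorname{div}\vec v=q^I-q^P$ a.e. in $\Omega\times(0,T)$ (divergence in space). **Weak solution.** $C^\infty_c(\mathbb R^d\times[0,T))$ is the set of restrictions to $\mathbb R^d\times[0,T)$ of functions of $C^\infty_c(\mathbb R^d\times(-\infty,T))$. A weak solution of the linear advection problem ($\partial_t\bar u+\operatorname{div}(\bar u\vec v)+\bar uq^P=fq^I$, $\bar u(\cdot,0)=u_{\rm ini}$) is a function $\bar u\in L^2(\Omega\times(0,T))$ such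 that for all $\varphi\in C^\infty_c(\mathbb R^d\times[0,T))$ $$-\int_0^T\!\!\int_\Omega\bar u\,\partial_t\varphi\,dx\,dt-\int_\Omega u_{\rm ini}\varphi(\cdot,0)\,dx+\int_0^T\!\!\int_\Omega(-\bar u\,\vec v\cdot\nabla\varphi+\bar u\,q^P\varphi)\,dx\,dt=\int_0^T\!\!\int_\Omega f\,q^I\varphi\,dx\,dt.$$ *)

theory Defs
  imports "HOL-Analysis.Analysis"
begin

text \<open>Space-time is \<open>'a \<times> real\<close> with \<open>'a\<close> a Euclidean space; functions of \<open>(x, t)\<close> take pairs.\<close>

definition pderiv_dir :: "'b::real_normed_vector \<Rightarrow> ('b \<Rightarrow> real) \<Rightarrow> 'b \<Rightarrow> real" where
  "pderiv_dir e \<phi> p = frechet_derivative \<phi> (at p) e"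

primrec Ck :: "nat \<Rightarrow> ('b::euclidean_space \<Rightarrow> real) \<Rightarrow> bool" where
  "Ck 0 \<phi> \<longleftrightarrow> continuous_on UNIV \<phi>"
| "Ck (Suc k) \<phi> \<longleftrightarrow>
     (\<forall>p. \<phi> differentiable (at p)) \<and> (\<forall>e\<in>Basis. Ck k (pderiv_dir e \<phi>))"

definition smooth :: "('b::euclidean_space \<Rightarrow> real) \<Rightarrow> bool" where
  "smooth \<phi> \<longleftrightarrow> (\<forall>k. Ck k \<phi>)"

text \<open>\<open>C\<^sub>c\<^sup>\<infinity>(U)\<close> for open \<open>U\<close>, its elements being extended by zero to the whole space.\<close>

definition test_function :: "'b::euclidean_space set \<Rightarrow> ('b \<Rightarrow> real) \<Rightarrow> bool" where
  "test_function U \<phi> \<longleftrightarrow>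
     smooth \<phi> \<and> compact (closure {p. \<phi> p \<noteq> 0}) \<and> closure {p. \<phi> p \<noteq> 0} \<subseteq> U"

definition dt :: "('a::euclidean_space \<times> real \<Rightarrow> real) \<Rightarrow> 'a \<times> real \<Rightarrow> real" where
  "dt \<phi> = pderiv_dir (0, 1) \<phi>"

definition grad_x :: "('a::euclidean_space \<times> real \<Rightarrow> real) \<Rightarrow> 'a \<times> real \<Rightarrow> 'a" where
  "grad_x \<phi> p = (\<Sum>i\<in>Basis. pderiv_dir (i, 0) \<phi> p *\<^sub>R i)"

text \<open>Functions are total, but only their values almost everywhere on the given set matter.\<close>

definition L2_on :: "'b::euclidean_space set \<Rightarrow> ('b \<Rightarrow> real) \<Rightarrow> bool" where
  "L2_on S g \<longleftrightarrow>
     set_borel_measurable lebesgue S g \<and> set_integrable lebesgue S (\<lambda>p. (g p)\<^sup>2)"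

definition Linf_on :: "'b::euclidean_space set \<Rightarrow> ('b \<Rightarrow> real) \<Rightarrow> bool" where
  "Linf_on S g \<longleftrightarrow>
     set_borel_measurable lebesgue S g \<and> (\<exists>C. AE p\<in>S in lebesgue. \<bar>g p\<bar> \<le> C)"

definition locally_integrable_on :: "'b::euclidean_space set \<Rightarrow> ('b \<Rightarrow> real) \<Rightarrow> bool" where
  "locally_integrable_on S g \<longleftrightarrow>
     (\<forall>K. compact K \<and> K \<subseteq> S \<longrightarrow> set_integrable lebesgue K g)"

definition has_weak_deriv_on ::
  "'b::euclidean_space set \<Rightarrow> 'b \<Rightarrow> ('b \<Rightarrow> real) \<Rightarrow> ('b \<Rightarrow> real) \<Rightarrow> bool" where
  "has_weak_deriv_on S e g h \<longleftrightarrow>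
     locally_integrable_on S g \<and> locally_integrable_on S h \<and>
     (\<forall>\<phi>. test_function S \<phi> \<longrightarrow>
        (LINT p:S|lebesgue. g p * pderiv_dir e \<phi> p) = - (LINT p:S|lebesgue. h p * \<phi> p))"

definition W1inf_on :: "'b::euclidean_space set \<Rightarrow> ('b \<Rightarrow> real) \<Rightarrow> bool" where
  "W1inf_on S g \<longleftrightarrow>
     Linf_on S g \<and> (\<forall>e\<in>Basis. \<exists>h. Linf_on S h \<and> has_weak_deriv_on S e g h)"

definition has_weak_div_on ::
  "('a::euclidean_space \<times> real) set \<Rightarrow> ('a \<times> real \<Rightarrow> 'a) \<Rightarrow> ('a \<times> real \<Rightarrow> real) \<Rightarrow> bool" where
  "has_weak_div_on S v g \<longleftrightarrow>
     (\<exists>h. (\<forall>i\<in>Basis. has_weak_deriv_on S (i, 0) (\<lambda>p. v p \<bullet> i) (h i)) \<and>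
          (AE p\<in>S in lebesgue. (\<Sum>i\<in>Basis. h i p) = g p))"

text \<open>The union of the polytopes need not be convex.  Taking the interior of a closed set
  excludes slits, so that the domain lies on one side of its boundary.\<close>

definition polyhedral_domain :: "'a::euclidean_space set \<Rightarrow> bool" where
  "polyhedral_domain \<Omega> \<longleftrightarrow>
     (\<exists>F. finite F \<and> (\<forall>P\<in>F. polytope P) \<and> \<Omega> = interior (\<Union>F))"

text \<open>For a polyhedral domain the outer normal exists exactly at the boundary points around
  which the domain is a half-space, hence at all boundary points up to a set of zero surface
  measure (edges, vertices).\<close>

definition outer_normal :: "'a::euclidean_space set \<Rightarrow> 'a \<Rightarrow> 'a \<Rightarrow> bool" where
  "outer_normal \<Omega> x n \<longleftrightarrow>
     norm n = 1 \<and> (\<exists>r>0. \<Omega> \<inter> ball x r = {y \<in> ball x r. (y - x) \<bullet> n < 0})"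

text \<open>Trace at a boundary point \<open>p\<close> of an open set: the limit at \<open>p\<close>, from inside, of the
  continuous representative (which every \<open>W\<^sup>1\<^sup>,\<^sup>\<infinity>\<close> function has).\<close>

definition has_trace_at ::
  "'b::euclidean_space set \<Rightarrow> ('b \<Rightarrow> 'c::euclidean_space) \<Rightarrow> 'b \<Rightarrow> 'c \<Rightarrow> bool" where
  "has_trace_at S g p l \<longleftrightarrow>
     (\<exists>w. continuous_on S w \<and> (AE q\<in>S in lebesgue. w q = g q) \<and> (w \<longlongrightarrow> l) (at p within S))"

definition no_normal_flux :: "'a::euclidean_space set \<Rightarrow> real \<Rightarrow> ('a \<times> real \<Rightarrow> 'a) \<Rightarrow> bool" where
  "no_normal_flux \<Omega> T v \<longleftrightarrow>
     (\<forall>x\<in>frontier \<Omega>. \<forall>n. outer_normal \<Omega> x n \<longrightarrow>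
        (\<forall>t\<in>{0<..<T}. \<exists>l. has_trace_at (\<Omega> \<times> {0<..<T}) v (x, t) l \<and> l \<bullet> n = 0))"

text \<open>The test functions are those of \<open>C\<^sub>c\<^sup>\<infinity>(\<real>\<^sup>d \<times> (-\<infinity>, T))\<close>; only their restrictions to
  \<open>\<real>\<^sup>d \<times> [0, T)\<close> enter the identity.\<close>

definition weak_solution ::
  "'a::euclidean_space set \<Rightarrow> real \<Rightarrow> ('a \<Rightarrow> real) \<Rightarrow> ('a \<times> real \<Rightarrow> real) \<Rightarrow>
   ('a \<times> real \<Rightarrow> real) \<Rightarrow> ('a \<times> real \<Rightarrow> real) \<Rightarrow> ('a \<times> real \<Rightarrow> 'a) \<Rightarrow>
   ('a \<times> real \<Rightarrow> real) \<Rightarrow> bool" where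
  "weak_solution \<Omega> T u_ini f qI qP v u \<longleftrightarrow>
     L2_on (\<Omega> \<times> {0<..<T}) u \<and>
     (\<forall>\<phi>. test_function (UNIV \<times> {..<T}) \<phi> \<longrightarrow>
        - (LINT t:{0<..<T}|lebesgue. LINT x:\<Omega>|lebesgue. u (x, t) * dt \<phi> (x, t))
        - (LINT x:\<Omega>|lebesgue. u_ini x * \<phi> (x, 0))
        + (LINT t:{0<..<T}|lebesgue. LINT x:\<Omega>|lebesgue.
             - (u (x, t) * (v (x, t) \<bullet> grad_x \<phi> (x, t))) + u (x, t) * qP (x, t) * \<phi> (x, t))
        = (LINT t:{0<..<T}|lebesgue. LINT x:\<Omega>|lebesgue. f (x, t) * qI (x, t) * \<phi> (x, t)))"

end

theory Submission
  imports Defs "HOL-Computational_Algebra.Polynomial"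
begin

text \<open>The solution is renormalised. For a bounded $\beta$ with bounded Lipschitz derivative, mollifying the equation
  in space only gives, for every $x$, an ordinary differential equation in time, to which the chain rule
  applies; the commutator of mollification with $\vec v\cdot\nabla$ tends to zero in $L^1$ because $\vec v$ is Lipschitz.
  This yields the identity for $\beta(\bar u)$ tested with $(T-t)\zeta(x)$ and $\zeta$ compactly supported in $\Omega$. The
  support condition on $\zeta$ is then removed: near a flat boundary point a cutoff at distance $\epsilon$ costs
  $\int |\beta(\bar u)|\,|\vec v\cdot\boldsymbol n|/\epsilon$ over a strip of measure $O(\epsilon)$, which vanishes since
  $\vec v\cdot\boldsymbol n\to 0$, and the remaining boundary points lie on finitely many planes of codimension two,
  for which the boundedness of $\beta$ suffices. With $\zeta=1$, finally let
  $\beta(s)=s^2/(1+s^2/m)$ increase to $s^2$.\<close>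

subsection \<open>Smooth bump functions\<close>

text \<open>The boundary forces \<beta> to be bounded. A cutoff at distance \<epsilon> has gradient
  1/\<epsilon>, and nothing bounds the mean of u^2 over a strip of width \<epsilon> when u is only
  square integrable; for bounded \<beta>(u) the measure of the strip decides alone. Mollifying in
  space only keeps the initial datum: test functions may be nonzero at t = 0, so for each x the
  mollified solution is a primitive started at the mollified datum. The weight T - t arises by
  integrating the renormalised equation once more in time, since no value of u at time T is at hand.
  Inside \<Omega> the velocity enters through its increments along segments, read off from weak
  derivatives, so no continuous representative has to be built. At the boundary the trace is given
  point by point; compactness makes the smallness of the normal velocity uniform on pieces of a face
  away from the edges and from the times 0 and T, and the bound on v covers the short time layers
  left over. Weak derivatives are tested only with product bumps on boxes, which are stable under
  translation and approximate indicators of boxes.\<close>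

definition smooth1 :: "(real \<Rightarrow> real) \<Rightarrow> bool" where
  "smooth1 g \<longleftrightarrow> (\<exists>D. D 0 = g \<and> (\<forall>n x. (D n has_real_derivative D (Suc n) x) (at x)))"

text \<open>Since \<open>smooth1\<close> carries a whole sequence of derivatives, differentiating is
  a shift of the index.\<close>

lemma smooth1_deriv:
  assumes "smooth1 g"
  obtains g' where "smooth1 g'" "\<And>x. (g has_real_derivative g' x) (at x)"
proof -
  obtain D where D: "D 0 = g" "\<forall>n x. (D n has_real_derivative D (Suc n) x) (at x)"
    using assms by (auto simp: smooth1_def)
  have "smooth1 (D 1)"
    unfolding smooth1_def by (rule exI[of _ "\<lambda>n. D (Suc n)"]) (use D in auto)
  then show ?thesis
    using that[of "D 1"] D by (metis One_nat_def)
qed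

lemma smooth1_affine:
  assumes "smooth1 g"
  shows "smooth1 (\<lambda>x. g (a * x + b))"
proof -
  obtain D where D: "D 0 = g" "\<And>n x. (D n has_real_derivative D (Suc n) x) (at x)"
    using assms by (auto simp: smooth1_def)
  have "((\<lambda>x. a ^ n * D n (a * x + b)) has_real_derivative a ^ Suc n * D (Suc n) (a * x + b)) (at x)"
    for n x
    by (auto intro!: derivative_eq_intros DERIV_chain2[OF D(2)])
  then show ?thesis
    unfolding smooth1_def
    by (intro exI[of _ "\<lambda>n x. a ^ n * D n (a * x + b)"]) (auto simp: D(1))
qed

lemma pderiv_dir_eqI:
  "(\<phi> has_derivative \<phi>') (at p) \<Longrightarrow> pderiv_dir e \<phi> p = \<phi>' e"
  unfolding pderiv_dir_def using frechet_derivative_at by metis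

lemma Ck_imp_continuous: "Ck k \<phi> \<Longrightarrow> continuous_on UNIV \<phi>"
  by (cases k) (auto intro!: continuous_at_imp_continuous_on differentiable_imp_continuous_within)

lemma Ck_Suc_imp: "Ck (Suc k) \<phi> \<Longrightarrow> Ck k \<phi>"
proof (induction k arbitrary: \<phi>)
  case 0
  from Ck_imp_continuous[OF this] show ?case by simp
next
  case (Suc k)
  then show ?case unfolding Ck.simps(2)[of "Suc k"] Ck.simps(2)[of k \<phi>] by blast
qed

lemma pderiv_dir_add:
  "\<phi> differentiable at p \<Longrightarrow> \<psi> differentiable at p \<Longrightarrow>
     pderiv_dir e (\<lambda>p. \<phi> p + \<psi> p) p = pderiv_dir e \<phi> p + pderiv_dir e \<psi> p"
  by (rule pderiv_dir_eqI[THEN trans])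
    (auto intro!: derivative_eq_intros simp: frechet_derivative_works pderiv_dir_def)

lemma pderiv_dir_mult:
  "\<phi> differentiable at p \<Longrightarrow> \<psi> differentiable at p \<Longrightarrow>
     pderiv_dir e (\<lambda>p. \<phi> p * \<psi> p) p = \<phi> p * pderiv_dir e \<psi> p + pderiv_dir e \<phi> p * \<psi> p"
  by (rule pderiv_dir_eqI[THEN trans, of _ "\<lambda>h. \<phi> p * frechet_derivative \<psi> (at p) h + frechet_derivative \<phi> (at p) h * \<psi> p"])
    (auto intro!: has_derivative_mult simp: frechet_derivative_works[symmetric] pderiv_dir_def)

lemma Ck_add: "Ck k \<phi> \<Longrightarrow> Ck k \<psi> \<Longrightarrow> Ck k (\<lambda>p. \<phi> p + \<psi> p)"
proof (induction k arbitrary: \<phi> \<psi>)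
  case (Suc k)
  then have "pderiv_dir e (\<lambda>p. \<phi> p + \<psi> p) = (\<lambda>p. pderiv_dir e \<phi> p + pderiv_dir e \<psi> p)" for e
    by (auto simp: pderiv_dir_add)
  with Suc show ?case by auto
qed (auto intro: continuous_intros)

lemma Ck_mult: "Ck k \<phi> \<Longrightarrow> Ck k \<psi> \<Longrightarrow> Ck k (\<lambda>p. \<phi> p * \<psi> p)"
proof (induction k arbitrary: \<phi> \<psi>)
  case (Suc k)
  then have "pderiv_dir e (\<lambda>p. \<phi> p * \<psi> p) = (\<lambda>p. \<phi> p * pderiv_dir e \<psi> p + pderiv_dir e \<phi> p * \<psi> p)" for e
    by (auto simp: pderiv_dir_mult)
  moreover have "Ck k \<phi>" "Ck k \<psi>"
    using Suc.prems Ck_Suc_imp by blast+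
  ultimately show ?case using Suc by (auto intro!: Ck_add)
qed (auto intro: continuous_intros)

lemma Ck_const: "Ck k (\<lambda>p. c)"
proof (induction k arbitrary: c)
  case (Suc k)
  have "pderiv_dir e (\<lambda>p::'a. c) = (\<lambda>p. 0)" for e
    by (auto intro!: pderiv_dir_eqI[THEN trans] derivative_eq_intros)
  with Suc show ?case by auto
qed auto

text \<open>A directional derivative of a ridge function is a constant times a ridge function with
  profile \<open>g'\<close>, so the class reproduces itself and the induction on \<open>k\<close>
  closes with \<open>g\<close> arbitrary. All bumps in several variables are products of such
  functions.\<close>

lemma Ck_ridge:
  assumes "smooth1 g"
  shows "Ck k (\<lambda>p. g (p \<bullet> e))"
  using assms
proof (induction k arbitrary: g)
  case 0
  obtain g' where g': "\<And>x. (g has_real_derivative g' x) (at x)"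
    using 0 smooth1_deriv by metis
  then have "continuous_on UNIV g"
    by (intro DERIV_continuous_on) (auto intro: has_field_derivative_at_within)
  then have "continuous_on UNIV (\<lambda>p. g (p \<bullet> e))"
    by (rule continuous_on_compose2) (auto intro!: continuous_intros)
  then show ?case by simp
next
  case (Suc k)
  obtain g' where g': "smooth1 g'" "\<And>x. (g has_real_derivative g' x) (at x)"
    using Suc smooth1_deriv by metis
  have der: "((\<lambda>p. g (p \<bullet> e)) has_derivative (\<lambda>h. g' (p \<bullet> e) * (h \<bullet> e))) (at p)" for p
    by (rule has_derivative_compose[OF _ g'(2)[unfolded has_field_derivative_def],
        of "\<lambda>p. p \<bullet> e" "\<lambda>h. h \<bullet> e" p UNIV]) (auto intro!: derivative_eq_intros)
  have "pderiv_dir e' (\<lambda>p. g (p \<bullet> e)) = (\<lambda>p. g' (p \<bullet> e) * (e' \<bullet> e))" for e'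
    using pderiv_dir_eqI[OF der] by auto
  then show ?case
    using der Suc.IH[OF g'(1)] by (auto simp: differentiable_def intro!: Ck_mult Ck_const)
qed

lemma smooth_ridge: "smooth1 g \<Longrightarrow> smooth (\<lambda>p. g (p \<bullet> e))"
  by (simp add: smooth_def Ck_ridge)

lemma smooth_mult: "smooth \<phi> \<Longrightarrow> smooth \<psi> \<Longrightarrow> smooth (\<lambda>p. \<phi> p * \<psi> p)"
  by (simp add: smooth_def Ck_mult)

lemma smooth_const: "smooth (\<lambda>p. c)"
  by (simp add: smooth_def Ck_const)

lemma smooth_prod: "(\<And>i. i \<in> I \<Longrightarrow> smooth (\<phi> i)) \<Longrightarrow> smooth (\<lambda>p. \<Prod>i\<in>I. \<phi> i p)"
  by (induction I rule: infinite_finite_induct) (auto intro!: smooth_mult smooth_const)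

lemma smooth_differentiable: "smooth \<phi> \<Longrightarrow> \<phi> differentiable at p"
  unfolding smooth_def by (metis Ck.simps(2))

lemma smooth_continuous: "smooth \<phi> \<Longrightarrow> continuous_on UNIV \<phi>"
  unfolding smooth_def using Ck_imp_continuous by blast

text \<open>\<open>Ck\<close> speaks of basis directions only. Linearity of the derivative transfers
  its information to arbitrary directions, which increments along segments need.\<close>

lemma pderiv_dir_linear_sum:
  assumes "\<phi> differentiable at p"
  shows "pderiv_dir e \<phi> p = (\<Sum>i\<in>Basis. (e \<bullet> i) * pderiv_dir i \<phi> p)"
proof -
  have "linear (frechet_derivative \<phi> (at p))"
    using assms frechet_derivative_works has_derivative_linear by blast
  then have "frechet_derivative \<phi> (at p) (\<Sum>i\<in>Basis. (e \<bullet> i) *\<^sub>R i) =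
    (\<Sum>i\<in>Basis. (e \<bullet> i) *\<^sub>R frechet_derivative \<phi> (at p) i)"
    by (simp add: linear_sum linear_scale)
  then show ?thesis
    by (simp add: pderiv_dir_def euclidean_representation)
qed

lemma smooth_pderiv_continuous: 
  assumes "smooth \<phi>" 
  shows "continuous_on UNIV (pderiv_dir e \<phi>)"
proof -
  have "continuous_on UNIV (pderiv_dir i \<phi>)" if "i \<in> Basis" for i
    using assms that unfolding smooth_def by (metis Ck.simps)
  then have "continuous_on UNIV (\<lambda>p. \<Sum>i\<in>Basis. (e \<bullet> i) * pderiv_dir i \<phi> p)"
    by (intro continuous_intros) auto
  moreover have "pderiv_dir e \<phi> = (\<lambda>p. \<Sum>i\<in>Basis. (e \<bullet> i) * pderiv_dir i \<phi> p)"
    using assms by (intro ext pderiv_dir_linear_sum smooth_differentiable)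
  ultimately show ?thesis by simp
qed

text \<open>The standard flat function: smooth, positive exactly on the positive axis, with all
  derivatives vanishing at 0.\<close>

definition expinv :: "real \<Rightarrow> real" where
  "expinv x = (if x > 0 then exp (- (1 / x)) else 0)"

lemma poly_exp_tendsto_0: "((\<lambda>y::real. poly p y * exp (- y)) \<longlongrightarrow> 0) at_top"
proof -
  have "((\<lambda>y::real. \<Sum>i\<le>degree p. coeff p i * (y ^ i / exp y)) \<longlongrightarrow> (\<Sum>i\<le>degree p. coeff p i * 0)) at_top"
    by (intro tendsto_intros tendsto_power_div_exp_0)
  moreover have "(\<Sum>i\<le>degree p. coeff p i * (y ^ i / exp y)) = poly p y * exp (- y)" for y
    by (simp add: poly_altdef exp_minus sum_distrib_right divide_inverse mult.assoc)
  ultimately show ?thesis by simp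
qed

text \<open>With y = 1/x, the n-th derivative of exp(-1/x) on the positive axis is P(y) exp(-y) for
  P = \<open>expinv_poly n\<close>. Differentiating once more, with dy/dx = -y^2, produces y^2 (P -
  P'), which is the recursion.\<close>

fun expinv_poly :: "nat \<Rightarrow> real poly" where
  "expinv_poly 0 = 1"
| "expinv_poly (Suc n) = [:0, 0, 1:] * (expinv_poly n - pderiv (expinv_poly n))"

lemma smooth1_expinv: "smooth1 expinv"
proof -
  define D where "D n x = (if x > 0 then poly (expinv_poly n) (1 / x) * exp (- (1 / x)) else 0)"
    for n and x :: real
  have "(D n has_real_derivative D (Suc n) x) (at x)" for n x
  proof -
    consider "x < 0" | "x = 0" | "x > 0" by linarith
    then show ?thesis
    proof cases
      case 1
      have "((\<lambda>x. 0) has_real_derivative D (Suc n) x) (at x)"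
        using 1 by (auto simp: D_def)
      moreover have "eventually (\<lambda>y. D n y = 0) (nhds x)"
        using 1 eventually_nhds_in_open[of "{..<0}" x] by (auto simp: D_def elim!: eventually_mono)
      ultimately show ?thesis
        by (subst DERIV_cong_ev[OF refl _ refl]) auto
    next
      case 3
      have "((\<lambda>x. poly (expinv_poly n) (1 / x) * exp (- (1 / x))) has_real_derivative D (Suc n) x) (at x)"
        using 3 by (auto simp: D_def power2_eq_square field_simps intro!: derivative_eq_intros DERIV_chain2[OF poly_DERIV])
      moreover have "eventually (\<lambda>y. D n y = poly (expinv_poly n) (1 / y) * exp (- (1 / y))) (nhds x)"
        using 3 eventually_nhds_in_open[of "{0<..}" x] by (auto simp: D_def elim!: eventually_mono)
      ultimately show ?thesis
        by (subst DERIV_cong_ev[OF refl _ refl]) auto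
    next
      case 2
      \<comment> \<open>The right difference quotient at 0 is \<open>D n x / x\<close>, that is y
        P(y) exp(-y) with y = 1/x tending to infinity. The extra factor y is the polynomial
        \<open>[:0, 1:]\<close>, and the exponential wins.\<close>
      have "((\<lambda>y. poly ([:0, 1:] * expinv_poly n) (inverse y) * exp (- (inverse y))) \<longlongrightarrow> 0) (at_right (0::real))"
        by (rule filterlim_compose[OF poly_exp_tendsto_0 filterlim_inverse_at_top_right])
      then have r: "((\<lambda>y. (D n y - D n 0) / (y - 0)) \<longlongrightarrow> 0) (at_right 0)"
        by (rule Lim_transform_eventually)
          (auto simp: D_def eventually_at_filter field_simps)
      have l: "((\<lambda>y. (D n y - D n 0) / (y - 0)) \<longlongrightarrow> 0) (at_left 0)"
        by (rule Lim_transform_eventually[OF tendsto_const])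
          (auto simp: D_def eventually_at_filter)
      from l r show ?thesis
        unfolding 2 has_field_derivative_iff by (simp add: filterlim_split_at D_def)
    qed
  qed
  moreover have "D 0 = expinv"
    by (auto simp: D_def expinv_def)
  ultimately show ?thesis
    unfolding smooth1_def by blast
qed

lemma expinv_nonneg: "0 \<le> expinv x" and expinv_le_1: "expinv x \<le> 1"
  by (auto simp: expinv_def)

lemma expinv_eq_0_iff: "expinv x = 0 \<longleftrightarrow> x \<le> 0"
  by (auto simp: expinv_def)

text \<open>For \<open>k > 0\<close> the function is positive exactly on the open box, and it tends
  to the indicator of the box as \<open>k\<close> grows. Boxes are chosen as supports because the
  family is closed under translation, its members split into factors in single coordinates, and open
  boxes generate the Borel sets.\<close>

definition box_bump :: "real \<Rightarrow> 'b::euclidean_space \<Rightarrow> 'b \<Rightarrow> 'b \<Rightarrow> real" where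
  "box_bump k a b p = (\<Prod>i\<in>Basis. expinv (k * (p \<bullet> i - a \<bullet> i)) * expinv (k * (b \<bullet> i - p \<bullet> i)))"

lemma smooth_box_bump_aux: "smooth (\<lambda>p. expinv (k * (p \<bullet> e - c)) * expinv (k * (d - p \<bullet> e)))"
proof -
  have "smooth (\<lambda>p. expinv (k * (p \<bullet> e) + (- (k * c))) * expinv ((- k) * (p \<bullet> e) + k * d))"
    by (intro smooth_mult smooth_ridge[of "\<lambda>x. expinv (_ * x + _)"] smooth1_affine smooth1_expinv)
  then show ?thesis by (simp add: algebra_simps)
qed

lemma smooth_box_bump: "smooth (box_bump k a b)"
  unfolding box_bump_def [abs_def] by (intro smooth_prod smooth_box_bump_aux)

lemma box_bump_nonneg: "0 \<le> box_bump k a b p"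
  unfolding box_bump_def by (intro prod_nonneg mult_nonneg_nonneg expinv_nonneg)

lemma box_bump_le_1: "box_bump k a b p \<le> 1"
  unfolding box_bump_def
  by (intro prod_le_1 conjI mult_nonneg_nonneg mult_le_one expinv_nonneg expinv_le_1)

lemma box_bump_eq_0_iff: "k > 0 \<Longrightarrow> box_bump k a b p = 0 \<longleftrightarrow> p \<notin> box a b"
  by (auto simp: box_bump_def expinv_eq_0_iff mem_box mult_le_0_iff not_less)

lemma test_functionI:
  assumes "smooth \<phi>" "compact K" "K \<subseteq> U" "\<And>p. p \<notin> K \<Longrightarrow> \<phi> p = 0"
  shows "test_function U \<phi>"
proof -
  have "closure {p. \<phi> p \<noteq> 0} \<subseteq> K"
    using assms by (intro closure_minimal) (auto intro: compact_imp_closed)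
  then show ?thesis
    using assms compact_Int_closed[of K "closure {p. \<phi> p \<noteq> 0}"]
    by (auto simp: test_function_def Int_absorb1)
qed

lemma test_function_box_bump: 
  "k > 0 \<Longrightarrow> cbox a b \<subseteq> U \<Longrightarrow> test_function U (box_bump k a b)"
  by (rule test_functionI[OF smooth_box_bump compact_cbox])
     (use box_subset_cbox in \<open>auto simp: box_bump_eq_0_iff\<close>)

lemma box_bump_shift: "box_bump k (a + c) (b + c) (p + c) = box_bump k a b p"
  by (simp add: box_bump_def inner_simps)

lemma tendsto_expinv_indicator: 
  "(\<lambda>n. expinv (real (Suc n) * x)) \<longlonglongrightarrow> (if x > 0 then 1 else 0)"
proof (cases "x > 0")
  case True
  have "(\<lambda>n. exp (- (1 / x * (1 / real (Suc n))))) \<longlonglongrightarrow> exp (- (1 / x * 0))"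
    by (intro tendsto_intros LIMSEQ_Suc lim_1_over_n)
  with True show ?thesis by (simp add: expinv_def mult.commute)
next
  case False
  then have "real (Suc n) * x \<le> 0" for n by (simp add: mult_le_0_iff)
  then have "expinv (real (Suc n) * x) = 0" for n by (simp add: expinv_eq_0_iff)
  with False show ?thesis by simp
qed

lemma tendsto_box_bump_indicator:
  "(\<lambda>n. box_bump (real (Suc n)) a b p) \<longlonglongrightarrow> indicator (box a b) p"
proof -
  have "(\<lambda>n. box_bump (real (Suc n)) a b p) \<longlonglongrightarrow>
    (\<Prod>i\<in>Basis. (if p \<bullet> i - a \<bullet> i > 0 then 1 else 0) * (if b \<bullet> i - p \<bullet> i > 0 then 1 else 0))"
    unfolding box_bump_def by (intro tendsto_intros tendsto_expinv_indicator)
  also have "(\<Prod>i\<in>Basis. (if p \<bullet> i - a \<bullet> i > 0 then 1 else 0) * (if b \<bullet> i - p \<bullet> i > 0 then 1 else 0))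
     = (indicator (box a b) p :: real)"
    by (auto simp: indicator_def mem_box)
  finally show ?thesis .
qed

lemma smooth_compact_support_bounded:
  assumes "smooth \<phi>" "compact K" "\<And>p. p \<notin> K \<Longrightarrow> \<phi> p = 0"
  obtains B where "B > 0" "\<And>p. \<bar>pderiv_dir e \<phi> p\<bar> \<le> B" "\<And>p. p \<notin> K \<Longrightarrow> pderiv_dir e \<phi> p = 0"
proof -
  have 0: "pderiv_dir e \<phi> p = 0" if "p \<notin> K" for p
  proof -
    have "eventually (\<lambda>q. q \<in> - K) (nhds p)"
      using assms(2) that compact_imp_closed by (intro eventually_nhds_in_open) auto
    then have ev: "eventually (\<lambda>q. 0 = \<phi> q) (nhds p)"
      by eventually_elim (use assms in auto)
    have "(\<phi> has_derivative (\<lambda>h. 0)) (at p)"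
      by (rule has_derivative_transform_eventually[OF has_derivative_const])
         (use ev assms that in \<open>auto simp: eventually_at_filter elim: eventually_mono\<close>)
    then show ?thesis by (rule pderiv_dir_eqI)
  qed
  have "compact (pderiv_dir e \<phi> ` K)"
    using assms by (intro compact_continuous_image continuous_on_subset[OF smooth_pderiv_continuous]) auto
  then obtain B where B: "B > 0" "\<And>p. p \<in> K \<Longrightarrow> \<bar>pderiv_dir e \<phi> p\<bar> \<le> B"
    using compact_imp_bounded[of "pderiv_dir e \<phi> ` K"] unfolding bounded_pos by auto
  then have "\<bar>pderiv_dir e \<phi> p\<bar> \<le> B" for p
    using 0[of p] by (cases "p \<in> K") auto
  with B(1) 0 show ?thesis by (intro that)
qed

subsection \<open>Translations and weak derivatives\<close>

lemma lborel_shift: "distr lborel borel (\<lambda>p. p + c) = (lborel :: 'b::euclidean_space measure)"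
proof -
  have "(\<lambda>p. p + c) = (+) c" by (simp add: fun_eq_iff add.commute)
  then show ?thesis using lborel_distr_plus[of c] by simp
qed

lemma integral_shift:
  fixes f :: "'b::euclidean_space \<Rightarrow> real"
  assumes [measurable]: "f \<in> borel_measurable borel"
  shows "(LINT p|lborel. f (p + c)) = integral\<^sup>L lborel f"
  by (subst (2) lborel_shift[of c, symmetric]) (simp add: integral_distr)

lemma integrable_shift:
  fixes f :: "'b::euclidean_space \<Rightarrow> real"
  assumes "integrable lborel f"
  shows "integrable lborel (\<lambda>p. f (p + c))"
proof (rule integrable_distr[of "\<lambda>p. p + c" lborel borel])
  show "integrable (distr lborel borel (\<lambda>p. p + c)) f"
    unfolding lborel_shift by (rule assms)
qed simp

lemma AE_shift:
  fixes P :: "'b::euclidean_space \<Rightarrow> bool"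
  assumes "AE p in lborel. P p"
  shows "AE p in lborel. P (p + c)"
proof (rule AE_distrD[of "\<lambda>p. p + c" lborel borel])
  show "AE p in distr lborel borel (\<lambda>p. p + c). P p"
    unfolding lborel_shift by (rule assms)
qed simp

section \<open>Continuity of translations in L1\<close>

definition modulus_L1 :: "('b::euclidean_space \<Rightarrow> real) \<Rightarrow> 'b \<Rightarrow> real" where
  "modulus_L1 H z = (LINT p|lborel. \<bar>H (p + z) - H p\<bar>)"

lemma modulus_L1_le:
  assumes "integrable lborel H"
  shows "modulus_L1 H z \<le> 2 * (LINT p|lborel. \<bar>H p\<bar>)"
proof -
  have "modulus_L1 H z \<le> (LINT p|lborel. \<bar>H (p + z)\<bar> + \<bar>H p\<bar>)"
    unfolding modulus_L1_def using assms by (intro integral_mono)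
      (auto intro!: integrable_abs Bochner_Integration.integrable_add Bochner_Integration.integrable_diff integrable_shift)
  also have "\<dots> = 2 * (LINT p|lborel. \<bar>H p\<bar>)"
    using assms integral_shift[of "\<lambda>p. \<bar>H p\<bar>" z] by (simp add: integrable_shift)
  finally show ?thesis .
qed

lemma modulus_L1_nonneg: "0 \<le> modulus_L1 H z"
  by (simp add: modulus_L1_def)

lemma modulus_L1_approx:
  assumes "integrable lborel H" "integrable lborel K"
  shows "modulus_L1 H z \<le> modulus_L1 K z + 2 * (LINT p|lborel. \<bar>H p - K p\<bar>)"
proof -
  have "modulus_L1 H z \<le> (LINT p|lborel. \<bar>K (p + z) - K p\<bar> + \<bar>(H (p + z) - K (p + z)) - (H p - K p)\<bar>)"
    unfolding modulus_L1_def using assms by (intro integral_mono)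
      (auto intro!: integrable_abs Bochner_Integration.integrable_add Bochner_Integration.integrable_diff integrable_shift)
  also have "\<dots> = modulus_L1 K z + modulus_L1 (\<lambda>p. H p - K p) z"
    unfolding modulus_L1_def using assms by (intro Bochner_Integration.integral_add)
      (auto intro!: integrable_abs Bochner_Integration.integrable_add Bochner_Integration.integrable_diff integrable_shift)
  also have "\<dots> \<le> modulus_L1 K z + 2 * (LINT p|lborel. \<bar>H p - K p\<bar>)"
    using assms modulus_L1_le[of "\<lambda>p. H p - K p" z] by auto
  finally show ?thesis .
qed

text \<open>A small shift moves points into and out of an open set, and only the loss is dominated
  by the indicator of the set. Translation invariance makes gain and loss equal in measure, so the
  modulus is twice the integral of the loss \<open>f n\<close>, and the loss vanishes pointwise
  because a point of an open set stays inside under small shifts.\<close>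

lemma modulus_L1_open:
  fixes O' :: "'b::euclidean_space set"
  assumes O: "open O'" "emeasure lborel O' < \<infinity>" and z: "z \<longlonglongrightarrow> 0"
  shows "(\<lambda>n. modulus_L1 (indicator O') (z n)) \<longlonglongrightarrow> 0"
proof -
  define f where "f n p = indicator O' p * (1 - indicator O' (p + z n) :: real)" for n p
  have [measurable]: "O' \<in> sets borel" using O by simp
  have int: "integrable lborel (indicator O' :: 'b \<Rightarrow> real)"
    using O by (simp add: integrable_indicator_iff)
  have [measurable]: "f n \<in> borel_measurable borel" for n
    unfolding f_def by measurable
  have "modulus_L1 (indicator O') (z n) = 2 * (LINT p|lborel. f n p)" for n
  proof -
    have intf: "integrable lborel (f n)"
      by (rule Bochner_Integration.integrable_bound[OF int]) (auto simp: f_def split: split_indicator)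
    have "modulus_L1 (indicator O') (z n) = (LINT p|lborel. (indicator O' (p + z n) - indicator O' p) + 2 * f n p)"
      unfolding modulus_L1_def f_def by (intro Bochner_Integration.integral_cong) (auto split: split_indicator)
    also have "\<dots> = 2 * (LINT p|lborel. f n p)"
      using int intf integrable_shift[OF int, of "z n"] integral_shift[of "indicator O' :: 'b \<Rightarrow> real" "z n"] by simp
    finally show ?thesis .
  qed
  moreover have "(\<lambda>n. LINT p|lborel. f n p) \<longlonglongrightarrow> (LINT p|(lborel::'b measure). 0)"
  proof (rule integral_dominated_convergence[where w="indicator O'"])
    show "AE p in lborel. (\<lambda>n. f n p) \<longlonglongrightarrow> 0"
    proof (rule AE_I2)
      fix p
      show "(\<lambda>n. f n p) \<longlonglongrightarrow> 0"
      proof (cases "p \<in> O'")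
        case True
        have "(\<lambda>n. p + z n) \<longlonglongrightarrow> p" using tendsto_add[OF tendsto_const z, of p] by simp
        then have "\<forall>\<^sub>F n in sequentially. p + z n \<in> O'"
          using O True topological_tendstoD by blast
        then have "\<forall>\<^sub>F n in sequentially. f n p = 0"
          by eventually_elim (simp add: f_def)
        then show ?thesis by (rule tendsto_eventually)
      qed (simp add: f_def)
    qed
  qed (use int in \<open>auto simp: f_def split: split_indicator\<close>)
  ultimately show ?thesis
    using tendsto_mult_right_zero[of "\<lambda>n. LINT p|lborel. f n p" sequentially 2] by simp
qed

text \<open>Density: open sets give all sets of finite measure by outer regularity, linearity gives
  simple functions, and \<open>modulus_L1_approx\<close> carries the convergence to L1 limits
  because the modulus changes by at most twice the L1 distance.\<close>

lemma modulus_L1_tendsto: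
  fixes H :: "'b::euclidean_space \<Rightarrow> real"
  assumes "integrable lborel H" and z: "z \<longlonglongrightarrow> 0"
  shows "(\<lambda>n. modulus_L1 H (z n)) \<longlonglongrightarrow> 0"
  using assms(1)
proof (induction rule: integrable_induct)
  case (base A c)
  have [measurable]: "A \<in> sets borel" using base by simp
  have "(\<lambda>n. modulus_L1 (indicator A :: 'b \<Rightarrow> real) (z n)) \<longlonglongrightarrow> 0"
  proof (rule LIMSEQ_I)
    fix r :: real assume "0 < r"
    then obtain U where U: "open U" "A \<subseteq> U" "emeasure lborel (U - A) < ennreal (r / 4)"
      using outer_regular_lborel[of A "r / 4"] by auto
    have [measurable]: "U \<in> sets borel" using U by simp
    have "emeasure lborel U = emeasure lborel A + emeasure lborel (U - A)"
      using U emeasure_mono[of A U lborel] plus_emeasure[of A lborel "U - A"] by (auto simp: Un_absorb1)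
    then have finU: "emeasure lborel U < \<infinity>"
      using U base by (metis ennreal_add_less_top infinity_ennreal_def ennreal_less_top order.strict_trans)
    have iA: "integrable lborel (indicator A :: 'b \<Rightarrow> real)" and iU: "integrable lborel (indicator U :: 'b \<Rightarrow> real)"
      using base finU by (auto simp: integrable_indicator_iff)
    have "(LINT p|lborel. \<bar>indicator A p - indicator U p :: real\<bar>) = (LINT p|lborel. indicator (U - A) p)"
      using U by (intro Bochner_Integration.integral_cong) (auto split: split_indicator)
    also have "\<dots> = measure lborel (U - A)" by simp
    also have "\<dots> \<le> r / 4"
      unfolding measure_def using U(3) \<open>0 < r\<close> by (intro enn2real_leI) auto
    finally have le: "modulus_L1 (indicator A) w \<le> modulus_L1 (indicator U) w + r / 2" for w
      using modulus_L1_approx[OF iA iU, of w] by simp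
    obtain N where N: "\<And>n. n \<ge> N \<Longrightarrow> modulus_L1 (indicator U) (z n) < r / 2"
      using LIMSEQ_D[OF modulus_L1_open[OF U(1) finU z], of "r / 2"] \<open>0 < r\<close> modulus_L1_nonneg by force
    show "\<exists>no. \<forall>n\<ge>no. norm (modulus_L1 (indicator A :: 'b \<Rightarrow> real) (z n) - 0) < r"
    proof (intro exI allI impI)
      fix n assume "n \<ge> N"
      then show "norm (modulus_L1 (indicator A :: 'b \<Rightarrow> real) (z n) - 0) < r"
        using le[of "z n"] N[of n] modulus_L1_nonneg[of "indicator A" "z n"] by simp
    qed
  qed
  moreover have "modulus_L1 (\<lambda>x. indicator A x *\<^sub>R c) w = modulus_L1 (indicator A) w * \<bar>c\<bar>" for w
    unfolding modulus_L1_def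
    by (simp add: left_diff_distrib[symmetric] abs_mult)
  ultimately show ?case
    using tendsto_mult_left_zero by force
next
  case (add f g)
  have "modulus_L1 (\<lambda>x. f x + g x) w \<le> modulus_L1 f w + modulus_L1 g w" for w
  proof -
    have "modulus_L1 (\<lambda>x. f x + g x) w \<le> (LINT p|lborel. \<bar>f (p + w) - f p\<bar> + \<bar>g (p + w) - g p\<bar>)"
      unfolding modulus_L1_def using add by (intro integral_mono)
      (auto intro!: integrable_abs Bochner_Integration.integrable_add Bochner_Integration.integrable_diff integrable_shift)
    then show ?thesis
      unfolding modulus_L1_def using add by (simp add: integrable_shift)
  qed
  moreover have "(\<lambda>n. modulus_L1 f (z n) + modulus_L1 g (z n)) \<longlonglongrightarrow> 0"
    using tendsto_add[OF add.IH] by simp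
  ultimately show ?case
    by (rule_tac tendsto_sandwich[OF _ _ tendsto_const]) (auto simp: modulus_L1_nonneg)
next
  case (lim f s)
  \<comment> \<open>The simple functions of the induction rule are bounded by 2 |f|, hence the
    factor 3 in the majorant.\<close>
  have L: "(\<lambda>i. LINT p|lborel. \<bar>f p - s i p\<bar>) \<longlonglongrightarrow> (LINT p|(lborel::'b measure). 0)"
  proof (rule integral_dominated_convergence[where w="\<lambda>p. 3 * \<bar>f p\<bar>"])
    show "AE p in lborel. (\<lambda>i. \<bar>f p - s i p\<bar>) \<longlonglongrightarrow> 0"
      using lim.hyps(2) by (intro AE_I2 tendsto_rabs_zero) (auto intro!: tendsto_eq_intros)
    show "AE p in lborel. norm \<bar>f p - s i p\<bar> \<le> 3 * \<bar>f p\<bar>" for i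
    proof (rule AE_I2)
      fix p
      show "norm \<bar>f p - s i p\<bar> \<le> 3 * \<bar>f p\<bar>"
        using lim.hyps(3)[of p i] by (simp add: abs_le_iff) linarith
    qed
  qed (use lim in auto)
  show ?case
  proof (rule LIMSEQ_I)
    fix r :: real assume "0 < r"
    then obtain i where i: "(LINT p|lborel. \<bar>f p - s i p\<bar>) < r / 4"
      using LIMSEQ_D[OF L, of "r / 4"] by force
    obtain N where N: "\<And>n. n \<ge> N \<Longrightarrow> modulus_L1 (s i) (z n) < r / 2"
      using LIMSEQ_D[OF lim.IH[of i], of "r / 2"] \<open>0 < r\<close> modulus_L1_nonneg by force
    show "\<exists>no. \<forall>n\<ge>no. norm (modulus_L1 f (z n) - 0) < r"
    proof (intro exI allI impI)
      fix n assume "n \<ge> N"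
      then show "norm (modulus_L1 f (z n) - 0) < r"
        using modulus_L1_approx[OF lim.hyps(4) lim.hyps(1)[of i], of "z n"] N[of n] i modulus_L1_nonneg[of f "z n"] by simp
    qed
  qed
qed

section \<open>The fundamental lemma of the calculus of variations\<close>

lemma integral_box_bump_tendsto:
  fixes H :: "'b::euclidean_space \<Rightarrow> real"
  assumes "integrable lborel H"
  shows "(\<lambda>n. LINT p|lborel. H p * box_bump (real (Suc n)) a b p) \<longlonglongrightarrow> (LINT p|lborel. H p * indicator (box a b) p)"
proof (rule integral_dominated_convergence[where w="\<lambda>p. \<bar>H p\<bar>"])
  have [measurable]: "box_bump k a b \<in> borel_measurable borel" for k
    by (intro borel_measurable_continuous_onI smooth_continuous smooth_box_bump)
  show "(\<lambda>p. H p * box_bump (real (Suc n)) a b p) \<in> borel_measurable lborel" for n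
    using assms by measurable
  show "AE p in lborel. (\<lambda>n. H p * box_bump (real (Suc n)) a b p) \<longlonglongrightarrow> H p * indicator (box a b) p"
    by (intro AE_I2 tendsto_intros tendsto_box_bump_indicator)
  show "AE p in lborel. norm (H p * box_bump (real (Suc n)) a b p) \<le> \<bar>H p\<bar>" for n
    by (intro AE_I2) (simp add: abs_mult box_bump_nonneg box_bump_le_1 mult_left_le)
qed (use assms in auto)

text \<open>Take the positive and the negative part of \<open>H\<close> as densities. The two
  measures agree on open boxes, an intersection-stable generator, hence everywhere, and densities
  are unique almost everywhere. Since \<open>ennreal\<close> sends negative numbers to 0,
  \<open>ennreal (H p) = ennreal (- H p)\<close> forces \<open>H p = 0\<close>.\<close>

lemma AE_eq_0_of_box_integrals:
  fixes H :: "'b::euclidean_space \<Rightarrow> real"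
  assumes H: "integrable lborel H" and "\<And>a b. (LINT p|lborel. H p * indicator (box a b) p) = 0"
  shows "AE p in lborel. H p = 0"
proof -
  have [measurable]: "H \<in> borel_measurable borel" using H by auto
  let ?M = "\<lambda>s. density lborel (\<lambda>p. ennreal (s * H p))"
  have em: "emeasure (?M s) (box a b) = ennreal (LINT p|lborel. max 0 (s * H p) * indicator (box a b) p)" for s a b
  proof -
    have "emeasure (?M s) (box a b) = (\<integral>\<^sup>+p. ennreal (max 0 (s * H p) * indicator (box a b) p) \<partial>lborel)"
      by (subst emeasure_density) (auto intro!: nn_integral_cong simp: ennreal_max_0 split: split_indicator)
    also have "\<dots> = ennreal (LINT p|lborel. max 0 (s * H p) * indicator (box a b) p)"
      using H by (intro nn_integral_eq_integral) (auto intro!: integrable_real_mult_indicator integrable_max)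
    finally show ?thesis .
  qed
  have "?M 1 = ?M (- 1)"
  proof (rule measure_eqI_generator_eq)
    let ?E = "range (\<lambda>(a, b). box a b::'b set)"
    show "Int_stable ?E"
      by (auto simp: Int_stable_def box_Int_box)
    show "?E \<subseteq> Pow UNIV" "sets (?M 1) = sigma_sets UNIV ?E" "sets (?M (- 1)) = sigma_sets UNIV ?E"
      by (simp_all add: borel_eq_box)
    let ?A = "\<lambda>n::nat. box (- (real n *\<^sub>R One)) (real n *\<^sub>R One) :: 'b set"
    show "range ?A \<subseteq> ?E" "(\<Union>i. ?A i) = UNIV"
      unfolding UN_box_eq_UNIV by auto
    show "emeasure (?M 1) (?A i) \<noteq> \<infinity>" for i unfolding em by simp
    show "emeasure (?M 1) X = emeasure (?M (- 1)) X" if XE: "X \<in> ?E" for X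
    proof -
      obtain a b where X: "X = box a b" using XE by (auto simp: image_iff)
      have "(LINT p|lborel. max 0 (1 * H p) * indicator (box a b) p) - (LINT p|lborel. max 0 (- 1 * H p) * indicator (box a b) p)
        = (LINT p|lborel. H p * indicator (box a b) p)"
      proof (subst Bochner_Integration.integral_diff[symmetric])
        show "integrable lborel (\<lambda>p. max 0 (1 * H p) * indicator (box a b) p)"
          "integrable lborel (\<lambda>p. max 0 (- 1 * H p) * indicator (box a b) p)"
          using H by (intro integrable_real_mult_indicator integrable_max; simp)+
      qed (auto intro!: Bochner_Integration.integral_cong simp: max_def split: split_indicator)
      then show ?thesis unfolding X em by (simp add: assms(2))
    qed
  qed
  then have "AE p in lborel. ennreal (1 * H p) = ennreal (- 1 * H p)"
    by (intro sigma_finite_measure.density_unique[OF sigma_finite_lborel]) auto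
  then show ?thesis
  proof eventually_elim
    case (elim p)
    then show ?case by (cases "H p \<ge> 0") (auto simp: ennreal_neg ennreal_eq_0_iff)
  qed
qed

text \<open>The bumps on a box converge to its indicator, so \<open>H\<close> has zero integral over
  every box whose closed version lies in \<open>W\<close>. Inside one closed box of a countable
  cover of \<open>W\<close>, intersecting with an arbitrary box gives a box again, which brings the
  restricted function under \<open>AE_eq_0_of_box_integrals\<close>; the faces of the boxes are
  null.\<close>

lemma du_Bois_Reymond:
  fixes H :: "'b::euclidean_space \<Rightarrow> real"
  assumes H: "integrable lborel H" and W: "open W"
    and 0: "\<And>k a b. k > 0 \<Longrightarrow> cbox a b \<subseteq> W \<Longrightarrow> (LINT p|lborel. H p * box_bump k a b p) = 0"
  shows "AE p in lborel. p \<in> W \<longrightarrow> H p = 0"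
proof -
  have box0: "(LINT p|lborel. H p * indicator (box a b) p) = 0" if "cbox a b \<subseteq> W" for a b
    using integral_box_bump_tendsto[OF H, of a b] 0[OF _ that]
    by (intro LIMSEQ_unique[OF _ tendsto_const]) simp
  obtain \<D> where D: "countable \<D>" "\<And>X. X \<in> \<D> \<Longrightarrow> X \<subseteq> W" "\<And>X. X \<in> \<D> \<Longrightarrow> \<exists>a b. X = cbox a b" "\<Union>\<D> = W"
    by (rule open_countable_Union_open_cbox[OF W]) (blast intro: that)
  have "AE p in lborel. p \<in> X \<longrightarrow> H p = 0" if X: "X \<in> \<D>" for X
  proof -
    obtain a b where ab: "X = cbox a b" using D X by blast
    have i: "integrable lborel (\<lambda>p. H p * indicator (box a b) p)"
      using H by (intro integrable_real_mult_indicator) auto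
    have "(LINT p|lborel. (H p * indicator (box a b) p) * indicator (box c d) p) = 0" for c d
    proof -
      define l where "l = (\<Sum>i\<in>Basis. max (a \<bullet> i) (c \<bullet> i) *\<^sub>R i)"
      define u where "u = (\<Sum>i\<in>Basis. min (b \<bullet> i) (d \<bullet> i) *\<^sub>R i)"
      have "(LINT p|lborel. (H p * indicator (box a b) p) * indicator (box c d) p)
         = (LINT p|lborel. H p * indicator (box l u) p)"
        by (intro Bochner_Integration.integral_cong)
          (auto simp: box_Int_box l_def u_def indicator_inter_arith[symmetric] mult.assoc)
      moreover have "cbox l u \<subseteq> cbox a b"
        by (auto simp: l_def u_def mem_box)
      ultimately show ?thesis using box0[of l u] D(2)[OF X] ab by auto
    qed
    then have "AE p in lborel. H p * indicator (box a b) p = 0"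
      using AE_eq_0_of_box_integrals[OF i] by simp
    moreover have "AE p in lborel. p \<notin> cbox a b - box a b"
      by (rule AE_not_in) (auto simp: null_sets_def emeasure_lborel_cbox_eq emeasure_lborel_box_eq box_subset_cbox
          emeasure_Diff)
    ultimately show ?thesis
      by eventually_elim (auto simp: ab)
  qed
  then have "AE p in lborel. \<forall>X\<in>\<D>. p \<in> X \<longrightarrow> H p = 0"
    using D(1) by (subst AE_ball_countable) auto
  then show ?thesis
    by eventually_elim (use D(4) in auto)
qed

section \<open>Averages of shifted functions\<close>

lemma box_bump_measurable [measurable]: "box_bump k a b \<in> borel_measurable borel"
  by (intro borel_measurable_continuous_onI smooth_continuous smooth_box_bump)

lemma pderiv_box_bump_measurable [measurable]: "pderiv_dir e (box_bump k a b) \<in> borel_measurable borel"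
  by (intro borel_measurable_continuous_onI smooth_pderiv_continuous smooth_box_bump)

text \<open>One definition serves three purposes, according to the shift map \<open>J\<close>:
  mollification in x of functions of x (\<open>uminus\<close>), mollification in x of functions of
  (x,t) (\<open>shiftx\<close>), and the mean over a segment, with an interval indicator as kernel.
  The L1 estimates are then proved once.\<close>

definition avg ::
  "('c::euclidean_space \<Rightarrow> real) \<Rightarrow> ('c \<Rightarrow> 'b::euclidean_space) \<Rightarrow> real \<Rightarrow> ('b \<Rightarrow> real) \<Rightarrow> 'b \<Rightarrow> real" where
  "avg k J \<epsilon> H p = (LINT w|lborel. k w * H (p + \<epsilon> *\<^sub>R J w))"

text \<open>Fubini is applied with \<open>w\<close> outside, where shift invariance makes the inner
  integral equal to |k w| times the L1 norm of \<open>H\<close>; the variables are swapped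
  afterwards.\<close>

lemma pair_integrable_shift:
  fixes k :: "'c::euclidean_space \<Rightarrow> real" and H :: "'b::euclidean_space \<Rightarrow> real"
  assumes k: "integrable lborel k" and H: "integrable lborel H" and [measurable]: "J \<in> borel_measurable borel"
  shows "integrable (lborel \<Otimes>\<^sub>M lborel) (\<lambda>(p, w). k w * H (p + \<epsilon> *\<^sub>R J w))"
proof -
  have [measurable]: "k \<in> borel_measurable borel" "H \<in> borel_measurable borel"
    using k H by auto
  have "integrable (lborel \<Otimes>\<^sub>M lborel) (\<lambda>(w, p). k w * H (p + \<epsilon> *\<^sub>R J w))"
  proof (rule lborel_pair.Fubini_integrable)
    have "(LINT p|lborel. norm (case (w, p) of (w, p) \<Rightarrow> k w * H (p + \<epsilon> *\<^sub>R J w))) = \<bar>k w\<bar> * (LINT p|lborel. \<bar>H p\<bar>)" for w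
      using integral_shift[of "\<lambda>p. \<bar>H p\<bar>" "\<epsilon> *\<^sub>R J w"] by (simp add: abs_mult)
    then show "integrable lborel (\<lambda>w. LINT p|lborel. norm (case (w, p) of (w, p) \<Rightarrow> k w * H (p + \<epsilon> *\<^sub>R J w)))"
      using k by simp
    show "AE w in lborel. integrable lborel (\<lambda>p. case (w, p) of (w, p) \<Rightarrow> k w * H (p + \<epsilon> *\<^sub>R J w))"
      using integrable_shift[OF H] by auto
  qed simp
  from lborel_pair.integrable_product_swap[OF this] show ?thesis
    by (simp add: case_prod_unfold)
qed

lemma pair_integrable_diff:
  fixes k :: "'c::euclidean_space \<Rightarrow> real" and H :: "'b::euclidean_space \<Rightarrow> real"
  assumes k: "integrable lborel k" and H: "integrable lborel H" and J: "J \<in> borel_measurable borel"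
  shows "integrable (lborel \<Otimes>\<^sub>M lborel) (\<lambda>(p, w). \<bar>k w\<bar> * \<bar>H (p + \<epsilon> *\<^sub>R J w) - H p\<bar>)"
proof -
  have "integrable (lborel \<Otimes>\<^sub>M lborel) (\<lambda>z. \<bar>(case z of (p, w) \<Rightarrow> k w * H (p + \<epsilon> *\<^sub>R J w)) - (case z of (p, w) \<Rightarrow> k w * H (p + 0 *\<^sub>R J w))\<bar>)"
    by (intro integrable_abs Bochner_Integration.integrable_diff pair_integrable_shift assms)
  then show ?thesis
    by (simp add: case_prod_unfold abs_mult[symmetric] right_diff_distrib)
qed

lemma integrable_avg:
  fixes k :: "'c::euclidean_space \<Rightarrow> real" and H :: "'b::euclidean_space \<Rightarrow> real"
  assumes "integrable lborel k" "integrable lborel H" "J \<in> borel_measurable borel"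
  shows "integrable lborel (avg k J \<epsilon> H)"
  using lborel_pair.integrable_fst'[OF pair_integrable_shift[OF assms]] unfolding avg_def by simp

lemma AE_integrable_avg:
  fixes k :: "'c::euclidean_space \<Rightarrow> real" and H :: "'b::euclidean_space \<Rightarrow> real"
  assumes "integrable lborel k" "integrable lborel H" "J \<in> borel_measurable borel"
  shows "AE p in lborel. integrable lborel (\<lambda>w. k w * H (p + \<epsilon> *\<^sub>R J w))"
  using lborel_pair.AE_integrable_fst'[OF pair_integrable_shift[OF assms]] by simp

lemma diff_avg_integrable:
  fixes k :: "'c::euclidean_space \<Rightarrow> real" and H :: "'b::euclidean_space \<Rightarrow> real"
  assumes "integrable lborel k" "integrable lborel H" "J \<in> borel_measurable borel"
  shows "integrable lborel (\<lambda>p. LINT w|lborel. \<bar>k w\<bar> * \<bar>H (p + \<epsilon> *\<^sub>R J w) - H p\<bar>)"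
  using lborel_pair.integrable_fst'[OF pair_integrable_diff[OF assms]] by simp

lemma AE_diff_avg_integrable:
  fixes k :: "'c::euclidean_space \<Rightarrow> real" and H :: "'b::euclidean_space \<Rightarrow> real"
  assumes "integrable lborel k" "integrable lborel H" "J \<in> borel_measurable borel"
  shows "AE p in lborel. integrable lborel (\<lambda>w. \<bar>k w\<bar> * \<bar>H (p + \<epsilon> *\<^sub>R J w) - H p\<bar>)"
  using lborel_pair.AE_integrable_fst'[OF pair_integrable_diff[OF assms]] by simp

text \<open>Exchanging the integrals turns the expression into the integral of |k w| times the L1
  modulus of \<open>H\<close> at the shift \<epsilon> J(w). The modulus tends to 0 for each
  \<open>w\<close> and never exceeds twice the L1 norm of \<open>H\<close>, so \<open>k\<close>
  dominates.\<close>

lemma diff_avg_tendsto: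
  fixes k :: "'c::euclidean_space \<Rightarrow> real" and H :: "'b::euclidean_space \<Rightarrow> real"
  assumes k: "integrable lborel k" and H: "integrable lborel H" and J[measurable]: "J \<in> borel_measurable borel"
    and \<epsilon>: "\<epsilon> \<longlonglongrightarrow> 0"
  shows "(\<lambda>n. LINT p|lborel. (LINT w|lborel. \<bar>k w\<bar> * \<bar>H (p + \<epsilon> n *\<^sub>R J w) - H p\<bar>)) \<longlonglongrightarrow> 0"
proof -
  have [measurable]: "k \<in> borel_measurable borel" "H \<in> borel_measurable borel"
    using k H by auto
  have [measurable]: "modulus_L1 H \<in> borel_measurable borel"
    unfolding modulus_L1_def[abs_def] by measurable
  have "(LINT p|lborel. (LINT w|lborel. \<bar>k w\<bar> * \<bar>H (p + \<epsilon> n *\<^sub>R J w) - H p\<bar>))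
     = (LINT w|lborel. \<bar>k w\<bar> * modulus_L1 H (\<epsilon> n *\<^sub>R J w))" for n
  proof -
    have "(LINT p|lborel. (LINT w|lborel. \<bar>k w\<bar> * \<bar>H (p + \<epsilon> n *\<^sub>R J w) - H p\<bar>))
      = (LINT w|lborel. (LINT p|lborel. \<bar>k w\<bar> * \<bar>H (p + \<epsilon> n *\<^sub>R J w) - H p\<bar>))"
      using lborel_pair.Fubini_integral[OF pair_integrable_diff[OF assms(1-3), of "\<epsilon> n"]] by simp
    then show ?thesis by (simp add: modulus_L1_def)
  qed
  moreover have "(\<lambda>n. LINT w|lborel. \<bar>k w\<bar> * modulus_L1 H (\<epsilon> n *\<^sub>R J w)) \<longlonglongrightarrow> (LINT w|(lborel::'c measure). 0)"
  proof (rule integral_dominated_convergence[where w="\<lambda>w. \<bar>k w\<bar> * (2 * (LINT p|lborel. \<bar>H p\<bar>))"])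
    show "AE w in lborel. (\<lambda>n. \<bar>k w\<bar> * modulus_L1 H (\<epsilon> n *\<^sub>R J w)) \<longlonglongrightarrow> 0"
    proof (rule AE_I2)
      fix w
      have "(\<lambda>n. \<epsilon> n *\<^sub>R J w) \<longlonglongrightarrow> 0" using tendsto_scaleR[OF \<epsilon> tendsto_const] by force
      from tendsto_mult[OF tendsto_const modulus_L1_tendsto[OF H this], of "\<bar>k w\<bar>"]
      show "(\<lambda>n. \<bar>k w\<bar> * modulus_L1 H (\<epsilon> n *\<^sub>R J w)) \<longlonglongrightarrow> 0" by simp
    qed
    show "AE w in lborel. norm (\<bar>k w\<bar> * modulus_L1 H (\<epsilon> n *\<^sub>R J w)) \<le> \<bar>k w\<bar> * (2 * (LINT p|lborel. \<bar>H p\<bar>))" for n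
      using modulus_L1_le[OF H] by (auto intro!: AE_I2 mult_left_mono simp: abs_mult modulus_L1_nonneg)
  qed (use k in auto)
  ultimately show ?thesis by simp
qed

lemma avg_tendsto_L1:
  fixes k :: "'c::euclidean_space \<Rightarrow> real" and H :: "'b::euclidean_space \<Rightarrow> real"
  assumes k: "integrable lborel k" and H: "integrable lborel H" and J[measurable]: "J \<in> borel_measurable borel"
    and \<epsilon>: "\<epsilon> \<longlonglongrightarrow> 0" and k1: "integral\<^sup>L lborel k = 1"
  shows "(\<lambda>n. LINT p|lborel. \<bar>avg k J (\<epsilon> n) H p - H p\<bar>) \<longlonglongrightarrow> 0"
proof (rule tendsto_sandwich[OF _ _ tendsto_const diff_avg_tendsto[OF assms(1-4)]])
  show "\<forall>\<^sub>F n in sequentially. (LINT p|lborel. \<bar>avg k J (\<epsilon> n) H p - H p\<bar>)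
    \<le> (LINT p|lborel. (LINT w|lborel. \<bar>k w\<bar> * \<bar>H (p + \<epsilon> n *\<^sub>R J w) - H p\<bar>))"
  proof (rule always_eventually, rule allI, rule integral_mono_AE)
    fix n
    show "integrable lborel (\<lambda>p. \<bar>avg k J (\<epsilon> n) H p - H p\<bar>)"
      using assms by (intro integrable_abs Bochner_Integration.integrable_diff integrable_avg)
    show "integrable lborel (\<lambda>p. LINT w|lborel. \<bar>k w\<bar> * \<bar>H (p + \<epsilon> n *\<^sub>R J w) - H p\<bar>)"
      by (intro diff_avg_integrable assms)
    show "AE p in lborel. \<bar>avg k J (\<epsilon> n) H p - H p\<bar> \<le> (LINT w|lborel. \<bar>k w\<bar> * \<bar>H (p + \<epsilon> n *\<^sub>R J w) - H p\<bar>)"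
      using AE_integrable_avg[OF assms(1-3), of "\<epsilon> n"]
    proof eventually_elim
      case (elim p)
      have "avg k J (\<epsilon> n) H p - H p = (LINT w|lborel. k w * H (p + \<epsilon> n *\<^sub>R J w)) - (LINT w|lborel. k w * H p)"
        using k1 by (simp add: avg_def)
      also have "\<dots> = (LINT w|lborel. k w * (H (p + \<epsilon> n *\<^sub>R J w) - H p))"
        using elim k by (simp add: right_diff_distrib)
      finally have eq: "avg k J (\<epsilon> n) H p - H p = (LINT w|lborel. k w * (H (p + \<epsilon> n *\<^sub>R J w) - H p))" .
      show ?case
        using integral_abs_bound[of lborel "\<lambda>w. k w * (H (p + \<epsilon> n *\<^sub>R J w) - H p)"]
        unfolding eq by (simp add: abs_mult)
    qed
  qed
qed (auto intro!: always_eventually)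

section \<open>Weak derivatives as increments along segments\<close>

abbreviation unit_avg :: "'b::euclidean_space \<Rightarrow> ('b \<Rightarrow> real) \<Rightarrow> 'b \<Rightarrow> real" where
  "unit_avg e H \<equiv> avg (indicator {0..1}) (\<lambda>s. s *\<^sub>R e) 1 H"

lemma unit_interval_integrable: "integrable lborel (indicator {0..1::real} :: real \<Rightarrow> real)"
  by (simp add: integrable_indicator_iff)

lemma box_bump_has_derivative:
  "(box_bump k a b has_derivative (\<lambda>h. pderiv_dir h (box_bump k a b) p)) (at p)"
  using smooth_differentiable[OF smooth_box_bump, of k a b p]
  unfolding pderiv_dir_def frechet_derivative_works .

lemma smooth_has_derivative:
  "smooth \<phi> \<Longrightarrow> (\<phi> has_derivative (\<lambda>h. pderiv_dir h \<phi> p)) (at p)"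
  using smooth_differentiable[of \<phi> p] unfolding pderiv_dir_def frechet_derivative_works .

lemma pderiv_dir_scale: 
  assumes "\<phi> differentiable at p" shows "pderiv_dir (c *\<^sub>R e) \<phi> p = c * pderiv_dir e \<phi> p"
  using assms linear_scale[of "frechet_derivative \<phi> (at p)"] linear_frechet_derivative
  by (auto simp: pderiv_dir_def)

lemma smooth_DERIV_line:
  assumes "smooth \<phi>"
  shows "((\<lambda>s. \<phi> (p + s *\<^sub>R e)) has_real_derivative pderiv_dir e \<phi> (p + s *\<^sub>R e)) (at s)"
proof -
  have "((\<lambda>s. \<phi> (p + s *\<^sub>R e)) has_derivative (\<lambda>h. pderiv_dir (h *\<^sub>R e) \<phi> (p + s *\<^sub>R e))) (at s)"
    by (rule has_derivative_compose[OF _ smooth_has_derivative[OF assms], of _ _ _ UNIV])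
       (auto intro!: derivative_eq_intros)
  then show ?thesis
    unfolding has_field_derivative_def
    by (simp add: pderiv_dir_scale[OF smooth_differentiable[OF assms]] mult.commute[of _ "pderiv_dir e \<phi> _"])
qed

lemma smooth_line_integral:
  assumes "smooth \<phi>"
  shows "\<phi> (p - e) - \<phi> p = - (LINT s|lborel. indicator {0..1} s * pderiv_dir e \<phi> (p - s *\<^sub>R e))"
proof -
  have c: "continuous_on UNIV (pderiv_dir e \<phi>)"
    using assms by (rule smooth_pderiv_continuous)
  have "(LINT s|lborel. - pderiv_dir e \<phi> (p - s *\<^sub>R e) * indicator {0..1} s) = \<phi> (p - 1 *\<^sub>R e) - \<phi> (p - 0 *\<^sub>R e)"
  proof (rule integral_FTC_Icc_real)
    show "((\<lambda>s. \<phi> (p - s *\<^sub>R e)) has_real_derivative - pderiv_dir e \<phi> (p - s *\<^sub>R e)) (at s)" for s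
      using smooth_DERIV_line[OF assms, of p "- e" s] pderiv_dir_scale[OF smooth_differentiable[OF assms], of "-1" e]
      by simp
    have "continuous_on UNIV (\<lambda>s. - pderiv_dir e \<phi> (p - s *\<^sub>R e))"
      by (intro continuous_intros continuous_on_compose2[OF c]) auto
    then show "isCont (\<lambda>s. - pderiv_dir e \<phi> (p - s *\<^sub>R e)) s" for s
      by (simp add: continuous_on_eq_continuous_at)
  qed simp
  then show ?thesis by (simp add: mult.commute)
qed

text \<open>The fundamental theorem of calculus for a weak derivative, with \<open>h\<close> the
  derivative in the unnormalised direction \<open>e\<close>. Against a bump, the increment of
  \<open>g\<close> is moved onto the bump, where the classical theorem applies; Fubini and the weak
  identity for each translated bump then return an average of \<open>h\<close>. The condition on
  \<open>W\<close> keeps every translate of a box in \<open>W\<close> inside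
  \<open>S\<close>.\<close>

lemma weak_deriv_increment:
  fixes g h :: "'b::euclidean_space \<Rightarrow> real"
  assumes g: "integrable lborel g" and h: "integrable lborel h"
    and weak: "\<And>k a b. k > 0 \<Longrightarrow> cbox a b \<subseteq> S \<Longrightarrow>
      (LINT p|lborel. g p * pderiv_dir e (box_bump k a b) p) = - (LINT p|lborel. h p * box_bump k a b p)"
    and W: "open W" "\<And>p s. p \<in> W \<Longrightarrow> s \<in> {0..1} \<Longrightarrow> p + s *\<^sub>R e \<in> S"
  shows "AE p in lborel. p \<in> W \<longrightarrow> g (p + e) - g p = unit_avg e h p"
proof -
  have [measurable]: "g \<in> borel_measurable borel" "h \<in> borel_measurable borel"
    using g h by auto
  have ih: "integrable lborel (unit_avg e h)"
    by (intro integrable_avg unit_interval_integrable h) simp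
  let ?H = "\<lambda>p. g (p + e) - g p - unit_avg e h p"
  have "AE p in lborel. p \<in> W \<longrightarrow> ?H p = 0"
  proof (rule du_Bois_Reymond[OF _ W(1)])
    show "integrable lborel ?H"
      by (intro Bochner_Integration.integrable_diff integrable_shift g ih)
    fix k :: real and a b :: 'b assume k: "k > 0" and ab: "cbox a b \<subseteq> W"
    let ?\<phi> = "box_bump k a b"
    have bnd: "norm (?\<phi> p) \<le> 1" for p
      using box_bump_nonneg[of k a b p] box_bump_le_1[of k a b p] by simp
    obtain B where B: "B > 0" "\<And>p. \<bar>pderiv_dir e ?\<phi> p\<bar> \<le> B" 
      using smooth_compact_support_bounded[OF smooth_box_bump compact_cbox, of a b k a b e] 
      by (metis box_bump_eq_0_iff box_subset_cbox k subsetD)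
    have ibdd: "integrable lborel (\<lambda>p. f p * ?\<phi> (p - c))" if "integrable lborel f" for f c
      by (rule Bochner_Integration.integrable_bound[OF that])
        (use that bnd in \<open>auto simp: abs_mult intro!: mult_left_le\<close>)
    have 1: "(LINT p|lborel. g (p + e) * ?\<phi> p) = (LINT p|lborel. g p * ?\<phi> (p - e))"
      using integral_shift[of "\<lambda>p. g p * ?\<phi> (p - e)" e] by simp
    have pint: "integrable (lborel \<Otimes>\<^sub>M lborel) (\<lambda>(p, s). g p * (indicator {0..1::real} s * pderiv_dir e ?\<phi> (p - s *\<^sub>R e)))"
    proof (rule Bochner_Integration.integrable_bound)
      show "integrable (lborel \<Otimes>\<^sub>M lborel) (\<lambda>(p, s). B * (indicator {0..1::real} s * g (p + 0 *\<^sub>R s *\<^sub>R e)))"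
        using pair_integrable_shift[OF unit_interval_integrable g, of "\<lambda>s. s *\<^sub>R e" 0]
        by (auto simp: case_prod_unfold)
      show "AE z in lborel \<Otimes>\<^sub>M lborel. norm (case z of (p, s) \<Rightarrow> g p * (indicator {0..1::real} s * pderiv_dir e ?\<phi> (p - s *\<^sub>R e)))
         \<le> norm (case z of (p, s) \<Rightarrow> B * (indicator {0..1::real} s * g (p + 0 *\<^sub>R s *\<^sub>R e)))"
        using mult_left_mono[OF B(2) abs_ge_zero] B(1) 
        by (intro AE_I2) (auto simp: abs_mult mult.commute split: split_indicator)
    qed measurable
    have "(LINT p|lborel. g p * ?\<phi> (p - e)) - (LINT p|lborel. g p * ?\<phi> p)
       = (LINT p|lborel. g p * (?\<phi> (p - e) - ?\<phi> p))"
      using ibdd[OF g, of e] ibdd[OF g, of 0] by (simp add: right_diff_distrib)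
    also have "\<dots> = - (LINT p|lborel. LINT s|lborel. g p * (indicator {0..1} s * pderiv_dir e ?\<phi> (p - s *\<^sub>R e)))"
      by (simp add: smooth_line_integral[OF smooth_box_bump])
    also have "\<dots> = - (LINT s|lborel. LINT p|lborel. g p * (indicator {0..1} s * pderiv_dir e ?\<phi> (p - s *\<^sub>R e)))"
      using lborel_pair.Fubini_integral[OF pint] by simp
    also have "\<dots> = (LINT s|lborel. LINT p|lborel. h (p + s *\<^sub>R e) * ?\<phi> p * indicator {0..1} s)"
    proof -
      have "(LINT p|lborel. g p * (indicator {0..1} s * pderiv_dir e ?\<phi> (p - s *\<^sub>R e)))
        = - (LINT p|lborel. h (p + s *\<^sub>R e) * ?\<phi> p * indicator {0..1} s)" for s :: real
      proof (cases "s \<in> {0..1}")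
        case True
        \<comment> \<open>Translating the bump amounts to translating its box, so the translate is
          again a bump to which \<open>weak\<close> applies.\<close>
        have sh: "?\<phi> (p - s *\<^sub>R e) = box_bump k (a + s *\<^sub>R e) (b + s *\<^sub>R e) p" for p
          using box_bump_shift[of k a "s *\<^sub>R e" b "p - s *\<^sub>R e"] by simp
        have d: "pderiv_dir e ?\<phi> (p - s *\<^sub>R e) = pderiv_dir e (box_bump k (a + s *\<^sub>R e) (b + s *\<^sub>R e)) p" for p
        proof -
          have "((\<lambda>p. ?\<phi> (p - s *\<^sub>R e)) has_derivative (\<lambda>h. pderiv_dir h ?\<phi> (p - s *\<^sub>R e))) (at p)"
            by (rule has_derivative_compose[OF _ box_bump_has_derivative, of _ _ _ UNIV])
              (auto intro!: derivative_eq_intros)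
          then show ?thesis unfolding sh by (rule pderiv_dir_eqI[symmetric])
        qed
        have "cbox (a + s *\<^sub>R e) (b + s *\<^sub>R e) \<subseteq> S"
        proof
          fix q assume "q \<in> cbox (a + s *\<^sub>R e) (b + s *\<^sub>R e)"
          then have "q - s *\<^sub>R e \<in> cbox a b" by (auto simp: mem_box inner_simps)
          then show "q \<in> S" using W(2)[of "q - s *\<^sub>R e" s] True ab by auto
        qed
        from weak[OF k this]
        have "(LINT p|lborel. g p * pderiv_dir e ?\<phi> (p - s *\<^sub>R e)) = - (LINT p|lborel. h p * ?\<phi> (p - s *\<^sub>R e))"
          unfolding d sh .
        also have "\<dots> = - (LINT p|lborel. h (p + s *\<^sub>R e) * ?\<phi> p)"
          using integral_shift[of "\<lambda>p. h p * ?\<phi> (p - s *\<^sub>R e)" "s *\<^sub>R e"] by simp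
        finally show ?thesis using True by simp
      qed simp
      then show ?thesis by simp
    qed
    also have "\<dots> = (LINT p|lborel. LINT s|lborel. h (p + s *\<^sub>R e) * ?\<phi> p * indicator {0..1} s)"
    proof (rule lborel_pair.Fubini_integral)
      have hp: "integrable (lborel \<Otimes>\<^sub>M lborel) (\<lambda>(p, s). indicator {0..1} s * h (p + s *\<^sub>R e))"
        using pair_integrable_shift[OF unit_interval_integrable h, of "\<lambda>s. s *\<^sub>R e" 1] by simp
      show "integrable (lborel \<Otimes>\<^sub>M lborel) (\<lambda>(p, s). h (p + s *\<^sub>R e) * ?\<phi> p * indicator {0..1} s)"
      proof (rule Bochner_Integration.integrable_bound[OF hp])
        show "AE z in lborel \<Otimes>\<^sub>M lborel. norm (case z of (p, s) \<Rightarrow> h (p + s *\<^sub>R e) * ?\<phi> p * indicator {0..1} s)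
          \<le> norm (case z of (p, s) \<Rightarrow> indicator {0..1} s * h (p + s *\<^sub>R e))"
          using mult_left_mono[OF bnd abs_ge_zero] by (intro AE_I2) (auto simp: abs_mult split: split_indicator)
      qed measurable
    qed
    also have "\<dots> = (LINT p|lborel. unit_avg e h p * ?\<phi> p)"
      by (intro Bochner_Integration.integral_cong refl)
        (subst avg_def, subst integral_mult_left_zero[symmetric], simp add: mult_ac)
    finally have "(LINT p|lborel. g (p + e) * ?\<phi> p) - (LINT p|lborel. g p * ?\<phi> p) = (LINT p|lborel. unit_avg e h p * ?\<phi> p)"
      unfolding 1 .
    then show "(LINT p|lborel. ?H p * ?\<phi> p) = 0"
      using ibdd[OF integrable_shift[OF g, of e], of 0] ibdd[OF g, of 0] ibdd[OF ih, of 0]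
      by (simp add: left_diff_distrib)
  qed
  then show ?thesis by eventually_elim auto
qed

text \<open>Integration by parts against functions \<Phi> that are differentiable in the single
  direction \<open>e\<close> and otherwise only measurable, as expressions in the mollified solution
  are in time. The weak identity admits smooth bumps only, so the difference quotient of \<Phi> is
  summed by parts against increments of \<open>F\<close>, and the step \<open>h\<close> then tends
  to 0.\<close>

lemma increments_by_parts:
  fixes F D \<Phi> \<Phi>' m :: "'b::euclidean_space \<Rightarrow> real" and h :: "nat \<Rightarrow> real"
  assumes D: "integrable lborel D" and [measurable]: "F \<in> borel_measurable borel" and F: "\<And>p. \<bar>F p\<bar> \<le> C"
    and \<Phi>: "integrable lborel \<Phi>" "\<And>p. \<bar>\<Phi> p\<bar> \<le> C'" and [measurable]: "\<Phi>' \<in> borel_measurable borel"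
    and m: "integrable lborel m" and h: "\<And>n. h n > 0" "h \<longlonglongrightarrow> 0"
    and incr: "\<And>n. AE p in lborel. \<Phi> p \<noteq> 0 \<longrightarrow>
      F (p + h n *\<^sub>R e) - F p = h n * avg (indicator {0..1}) (\<lambda>s. s *\<^sub>R e) (h n) D p"
    and der: "AE p in lborel. (\<lambda>n. (\<Phi> (p - h n *\<^sub>R e) - \<Phi> p) / h n) \<longlonglongrightarrow> - \<Phi>' p"
    and dom: "\<And>n. AE p in lborel. \<bar>\<Phi> (p - h n *\<^sub>R e) - \<Phi> p\<bar> \<le> h n * m p"
  shows "(LINT p|lborel. F p * \<Phi>' p) = - (LINT p|lborel. D p * \<Phi> p)"
proof -
  have [measurable]: "D \<in> borel_measurable borel" "\<Phi> \<in> borel_measurable borel" using D \<Phi> by auto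
  have C: "0 \<le> C" "0 \<le> C'" using F[of undefined] \<Phi>(2)[of undefined] by linarith+
  \<comment> \<open>\<open>a n\<close> is evaluated twice: with the quotient on \<Phi> it converges
    to the integral of - F \<Phi>' by domination, and with the shift moved to \<open>F\<close> it
    becomes the integral of \<Phi> against an average of \<open>D\<close>.\<close>
  define a where "a n = (LINT p|lborel. F p * ((\<Phi> (p - h n *\<^sub>R e) - \<Phi> p) / h n))" for n
  have "a \<longlonglongrightarrow> (LINT p|lborel. F p * (- \<Phi>' p))"
    unfolding a_def
  proof (rule integral_dominated_convergence[where w="\<lambda>p. C * m p"])
    show "AE p in lborel. (\<lambda>n. F p * ((\<Phi> (p - h n *\<^sub>R e) - \<Phi> p) / h n)) \<longlonglongrightarrow> F p * (- \<Phi>' p)"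
      using der by eventually_elim (intro tendsto_intros)
    show "AE p in lborel. norm (F p * ((\<Phi> (p - h n *\<^sub>R e) - \<Phi> p) / h n)) \<le> C * m p" for n
      using dom[of n]
    proof eventually_elim
      case (elim p)
      then have "\<bar>(\<Phi> (p - h n *\<^sub>R e) - \<Phi> p) / h n\<bar> \<le> m p"
        using h(1)[of n] by (simp add: field_simps)
      then show ?case
        unfolding real_norm_def abs_mult using F[of p] C by (intro mult_mono) auto
    qed
  qed (use m in auto)
  moreover have "a \<longlonglongrightarrow> (LINT p|lborel. \<Phi> p * D p)"
  proof -
    let ?A = "\<lambda>n. avg (indicator {0..1}) (\<lambda>s. s *\<^sub>R e) (h n) D"
    have iA: "integrable lborel (?A n)" for n
      by (intro integrable_avg unit_interval_integrable D) simp
    have iF: "integrable lborel (\<lambda>p. F (p + c) * f p)" if "integrable lborel f" for f c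
      by (rule Bochner_Integration.integrable_bound[OF integrable_mult_right[OF that, of C]])
        (use that F C in \<open>auto simp: abs_mult intro!: mult_right_mono\<close>)
    have i\<Phi>: "integrable lborel (\<lambda>p. \<Phi> p * f p)" if "integrable lborel f" for f
      by (rule Bochner_Integration.integrable_bound[OF integrable_mult_right[OF that, of C']])
        (use that \<Phi> C in \<open>auto simp: abs_mult intro!: mult_right_mono\<close>)
    have a: "a n = (LINT p|lborel. \<Phi> p * ?A n p)" for n
    proof -
      have "a n * h n = (LINT p|lborel. F p * \<Phi> (p - h n *\<^sub>R e) - F p * \<Phi> p)"
      proof -
        have "a n * h n = (LINT p|lborel. F p * ((\<Phi> (p - h n *\<^sub>R e) - \<Phi> p) / h n) * h n)"
          unfolding a_def by (rule integral_mult_left_zero[symmetric])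
        then show ?thesis using h(1)[of n] by (simp add: right_diff_distrib)
      qed
      also have "\<dots> = (LINT p|lborel. F p * \<Phi> (p - h n *\<^sub>R e)) - (LINT p|lborel. F p * \<Phi> p)"
        using iF[OF \<Phi>(1), of 0] iF[OF integrable_shift[OF \<Phi>(1), of "- h n *\<^sub>R e"], of 0]
        by (intro Bochner_Integration.integral_diff) auto
      also have "(LINT p|lborel. F p * \<Phi> (p - h n *\<^sub>R e)) = (LINT p|lborel. F (p + h n *\<^sub>R e) * \<Phi> p)"
        using integral_shift[of "\<lambda>p. F p * \<Phi> (p - h n *\<^sub>R e)" "h n *\<^sub>R e"] by simp
      also have "\<dots> - (LINT p|lborel. F p * \<Phi> p) = (LINT p|lborel. F (p + h n *\<^sub>R e) * \<Phi> p - F p * \<Phi> p)"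
        using iF[OF \<Phi>(1), of 0] iF[OF \<Phi>(1), of "h n *\<^sub>R e"] by simp
      also have "\<dots> = (LINT p|lborel. (\<Phi> p * ?A n p) * h n)"
      proof (rule integral_cong_AE)
        show "AE p in lborel. F (p + h n *\<^sub>R e) * \<Phi> p - F p * \<Phi> p = (\<Phi> p * ?A n p) * h n"
          using incr[of n] by eventually_elim (auto simp: left_diff_distrib[symmetric])
      qed (use iA[of n] in auto)
      finally show ?thesis using h(1)[of n] by simp
    qed
    have "(\<lambda>n. C' * (LINT p|lborel. \<bar>?A n p - D p\<bar>)) \<longlonglongrightarrow> C' * 0"
      by (intro tendsto_intros avg_tendsto_L1 unit_interval_integrable D h) auto
    then have lim0: "(\<lambda>n. C' * (LINT p|lborel. \<bar>?A n p - D p\<bar>)) \<longlonglongrightarrow> 0" by simp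
    have "(\<lambda>n. a n - (LINT p|lborel. \<Phi> p * D p)) \<longlonglongrightarrow> 0"
    proof (rule Lim_null_comparison[OF always_eventually lim0], rule allI)
      fix n
      have "a n - (LINT p|lborel. \<Phi> p * D p) = (LINT p|lborel. \<Phi> p * (?A n p - D p))"
        using i\<Phi>[OF iA[of n]] i\<Phi>[OF D] by (simp add: a right_diff_distrib)
      also have "\<bar>\<dots>\<bar> \<le> (LINT p|lborel. \<bar>\<Phi> p * (?A n p - D p)\<bar>)"
        by (rule integral_abs_bound)
      also have "\<dots> \<le> (LINT p|lborel. C' * \<bar>?A n p - D p\<bar>)"
      proof (rule integral_mono)
        show "integrable lborel (\<lambda>p. \<bar>\<Phi> p * (?A n p - D p)\<bar>)"
          using iA[of n] D by (intro integrable_abs i\<Phi>) auto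
      qed (use iA[of n] D \<Phi>(2) in \<open>auto simp: abs_mult intro!: mult_right_mono\<close>)
      finally show "norm (a n - (LINT p|lborel. \<Phi> p * D p)) \<le> C' * (LINT p|lborel. \<bar>?A n p - D p\<bar>)"
        by simp
    qed
    then show ?thesis by (rule LIM_zero_cancel)
  qed
  ultimately have "(LINT p|lborel. F p * (- \<Phi>' p)) = (LINT p|lborel. \<Phi> p * D p)"
    by (rule LIMSEQ_unique)
  then show ?thesis by (simp add: mult.commute[of "D _"])
qed

section \<open>Primitives in time and the chain rule\<close>

lemma AE_lborel_ex_in_interval:
  fixes a b :: real
  assumes "AE t in lborel. P t" "a < b"
  obtains t where "a < t" "t < b" "P t"
proof -
  have "\<not> (AE t in lborel. t \<notin> {a<..<b})"
    using assms(2) by (subst AE_iff_null_sets[symmetric]) (auto simp: null_sets_def)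
  moreover have "AE t in lborel. t \<notin> {a<..<b}" if "\<not> (\<exists>t. a < t \<and> t < b \<and> P t)"
    using assms(1) by eventually_elim (use that in auto)
  ultimately show ?thesis using that by blast
qed

text \<open>The interval reaches down to a negative \<alpha>, and before time 0 the function
  \<open>F\<close> is a known constant and \<open>G\<close> vanishes. A starting time t0 < 0 is
  picked at which the increment formula holds for almost every length, so the value \<open>c\<close>
  and the lower limit 0 enter without any trace of \<open>F\<close> at 0.\<close>

lemma weak_deriv_primitive:
  fixes F G :: "real \<Rightarrow> real"
  assumes F: "integrable lborel F" and G: "integrable lborel G" and \<alpha>: "\<alpha> < 0"
    and weak: "\<And>k a b. k > 0 \<Longrightarrow> cbox a b \<subseteq> {\<alpha><..<T} \<Longrightarrow>
      (LINT t|lborel. F t * pderiv_dir 1 (box_bump k a b) t) = - (LINT t|lborel. G t * box_bump k a b t)"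
    and F0: "\<And>t. \<alpha> < t \<Longrightarrow> t < 0 \<Longrightarrow> F t = c" and G0: "\<And>t. t < 0 \<Longrightarrow> G t = 0"
  shows "AE t in lborel. 0 < t \<and> t < T \<longrightarrow> F t = c + (LINT s|lborel. indicator {0..t} s * G s)"
proof -
  have [measurable]: "F \<in> borel_measurable borel" "G \<in> borel_measurable borel" using F G by auto
  define I where "I a b = (LINT s|lborel. (if a \<le> s \<and> s \<le> b then G s else 0))" for a b
  have inc: "AE t in lborel. 0 < h \<and> \<alpha> < t \<and> t + h < T \<longrightarrow> F (t + h) = F t + I t (t + h)" for h
  proof (cases "h > 0")
    case True
    have "AE t in lborel. t \<in> {\<alpha><..<T - h} \<longrightarrow> F (t + h) - F t = unit_avg h (\<lambda>t. h * G t) t"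
    proof (rule weak_deriv_increment[OF F, where S="{\<alpha><..<T}"])
      fix k a b :: real assume *: "k > 0" "cbox a b \<subseteq> {\<alpha><..<T}"
      have "pderiv_dir h (box_bump k a b) t = h * pderiv_dir 1 (box_bump k a b) t" for t
        using pderiv_dir_scale[OF smooth_differentiable[OF smooth_box_bump], of h "1::real" k a b t] by simp
      then show "(LINT p|lborel. F p * pderiv_dir h (box_bump k a b) p) = - (LINT p|lborel. h * G p * box_bump k a b p)"
        using weak[OF *] by (simp add: mult.left_commute[of _ h] mult.assoc)
    next
      fix p s :: real assume ps: "p \<in> {\<alpha><..<T - h}" "s \<in> {0..1}"
      have "0 \<le> s * h" "s * h \<le> 1 * h"
        using ps True by (auto intro: mult_right_mono)
      then show "p + s *\<^sub>R h \<in> {\<alpha><..<T}"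
        using ps by auto
    qed (use G in auto)
    moreover have "unit_avg h (\<lambda>t. h * G t) t = I t (t + h)" for t
    proof -
      have "I t (t + h) = \<bar>h\<bar> *\<^sub>R (LINT s|lborel. (if t \<le> t + h * s \<and> t + h * s \<le> t + h then G (t + h * s) else 0))"
        unfolding I_def using True by (intro lborel_integral_real_affine) auto
      also have "\<dots> = unit_avg h (\<lambda>t. h * G t) t"
        unfolding avg_def using True
        by (auto simp flip: integral_mult_right_zero intro!: Bochner_Integration.integral_cong
          simp: mult.commute[of _ h] zero_le_mult_iff split: split_indicator)
      finally show ?thesis ..
    qed
    ultimately have "AE t in lborel. t \<in> {\<alpha><..<T - h} \<longrightarrow> F (t + h) - F t = I t (t + h)" by simp
    then show ?thesis by eventually_elim auto
  qed auto
  have [measurable]: "(\<lambda>x. I (fst x) (fst x + snd x)) \<in> borel_measurable (borel \<Otimes>\<^sub>M borel)"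
    unfolding I_def by measurable
  \<comment> \<open>Fubini exchanges the quantifiers: the increment formula holds for each length h
    at almost every t, but one t valid for almost every h is wanted.\<close>
  have "AE t in lborel. AE h in lborel. 0 < h \<and> \<alpha> < t \<and> t + h < T \<longrightarrow> F (t + h) = F t + I t (t + h)"
  proof (subst lborel_pair.AE_commute)
    have "Measurable.pred (lborel \<Otimes>\<^sub>M lborel) (\<lambda>x. 0 < snd x \<and> \<alpha> < fst x \<and> fst x + snd x < T \<longrightarrow> F (fst x + snd x) = F (fst x) + I (fst x) (fst x + snd x))"
      by measurable
    then show "{x \<in> space (lborel \<Otimes>\<^sub>M lborel). 0 < snd x \<and> \<alpha> < fst x \<and> fst x + snd x < T \<longrightarrow> F (fst x + snd x) = F (fst x) + I (fst x) (fst x + snd x)} \<in> sets (lborel \<Otimes>\<^sub>M lborel)"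
      by (simp only: pred_def)
  qed (use inc in auto)
  then obtain t0 where t0: "\<alpha> < t0" "t0 < 0" and
    "AE h in lborel. 0 < h \<and> \<alpha> < t0 \<and> t0 + h < T \<longrightarrow> F (t0 + h) = F t0 + I t0 (t0 + h)"
    using AE_lborel_ex_in_interval[OF _ \<alpha>] by blast
  from AE_shift[OF this(3), of "- t0"] show ?thesis
  proof eventually_elim
    case (elim t)
    have "I t0 t = (LINT s|lborel. indicator {0..t} s * G s)"
      unfolding I_def using t0(2) by (intro Bochner_Integration.integral_cong) (auto simp: G0 split: split_indicator)
    with elim t0 F0[OF t0] show ?case by auto
  qed
qed

lemma continuous_primitive:
  fixes G :: "real \<Rightarrow> real"
  assumes G: "integrable lborel G"
  shows "continuous_on UNIV (\<lambda>t. LINT s|lborel. indicator {0..t} s * G s)"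
proof -
  have [measurable]: "G \<in> borel_measurable borel" using G by auto
  have "isCont (\<lambda>t. LINT s|lborel. indicator {0..t} s * G s) t" for t
  proof (rule continuous_at_sequentiallyI)
    fix x assume x: "x \<longlonglongrightarrow> t"
    show "(\<lambda>n. LINT s|lborel. indicator {0..x n} s * G s) \<longlonglongrightarrow> (LINT s|lborel. indicator {0..t} s * G s)"
    proof (rule integral_dominated_convergence[where w="\<lambda>s. \<bar>G s\<bar>"])
      have "AE s in lborel. s \<noteq> t" by (rule AE_lborel_singleton)
      then show "AE s in lborel. (\<lambda>n. indicator {0..x n} s * G s) \<longlonglongrightarrow> indicator {0..t} s * G s"
      proof eventually_elim
        case (elim s)
        then consider "s < t" | "s > t" by linarith
        then have "\<forall>\<^sub>F n in sequentially. indicator {0..x n} s = (indicator {0..t} s :: real)"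
        proof cases
          case 1
          with order_tendstoD(1)[OF x, of s] show ?thesis
            by (auto elim!: eventually_mono simp: indicator_def)
        next
          case 2
          with order_tendstoD(2)[OF x, of s] show ?thesis
            by (auto elim!: eventually_mono simp: indicator_def)
        qed
        then show ?case by (intro tendsto_mult tendsto_eventually tendsto_const)
      qed
    qed (use G in \<open>auto split: split_indicator\<close>)
  qed
  then show ?thesis by (simp add: continuous_on_eq_continuous_at)
qed

text \<open>\<open>G\<close> is merely integrable, so \<open>F\<close> need not be differentiable
  everywhere. Instead \<open>E\<close>, the difference of \<beta>(F) and the candidate integral, is
  shown to be constant: its increments are at most quadratic in those of \<open>A\<close>, the
  primitive of |G|, and a function that varies quadratically with respect to a continuous monotone
  one does not vary at all.\<close>

lemma chain_rule_primitive:
  fixes G \<beta> \<beta>' :: "real \<Rightarrow> real"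
  assumes G: "integrable lborel G" and \<beta>: "\<And>x. (\<beta> has_real_derivative \<beta>' x) (at x)"
    and B: "\<And>x. \<bar>\<beta>' x\<bar> \<le> B" "\<And>x y. \<bar>\<beta>' x - \<beta>' y\<bar> \<le> B * \<bar>x - y\<bar>"
    and F: "\<And>t. F t = c + (LINT s|lborel. indicator {0..t} s * G s)" and t: "0 \<le> t"
  shows "\<beta> (F t) = \<beta> c + (LINT s|lborel. indicator {0..t} s * (\<beta>' (F s) * G s))"
proof -
  have [measurable]: "G \<in> borel_measurable borel" using G by auto
  have contF: "continuous_on UNIV F"
    unfolding F by (intro continuous_intros continuous_primitive G)
  have cont\<beta>': "continuous_on UNIV \<beta>'"
  proof (rule continuous_onI)
    fix x e :: real assume "e > 0"
    have "B \<ge> 0" using B(1)[of 0] by linarith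
    show "\<exists>d>0. \<forall>x'\<in>UNIV. dist x' x < d \<longrightarrow> dist (\<beta>' x') (\<beta>' x) \<le> e"
    proof (intro exI[of _ "e / (B + 1)"] conjI ballI impI)
      fix x' assume "dist x' x < e / (B + 1)"
      then have "B * \<bar>x' - x\<bar> \<le> (B + 1) * (e / (B + 1))"
        using \<open>B \<ge> 0\<close> by (intro mult_mono) (auto simp: dist_real_def)
      then show "dist (\<beta>' x') (\<beta>' x) \<le> e"
        using B(2)[of x' x] \<open>B \<ge> 0\<close> by (simp add: dist_real_def)
    qed (use \<open>B \<ge> 0\<close> \<open>e > 0\<close> in auto)
  qed
  have [measurable]: "F \<in> borel_measurable borel" "\<beta>' \<in> borel_measurable borel"
    using contF cont\<beta>' by (auto intro: borel_measurable_continuous_onI)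
  have iG: "integrable lborel (\<lambda>s. \<beta>' (F s) * G s)"
    by (rule Bochner_Integration.integrable_bound[OF integrable_mult_right[OF G, of B]])
      (use B(1) in \<open>auto simp: abs_mult intro!: mult_right_mono order_trans[OF B(1)]\<close>)
  define A where "A t = (LINT s|lborel. indicator {0..t} s * \<bar>G s\<bar>)" for t
  define E where "E t = \<beta> (F t) - (LINT s|lborel. indicator {0..t} s * (\<beta>' (F s) * G s))" for t
  have contA: "continuous_on UNIV A"
    unfolding A_def using G by (intro continuous_primitive) auto
  have split: "(LINT s|lborel. indicator {0..b} s * f s) - (LINT s|lborel. indicator {0..a} s * f s)
      = (LINT s|lborel. indicator {a<..b} s * f s)"
    if "0 \<le> a" "a \<le> b" "integrable lborel f" for a b and f :: "real \<Rightarrow> real"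
    using that by (subst Bochner_Integration.integral_diff[symmetric])
      (auto intro!: Bochner_Integration.integral_cong integrable_real_mult_indicator simp: mult.commute[of "indicator _ _"] split: split_indicator)
  have ii: "integrable lborel (\<lambda>s. indicator {a<..b} s * f s)" if "integrable lborel f" for a b and f :: "real \<Rightarrow> real"
    using integrable_real_mult_indicator[OF _ that, of "{a<..b}"] by (simp add: mult.commute)
  have dF: "\<bar>F b - F a\<bar> \<le> A b - A a" if "0 \<le> a" "a \<le> b" for a b
  proof -
    have "F b - F a = (LINT s|lborel. indicator {a<..b} s * G s)"
      using split[OF that G] by (simp add: F)
    also have "\<bar>\<dots>\<bar> \<le> (LINT s|lborel. \<bar>indicator {a<..b} s * G s\<bar>)"
      by (rule integral_abs_bound)
    also have "\<dots> = A b - A a"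
      using split[OF that, of "\<lambda>s. \<bar>G s\<bar>"] G by (simp add: A_def abs_mult)
    finally show ?thesis .
  qed
  have Amono: "A a \<le> A b" if "0 \<le> a" "a \<le> b" for a b
    using dF[OF that] by linarith
  \<comment> \<open>With the increment of \<beta>(F) written as \<beta>'(\<xi>) times the integral
    of \<open>G\<close>, the increment of \<open>E\<close> is the integral of (\<beta>'(\<xi>) -
    \<beta>'(F s)) G(s); the Lipschitz bound on \<beta>' supplies the second factor
    \<open>A b - A a\<close>.\<close>
  have quad: "\<bar>E b - E a\<bar> \<le> 2 * B * (A b - A a)\<^sup>2" if ab: "0 \<le> a" "a \<le> b" for a b
  proof -
    have B0: "0 \<le> B" using B(1)[of 0] by linarith
    obtain \<xi> where \<xi>: "\<bar>\<xi> - F a\<bar> \<le> \<bar>F b - F a\<bar>" "\<beta> (F b) - \<beta> (F a) = \<beta>' \<xi> * (F b - F a)"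
    proof -
      consider "F a < F b" | "F b < F a" | "F a = F b" by linarith
      then show ?thesis
      proof cases
        case 1
        obtain \<xi> where "F a < \<xi>" "\<xi> < F b" "\<beta> (F b) - \<beta> (F a) = (F b - F a) * \<beta>' \<xi>"
          using MVT2[OF 1, of \<beta> \<beta>'] \<beta> by blast
        then show ?thesis by (intro that[of \<xi>]) (auto simp: mult.commute)
      next
        case 2
        obtain \<xi> where "F b < \<xi>" "\<xi> < F a" "\<beta> (F a) - \<beta> (F b) = (F a - F b) * \<beta>' \<xi>"
          using MVT2[OF 2, of \<beta> \<beta>'] \<beta> by blast
        then show ?thesis by (intro that[of \<xi>]) (auto simp: algebra_simps)
      qed (intro that[of "F a"], auto)
    qed
    have "E b - E a = \<beta>' \<xi> * (F b - F a) - (LINT s|lborel. indicator {a<..b} s * (\<beta>' (F s) * G s))"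
      using \<xi>(2) split[OF ab iG] by (simp add: E_def)
    also have "F b - F a = (LINT s|lborel. indicator {a<..b} s * G s)"
      using split[OF ab G] by (simp add: F)
    also have "\<beta>' \<xi> * \<dots> - (LINT s|lborel. indicator {a<..b} s * (\<beta>' (F s) * G s))
       = (LINT s|lborel. indicator {a<..b} s * ((\<beta>' \<xi> - \<beta>' (F s)) * G s))"
    proof -
      have "(LINT s|lborel. indicator {a<..b} s * ((\<beta>' \<xi> - \<beta>' (F s)) * G s))
        = (LINT s|lborel. \<beta>' \<xi> * (indicator {a<..b} s * G s) - indicator {a<..b} s * (\<beta>' (F s) * G s))"
        by (intro Bochner_Integration.integral_cong) (auto simp: algebra_simps)
      then show ?thesis
        using ii[OF G, of a b] ii[OF iG, of a b] by simp
    qed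
    also have "\<bar>\<dots>\<bar> \<le> (LINT s|lborel. \<bar>indicator {a<..b} s * ((\<beta>' \<xi> - \<beta>' (F s)) * G s)\<bar>)"
      by (rule integral_abs_bound)
    also have "\<dots> \<le> (LINT s|lborel. (2 * B * (A b - A a)) * (indicator {a<..b} s * \<bar>G s\<bar>))"
    proof (rule integral_mono)
      show "integrable lborel (\<lambda>s. \<bar>indicator {a<..b} s * ((\<beta>' \<xi> - \<beta>' (F s)) * G s)\<bar>)"
        using ii[OF Bochner_Integration.integrable_diff[OF integrable_mult_right[OF G, of "\<beta>' \<xi>"] iG], of a b]
        by (simp add: left_diff_distrib)
      show "integrable lborel (\<lambda>s. (2 * B * (A b - A a)) * (indicator {a<..b} s * \<bar>G s\<bar>))"
        using G by (intro integrable_mult_right ii) auto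
      fix s
      show "\<bar>indicator {a<..b} s * ((\<beta>' \<xi> - \<beta>' (F s)) * G s)\<bar> \<le> (2 * B * (A b - A a)) * (indicator {a<..b} s * \<bar>G s\<bar>)"
      proof (cases "s \<in> {a<..b}")
        case True
        have "\<bar>\<xi> - F s\<bar> \<le> \<bar>\<xi> - F a\<bar> + \<bar>F s - F a\<bar>" by linarith
        also have "\<dots> \<le> 2 * (A b - A a)"
          using \<xi>(1) dF[OF ab] dF[of a s] Amono[of s b] ab True by auto
        finally have "\<bar>\<beta>' \<xi> - \<beta>' (F s)\<bar> \<le> B * (2 * (A b - A a))"
          using B(2)[of \<xi> "F s"] B0 by (meson mult_left_mono order_trans)
        then show ?thesis
          using True mult_right_mono[of _ _ "\<bar>G s\<bar>"] by (fastforce simp: abs_mult mult_ac)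
      qed simp
    qed
    also have "\<dots> = 2 * B * (A b - A a) * (A b - A a)"
      using split[OF ab, of "\<lambda>s. \<bar>G s\<bar>"] G by (simp add: A_def)
    finally show ?thesis by (simp add: power2_eq_square mult_ac)
  qed
  have halve: "\<bar>E b - E a\<bar> \<le> 2 * B * (A b - A a)\<^sup>2 / 2 ^ n" if "0 \<le> a" "a \<le> b" for a b n
    using that
  proof (induction n arbitrary: a b)
    case 0
    then show ?case using quad by simp
  next
    case (Suc n)
    have "A a \<le> (A a + A b) / 2" "(A a + A b) / 2 \<le> A b"
      using Amono[OF Suc.prems] by auto
    \<comment> \<open>Bisection is in the values of \<open>A\<close>, not in time. The two halves
      contribute twice (1/2)^2, so the bound is halved at each level.\<close>
    then obtain x where x: "a \<le> x" "x \<le> b" "A x = (A a + A b) / 2"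
      using IVT'[of A a "(A a + A b) / 2" b] Suc.prems continuous_on_subset[OF contA, of "{a..b}"] by blast
    have "\<bar>E b - E a\<bar> \<le> \<bar>E b - E x\<bar> + \<bar>E x - E a\<bar>" by linarith
    also have "\<dots> \<le> 2 * B * (A b - A x)\<^sup>2 / 2 ^ n + 2 * B * (A x - A a)\<^sup>2 / 2 ^ n"
      using Suc.IH[of x b] Suc.IH[of a x] x Suc.prems by linarith
    also have "\<dots> = 2 * B * (A b - A a)\<^sup>2 / 2 ^ Suc n"
      unfolding x(3) by (simp add: field_simps power2_eq_square)
    finally show ?case .
  qed
  have "(\<lambda>n. 2 * B * (A t - A 0)\<^sup>2 * (1 / 2) ^ n) \<longlonglongrightarrow> 2 * B * (A t - A 0)\<^sup>2 * 0"
    by (intro tendsto_intros LIMSEQ_power_zero) auto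
  moreover have "x * (1 / 2) ^ n = x / 2 ^ n" for x :: real and n
    by (simp add: power_one_over)
  ultimately have "(\<lambda>n. 2 * B * (A t - A 0)\<^sup>2 / 2 ^ n) \<longlonglongrightarrow> 0"
    by simp
  from LIMSEQ_le_const[OF this, of "\<bar>E t - E 0\<bar>"] have "\<bar>E t - E 0\<bar> \<le> 0"
    using halve[OF order_refl t] by blast
  moreover have z: "(LINT s|lborel. indicator {0..0} s * f s) = 0" for f :: "real \<Rightarrow> real"
    by (rule integral_eq_zero_AE) (rule eventually_mono[OF AE_lborel_singleton[of "0::real"]], simp)
  ultimately show ?thesis
    by (simp add: E_def F)
qed

subsection \<open>Mollification of the transport equation\<close>

lemma integral_affine:
  fixes f :: "'b::euclidean_space \<Rightarrow> real"
  assumes [measurable]: "f \<in> borel_measurable borel" and c: "c \<noteq> 0"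
  shows "integral\<^sup>L lborel f = \<bar>c\<bar> ^ DIM('b) * (LINT p|lborel. f (t + c *\<^sub>R p))"
  by (subst lborel_affine[OF c, of t]) (simp add: integral_density integral_distr)

definition moll :: "'a::euclidean_space \<Rightarrow> real" where
  "moll w = box_bump 1 (- One) One w / (LINT p|lborel. box_bump 1 (- One) (One::'a) p)"

lemma box_bump_integrable:
  assumes "k > 0" shows "integrable lborel (box_bump k a (b::'b::euclidean_space))"
proof (rule Bochner_Integration.integrable_bound)
  show "integrable lborel (indicator (cbox a b) :: 'b \<Rightarrow> real)"
    using emeasure_bounded_finite[OF bounded_cbox, of a b] by (simp add: integrable_indicator_iff)
  show "AE p in lborel. norm (box_bump k a b p) \<le> norm (indicator (cbox a b) p :: real)"
  proof (rule AE_I2)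
    fix p
    show "norm (box_bump k a b p) \<le> norm (indicator (cbox a b) p :: real)"
      using box_bump_nonneg[of k a b p] box_bump_le_1[of k a b p] box_bump_eq_0_iff[OF assms, of a b p] box_subset_cbox[of a b]
      by (cases "p \<in> cbox a b") auto
  qed
qed auto

lemma integral_box_bump_pos: "0 < (LINT p|lborel. box_bump 1 (- One) (One::'a::euclidean_space) p)"
proof -
  let ?\<phi> = "box_bump 1 (- One) (One::'a)"
  have "(LINT p|lborel. ?\<phi> p) \<noteq> 0"
  proof
    assume "(LINT p|lborel. ?\<phi> p) = 0"
    then have "AE p in lborel. ?\<phi> p = 0"
      using box_bump_integrable[of 1 "- One" "One::'a"] by (subst (asm) integral_nonneg_eq_0_iff_AE) (auto simp: box_bump_nonneg)
    then have "AE p in lborel. p \<notin> box (- One) (One::'a)"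
      by (simp add: box_bump_eq_0_iff)
    then have "emeasure lborel (box (- One) (One::'a)) = 0"
      by (subst (asm) AE_iff_null_sets[symmetric]) (auto simp: null_sets_def)
    moreover have "0 < (\<Prod>b\<in>Basis. (One - - (One::'a)) \<bullet> b)"
      by (intro prod_pos) (simp add: inner_add_left)
    ultimately show False
      by (subst (asm) emeasure_lborel_box) (auto simp: ennreal_eq_0_iff)
  qed
  moreover have "0 \<le> (LINT p|lborel. ?\<phi> p)" by (simp add: box_bump_nonneg)
  ultimately show ?thesis by linarith
qed

lemma smooth_moll: "smooth moll"
proof -
  have "smooth (\<lambda>w::'a. box_bump 1 (- One) One w * (1 / (LINT p|lborel. box_bump 1 (- One) (One::'a) p)))"
    by (intro smooth_mult smooth_box_bump smooth_const)
  then show ?thesis by (simp add: moll_def[abs_def])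
qed

lemma moll_measurable [measurable]: "moll \<in> borel_measurable borel"
  by (intro borel_measurable_continuous_onI smooth_continuous smooth_moll)

lemma pderiv_moll_measurable [measurable]: "pderiv_dir e moll \<in> borel_measurable borel"
  by (intro borel_measurable_continuous_onI smooth_pderiv_continuous smooth_moll)

lemma moll_integrable: "integrable lborel moll"
  unfolding moll_def[abs_def] by (intro integrable_divide_zero box_bump_integrable) auto

lemma integral_moll: "integral\<^sup>L lborel (moll :: 'a::euclidean_space \<Rightarrow> real) = 1"
  using integral_box_bump_pos[where 'a='a] by (simp add: moll_def[abs_def])

lemma moll_nonneg: "0 \<le> moll w"
  using integral_box_bump_pos[where 'a='a] by (simp add: moll_def box_bump_nonneg)

lemma moll_eq_0: "w \<notin> cbox (- One) One \<Longrightarrow> moll w = 0"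
  using box_bump_eq_0_iff[of 1 "- One" One w] box_subset_cbox by (auto simp: moll_def)

lemma norm_le_DIM: "w \<in> cbox (- One) (One::'a::euclidean_space) \<Longrightarrow> norm w \<le> DIM('a)"
proof -
  assume w: "w \<in> cbox (- One) (One::'a)"
  have "norm w \<le> (\<Sum>i\<in>Basis. \<bar>w \<bullet> i\<bar>)" by (rule norm_le_l1)
  also have "\<dots> \<le> (\<Sum>i\<in>(Basis::'a set). 1)"
    using w by (intro sum_mono) (auto simp: mem_box abs_le_iff)
  finally show ?thesis by simp
qed

lemma moll_bounded:
  obtains B where "B > 0" "\<And>w. \<bar>moll (w::'a::euclidean_space)\<bar> \<le> B"
proof -
  have "compact (moll ` cbox (- One) (One::'a))"
    by (intro compact_continuous_image continuous_on_subset[OF smooth_continuous[OF smooth_moll]]) auto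
  then obtain B where B: "B > 0" "\<And>p. p \<in> cbox (- One) (One::'a) \<Longrightarrow> \<bar>moll p\<bar> \<le> B"
    using compact_imp_bounded[of "moll ` cbox (- One) (One::'a)"] unfolding bounded_pos by auto
  then have "\<bar>moll p\<bar> \<le> B" for p :: 'a
    using moll_eq_0[of p] by (cases "p \<in> cbox (- One) One") auto
  with B(1) show ?thesis by (intro that)
qed

lemma pderiv_moll_bounded:
  obtains B where "B > 0" "\<And>w. \<bar>pderiv_dir e moll (w::'a::euclidean_space)\<bar> \<le> B"
    "\<And>w. w \<notin> cbox (- One) One \<Longrightarrow> pderiv_dir e moll w = 0"
  using smooth_compact_support_bounded[OF smooth_moll compact_cbox, of "- One" One e] moll_eq_0 by metis

text \<open>The exponent 0 gives integrability of the derivative itself, the exponent 1 that of the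
  kernel in the commutator estimate.\<close>

lemma norm_pderiv_moll_integrable: "integrable lborel (\<lambda>w::'a::euclidean_space. norm w ^ j * pderiv_dir e moll w)"
proof -
  obtain B where B: "B > 0" "\<And>w. \<bar>pderiv_dir e moll (w::'a)\<bar> \<le> B"
    "\<And>w. w \<notin> cbox (- One) One \<Longrightarrow> pderiv_dir e moll w = 0"
    using pderiv_moll_bounded by metis
  show ?thesis
  proof (rule Bochner_Integration.integrable_bound)
  show "integrable lborel (\<lambda>w. real DIM('a) ^ j * B * indicator (cbox (- One) (One::'a)) w :: real)"
    by (intro integrable_mult_right) (use emeasure_bounded_finite[OF bounded_cbox] in \<open>simp add: integrable_indicator_iff\<close>)
  show "AE w in lborel. norm (norm w ^ j * pderiv_dir e moll w) \<le> norm (real DIM('a) ^ j * B * indicator (cbox (- One) (One::'a)) w)"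
  proof (rule AE_I2)
    fix w :: 'a
    show "norm (norm w ^ j * pderiv_dir e moll w) \<le> norm (real DIM('a) ^ j * B * indicator (cbox (- One) (One::'a)) w)"
    proof (cases "w \<in> cbox (- One) One")
      case True
      then show ?thesis
        using B(1,2) norm_le_DIM[OF True] by (auto simp: abs_mult intro!: mult_mono power_mono)
    qed (simp add: B(3))
  qed
  qed measurable
qed

lemma pderiv_moll_integrable: "integrable lborel (pderiv_dir e moll)"
  using norm_pderiv_moll_integrable[of 0 e] by simp

text \<open>\<open>moll\<close> and its translate by \<open>e\<close> have equal integrals, while
  their difference is minus an average of integrals of translated derivatives, all equal to one
  another. The vanishing allows u(x) v(x) to be inserted in the commutator at no cost.\<close>

lemma integral_pderiv_moll: "integral\<^sup>L lborel (pderiv_dir e (moll :: 'a::euclidean_space \<Rightarrow> real)) = 0"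
proof -
  have p: "integrable (lborel \<Otimes>\<^sub>M lborel) (\<lambda>(p::'a, s::real). indicator {0..1} s * pderiv_dir e moll (p + 1 *\<^sub>R (- (s *\<^sub>R e))))"
    by (intro pair_integrable_shift unit_interval_integrable pderiv_moll_integrable) simp
  have "0 = (LINT p|lborel. moll (p - e)) - (LINT p|lborel. moll (p::'a))"
    using integral_shift[of moll "- e"] by simp
  also have "\<dots> = (LINT p|lborel. moll (p - e) - moll p)"
    using moll_integrable integrable_shift[OF moll_integrable, of "- e"]
    by (intro Bochner_Integration.integral_diff[symmetric]) auto
  also have "\<dots> = - (LINT p|lborel. LINT s|lborel. indicator {0..1} s * pderiv_dir e moll (p - s *\<^sub>R e))"
    by (simp add: smooth_line_integral[OF smooth_moll])
  also have "\<dots> = - (LINT s|lborel. LINT p|lborel. indicator {0..1} s * pderiv_dir e moll (p - s *\<^sub>R e))"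
    using lborel_pair.Fubini_integral[OF p] by simp
  also have "\<dots> = - (LINT s|lborel. indicator {0..1::real} s * integral\<^sup>L lborel (pderiv_dir e (moll :: 'a \<Rightarrow> real)))"
    using integral_shift[of "pderiv_dir e (moll :: 'a \<Rightarrow> real)" "- (_ *\<^sub>R e)"] by simp
  also have "\<dots> = - integral\<^sup>L lborel (pderiv_dir e (moll :: 'a \<Rightarrow> real))"
    by simp
  finally show ?thesis by simp
qed

lemma moll_scaled_eq:
  assumes "\<epsilon> > 0"
  shows "moll ((x - y) /\<^sub>R \<epsilon>) = box_bump (1 / \<epsilon>) (x - \<epsilon> *\<^sub>R One) (x + \<epsilon> *\<^sub>R One) (y::'a::euclidean_space)
    / (LINT p|lborel. box_bump 1 (- One) (One::'a) p)"
proof -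
  have "box_bump 1 (- One) One ((x - y) /\<^sub>R \<epsilon>) = box_bump (1 / \<epsilon>) (x - \<epsilon> *\<^sub>R One) (x + \<epsilon> *\<^sub>R One) y"
    unfolding box_bump_def
  proof (rule prod.cong[OF refl], goal_cases)
    case (1 i)
    have "1 * (((x - y) /\<^sub>R \<epsilon>) \<bullet> i - (- One) \<bullet> i) = 1 / \<epsilon> * ((x + \<epsilon> *\<^sub>R One) \<bullet> i - y \<bullet> i)"
      "1 * (One \<bullet> i - ((x - y) /\<^sub>R \<epsilon>) \<bullet> i) = 1 / \<epsilon> * (y \<bullet> i - (x - \<epsilon> *\<^sub>R One) \<bullet> i)"
      using 1 assms by (simp_all add: inner_simps field_simps)
    then show ?case by (simp only: mult.commute)
  qed
  then show ?thesis by (simp add: moll_def)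
qed

lemma smooth_box_bump_fst: "smooth (\<lambda>p::'a::euclidean_space \<times> 'c::euclidean_space. box_bump k a b (fst p))"
proof -
  have "smooth (\<lambda>p::'a \<times> 'c. expinv (k * (p \<bullet> (i, 0) - a \<bullet> i)) * expinv (k * (b \<bullet> i - p \<bullet> (i, 0))))" for i
    by (rule smooth_box_bump_aux)
  then show ?thesis
    unfolding box_bump_def by (intro smooth_prod) (simp add: inner_prod_def)
qed

lemma smooth_box_bump_snd: "smooth (\<lambda>p::'a::euclidean_space \<times> 'c::euclidean_space. box_bump k a b (snd p))"
proof -
  have "smooth (\<lambda>p::'a \<times> 'c. expinv (k * (p \<bullet> (0, i) - a \<bullet> i)) * expinv (k * (b \<bullet> i - p \<bullet> (0, i))))" for i
    by (rule smooth_box_bump_aux)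
  then show ?thesis
    unfolding box_bump_def by (intro smooth_prod) (simp add: inner_prod_def)
qed

text \<open>Testing with this function evaluates the mollified equation at the point
  \<open>x\<close>. Admissible test functions live on the whole space and at all times below T, so
  the kernel may stick out of the spatial domain and the time bump may be nonzero at 0. Hence the
  equation is obtained at every \<open>x\<close>, with the data extended by zero and the initial
  datum present.\<close>

definition tensor_test :: "real \<Rightarrow> 'a::euclidean_space \<Rightarrow> real \<Rightarrow> real \<Rightarrow> real \<Rightarrow> 'a \<times> real \<Rightarrow> real" where
  "tensor_test \<epsilon> x k a b p = moll ((x - fst p) /\<^sub>R \<epsilon>) * box_bump k a b (snd p)"

lemma test_function_tensor:
  fixes x :: "'a::euclidean_space"
  assumes "\<epsilon> > 0" "k > 0" "cbox a b \<subseteq> {..<T}"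
  shows "test_function (UNIV \<times> {..<T}) (tensor_test \<epsilon> x k a b)"
proof (rule test_functionI)
  have "smooth (\<lambda>p::'a \<times> real. (box_bump (1 / \<epsilon>) (x - \<epsilon> *\<^sub>R One) (x + \<epsilon> *\<^sub>R One) (fst p)
     * (1 / (LINT p|lborel. box_bump 1 (- One) (One::'a) p))) * box_bump k a b (snd p))"
    by (intro smooth_mult smooth_box_bump_fst smooth_box_bump_snd smooth_const)
  then show "smooth (tensor_test \<epsilon> x k a b)"
    using assms by (simp add: tensor_test_def[abs_def] moll_scaled_eq)
  let ?K = "cbox (x - \<epsilon> *\<^sub>R One) (x + \<epsilon> *\<^sub>R One) \<times> cbox a b"
  show "compact ?K" by (intro compact_Times compact_cbox)
  show "?K \<subseteq> UNIV \<times> {..<T}" using assms by auto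
  show "tensor_test \<epsilon> x k a b p = 0" if "p \<notin> ?K" for p
    using that assms box_subset_cbox[of a b] box_subset_cbox[of "x - \<epsilon> *\<^sub>R One" "x + \<epsilon> *\<^sub>R One"]
      box_bump_eq_0_iff[of "1 / \<epsilon>" "x - \<epsilon> *\<^sub>R One" "x + \<epsilon> *\<^sub>R One" "fst p"] box_bump_eq_0_iff[of k a b "snd p"]
    by (auto simp: tensor_test_def moll_scaled_eq mem_Times_iff)
qed

lemma tensor_test_has_derivative:
  "(tensor_test \<epsilon> x k a b has_derivative
     (\<lambda>h. moll ((x - fst p) /\<^sub>R \<epsilon>) * pderiv_dir (snd h) (box_bump k a b) (snd p)
        + pderiv_dir (- (fst h /\<^sub>R \<epsilon>)) moll ((x - fst p) /\<^sub>R \<epsilon>) * box_bump k a b (snd p))) (at p)"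
  unfolding tensor_test_def[abs_def]
proof (rule has_derivative_mult)
  show "((\<lambda>p. moll ((x - fst p) /\<^sub>R \<epsilon>)) has_derivative (\<lambda>h. pderiv_dir (- (fst h /\<^sub>R \<epsilon>)) moll ((x - fst p) /\<^sub>R \<epsilon>))) (at p)"
    by (rule has_derivative_compose[OF _ smooth_has_derivative[OF smooth_moll], of _ _ _ UNIV])
      (auto intro!: derivative_eq_intros)
  show "((\<lambda>p. box_bump k a b (snd p)) has_derivative (\<lambda>h. pderiv_dir (snd h) (box_bump k a b) (snd p))) (at p)"
    by (rule has_derivative_compose[OF _ box_bump_has_derivative, of _ _ _ UNIV])
      (auto intro!: derivative_eq_intros)
qed

lemma pderiv_dir_0 [simp]: "\<phi> differentiable at p \<Longrightarrow> pderiv_dir 0 \<phi> p = 0"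
  using pderiv_dir_scale[of \<phi> p 0 0] by simp

lemma dt_tensor_test:
  "dt (tensor_test \<epsilon> x k a b) p = moll ((x - fst p) /\<^sub>R \<epsilon>) * pderiv_dir 1 (box_bump k a b) (snd p)"
  unfolding dt_def pderiv_dir_eqI[OF tensor_test_has_derivative]
  by (simp add: smooth_differentiable[OF smooth_moll])

lemma grad_x_tensor_test:
  "grad_x (tensor_test \<epsilon> x k a b) p =
     (\<Sum>i\<in>Basis. (- (pderiv_dir i moll ((x - fst p) /\<^sub>R \<epsilon>) / \<epsilon>) * box_bump k a b (snd p)) *\<^sub>R i)"
proof -
  have "pderiv_dir (i, 0) (tensor_test \<epsilon> x k a b) p = - (pderiv_dir i moll ((x - fst p) /\<^sub>R \<epsilon>) / \<epsilon>) * box_bump k a b (snd p)" for i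
    unfolding pderiv_dir_eqI[OF tensor_test_has_derivative]
    using pderiv_dir_scale[OF smooth_differentiable[OF smooth_moll], of "- inverse \<epsilon>" i]
    by (simp add: smooth_differentiable[OF smooth_box_bump] divide_inverse)
  then show ?thesis by (simp add: grad_x_def)
qed

lemma unit_avg_bound:
  assumes "\<And>p. \<bar>H p\<bar> \<le> C"
  shows "\<bar>unit_avg e H p\<bar> \<le> C"
proof -
  have "\<bar>unit_avg e H p\<bar> \<le> (LINT s|lborel. \<bar>indicator {0..1} s * H (p + 1 *\<^sub>R s *\<^sub>R e)\<bar>)"
    unfolding avg_def by (rule integral_abs_bound)
  also have "\<dots> \<le> (LINT s|lborel. indicator {0..1::real} s * C)"
    using assms order_trans[OF abs_ge_zero assms]
    by (intro integral_mono') (auto intro: unit_interval_integrable split: split_indicator)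
  finally show ?thesis by simp
qed

lemma AE_snd:
  assumes "AE s in lborel. P s"
  shows "AE p in (lborel :: ('a::euclidean_space \<times> 'c::euclidean_space) measure). P (snd p)"
proof -
  obtain N where N: "N \<in> null_sets lborel" "{s \<in> space lborel. \<not> P s} \<subseteq> N"
    using assms unfolding eventually_ae_filter by auto
  have "N \<in> sets borel" using N by auto
  have "emeasure (lborel \<Otimes>\<^sub>M lborel) ((UNIV :: 'a set) \<times> N) = 0"
    using N by (subst lborel.emeasure_pair_measure_Times) (auto simp: null_sets_def)
  then have "(UNIV :: 'a set) \<times> N \<in> null_sets lborel"
    using \<open>N \<in> sets borel\<close> unfolding null_sets_def lborel_prod
    by (auto intro!: borel_Times)
  then show ?thesis
    by (rule AE_I') (use N(2) in auto)
qed

lemma sum_Basis_pair: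
  fixes f :: "'a::euclidean_space \<times> 'c::euclidean_space \<Rightarrow> real"
  shows "sum f Basis = (\<Sum>i\<in>Basis. f (i, 0)) + (\<Sum>i\<in>Basis. f (0, i))"
proof -
  have "inj_on (\<lambda>u. (u::'a, 0::'c)) Basis" "inj_on (\<lambda>u. (0::'a, u::'c)) Basis"
    by (auto intro!: inj_onI)
  then show ?thesis
    unfolding Basis_prod_def by (subst sum.union_disjoint) (auto simp: sum.reindex)
qed

text \<open>The data are Borel representatives extended by zero outside $\Omega\times(0,T)$; $D_{ij}$ stands for
  $\partial_j v_i$, $d$ for the divergence $q^I-q^P$, and the zeroth order terms are collected in
  $g = fq^I-\bar uq^P$.\<close>

locale transport =
  fixes \<Omega> :: "'a::euclidean_space set" and T M :: real and u0 :: "'a \<Rightarrow> real"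
    and u g d :: "'a \<times> real \<Rightarrow> real" and v :: "'a \<times> real \<Rightarrow> 'a" and D :: "'a \<Rightarrow> 'a \<Rightarrow> 'a \<times> real \<Rightarrow> real"
  assumes open_Omega: "open \<Omega>" and bounded_Omega: "bounded \<Omega>" and T: "T > 0"
    and u0: "integrable lborel u0" and u: "integrable lborel u" and g: "integrable lborel g"
    and v_meas [measurable]: "v \<in> borel_measurable borel" and v_bound: "\<And>p. norm (v p) \<le> M"
    and d_meas [measurable]: "d \<in> borel_measurable borel" and d_bound: "\<And>p. \<bar>d p\<bar> \<le> M"
    and D_meas: "\<And>i j. i \<in> Basis \<Longrightarrow> j \<in> Basis \<Longrightarrow> D i j \<in> borel_measurable borel"
    and D_bound: "\<And>i j p. i \<in> Basis \<Longrightarrow> j \<in> Basis \<Longrightarrow> \<bar>D i j p\<bar> \<le> M"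
    and outside: "\<And>p. p \<notin> \<Omega> \<times> {0<..<T} \<Longrightarrow> u p = 0" "\<And>p. p \<notin> \<Omega> \<times> {0<..<T} \<Longrightarrow> g p = 0"
      "\<And>p. p \<notin> \<Omega> \<times> {0<..<T} \<Longrightarrow> v p = 0" "\<And>p. p \<notin> \<Omega> \<times> {0<..<T} \<Longrightarrow> d p = 0"
      "\<And>i j p. i \<in> Basis \<Longrightarrow> j \<in> Basis \<Longrightarrow> p \<notin> \<Omega> \<times> {0<..<T} \<Longrightarrow> D i j p = 0"
    and weak_D: "\<And>i j k a b. i \<in> Basis \<Longrightarrow> j \<in> Basis \<Longrightarrow> k > 0 \<Longrightarrow> cbox a b \<subseteq> \<Omega> \<times> {0<..<T} \<Longrightarrow>
      (LINT p|lborel. (v p \<bullet> i) * pderiv_dir (j, 0) (box_bump k a b) p) = - (LINT p|lborel. D i j p * box_bump k a b p)"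
    and div: "AE p in lborel. (\<Sum>i\<in>Basis. D i i p) = d p"
    and weak: "\<And>\<phi>. test_function (UNIV \<times> {..<T}) \<phi> \<Longrightarrow>
      - (LINT p|lborel. u p * dt \<phi> p) - (LINT x|lborel. u0 x * \<phi> (x, 0))
      - (LINT p|lborel. u p * (v p \<bullet> grad_x \<phi> p)) = (LINT p|lborel. g p * \<phi> p)"
begin

abbreviation Q where "Q \<equiv> \<Omega> \<times> {0<..<T}"

lemma open_Q: "open Q" and bounded_Q: "bounded Q"
  using open_Omega bounded_Omega by (auto intro: open_Times bounded_Times)

lemma [measurable]: "u0 \<in> borel_measurable borel" "u \<in> borel_measurable borel" "g \<in> borel_measurable borel"
  using u0 u g by auto

lemma M_nonneg: "0 \<le> M"
  using d_bound[of undefined] by linarith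

lemma integrable_bounded_Q:
  assumes "f \<in> borel_measurable borel" "\<And>p. \<bar>f p\<bar> \<le> C" "\<And>p. p \<notin> Q \<Longrightarrow> f p = 0"
  shows "integrable lborel (f :: 'a \<times> real \<Rightarrow> real)"
proof (rule Bochner_Integration.integrable_bound)
  show "integrable lborel (\<lambda>p. C * indicator Q p :: real)"
    using emeasure_bounded_finite[OF bounded_Q] open_Q by (intro integrable_mult_right) (auto simp: integrable_indicator_iff)
  show "AE p in lborel. norm (f p) \<le> norm (C * indicator Q p :: real)"
    using assms(2,3) order_trans[OF abs_ge_zero assms(2)] by (intro AE_I2) (auto split: split_indicator)
qed (use assms in auto)

lemma v_inner_bound: "i \<in> Basis \<Longrightarrow> \<bar>v p \<bullet> i\<bar> \<le> M"
  using Basis_le_norm[of i "v p"] v_bound[of p] by linarith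

lemma v_integrable: "i \<in> Basis \<Longrightarrow> integrable lborel (\<lambda>p. v p \<bullet> i)"
  by (rule integrable_bounded_Q[of _ M]) (auto simp: v_inner_bound outside)

lemma d_integrable: "integrable lborel d"
  by (rule integrable_bounded_Q[of _ M]) (auto simp: d_bound outside)

lemma D_integrable: "i \<in> Basis \<Longrightarrow> j \<in> Basis \<Longrightarrow> integrable lborel (D i j)"
  by (rule integrable_bounded_Q[of _ M]) (auto simp: D_bound D_meas outside)

text \<open>The horizontal direction (z,0) is expanded over the spatial basis, so the derivative
  along the segment is the combination of the functions \<open>D i j\<close> with the coordinates of
  \<open>z\<close> as coefficients.\<close>

lemma v_increment:
  assumes i: "i \<in> Basis" and W: "open W" "\<And>p s. p \<in> W \<Longrightarrow> s \<in> {0..1} \<Longrightarrow> p + s *\<^sub>R (z, 0) \<in> Q"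
  shows "AE p in lborel. p \<in> W \<longrightarrow> v (p + (z, 0)) \<bullet> i - v p \<bullet> i = unit_avg (z, 0) (\<lambda>p. \<Sum>j\<in>Basis. (z \<bullet> j) * D i j p) p"
proof (rule weak_deriv_increment[OF v_integrable[OF i] _ _ W])
  show "integrable lborel (\<lambda>p. \<Sum>j\<in>Basis. (z \<bullet> j) * D i j p)"
    using D_integrable i by (intro Bochner_Integration.integrable_sum integrable_mult_right) auto
  fix k :: real and a b :: "'a \<times> real" assume k: "k > 0" and ab: "cbox a b \<subseteq> Q"
  let ?\<phi> = "box_bump k a b"
  have pd: "pderiv_dir (z, 0) ?\<phi> p = (\<Sum>j\<in>Basis. (z \<bullet> j) * pderiv_dir (j, 0) ?\<phi> p)" for p
    by (subst pderiv_dir_linear_sum)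
      (simp_all add: smooth_differentiable smooth_box_bump sum_Basis_pair)
  have int: "integrable lborel (\<lambda>p. (v p \<bullet> i) * pderiv_dir e ?\<phi> p)" for e
  proof -
    obtain B where B: "B > 0" "\<And>p. \<bar>pderiv_dir e ?\<phi> p\<bar> \<le> B" 
      using smooth_compact_support_bounded[OF smooth_box_bump compact_cbox, of a b k a b e] 
      by (metis box_bump_eq_0_iff box_subset_cbox k subsetD)
    show ?thesis
      by (rule integrable_bounded_Q[of _ "M * B"])
        (use B v_inner_bound[OF i] M_nonneg in \<open>auto simp: abs_mult outside intro!: mult_mono\<close>)
  qed
  have int': "integrable lborel (\<lambda>p. D i j p * ?\<phi> p)" if "j \<in> Basis" for j
  proof (rule integrable_bounded_Q[of _ "M * 1"])
    show "\<bar>D i j p * ?\<phi> p\<bar> \<le> M * 1" for p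
      unfolding abs_mult by (intro mult_mono D_bound i that) (auto simp: M_nonneg box_bump_nonneg box_bump_le_1)
  qed (use D_meas that i in \<open>auto simp: outside\<close>)
  have "(LINT p|lborel. (v p \<bullet> i) * pderiv_dir (z, 0) ?\<phi> p) = (LINT p|lborel. (\<Sum>j\<in>Basis. (z \<bullet> j) * ((v p \<bullet> i) * pderiv_dir (j, 0) ?\<phi> p)))"
    unfolding pd sum_distrib_left by (simp add: mult.left_commute)
  also have "\<dots> = (\<Sum>j\<in>Basis. (z \<bullet> j) * (LINT p|lborel. (v p \<bullet> i) * pderiv_dir (j, 0) ?\<phi> p))"
    using int by (subst Bochner_Integration.integral_sum) auto
  also have "\<dots> = - (\<Sum>j\<in>Basis. (z \<bullet> j) * (LINT p|lborel. D i j p * ?\<phi> p))"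
    using weak_D[OF i _ k ab] by (simp add: sum_negf)
  also have "\<dots> = - (LINT p|lborel. (\<Sum>j\<in>Basis. (z \<bullet> j) * (D i j p * ?\<phi> p)))"
    using int' by (subst Bochner_Integration.integral_sum) auto
  finally show "(LINT p|lborel. (v p \<bullet> i) * pderiv_dir (z, 0) ?\<phi> p) = - (LINT p|lborel. (\<Sum>j\<in>Basis. (z \<bullet> j) * D i j p) * ?\<phi> p)"
    by (simp add: sum_distrib_right mult.assoc)
qed

text \<open>The exceptional null set may depend on \<open>z\<close>; an integral over
  \<open>z\<close> requires an exchange of quantifiers by Fubini. The dimension comes from bounding
  each summand of the derivative along the segment by M times the norm of \<open>z\<close>.\<close>

lemma v_Lipschitz:
  assumes i: "i \<in> Basis" and W: "open W" "\<And>p s. p \<in> W \<Longrightarrow> s \<in> {0..1} \<Longrightarrow> p + s *\<^sub>R (z, 0) \<in> Q"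
  shows "AE p in lborel. p \<in> W \<longrightarrow> \<bar>v (p + (z, 0)) \<bullet> i - v p \<bullet> i\<bar> \<le> DIM('a) * M * norm z"
proof -
  have "\<bar>\<Sum>j\<in>Basis. (z \<bullet> j) * D i j p\<bar> \<le> (\<Sum>j\<in>(Basis::'a set). norm z * M)" for p
    by (intro order_trans[OF sum_abs] sum_mono) (auto simp: abs_mult intro!: mult_mono D_bound[OF i] Basis_le_norm)
  then have "\<bar>unit_avg (z, 0) (\<lambda>p. \<Sum>j\<in>Basis. (z \<bullet> j) * D i j p) p\<bar> \<le> DIM('a) * M * norm z" for p
    by (intro unit_avg_bound) (simp add: mult_ac)
  with v_increment[OF assms] show ?thesis
    by (auto elim!: eventually_mono)
qed

text \<open>In time \<Phi> is only measurable and bounded, since it will contain the mollified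
  solution, which is regular in x only. Accordingly the bound \<open>m\<close> on its x-derivative
  depends on time and is merely integrable.\<close>

lemma v_by_parts:
  assumes i: "i \<in> Basis" and K: "compact K" "K \<subseteq> \<Omega>"
    and \<Phi>: "\<Phi> \<in> borel_measurable borel" "\<And>p. \<bar>\<Phi> p\<bar> \<le> C" "\<And>y s. \<Phi> (y, s) \<noteq> 0 \<Longrightarrow> y \<in> K \<and> 0 < s \<and> s < T"
    and \<Phi>': "\<Phi>' \<in> borel_measurable borel" and m: "integrable lborel m"
    and der: "AE s in lborel. \<forall>y. ((\<lambda>r. \<Phi> (y + r *\<^sub>R i, s)) has_real_derivative \<Phi>' (y, s)) (at 0) \<and> \<bar>\<Phi>' (y, s)\<bar> \<le> m s"
  shows "(LINT p|lborel. (v p \<bullet> i) * \<Phi>' p) = - (LINT p|lborel. D i i p * \<Phi> p)"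
proof -
  obtain \<delta> where \<delta>: "\<delta> > 0" "(\<Union>x\<in>K. ball x \<delta>) \<subseteq> \<Omega>"
    using compact_subset_open_imp_ball_epsilon_subset[OF K(1) open_Omega K(2)] by blast
  define W where "W = (\<Union>x\<in>K. ball x (\<delta> / 2)) \<times> {0<..<T}"
  have W: "open W" unfolding W_def by (intro open_Times) auto
  have WQ: "(x + z, t) \<in> Q" if xt: "(x, t) \<in> W" and z: "norm z \<le> \<delta> / 2" for x z t
  proof -
    obtain y where y: "y \<in> K" "dist y x < \<delta> / 2" using xt by (auto simp: W_def)
    have "dist y (x + z) \<le> dist y x + norm z"
      using dist_triangle[of y "x + z" x] by (simp add: dist_norm)
    then have "x + z \<in> ball y \<delta>" using y z by auto
    then have "x + z \<in> \<Omega>" using \<delta> y by blast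
    then show ?thesis using xt by (auto simp: W_def)
  qed
  obtain R where R: "\<And>x. x \<in> K \<Longrightarrow> norm x \<le> R"
    using compact_imp_bounded[OF K(1)] bounded_iff by metis
  \<comment> \<open>Steps of length at most \<delta>/2: points within \<delta>/2 of \<open>K\<close>
    can be shifted by one step and stay in \<Omega>, as \<open>v_increment\<close> requires.\<close>
  define h where "h n = (\<delta> / 2) / real (Suc n)" for n
  have h: "h n > 0" "h n \<le> \<delta> / 2" for n
    using \<delta>(1) by (auto simp: h_def field_simps)
  have "(\<lambda>n. (\<delta> / 2) * (1 / real (Suc n))) \<longlonglongrightarrow> (\<delta> / 2) * 0"
    by (intro tendsto_intros LIMSEQ_Suc lim_1_over_n)
  then have h0: "h \<longlonglongrightarrow> 0" by (simp add: h_def[abs_def])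
  \<comment> \<open>The shifted \<Phi> lives within one step of \<open>K\<close>, hence in the ball
    of radius R + \<delta>. Cutting the time majorant off there makes it integrable over
    space-time.\<close>
  define m' where "m' p = indicator (cball 0 (R + \<delta>)) (fst p) * m (snd p)" for p :: "'a \<times> real"
  have m': "integrable lborel m'"
  proof -
    have [measurable]: "m \<in> borel_measurable borel" "cball (0::'a) (R + \<delta>) \<in> sets borel" using m by auto
    have meas: "(\<lambda>(x, t). indicator (cball (0::'a) (R + \<delta>)) x * m t) \<in> borel_measurable (lborel \<Otimes>\<^sub>M lborel)"
      by measurable
    have "integrable (lborel \<Otimes>\<^sub>M lborel) (\<lambda>(x, t). indicator (cball (0::'a) (R + \<delta>)) x * m t)"
    proof (rule lborel_pair.Fubini_integrable)
      have "(LINT t|lborel. norm (case (x, t) of (x, t) \<Rightarrow> indicator (cball (0::'a) (R + \<delta>)) x * m t)) =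
        indicator (cball 0 (R + \<delta>)) x * (LINT t|lborel. \<bar>m t\<bar>)" for x
        by (simp add: abs_mult)
      then show "integrable lborel (\<lambda>x. LINT t|lborel. norm (case (x, t) of (x, t) \<Rightarrow> indicator (cball (0::'a) (R + \<delta>)) x * m t))"
        using emeasure_bounded_finite[OF bounded_cball, of "0::'a" "R + \<delta>"]
        by (simp only:) (intro integrable_mult_left, simp add: integrable_indicator_iff)
    qed (use m meas in auto)
    then show ?thesis by (simp add: lborel_prod m'_def[abs_def] case_prod_unfold)
  qed
  have bound_int: "integrable lborel \<Phi>"
    by (rule integrable_bounded_Q[OF \<Phi>(1,2)]) (use \<Phi>(3) K in fastforce)
  show ?thesis
  proof (rule increments_by_parts[OF D_integrable[OF i i] _ v_inner_bound[OF i] bound_int \<Phi>(2) \<Phi>' m' h(1) h0, where e="(i, 0)"])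
    fix n
    have "AE p in lborel. p \<in> W \<longrightarrow> v (p + (h n *\<^sub>R i, 0)) \<bullet> i - v p \<bullet> i
      = unit_avg (h n *\<^sub>R i, 0) (\<lambda>p. \<Sum>j\<in>Basis. (h n *\<^sub>R i \<bullet> j) * D i j p) p"
    proof (rule v_increment[OF i W])
      fix p s assume "p \<in> W" "s \<in> {0..1::real}"
      moreover have "norm (s *\<^sub>R h n *\<^sub>R i) \<le> \<delta> / 2"
        using \<open>s \<in> {0..1}\<close> h[of n] i mult_mono[of s 1 "h n" "\<delta> / 2"] by simp
      ultimately show "p + s *\<^sub>R (h n *\<^sub>R i, 0) \<in> Q"
        using WQ[of "fst p" "snd p" "s *\<^sub>R h n *\<^sub>R i"] by (cases p) auto
    qed
    moreover have "unit_avg (h n *\<^sub>R i, 0) (\<lambda>p. \<Sum>j\<in>Basis. (h n *\<^sub>R i \<bullet> j) * D i j p) p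
      = h n * avg (indicator {0..1}) (\<lambda>s. s *\<^sub>R (i, 0)) (h n) (D i i) p" for p
    proof -
      have "(\<Sum>j\<in>Basis. (h n *\<^sub>R i \<bullet> j) * D i j q) = h n * D i i q" for q
      proof -
        have "(\<Sum>j\<in>Basis. (h n *\<^sub>R i \<bullet> j) * D i j q) = (\<Sum>j\<in>Basis. if j = i then h n * D i i q else 0)"
          using i by (intro sum.cong) (auto simp: inner_Basis)
        then show ?thesis using i by simp
      qed
      then have "unit_avg (h n *\<^sub>R i, 0) (\<lambda>p. \<Sum>j\<in>Basis. (h n *\<^sub>R i \<bullet> j) * D i j p) p
        = (LINT s|lborel. h n * (indicator {0..1} s * D i i (p + h n *\<^sub>R s *\<^sub>R (i, 0))))"
        unfolding avg_def by (simp only:) (rule Bochner_Integration.integral_cong[OF refl], simp add: mult_ac)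
      then show ?thesis unfolding avg_def by simp
    qed
    ultimately show "AE p in lborel. \<Phi> p \<noteq> 0 \<longrightarrow> v (p + h n *\<^sub>R (i, 0)) \<bullet> i - v p \<bullet> i
       = h n * avg (indicator {0..1}) (\<lambda>s. s *\<^sub>R (i, 0)) (h n) (D i i) p"
    proof -
      assume *: "AE p in lborel. p \<in> W \<longrightarrow> v (p + (h n *\<^sub>R i, 0)) \<bullet> i - v p \<bullet> i
        = unit_avg (h n *\<^sub>R i, 0) (\<lambda>p. \<Sum>j\<in>Basis. (h n *\<^sub>R i \<bullet> j) * D i j p) p"
      assume **: "\<And>p. unit_avg (h n *\<^sub>R i, 0) (\<lambda>p. \<Sum>j\<in>Basis. (h n *\<^sub>R i \<bullet> j) * D i j p) p
        = h n * avg (indicator {0..1}) (\<lambda>s. s *\<^sub>R (i, 0)) (h n) (D i i) p"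
      have "p \<in> W" if "\<Phi> p \<noteq> 0" for p
        using \<Phi>(3)[of "fst p" "snd p"] that \<delta>(1) by (cases p) (auto simp: W_def intro!: bexI[of _ "fst p"])
      with * show ?thesis unfolding ** by (auto elim!: eventually_mono)
    qed
  next
    have "AE p in lborel. \<forall>y. ((\<lambda>r. \<Phi> (y + r *\<^sub>R i, snd p)) has_real_derivative \<Phi>' (y, snd p)) (at 0)"
      by (rule AE_snd) (use der in eventually_elim, blast)
    then show "AE p in lborel. (\<lambda>n. (\<Phi> (p - h n *\<^sub>R (i, 0)) - \<Phi> p) / h n) \<longlonglongrightarrow> - \<Phi>' p"
    proof eventually_elim
      case (elim p)
      obtain y s where p: "p = (y, s)" by (cases p)
      have "((\<lambda>r. (\<Phi> (y + r *\<^sub>R i, s) - \<Phi> (y + 0 *\<^sub>R i, s)) / (r - 0)) \<longlongrightarrow> \<Phi>' (y, s)) (at 0)"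
        using elim[rule_format, of y] unfolding has_field_derivative_iff p by simp
      moreover have "filterlim (\<lambda>n. - h n) (at 0) sequentially"
        using tendsto_minus[OF h0] h(1) unfolding filterlim_at by (auto intro!: always_eventually simp: less_imp_neq[symmetric])
      ultimately have "(\<lambda>n. (\<Phi> (y + (- h n) *\<^sub>R i, s) - \<Phi> (y + 0 *\<^sub>R i, s)) / (- h n - 0)) \<longlonglongrightarrow> \<Phi>' (y, s)"
        by (rule filterlim_compose)
      from tendsto_minus[OF this] show ?case by (simp add: p)
    qed
  next
    fix n
    have "AE p in lborel. \<forall>y. ((\<lambda>r. \<Phi> (y + r *\<^sub>R i, snd p)) has_real_derivative \<Phi>' (y, snd p)) (at 0) \<and> \<bar>\<Phi>' (y, snd p)\<bar> \<le> m (snd p)"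
      by (rule AE_snd[OF der])
    then show "AE p in lborel. \<bar>\<Phi> (p - h n *\<^sub>R (i, 0)) - \<Phi> p\<bar> \<le> h n * m' p"
    proof eventually_elim
      case (elim p)
      obtain y s where p: "p = (y, s)" by (cases p)
      have d: "((\<lambda>r. \<Phi> (y + r *\<^sub>R i, s)) has_real_derivative \<Phi>' (y + r *\<^sub>R i, s)) (at r)" for r
      proof -
        have "((\<lambda>r'. \<Phi> (y + r *\<^sub>R i + r' *\<^sub>R i, s)) has_real_derivative \<Phi>' (y + r *\<^sub>R i, s)) (at (r + - r))"
          using elim by (simp add: p)
        from DERIV_shift[THEN iffD1, OF this] show ?thesis
          by (simp add: algebra_simps)
      qed
      have "\<bar>\<Phi> (y - h n *\<^sub>R i, s) - \<Phi> (y, s)\<bar> \<le> h n * m s"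
      proof -
        obtain z where "\<Phi> (y + 0 *\<^sub>R i, s) - \<Phi> (y + (- h n) *\<^sub>R i, s) = (0 - (- h n)) * \<Phi>' (y + z *\<^sub>R i, s)"
          using MVT2[of "- h n" 0 "\<lambda>r. \<Phi> (y + r *\<^sub>R i, s)" "\<lambda>r. \<Phi>' (y + r *\<^sub>R i, s)"] h(1)[of n] d by auto
        then have "\<bar>\<Phi> (y - h n *\<^sub>R i, s) - \<Phi> (y, s)\<bar> = h n * \<bar>\<Phi>' (y + z *\<^sub>R i, s)\<bar>"
          using h(1)[of n] by (simp add: abs_minus_commute abs_mult)
        then show ?thesis using elim h(1)[of n] by (simp add: p)
      qed
      moreover have "\<Phi> (y - h n *\<^sub>R i, s) = 0 \<and> \<Phi> (y, s) = 0" if "norm y > R + \<delta>"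
      proof -
        have "norm y \<le> norm (y - h n *\<^sub>R i) + h n"
          using norm_triangle_ineq[of "y - h n *\<^sub>R i" "h n *\<^sub>R i"] i h(1)[of n] by simp
        then have "y \<notin> K" "y - h n *\<^sub>R i \<notin> K"
          using that R[of y] R[of "y - h n *\<^sub>R i"] h(2)[of n] \<delta>(1) by auto
        then show ?thesis using \<Phi>(3) by blast
      qed
      ultimately show ?case
        by (cases "norm y \<le> R + \<delta>") (auto simp: p m'_def)
    qed
  qed (use h in auto)
qed

end

section \<open>The mollified equation on lines of constant x\<close>

abbreviation shiftx :: "'a::euclidean_space \<Rightarrow> 'a \<times> real" where
  "shiftx w \<equiv> (- w, 0)"

lemma borel_measurable_fst [measurable]: "(fst :: 'a::euclidean_space \<times> 'c::euclidean_space \<Rightarrow> 'a) \<in> borel_measurable borel"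
  and borel_measurable_snd [measurable]: "(snd :: 'a \<times> 'c \<Rightarrow> 'c) \<in> borel_measurable borel"
  by (intro borel_measurable_continuous_onI continuous_intros)+

text \<open>Substituting y = x - \<epsilon> w exhibits \<open>avg\<close> as a convolution in x,
  with the normalising power of \<epsilon> taken out of the kernel.\<close>

lemma avg_section:
  fixes k :: "'a::euclidean_space \<Rightarrow> real" and H :: "'a \<times> real \<Rightarrow> real"
  assumes \<epsilon>: "\<epsilon> > 0" and [measurable]: "k \<in> borel_measurable borel" "H \<in> borel_measurable borel"
  shows "avg k shiftx \<epsilon> H (x, t) = (LINT y|lborel. k ((x - y) /\<^sub>R \<epsilon>) * H (y, t)) / \<epsilon> ^ DIM('a)"
proof -
  have "(LINT y|lborel. k ((x - y) /\<^sub>R \<epsilon>) * H (y, t))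
    = \<bar>- \<epsilon>\<bar> ^ DIM('a) * (LINT w|lborel. k ((x - (x + (- \<epsilon>) *\<^sub>R w)) /\<^sub>R \<epsilon>) * H (x + (- \<epsilon>) *\<^sub>R w, t))"
    using \<epsilon> by (intro integral_affine) auto
  then show ?thesis
    using \<epsilon> by (simp add: avg_def)
qed

lemma avg_uminus_section:
  fixes k H :: "'a::euclidean_space \<Rightarrow> real"
  assumes \<epsilon>: "\<epsilon> > 0" and [measurable]: "k \<in> borel_measurable borel" "H \<in> borel_measurable borel"
  shows "avg k uminus \<epsilon> H x = (LINT y|lborel. k ((x - y) /\<^sub>R \<epsilon>) * H y) / \<epsilon> ^ DIM('a)"
proof -
  have "(LINT y|lborel. k ((x - y) /\<^sub>R \<epsilon>) * H y)
    = \<bar>- \<epsilon>\<bar> ^ DIM('a) * (LINT w|lborel. k ((x - (x + (- \<epsilon>) *\<^sub>R w)) /\<^sub>R \<epsilon>) * H (x + (- \<epsilon>) *\<^sub>R w))"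
    using \<epsilon> by (intro integral_affine) auto
  then show ?thesis
    using \<epsilon> by (simp add: avg_def)
qed

text \<open>Because the kernel is bounded, the averages are integrable in time for every
  \<open>x\<close>, not only for almost every one. This is what allows an equation on each single
  line of constant \<open>x\<close>.\<close>

lemma
  fixes k :: "'a::euclidean_space \<Rightarrow> real" and H :: "'a \<times> real \<Rightarrow> real"
  assumes \<epsilon>: "\<epsilon> > 0" and [measurable]: "k \<in> borel_measurable borel" and k: "\<And>w. \<bar>k w\<bar> \<le> B" and H: "integrable lborel H"
    and [measurable]: "\<psi> \<in> borel_measurable borel" and \<psi>: "\<And>t. \<bar>\<psi> t\<bar> \<le> B'"
  shows integrable_avg_section: "integrable lborel (\<lambda>t. \<psi> t * avg k shiftx \<epsilon> H (x, t))"
    and integral_avg_section: "(LINT t|lborel. \<psi> t * avg k shiftx \<epsilon> H (x, t)) =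
      (LINT p|lborel. k ((x - fst p) /\<^sub>R \<epsilon>) * \<psi> (snd p) * H p) / \<epsilon> ^ DIM('a)"
    and integrable_kernel: "integrable lborel (\<lambda>p. k ((x - fst p) /\<^sub>R \<epsilon>) * \<psi> (snd p) * H p)"
proof -
  have [measurable]: "H \<in> borel_measurable borel" using H by auto
  have B: "0 \<le> B" "0 \<le> B'" using k[of undefined] \<psi>[of undefined] by linarith+
  show i: "integrable lborel (\<lambda>p. k ((x - fst p) /\<^sub>R \<epsilon>) * \<psi> (snd p) * H p)"
    by (rule Bochner_Integration.integrable_bound[OF integrable_mult_right[OF H, of "B * B'"]])
      (use B k \<psi> in \<open>auto simp: abs_mult intro!: AE_I2 mult_right_mono mult_mono\<close>)
  then have i': "integrable (lborel \<Otimes>\<^sub>M lborel) (case_prod (\<lambda>y t. k ((x - y) /\<^sub>R \<epsilon>) * \<psi> t * H (y, t)))"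
    by (simp add: lborel_prod case_prod_unfold)
  have eq: "\<psi> t * avg k shiftx \<epsilon> H (x, t) = (LINT y|lborel. k ((x - y) /\<^sub>R \<epsilon>) * \<psi> t * H (y, t)) / \<epsilon> ^ DIM('a)" for t
  proof -
    have "(LINT y|lborel. k ((x - y) /\<^sub>R \<epsilon>) * \<psi> t * H (y, t)) = (LINT y|lborel. \<psi> t * (k ((x - y) /\<^sub>R \<epsilon>) * H (y, t)))"
      by (simp add: mult_ac)
    then show ?thesis by (simp add: avg_section[OF \<epsilon>])
  qed
  show "integrable lborel (\<lambda>t. \<psi> t * avg k shiftx \<epsilon> H (x, t))"
    unfolding eq using lborel_pair.integrable_snd[OF i'] by simp
  show "(LINT t|lborel. \<psi> t * avg k shiftx \<epsilon> H (x, t)) =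
      (LINT p|lborel. k ((x - fst p) /\<^sub>R \<epsilon>) * \<psi> (snd p) * H p) / \<epsilon> ^ DIM('a)"
    unfolding eq using lborel_pair.integral_snd[OF i'] by (simp add: lborel_prod case_prod_unfold)
qed

text \<open>Fubini over the triangle 0 \<le> s \<le> t \<le> T: each \<open>s\<close> is counted for
  a length of time T - s. The weight of the final identity originates here.\<close>

lemma integral_primitive:
  fixes h :: "real \<Rightarrow> real"
  assumes h: "integrable lborel h" and T: "T > 0"
  shows "(LINT t|lborel. indicator {0..T} t * (LINT s|lborel. indicator {0..t} s * h s))
    = (LINT s|lborel. indicator {0..T} s * (T - s) * h s)"
proof -
  have [measurable]: "h \<in> borel_measurable borel" using h by auto
  define f where "f t s = (if 0 \<le> t \<and> t \<le> T \<and> 0 \<le> s \<and> s \<le> t then h s else 0)" for t s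
  have f: "integrable (lborel \<Otimes>\<^sub>M lborel) (case_prod f)"
  proof (rule Bochner_Integration.integrable_bound)
    have "integrable (lborel \<Otimes>\<^sub>M lborel) (\<lambda>(p, w). indicator {0..T} w * h (p + 0 *\<^sub>R w))"
      by (rule pair_integrable_shift) (use h T in \<open>auto simp: integrable_indicator_iff\<close>)
    from lborel_pair.integrable_product_swap[OF this]
    show "integrable (lborel \<Otimes>\<^sub>M lborel) (\<lambda>(t, s). indicator {0..T} t * h s)"
      by (simp add: case_prod_unfold)
    show "case_prod f \<in> borel_measurable (lborel \<Otimes>\<^sub>M lborel)"
      unfolding f_def by measurable
  qed (auto simp: f_def)
  have "(LINT t|lborel. indicator {0..T} t * (LINT s|lborel. indicator {0..t} s * h s)) = (LINT t|lborel. LINT s|lborel. f t s)"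
  proof (rule Bochner_Integration.integral_cong[OF refl])
    fix t
    have "indicator {0..T} t * (LINT s|lborel. indicator {0..t} s * h s) = (LINT s|lborel. indicator {0..T} t * (indicator {0..t} s * h s))"
      by (rule integral_mult_right_zero[symmetric])
    also have "\<dots> = (LINT s|lborel. f t s)"
      by (rule Bochner_Integration.integral_cong) (auto simp: f_def split: split_indicator)
    finally show "indicator {0..T} t * (LINT s|lborel. indicator {0..t} s * h s) = (LINT s|lborel. f t s)" .
  qed
  also have "\<dots> = (LINT s|lborel. LINT t|lborel. f t s)"
    by (rule lborel_pair.Fubini_integral[OF f, symmetric])
  also have "\<dots> = (LINT s|lborel. indicator {0..T} s * (T - s) * h s)"
  proof (rule Bochner_Integration.integral_cong[OF refl])
    fix s
    have "(LINT t|lborel. f t s) = (LINT t|lborel. (indicator {0..T} s * h s) * indicator {s..T} t)"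
      by (intro Bochner_Integration.integral_cong) (auto simp: f_def split: split_indicator)
    also have "\<dots> = indicator {0..T} s * h s * measure lborel {s..T}"
      by simp
    also have "\<dots> = indicator {0..T} s * (T - s) * h s"
      by (auto split: split_indicator)
    finally show "(LINT t|lborel. f t s) = indicator {0..T} s * (T - s) * h s" .
  qed
  finally show ?thesis .
qed

context transport
begin

abbreviation um where "um \<epsilon> \<equiv> avg moll shiftx \<epsilon> u"
abbreviation gm where "gm \<epsilon> \<equiv> avg moll shiftx \<epsilon> g"
abbreviation dm where "dm \<epsilon> \<equiv> avg moll shiftx \<epsilon> d"
abbreviation u0m where "u0m \<epsilon> \<equiv> avg moll uminus \<epsilon> u0"
abbreviation flux_m where
  "flux_m i \<epsilon> \<equiv> avg (pderiv_dir i moll) shiftx \<epsilon> (\<lambda>p. u p * (v p \<bullet> i))"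
text \<open>The time derivative of \<open>um \<epsilon>\<close>: in the divergence of u v the
  derivative is moved onto the kernel, whose rescaling produces the factor 1/\<epsilon>.\<close>

definition rhs_m where
  "rhs_m \<epsilon> p = gm \<epsilon> p - (\<Sum>i\<in>Basis. flux_m i \<epsilon> p) / \<epsilon>"

lemma uv_integrable: "i \<in> Basis \<Longrightarrow> integrable lborel (\<lambda>p. u p * (v p \<bullet> i))"
  by (rule Bochner_Integration.integrable_bound[OF integrable_mult_right[OF u, of M]])
    (use M_nonneg v_inner_bound in \<open>auto simp: abs_mult mult.commute[of M] intro!: mult_left_mono\<close>)

lemma shiftx_measurable: "shiftx \<in> borel_measurable borel"
  by simp

lemma rhs_m_integrable: "integrable lborel (rhs_m \<epsilon>)"
  unfolding rhs_m_def[abs_def] using uv_integrable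
  by (intro Bochner_Integration.integrable_diff integrable_divide_zero Bochner_Integration.integrable_sum
     integrable_avg moll_integrable pderiv_moll_integrable g shiftx_measurable) auto

lemma rhs_m_section_integrable:
  assumes \<epsilon>: "\<epsilon> > 0"
  shows "integrable lborel (\<lambda>t. rhs_m \<epsilon> (x, t))"
proof -
  obtain B where B: "\<And>w. \<bar>moll (w::'a)\<bar> \<le> B" using moll_bounded by metis
  have 1: "integrable lborel (\<lambda>t. gm \<epsilon> (x, t))"
    using integrable_avg_section[OF \<epsilon> moll_measurable B g, of "\<lambda>_. 1" 1 x] by simp
  have 2: "integrable lborel (\<lambda>t. flux_m i \<epsilon> (x, t))" if i: "i \<in> Basis" for i
  proof -
    obtain B where B: "\<And>w. \<bar>pderiv_dir i moll (w::'a)\<bar> \<le> B" using pderiv_moll_bounded by metis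
    show ?thesis using integrable_avg_section[OF \<epsilon> pderiv_moll_measurable B uv_integrable[OF i], of "\<lambda>_. 1" 1 x] by simp
  qed
  show ?thesis
    unfolding rhs_m_def using 1 2
    by (intro Bochner_Integration.integrable_diff integrable_divide_zero Bochner_Integration.integrable_sum) auto
qed

text \<open>The weak formulation is tested with \<open>tensor_test\<close>, and its integrals become
  one-dimensional ones at fixed \<open>x\<close>, all carrying the same power of \<epsilon>. What
  remains is the weak form of an ordinary differential equation with an initial term.\<close>

lemma mollified_equation:
  assumes \<epsilon>: "\<epsilon> > 0"
  shows "AE t in lborel. 0 < t \<and> t < T \<longrightarrow>
    um \<epsilon> (x, t) = u0m \<epsilon> x + (LINT s|lborel. indicator {0..t} s * rhs_m \<epsilon> (x, s))"
proof -
  obtain B0 where B0: "\<And>w. \<bar>moll (w::'a)\<bar> \<le> B0" using moll_bounded by metis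
  have um0: "um \<epsilon> (x, t) = 0" if "t \<le> 0" for t
    using that by (simp add: avg_def outside)
  have rhs0: "rhs_m \<epsilon> (x, t) = 0" if "t < 0" for t
    using that by (simp add: rhs_m_def avg_def outside)
  \<comment> \<open>Prescribing the mollified datum on [-1,0] absorbs the initial term: the
    derivative of the time bump integrates over [-1,0] to its value at 0. So \<open>F\<close> has
    \<open>rhs_m\<close> as weak derivative on the whole of (-1,T).\<close>
  define F where "F t = um \<epsilon> (x, t) + u0m \<epsilon> x * indicator {-1..0} t" for t
  have ium: "integrable lborel (\<lambda>t. um \<epsilon> (x, t))"
    using integrable_avg_section[OF \<epsilon> moll_measurable B0 u, of "\<lambda>_. 1" 1 x] by simp
  have ii: "integrable lborel (indicator {-1..0::real} :: real \<Rightarrow> real)"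
    by (simp add: integrable_indicator_iff)
  have F: "integrable lborel F"
    unfolding F_def using ium ii by (intro Bochner_Integration.integrable_add integrable_mult_right)
  have "AE t in lborel. 0 < t \<and> t < T \<longrightarrow> F t = u0m \<epsilon> x + (LINT s|lborel. indicator {0..t} s * rhs_m \<epsilon> (x, s))"
  proof (rule weak_deriv_primitive[where \<alpha>="-1", OF F rhs_m_section_integrable[OF \<epsilon>]])
    fix k a b :: real assume k: "k > 0" and ab: "cbox a b \<subseteq> {-1<..<T}"
    let ?\<theta> = "box_bump k a b" and ?N = "\<epsilon> ^ DIM('a)"
    let ?t = "tensor_test \<epsilon> x k a b"
    have \<theta>: "\<bar>?\<theta> t\<bar> \<le> 1" for t
      using box_bump_nonneg[of k a b t] box_bump_le_1[of k a b t] by simp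
    obtain B where B: "B > 0" "\<And>p. \<bar>pderiv_dir 1 ?\<theta> p\<bar> \<le> B" 
      using smooth_compact_support_bounded[OF smooth_box_bump compact_cbox, of a b k a b 1] 
      by (metis box_bump_eq_0_iff box_subset_cbox k subsetD)
    have w: "- (LINT p|lborel. u p * dt ?t p) - (LINT x'|lborel. u0 x' * ?t (x', 0))
      - (LINT p|lborel. u p * (v p \<bullet> grad_x ?t p)) = (LINT p|lborel. g p * ?t p)"
      using ab by (intro weak test_function_tensor \<epsilon> k) auto
    have 1: "(LINT p|lborel. u p * dt ?t p) = ?N * (LINT t|lborel. pderiv_dir 1 ?\<theta> t * um \<epsilon> (x, t))"
      using integral_avg_section[OF \<epsilon> moll_measurable B0 u pderiv_box_bump_measurable B(2), of x] \<epsilon>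
      by (simp add: dt_tensor_test mult_ac)
    have 2: "(LINT x'|lborel. u0 x' * ?t (x', 0)) = ?N * (u0m \<epsilon> x * ?\<theta> 0)"
    proof -
      have "(LINT x'|lborel. u0 x' * ?t (x', 0)) = (LINT x'|lborel. (moll ((x - x') /\<^sub>R \<epsilon>) * u0 x') * ?\<theta> 0)"
        by (simp add: tensor_test_def mult_ac)
      then show ?thesis using \<epsilon> by (simp add: avg_uminus_section)
    qed
    have 4: "(LINT p|lborel. g p * ?t p) = ?N * (LINT t|lborel. ?\<theta> t * gm \<epsilon> (x, t))"
      using integral_avg_section[OF \<epsilon> moll_measurable B0 g box_bump_measurable \<theta>, of x] \<epsilon>
      by (simp add: tensor_test_def mult_ac)
    have 3: "(LINT p|lborel. u p * (v p \<bullet> grad_x ?t p)) = - ?N * (LINT t|lborel. ?\<theta> t * ((\<Sum>i\<in>Basis. flux_m i \<epsilon> (x, t)) / \<epsilon>))"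
    proof -
      let ?f = "\<lambda>i p. pderiv_dir i moll ((x - fst p) /\<^sub>R \<epsilon>) * ?\<theta> (snd p) * (u p * (v p \<bullet> i))"
      have s: "(LINT p|lborel. ?f i p) = ?N * (LINT t|lborel. ?\<theta> t * flux_m i \<epsilon> (x, t))"
        and si: "integrable lborel (?f i)" and si': "integrable lborel (\<lambda>t. ?\<theta> t * flux_m i \<epsilon> (x, t))" if i: "i \<in> Basis" for i
      proof -
        obtain B where B: "\<And>w. \<bar>pderiv_dir i moll (w::'a)\<bar> \<le> B" using pderiv_moll_bounded by metis
        note * = \<epsilon> pderiv_moll_measurable B uv_integrable[OF i] box_bump_measurable \<theta>
        show "(LINT p|lborel. ?f i p) = ?N * (LINT t|lborel. ?\<theta> t * flux_m i \<epsilon> (x, t))"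
          using integral_avg_section[OF *, of x] \<epsilon> by simp
        show "integrable lborel (?f i)" by (rule integrable_kernel[OF *])
        show "integrable lborel (\<lambda>t. ?\<theta> t * flux_m i \<epsilon> (x, t))" by (rule integrable_avg_section[OF *])
      qed
      have "(LINT p|lborel. u p * (v p \<bullet> grad_x ?t p)) = (LINT p|lborel. (\<Sum>i\<in>Basis. (- 1 / \<epsilon>) * ?f i p))"
        unfolding grad_x_tensor_test inner_sum_right sum_distrib_left
        by (intro Bochner_Integration.integral_cong sum.cong refl) (simp add: mult_ac)
      also have "\<dots> = (\<Sum>i\<in>Basis. (- 1 / \<epsilon>) * (LINT p|lborel. ?f i p))"
        using si by (subst Bochner_Integration.integral_sum) (auto intro!: integrable_mult_right)
      also have "\<dots> = - ?N * (\<Sum>i\<in>Basis. (LINT t|lborel. ?\<theta> t * flux_m i \<epsilon> (x, t)) / \<epsilon>)"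
        using s by (simp add: sum_distrib_left field_simps)
      also have "(\<Sum>i\<in>Basis. (LINT t|lborel. ?\<theta> t * flux_m i \<epsilon> (x, t)) / \<epsilon>) = (LINT t|lborel. (\<Sum>i\<in>Basis. ?\<theta> t * flux_m i \<epsilon> (x, t) / \<epsilon>))"
        using si' by (subst Bochner_Integration.integral_sum) auto
      also have "\<dots> = (LINT t|lborel. ?\<theta> t * ((\<Sum>i\<in>Basis. flux_m i \<epsilon> (x, t)) / \<epsilon>))"
        by (simp add: sum_distrib_left sum_divide_distrib)
      finally show ?thesis .
    qed
    have ig: "integrable lborel (\<lambda>t. ?\<theta> t * gm \<epsilon> (x, t))"
      by (rule integrable_avg_section[OF \<epsilon> moll_measurable B0 g box_bump_measurable \<theta>])
    have ir: "integrable lborel (\<lambda>t. ?\<theta> t * rhs_m \<epsilon> (x, t))"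
      by (rule Bochner_Integration.integrable_bound[OF rhs_m_section_integrable[OF \<epsilon>, of x]])
        (use \<theta> rhs_m_section_integrable[OF \<epsilon>, of x] in \<open>auto simp: abs_mult intro!: mult_left_le_one_le\<close>)
    have "(LINT t|lborel. ?\<theta> t * rhs_m \<epsilon> (x, t)) = (LINT t|lborel. ?\<theta> t * gm \<epsilon> (x, t)) - (LINT t|lborel. ?\<theta> t * ((\<Sum>i\<in>Basis. flux_m i \<epsilon> (x, t)) / \<epsilon>))"
    proof (subst Bochner_Integration.integral_diff[symmetric])
      have "integrable lborel (\<lambda>t. ?\<theta> t * gm \<epsilon> (x, t) - ?\<theta> t * rhs_m \<epsilon> (x, t))"
        using ig ir by simp
      then show "integrable lborel (\<lambda>t. ?\<theta> t * ((\<Sum>i\<in>Basis. flux_m i \<epsilon> (x, t)) / \<epsilon>))"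
        by (simp add: rhs_m_def right_diff_distrib)
    qed (use ig in \<open>simp_all add: rhs_m_def right_diff_distrib\<close>)
    with w have "?N * (- (LINT t|lborel. pderiv_dir 1 ?\<theta> t * um \<epsilon> (x, t)) - u0m \<epsilon> x * ?\<theta> 0) = ?N * (LINT t|lborel. ?\<theta> t * rhs_m \<epsilon> (x, t))"
      unfolding 1 2 3 4 by (simp add: right_diff_distrib)
    then have eq: "- (LINT t|lborel. pderiv_dir 1 ?\<theta> t * um \<epsilon> (x, t)) - u0m \<epsilon> x * ?\<theta> 0 = (LINT t|lborel. ?\<theta> t * rhs_m \<epsilon> (x, t))"
      using \<epsilon> by simp
    have ftc: "(LINT t|lborel. pderiv_dir 1 ?\<theta> t * indicator {-1..0} t) = ?\<theta> 0"
    proof -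
      have "((?\<theta>) has_real_derivative pderiv_dir 1 ?\<theta> t) (at t)" for t
        using smooth_DERIV_line[OF smooth_box_bump, of k a b 0 1 t] by simp
      moreover have "continuous_on UNIV (pderiv_dir 1 ?\<theta>)"
        by (intro smooth_pderiv_continuous smooth_box_bump)
      ultimately have "(LINT t|lborel. pderiv_dir 1 ?\<theta> t * indicator {-1..0} t) = ?\<theta> 0 - ?\<theta> (-1)"
        by (intro integral_FTC_Icc_real) (auto simp: continuous_on_eq_continuous_at)
      moreover have "?\<theta> (-1) = 0"
      proof -
        have "-1 \<notin> cbox a b" using ab by force
        then show ?thesis using box_subset_cbox[of a b] by (simp only: box_bump_eq_0_iff[OF k]) blast
      qed
      ultimately show ?thesis by simp
    qed
    have id: "integrable lborel (\<lambda>t. pderiv_dir 1 ?\<theta> t * um \<epsilon> (x, t))"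
      by (rule integrable_avg_section[OF \<epsilon> moll_measurable B0 u pderiv_box_bump_measurable B(2)])
    have id': "integrable lborel (\<lambda>t. pderiv_dir 1 ?\<theta> t * indicator {-1..0} t)"
      by (rule Bochner_Integration.integrable_bound[OF integrable_mult_right[OF ii, of B]])
        (use B in \<open>auto split: split_indicator\<close>)
    have "(LINT t|lborel. F t * pderiv_dir 1 ?\<theta> t) = (LINT t|lborel. pderiv_dir 1 ?\<theta> t * um \<epsilon> (x, t) + u0m \<epsilon> x * (pderiv_dir 1 ?\<theta> t * indicator {-1..0} t))"
      by (simp add: F_def algebra_simps)
    also have "\<dots> = (LINT t|lborel. pderiv_dir 1 ?\<theta> t * um \<epsilon> (x, t)) + u0m \<epsilon> x * ?\<theta> 0"
      using id id' ftc by simp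
    finally show "(LINT t|lborel. F t * pderiv_dir 1 ?\<theta> t) = - (LINT t|lborel. rhs_m \<epsilon> (x, t) * ?\<theta> t)"
      using eq by (simp add: mult.commute)
  qed (auto simp: F_def um0 rhs0)
  then show ?thesis by eventually_elim (auto simp: F_def)
qed

end

text \<open>One constant \<open>B\<close> for all bounds. Boundedness of \<beta> serves dominated
  convergence and the boundary cutoffs; boundedness and Lipschitz continuity of \<beta>' serve the
  chain rule.\<close>

locale renormalised = transport +
  fixes \<beta> \<beta>' :: "real \<Rightarrow> real" and B :: real
  assumes \<beta>: "\<And>x. (\<beta> has_real_derivative \<beta>' x) (at x)"
    and \<beta>_bound: "\<And>x. \<bar>\<beta> x\<bar> \<le> B" and \<beta>'_bound: "\<And>x. \<bar>\<beta>' x\<bar> \<le> B"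
    and \<beta>'_Lipschitz: "\<And>x y. \<bar>\<beta>' x - \<beta>' y\<bar> \<le> B * \<bar>x - y\<bar>"
begin

lemma B_nonneg: "0 \<le> B" using \<beta>_bound[of 0] by linarith

lemma \<beta>_Lipschitz: "\<bar>\<beta> x - \<beta> y\<bar> \<le> B * \<bar>x - y\<bar>"
proof -
  have "norm (\<beta> x - \<beta> y) \<le> B * norm (x - y)"
    by (rule field_differentiable_bound[of UNIV \<beta> \<beta>' B]) (use \<beta> \<beta>'_bound in auto)
  then show ?thesis by simp
qed

lemma continuous_beta: "continuous_on UNIV \<beta>" and continuous_beta': "continuous_on UNIV \<beta>'"
proof -
  show "continuous_on UNIV \<beta>"
    by (intro DERIV_continuous_on) (use \<beta> in \<open>auto intro: has_field_derivative_at_within\<close>)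
  have "B-lipschitz_on UNIV \<beta>'"
    by (rule lipschitz_onI) (use \<beta>'_Lipschitz B_nonneg in \<open>auto simp: dist_real_def\<close>)
  then show "continuous_on UNIV \<beta>'" by (rule lipschitz_on_continuous_on)
qed

lemma beta_measurable [measurable]: "\<beta> \<in> borel_measurable borel" "\<beta>' \<in> borel_measurable borel"
  by (intro borel_measurable_continuous_onI continuous_beta continuous_beta')+

lemma avg_measurable:
  assumes "integrable lborel k" "integrable lborel H" "J \<in> borel_measurable borel"
  shows "avg k J \<epsilon> H \<in> borel_measurable borel"
  using integrable_avg[OF assms] by auto

lemma um_measurable [measurable]: "um \<epsilon> \<in> borel_measurable borel"
  and gm_measurable [measurable]: "gm \<epsilon> \<in> borel_measurable borel"
  and dm_measurable [measurable]: "dm \<epsilon> \<in> borel_measurable borel"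
  and u0m_measurable [measurable]: "u0m \<epsilon> \<in> borel_measurable borel"
  and rhs_m_measurable [measurable]: "rhs_m \<epsilon> \<in> borel_measurable borel"
  using rhs_m_integrable by (auto intro!: avg_measurable moll_integrable u g d_integrable u0)

text \<open>The chain rule is integrated over all final times t in [0,T] instead of being evaluated
  at T; \<open>integral_primitive\<close> then collapses the double time integral to a
  weight.\<close>

lemma renormalised_section:
  assumes \<epsilon>: "\<epsilon> > 0"
  shows "(LINT t|lborel. indicator {0..T} t * \<beta> (um \<epsilon> (x, t))) = T * \<beta> (u0m \<epsilon> x)
    + (LINT t|lborel. indicator {0..T} t * (T - t) * (\<beta>' (um \<epsilon> (x, t)) * rhs_m \<epsilon> (x, t)))"
proof -
  define F where "F t = u0m \<epsilon> x + (LINT s|lborel. indicator {0..t} s * rhs_m \<epsilon> (x, s))" for t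
  note G = rhs_m_section_integrable[OF \<epsilon>, of x]
  have "continuous_on UNIV F"
    unfolding F_def by (intro continuous_intros continuous_primitive G)
  then have [measurable]: "F \<in> borel_measurable borel" by (rule borel_measurable_continuous_onI)
  have eq: "AE t in lborel. indicator {0..T} t * h (um \<epsilon> (x, t)) t = indicator {0..T} t * (h (F t) t :: real)" for h
  proof -
    have "AE t in lborel. t \<noteq> 0 \<and> t \<noteq> T"
      using AE_lborel_singleton[of 0] AE_lborel_singleton[of T] by eventually_elim auto
    with mollified_equation[OF \<epsilon>, of x] show ?thesis
      by eventually_elim (auto simp: F_def split: split_indicator)
  qed
  let ?h = "\<lambda>s. \<beta>' (F s) * rhs_m \<epsilon> (x, s)"
  have h: "integrable lborel ?h"
    by (rule Bochner_Integration.integrable_bound[OF integrable_mult_right[OF G, of B]])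
      (use \<beta>'_bound B_nonneg in \<open>auto simp: abs_mult intro!: mult_right_mono\<close>)
  have "(LINT t|lborel. indicator {0..T} t * \<beta> (um \<epsilon> (x, t))) = (LINT t|lborel. indicator {0..T} t * \<beta> (F t))"
    using eq[of "\<lambda>y t. \<beta> y"] by (intro integral_cong_AE) auto
  also have "\<dots> = (LINT t|lborel. \<beta> (u0m \<epsilon> x) * indicator {0..T} t + indicator {0..T} t * (LINT s|lborel. indicator {0..t} s * ?h s))"
    using chain_rule_primitive[OF G \<beta> \<beta>'_bound \<beta>'_Lipschitz F_def]
    by (intro Bochner_Integration.integral_cong) (auto split: split_indicator)
  also have "\<dots> = T * \<beta> (u0m \<epsilon> x) + (LINT t|lborel. indicator {0..T} t * (LINT s|lborel. indicator {0..t} s * ?h s))"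
  proof (subst Bochner_Integration.integral_add)
    have c: "continuous_on {0..T} (\<lambda>t. LINT s|lborel. indicator {0..t} s * ?h s)"
      using continuous_primitive[OF h] by (rule continuous_on_subset) auto
    have "integrable lborel (\<lambda>t. indicator {0..T} t *\<^sub>R (LINT s|lborel. indicator {0..t} s * ?h s))"
      by (rule borel_integrable_compact[OF _ c]) auto
    then show "integrable lborel (\<lambda>t. indicator {0..T} t * (LINT s|lborel. indicator {0..t} s * ?h s))"
      by simp
  qed (use T in \<open>auto simp: integrable_indicator_iff\<close>)
  also have "(LINT t|lborel. indicator {0..T} t * (LINT s|lborel. indicator {0..t} s * ?h s)) = (LINT t|lborel. indicator {0..T} t * (T - t) * ?h t)"
    by (rule integral_primitive[OF h T])
  also have "\<dots> = (LINT t|lborel. indicator {0..T} t * (T - t) * (\<beta>' (um \<epsilon> (x, t)) * rhs_m \<epsilon> (x, t)))"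
    using eq[of "\<lambda>y t. (T - t) * (\<beta>' y * rhs_m \<epsilon> (x, t))"]
    by (intro integral_cong_AE) (auto simp: mult.assoc elim!: eventually_mono)
  finally show ?thesis .
qed

end

text \<open>Differentiation under the integral sign: the difference quotients of the rescaled kernel
  are bounded by \<open>B / \<epsilon>\<close>, so a multiple of |h| dominates.\<close>

lemma avg_deriv:
  fixes h :: "'a::euclidean_space \<Rightarrow> real"
  assumes \<epsilon>: "\<epsilon> > 0" and h: "integrable lborel h"
  shows "((\<lambda>r. avg moll uminus \<epsilon> h (y + r *\<^sub>R e)) has_real_derivative avg (pderiv_dir e moll) uminus \<epsilon> h y / \<epsilon>) (at 0)"
proof -
  have [measurable]: "h \<in> borel_measurable borel" using h by auto
  obtain B where B: "B > 0" "\<And>w. \<bar>pderiv_dir e moll (w::'a)\<bar> \<le> B" using pderiv_moll_bounded by metis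
  obtain B0 where B0: "B0 > 0" "\<And>w. \<bar>moll (w::'a)\<bar> \<le> B0" using moll_bounded by metis
  let ?k = "\<lambda>r y'. moll ((y + r *\<^sub>R e - y') /\<^sub>R \<epsilon>)"
  let ?k' = "\<lambda>r y'. pderiv_dir e moll ((y + r *\<^sub>R e - y') /\<^sub>R \<epsilon>) / \<epsilon>"
  have dk: "((\<lambda>r. ?k r y') has_real_derivative ?k' r y') (at r)" for r y'
    using smooth_DERIV_line[OF smooth_moll, of "(y - y') /\<^sub>R \<epsilon>" "e /\<^sub>R \<epsilon>" r]
      pderiv_dir_scale[OF smooth_differentiable[OF smooth_moll], of "inverse \<epsilon>" e]
    by (simp add: algebra_simps divide_inverse)
  have ik: "integrable lborel (\<lambda>y'. ?k r y' * h y')" for r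
    by (rule Bochner_Integration.integrable_bound[OF integrable_mult_right[OF h, of B0]])
      (use B0 in \<open>auto simp: abs_mult intro!: mult_right_mono\<close>)
  have "((\<lambda>r. ((LINT y'|lborel. ?k r y' * h y') - (LINT y'|lborel. ?k 0 y' * h y')) / (r - 0)) \<longlongrightarrow> (LINT y'|lborel. ?k' 0 y' * h y')) (at 0)"
    unfolding tendsto_at_iff_sequentially comp_def
  proof (intro allI impI)
    fix r :: "nat \<Rightarrow> real" assume r: "\<forall>n. r n \<in> UNIV - {0}" "r \<longlonglongrightarrow> 0"
    have eq: "((LINT y'|lborel. ?k (r n) y' * h y') - (LINT y'|lborel. ?k 0 y' * h y')) / (r n - 0)
      = (LINT y'|lborel. (?k (r n) y' - ?k 0 y') / r n * h y')" for n
      using ik[of "r n"] ik[of 0] by (simp add: left_diff_distrib diff_divide_distrib)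
    show "(\<lambda>n. ((LINT y'|lborel. ?k (r n) y' * h y') - (LINT y'|lborel. ?k 0 y' * h y')) / (r n - 0)) \<longlonglongrightarrow> (LINT y'|lborel. ?k' 0 y' * h y')"
      unfolding eq
    proof (rule integral_dominated_convergence[where w="\<lambda>y'. B / \<epsilon> * \<bar>h y'\<bar>"])
      show "AE y' in lborel. (\<lambda>n. (?k (r n) y' - ?k 0 y') / r n * h y') \<longlonglongrightarrow> ?k' 0 y' * h y'"
      proof (rule AE_I2, rule tendsto_mult[OF _ tendsto_const])
        fix y'
        have "((\<lambda>r. (?k r y' - ?k 0 y') / (r - 0)) \<longlongrightarrow> ?k' 0 y') (at 0)"
          using dk[of y' 0] unfolding has_field_derivative_iff .
        from this[unfolded tendsto_at_iff_sequentially comp_def] r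
        show "(\<lambda>n. (?k (r n) y' - ?k 0 y') / r n) \<longlonglongrightarrow> ?k' 0 y'" by force
      qed
      show "AE y' in lborel. norm ((?k (r n) y' - ?k 0 y') / r n * h y') \<le> B / \<epsilon> * \<bar>h y'\<bar>" for n
      proof (rule AE_I2)
        fix y'
        have "norm (?k (r n) y' - ?k 0 y') \<le> (B / \<epsilon>) * norm (r n - 0)"
          by (rule field_differentiable_bound[of UNIV _ "\<lambda>r. ?k' r y'"]) (use dk B \<epsilon> in \<open>auto simp: divide_right_mono\<close>)
        moreover have "r n \<noteq> 0" using r by auto
        ultimately have "\<bar>(?k (r n) y' - ?k 0 y') / r n\<bar> \<le> B / \<epsilon>"
          by (simp add: field_simps abs_mult)
        then show "norm ((?k (r n) y' - ?k 0 y') / r n * h y') \<le> B / \<epsilon> * \<bar>h y'\<bar>"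
          unfolding real_norm_def abs_mult[of _ "h y'"] by (rule mult_right_mono) simp
      qed
    qed (use h in auto)
  qed
  then have "((\<lambda>r. LINT y'|lborel. ?k r y' * h y') has_real_derivative (LINT y'|lborel. ?k' 0 y' * h y')) (at 0)"
    unfolding has_field_derivative_iff .
  from DERIV_cdivide[OF this, of "\<epsilon> ^ DIM('a)"] show ?thesis
    by (simp add: avg_uminus_section[OF \<epsilon>] mult.commute[of \<epsilon>])
qed

lemma avg_bounded:
  assumes \<epsilon>: "\<epsilon> > 0" and [measurable]: "k \<in> borel_measurable borel" and k: "\<And>w. \<bar>k w\<bar> \<le> B"
    and h: "integrable lborel (h :: 'a::euclidean_space \<Rightarrow> real)"
  shows "\<bar>avg k uminus \<epsilon> h y\<bar> \<le> B / \<epsilon> ^ DIM('a) * (LINT y|lborel. \<bar>h y\<bar>)"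
proof -
  have [measurable]: "h \<in> borel_measurable borel" using h by auto
  have "\<bar>LINT y'|lborel. k ((y - y') /\<^sub>R \<epsilon>) * h y'\<bar> \<le> (LINT y'|lborel. \<bar>k ((y - y') /\<^sub>R \<epsilon>) * h y'\<bar>)"
    by (rule integral_abs_bound)
  also have "\<dots> \<le> (LINT y'|lborel. B * \<bar>h y'\<bar>)"
    using h k order_trans[OF abs_ge_zero k] by (intro integral_mono') (auto simp: abs_mult intro!: mult_right_mono)
  finally show ?thesis
    using \<epsilon> by (simp add: avg_uminus_section divide_right_mono)
qed

text \<open>Function and gradient are kept as an explicit pair, so that gradients of products and
  compositions are terms rather than existence statements. One continuous derivative is enough for
  cutoffs, since the integration by parts in \<open>v_by_parts\<close> accepts test functions that
  are not smooth.\<close>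

definition C1_fun :: "('a::euclidean_space \<Rightarrow> real) \<Rightarrow> ('a \<Rightarrow> 'a) \<Rightarrow> bool" where
  "C1_fun \<zeta> X \<longleftrightarrow> (\<forall>x. (\<zeta> has_derivative (\<lambda>h. X x \<bullet> h)) (at x)) \<and> continuous_on UNIV X"

lemma C1_fun_continuous: "C1_fun \<zeta> X \<Longrightarrow> continuous_on UNIV \<zeta>" "C1_fun \<zeta> X \<Longrightarrow> continuous_on UNIV X"
proof -
  show "continuous_on UNIV \<zeta>" if "C1_fun \<zeta> X"
    using that unfolding C1_fun_def by (intro has_derivative_continuous_on[of UNIV \<zeta> "\<lambda>x h. X x \<bullet> h"]) auto
  show "continuous_on UNIV X" if "C1_fun \<zeta> X"
    using that unfolding C1_fun_def by simp
qed

lemma C1_fun_line: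
  assumes "C1_fun \<zeta> X"
  shows "((\<lambda>r. \<zeta> (y + r *\<^sub>R i)) has_real_derivative X y \<bullet> i) (at 0)"
proof -
  have "((\<lambda>r. \<zeta> (y + r *\<^sub>R i)) has_derivative (\<lambda>h. X (y + 0 *\<^sub>R i) \<bullet> (h *\<^sub>R i))) (at 0)"
    by (rule has_derivative_compose[of "\<lambda>r. y + r *\<^sub>R i" _ _ UNIV \<zeta>])
      (use assms in \<open>auto simp: C1_fun_def intro!: derivative_eq_intros\<close>)
  then show ?thesis
    unfolding has_field_derivative_def by (simp add: mult.commute[of _ "X y \<bullet> i"])
qed

lemma C1_fun_zero_open:
  assumes "C1_fun \<zeta> X" "open U" "\<And>x. x \<in> U \<Longrightarrow> \<zeta> x = 0" "x \<in> U"
  shows "X x = 0"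
proof -
  have "((\<lambda>_. 0) has_derivative (\<lambda>h. X x \<bullet> h)) (at x)"
    by (rule has_derivative_transform_within_open[of \<zeta> _ _ _ U]) (use assms in \<open>auto simp: C1_fun_def\<close>)
  then have "(\<lambda>h. X x \<bullet> h) = (\<lambda>h. 0)"
    by (rule has_derivative_unique) auto
  then have "X x \<bullet> X x = 0" by metis
  then show ?thesis by simp
qed

lemma continuous_compact_support_bounded:
  fixes f :: "'a::euclidean_space \<Rightarrow> 'b::real_normed_vector"
  assumes "continuous_on UNIV f" "compact K" "\<And>x. x \<notin> K \<Longrightarrow> f x = 0"
  obtains C where "C \<ge> 0" "\<And>x. norm (f x) \<le> C"
proof -
  have "bounded (f ` K)"
    using assms by (intro compact_imp_bounded compact_continuous_image continuous_on_subset[OF assms(1)]) auto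
  then obtain C where "C > 0" "\<And>x. x \<in> K \<Longrightarrow> norm (f x) \<le> C"
    unfolding bounded_pos by auto
  with assms(3) show ?thesis
    by (intro that[of C]) (auto, metis less_imp_le norm_zero)
qed

context renormalised
begin

text \<open>These averages are \<epsilon> times derivatives of mollifications: the factor
  1/\<epsilon> is kept outside so that the general results on \<open>avg\<close> apply.\<close>

abbreviation u_grad_m where "u_grad_m i \<epsilon> \<equiv> avg (pderiv_dir i moll) shiftx \<epsilon> u"
abbreviation v_grad_m where "v_grad_m i \<epsilon> \<equiv> avg (pderiv_dir i moll) shiftx \<epsilon> (\<lambda>p. v p \<bullet> i)"

lemma u_grad_m_integrable: "integrable lborel (u_grad_m i \<epsilon>)"
  and flux_m_integrable: "i \<in> Basis \<Longrightarrow> integrable lborel (flux_m i \<epsilon>)"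
  and v_grad_m_integrable: "i \<in> Basis \<Longrightarrow> integrable lborel (v_grad_m i \<epsilon>)"
  and um_integrable: "integrable lborel (um \<epsilon>)"
  and gm_integrable: "integrable lborel (gm \<epsilon>)"
  and dm_integrable: "integrable lborel (dm \<epsilon>)"
  by (intro integrable_avg pderiv_moll_integrable moll_integrable u g d_integrable uv_integrable v_integrable; simp)+

lemma dm_bound: "\<bar>dm \<epsilon> p\<bar> \<le> M"
proof -
  have "\<bar>dm \<epsilon> p\<bar> \<le> (LINT w|lborel. \<bar>moll w * d (p + \<epsilon> *\<^sub>R shiftx w)\<bar>)"
    unfolding avg_def by (rule integral_abs_bound)
  also have "\<dots> \<le> (LINT w|lborel. moll (w::'a) * M)"
    using M_nonneg by (intro integral_mono' integrable_mult_left moll_integrable)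
      (auto simp: abs_mult moll_nonneg intro!: mult_left_mono d_bound)
  finally show ?thesis by (simp add: integral_moll)
qed

text \<open>The function integrated by parts is (T - t) \<zeta> \<beta>(um); its derivative in x is
  computed by the chain rule at almost every time, namely when u is integrable over x. At such a
  time the gradient of \<open>um\<close> is bounded by a constant depending on \<epsilon> times the
  L1 norm of u in x, which explains the majorant \<open>m\<close>.\<close>

lemma v_by_parts_mollified:
  assumes \<epsilon>: "\<epsilon> > 0" and i: "i \<in> Basis" and \<zeta>: "C1_fun \<zeta> X" and K: "compact K" "K \<subseteq> \<Omega>" "\<And>x. x \<notin> K \<Longrightarrow> \<zeta> x = 0"
  shows "(LINT p|lborel. (v p \<bullet> i) * (indicator {0<..<T} (snd p) * (T - snd p) *
       ((X (fst p) \<bullet> i) * \<beta> (um \<epsilon> p) + \<zeta> (fst p) * (\<beta>' (um \<epsilon> p) * (u_grad_m i \<epsilon> p / \<epsilon>)))))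
     = - (LINT p|lborel. D i i p * (indicator {0<..<T} (snd p) * (T - snd p) * (\<zeta> (fst p) * \<beta> (um \<epsilon> p))))"
    (is "(LINT p|lborel. (v p \<bullet> i) * ?\<Phi>' p) = - (LINT p|lborel. D i i p * ?\<Phi> p)")
proof -
  have [measurable]: "\<zeta> \<in> borel_measurable borel" "X \<in> borel_measurable borel"
    using C1_fun_continuous[OF \<zeta>] by (auto intro: borel_measurable_continuous_onI)
  have [measurable]: "u_grad_m i \<epsilon> \<in> borel_measurable borel" using u_grad_m_integrable by auto
  obtain C where C: "C \<ge> 0" "\<And>x. \<bar>\<zeta> x\<bar> \<le> C"
    using continuous_compact_support_bounded[OF C1_fun_continuous(1)[OF \<zeta>] K(1,3)] by (metis real_norm_def)
  have X0: "X x = 0" if "x \<notin> K" for x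
    using that K by (intro C1_fun_zero_open[OF \<zeta>, of "- K"]) (auto simp: compact_imp_closed)
  obtain C' where C': "C' \<ge> 0" "\<And>x. norm (X x) \<le> C'"
    using continuous_compact_support_bounded[OF C1_fun_continuous(2)[OF \<zeta>] K(1) X0] by metis
  obtain B1 where B1: "B1 > 0" "\<And>w. \<bar>pderiv_dir i moll (w::'a)\<bar> \<le> B1" using pderiv_moll_bounded by metis
  define m where "m s = indicator {0<..<T} s * (T * (C' * B)) + (T * (C * (B * (B1 / \<epsilon> ^ DIM('a) / \<epsilon>)))) * (LINT y|lborel. \<bar>u (y, s)\<bar>)" for s
  have T0: "0 \<le> indicator {0<..<T} s * (T - s)" "indicator {0<..<T} s * (T - s) \<le> T" for s
    using T by (auto split: split_indicator)
  show ?thesis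
  proof (rule v_by_parts[OF i K(1,2), where C="T * (C * B)" and m=m])
    show "\<bar>?\<Phi> p\<bar> \<le> T * (C * B)" for p
      unfolding abs_mult[of _ "_ * \<beta> _"] abs_mult[of "\<zeta> _"] using T0[of "snd p"] C \<beta>_bound[of "um \<epsilon> p"] T
      by (intro mult_mono) auto
    have "integrable lborel (\<lambda>s. LINT y|lborel. \<bar>u (y, s)\<bar>)"
    proof -
      have "integrable (lborel \<Otimes>\<^sub>M lborel) (case_prod (\<lambda>y s. \<bar>u (y, s)\<bar>))"
        using integrable_abs[OF u] by (simp add: lborel_prod case_prod_unfold)
      from lborel_pair.integrable_snd[OF this] show ?thesis by simp
    qed
    then show "integrable lborel m"
      unfolding m_def using T by (intro Bochner_Integration.integrable_add integrable_mult_left integrable_mult_right)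
        (auto simp: integrable_indicator_iff)
    have "AE s in lborel. integrable lborel (\<lambda>y. u (y, s))"
    proof -
      have "integrable (lborel \<Otimes>\<^sub>M lborel) (\<lambda>(s, y). u (y, s))"
        by (rule lborel_pair.integrable_product_swap) (simp add: lborel_prod u)
      from lborel_pair.AE_integrable_fst'[OF this] show ?thesis by simp
    qed
    then show "AE s in lborel. \<forall>y. ((\<lambda>r. ?\<Phi> (y + r *\<^sub>R i, s)) has_real_derivative ?\<Phi>' (y, s)) (at 0) \<and> \<bar>?\<Phi>' (y, s)\<bar> \<le> m s"
    proof eventually_elim
      case (elim s)
      show ?case
      proof (intro allI conjI)
        fix y
        have um: "um \<epsilon> (y, s) = avg moll uminus \<epsilon> (\<lambda>y. u (y, s)) y" for y
          by (simp add: avg_def)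
        have gm: "u_grad_m i \<epsilon> (y, s) = avg (pderiv_dir i moll) uminus \<epsilon> (\<lambda>y. u (y, s)) y"
          by (simp add: avg_def)
        have "((\<lambda>r. um \<epsilon> (y + r *\<^sub>R i, s)) has_real_derivative u_grad_m i \<epsilon> (y, s) / \<epsilon>) (at 0)"
          unfolding um gm by (rule avg_deriv[OF \<epsilon> elim])
        then have "((\<lambda>r. \<beta> (um \<epsilon> (y + r *\<^sub>R i, s))) has_real_derivative \<beta>' (um \<epsilon> (y, s)) * (u_grad_m i \<epsilon> (y, s) / \<epsilon>)) (at 0)"
          using DERIV_chain2[OF \<beta>, of "\<lambda>r. um \<epsilon> (y + r *\<^sub>R i, s)" "u_grad_m i \<epsilon> (y, s) / \<epsilon>" 0 UNIV] by simp
        from DERIV_cmult[OF DERIV_mult[OF C1_fun_line[OF \<zeta>, of y i] this], of "indicator {0<..<T} s * (T - s)"]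
        show "((\<lambda>r. ?\<Phi> (y + r *\<^sub>R i, s)) has_real_derivative ?\<Phi>' (y, s)) (at 0)"
          by (simp add: mult.commute[of _ "\<zeta> y"])
        have g: "\<bar>u_grad_m i \<epsilon> (y, s) / \<epsilon>\<bar> \<le> B1 / \<epsilon> ^ DIM('a) / \<epsilon> * (LINT y|lborel. \<bar>u (y, s)\<bar>)"
          using avg_bounded[OF \<epsilon> pderiv_moll_measurable B1(2) elim, of y] \<epsilon> unfolding gm[symmetric]
          by (simp add: field_simps)
        have Xi: "\<bar>X y \<bullet> i\<bar> \<le> C'" using Basis_le_norm[OF i, of "X y"] C'(2)[of y] by linarith
        let ?A = "(X y \<bullet> i) * \<beta> (um \<epsilon> (y, s)) + \<zeta> y * (\<beta>' (um \<epsilon> (y, s)) * (u_grad_m i \<epsilon> (y, s) / \<epsilon>))"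
        let ?E = "C' * B + C * (B * (B1 / \<epsilon> ^ DIM('a) / \<epsilon> * (LINT y|lborel. \<bar>u (y, s)\<bar>)))"
        have "\<bar>?A\<bar> \<le> \<bar>X y \<bullet> i\<bar> * \<bar>\<beta> (um \<epsilon> (y, s))\<bar> + \<bar>\<zeta> y\<bar> * (\<bar>\<beta>' (um \<epsilon> (y, s))\<bar> * \<bar>u_grad_m i \<epsilon> (y, s) / \<epsilon>\<bar>)"
          unfolding abs_mult[symmetric] by (rule abs_triangle_ineq)
        also have "\<dots> \<le> ?E"
          by (intro add_mono mult_mono Xi g \<beta>_bound \<beta>'_bound C C' mult_nonneg_nonneg abs_ge_zero B_nonneg)
        finally have A: "\<bar>?A\<bar> \<le> ?E" .
        have "\<bar>?\<Phi>' (y, s)\<bar> = (indicator {0<..<T} s * (T - s)) * \<bar>?A\<bar>"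
          using abs_mult[of "indicator {0<..<T} s * (T - s)" ?A] abs_of_nonneg[OF T0(1)[of s]] by (simp only: fst_conv snd_conv)
        also have "\<dots> \<le> (indicator {0<..<T} s * T) * ?E"
          using A by (cases "s \<in> {0<..<T}") (auto intro!: mult_mono)
        also have "\<dots> \<le> m s"
        proof -
          have "0 \<le> C * (B * (B1 / \<epsilon> ^ DIM('a) / \<epsilon> * (LINT y|lborel. \<bar>u (y, s)\<bar>)))"
            using C B_nonneg B1 \<epsilon> by (intro mult_nonneg_nonneg) auto
          moreover have "(indicator {0<..<T} s * T) * (c + P) \<le> indicator {0<..<T} s * (T * c) + T * P" if "0 \<le> P" for c P
            using T that by (auto simp: distrib_left split: split_indicator)
          ultimately show ?thesis unfolding m_def by (simp only: mult.assoc)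
        qed
        finally show "\<bar>?\<Phi>' (y, s)\<bar> \<le> m s" .
      qed
    qed
    show "y \<in> K \<and> 0 < s \<and> s < T" if "?\<Phi> (y, s) \<noteq> 0" for y s
      using that K(3)[of y] by (auto split: split_indicator_asm)
  qed measurable
qed

text \<open>The condition on \<open>K\<close> keeps the support of the kernel inside \<Omega>, where
  the divergence of the mollified velocity is the mollified divergence. The identity is proved at
  fixed \<open>x\<close> by testing in time, because the weak derivatives of v are statements about
  space-time integrals.\<close>

lemma v_grad_m_eq_dm:
  assumes \<epsilon>: "\<epsilon> > 0" and K: "\<And>x. x \<in> K \<Longrightarrow> cbox (x - \<epsilon> *\<^sub>R One) (x + \<epsilon> *\<^sub>R One) \<subseteq> \<Omega>" and [measurable]: "K \<in> sets borel"
  shows "AE p in lborel. fst p \<in> K \<and> 0 < snd p \<and> snd p < T \<longrightarrow> (\<Sum>i\<in>Basis. v_grad_m i \<epsilon> p) / \<epsilon> = dm \<epsilon> p"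
proof -
  have sec: "AE t in lborel. t \<in> {0<..<T} \<longrightarrow> (\<Sum>i\<in>Basis. v_grad_m i \<epsilon> (x, t)) / \<epsilon> - dm \<epsilon> (x, t) = 0" if x: "x \<in> K" for x
  proof (rule du_Bois_Reymond)
    obtain B0 where B0: "\<And>w. \<bar>moll (w::'a)\<bar> \<le> B0" using moll_bounded by metis
    obtain B1 where B1: "\<And>i w. \<bar>pderiv_dir i moll (w::'a)\<bar> \<le> B1 i" using pderiv_moll_bounded by metis
    have 1: "integrable lborel (\<lambda>t. \<psi> t * v_grad_m i \<epsilon> (x, t))" if "i \<in> Basis" "\<psi> \<in> borel_measurable borel" "\<And>t. \<bar>\<psi> t\<bar> \<le> 1" for i \<psi>
      by (rule integrable_avg_section[OF \<epsilon> pderiv_moll_measurable B1 v_integrable[OF that(1)] that(2,3)])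
    have 2: "integrable lborel (\<lambda>t. \<psi> t * dm \<epsilon> (x, t))" if "\<psi> \<in> borel_measurable borel" "\<And>t. \<bar>\<psi> t\<bar> \<le> 1" for \<psi>
      by (rule integrable_avg_section[OF \<epsilon> moll_measurable B0 d_integrable that])
    show "integrable lborel (\<lambda>t. (\<Sum>i\<in>Basis. v_grad_m i \<epsilon> (x, t)) / \<epsilon> - dm \<epsilon> (x, t))"
      using 1[of _ "\<lambda>_. 1"] 2[of "\<lambda>_. 1"]
      by (intro Bochner_Integration.integrable_diff integrable_divide_zero Bochner_Integration.integrable_sum) auto
    fix k a b :: real assume k: "k > 0" and ab: "cbox a b \<subseteq> {0<..<T}"
    let ?\<theta> = "box_bump k a b"
    have \<theta>: "\<bar>?\<theta> t\<bar> \<le> 1" for t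
      using box_bump_nonneg[of k a b t] box_bump_le_1[of k a b t] by simp
    let ?\<Phi> = "\<lambda>p. moll ((x - fst p) /\<^sub>R \<epsilon>) * ?\<theta> (snd p)"
    have parts: "(LINT t|lborel. ?\<theta> t * v_grad_m i \<epsilon> (x, t)) / \<epsilon> = (LINT p|lborel. D i i p * ?\<Phi> p) / \<epsilon> ^ DIM('a)" if i: "i \<in> Basis" for i
    proof -
      have "(LINT p|lborel. (v p \<bullet> i) * (- (pderiv_dir i moll ((x - fst p) /\<^sub>R \<epsilon>) / \<epsilon>) * ?\<theta> (snd p))) = - (LINT p|lborel. D i i p * ?\<Phi> p)"
      proof (rule v_by_parts[OF i compact_cbox K[OF x], where C="B0 * 1" and m="\<lambda>s. B1 i / \<epsilon> * indicator {0<..<T} s"])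
        show "\<bar>?\<Phi> p\<bar> \<le> B0 * 1" for p
          unfolding abs_mult using B0 \<theta> order_trans[OF abs_ge_zero B0] by (intro mult_mono) auto
        show "y \<in> cbox (x - \<epsilon> *\<^sub>R One) (x + \<epsilon> *\<^sub>R One) \<and> 0 < s \<and> s < T" if "?\<Phi> (y, s) \<noteq> 0" for y s
        proof -
          have "moll ((x - y) /\<^sub>R \<epsilon>) \<noteq> 0" "?\<theta> s \<noteq> 0" using that by auto
          then have "box_bump (1 / \<epsilon>) (x - \<epsilon> *\<^sub>R One) (x + \<epsilon> *\<^sub>R One) y \<noteq> 0"
            by (auto simp: moll_scaled_eq[OF \<epsilon>])
          then have "y \<in> cbox (x - \<epsilon> *\<^sub>R One) (x + \<epsilon> *\<^sub>R One)"
            using box_bump_eq_0_iff[OF divide_pos_pos[OF zero_less_one \<epsilon>], of "x - \<epsilon> *\<^sub>R One" "x + \<epsilon> *\<^sub>R One" y] box_subset_cbox by blast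
          moreover have "s \<in> {0<..<T}"
            using \<open>?\<theta> s \<noteq> 0\<close> ab box_subset_cbox[of a b] box_bump_eq_0_iff[OF k, of a b s] by blast
          ultimately show ?thesis by simp
        qed
        show "integrable lborel (\<lambda>s. B1 i / \<epsilon> * indicator {0<..<T} s)"
          using T by (intro integrable_mult_right) (auto simp: integrable_indicator_iff)
        show "AE s in lborel. \<forall>y. ((\<lambda>r. ?\<Phi> (y + r *\<^sub>R i, s)) has_real_derivative - (pderiv_dir i moll ((x - fst (y, s)) /\<^sub>R \<epsilon>) / \<epsilon>) * ?\<theta> (snd (y, s))) (at 0)
          \<and> \<bar>- (pderiv_dir i moll ((x - fst (y, s)) /\<^sub>R \<epsilon>) / \<epsilon>) * ?\<theta> (snd (y, s))\<bar> \<le> B1 i / \<epsilon> * indicator {0<..<T} s"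
        proof (intro AE_I2 allI conjI)
          fix s y
          have "((\<lambda>r. moll ((x - (y + r *\<^sub>R i)) /\<^sub>R \<epsilon>)) has_real_derivative - (pderiv_dir i moll ((x - y) /\<^sub>R \<epsilon>) / \<epsilon>)) (at 0)"
            using smooth_DERIV_line[OF smooth_moll, of "(x - y) /\<^sub>R \<epsilon>" "(- inverse \<epsilon>) *\<^sub>R i" 0]
              pderiv_dir_scale[OF smooth_differentiable[OF smooth_moll], of "- inverse \<epsilon>" i]
            by (simp add: algebra_simps divide_inverse)
          from DERIV_cmult_right[OF this, of "?\<theta> s"]
          show "((\<lambda>r. ?\<Phi> (y + r *\<^sub>R i, s)) has_real_derivative - (pderiv_dir i moll ((x - fst (y, s)) /\<^sub>R \<epsilon>) / \<epsilon>) * ?\<theta> (snd (y, s))) (at 0)"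
            by simp
          have "\<bar>?\<theta> s\<bar> \<le> indicator {0<..<T} s"
          proof (cases "s \<in> {0<..<T}")
            case False
            then have "s \<notin> box a b" using ab box_subset_cbox[of a b] by blast
            then show ?thesis using box_bump_eq_0_iff[OF k, of a b s] by simp
          qed (use \<theta> in auto)
          then show "\<bar>- (pderiv_dir i moll ((x - fst (y, s)) /\<^sub>R \<epsilon>) / \<epsilon>) * ?\<theta> (snd (y, s))\<bar> \<le> B1 i / \<epsilon> * indicator {0<..<T} s"
            unfolding abs_mult using \<epsilon> B1[of i] order_trans[OF abs_ge_zero B1[of i]]
            by (intro mult_mono) (auto simp: divide_right_mono)
        qed
      qed measurable
      moreover have "(LINT p|lborel. (v p \<bullet> i) * (- (pderiv_dir i moll ((x - fst p) /\<^sub>R \<epsilon>) / \<epsilon>) * ?\<theta> (snd p)))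
        = - ((LINT p|lborel. pderiv_dir i moll ((x - fst p) /\<^sub>R \<epsilon>) * ?\<theta> (snd p) * (v p \<bullet> i)) / \<epsilon>)"
        by (simp add: mult_ac)
      moreover have "(LINT t|lborel. ?\<theta> t * v_grad_m i \<epsilon> (x, t)) = (LINT p|lborel. pderiv_dir i moll ((x - fst p) /\<^sub>R \<epsilon>) * ?\<theta> (snd p) * (v p \<bullet> i)) / \<epsilon> ^ DIM('a)"
        by (rule integral_avg_section[OF \<epsilon> pderiv_moll_measurable B1 v_integrable[OF i] box_bump_measurable \<theta>])
      ultimately show ?thesis by simp
    qed
    have iD: "integrable lborel (\<lambda>p. D i i p * ?\<Phi> p)" if i: "i \<in> Basis" for i
      using integrable_kernel[OF \<epsilon> moll_measurable B0 D_integrable[OF i i] box_bump_measurable \<theta>, of x] by (simp add: mult_ac)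
    have "(LINT t|lborel. ?\<theta> t * dm \<epsilon> (x, t)) = (LINT p|lborel. d p * ?\<Phi> p) / \<epsilon> ^ DIM('a)"
      using integral_avg_section[OF \<epsilon> moll_measurable B0 d_integrable box_bump_measurable \<theta>, of x] by (simp add: mult_ac)
    also have "(LINT p|lborel. d p * ?\<Phi> p) = (LINT p|lborel. (\<Sum>i\<in>Basis. D i i p * ?\<Phi> p))"
      unfolding sum_distrib_right[symmetric] using div D_meas
      by (intro integral_cong_AE) (auto elim!: eventually_mono)
    also have "\<dots> = (\<Sum>i\<in>Basis. LINT p|lborel. D i i p * ?\<Phi> p)"
      using iD by (intro Bochner_Integration.integral_sum) auto
    also have "\<dots> / \<epsilon> ^ DIM('a) = (\<Sum>i\<in>Basis. (LINT t|lborel. ?\<theta> t * v_grad_m i \<epsilon> (x, t)) / \<epsilon>)"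
      using parts by (simp add: sum_divide_distrib)
    also have "\<dots> = (LINT t|lborel. (\<Sum>i\<in>Basis. ?\<theta> t * v_grad_m i \<epsilon> (x, t) / \<epsilon>))"
      using 1[OF _ box_bump_measurable \<theta>] by (subst Bochner_Integration.integral_sum) auto
    also have "\<dots> = (LINT t|lborel. ?\<theta> t * ((\<Sum>i\<in>Basis. v_grad_m i \<epsilon> (x, t)) / \<epsilon>))"
      by (simp add: sum_distrib_left sum_divide_distrib)
    finally have eq: "(LINT t|lborel. ?\<theta> t * ((\<Sum>i\<in>Basis. v_grad_m i \<epsilon> (x, t)) / \<epsilon>)) = (LINT t|lborel. ?\<theta> t * dm \<epsilon> (x, t))" ..
    have "integrable lborel (\<lambda>t. ?\<theta> t * ((\<Sum>i\<in>Basis. v_grad_m i \<epsilon> (x, t)) / \<epsilon>))"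
      using 1[OF _ box_bump_measurable \<theta>]
      by (subst times_divide_eq_right, subst sum_distrib_left) (intro integrable_divide_zero Bochner_Integration.integrable_sum, auto)
    then have "(LINT t|lborel. ?\<theta> t * ((\<Sum>i\<in>Basis. v_grad_m i \<epsilon> (x, t)) / \<epsilon>) - ?\<theta> t * dm \<epsilon> (x, t)) = 0"
      using eq 2[OF box_bump_measurable \<theta>] by simp
    then show "(LINT t|lborel. ((\<Sum>i\<in>Basis. v_grad_m i \<epsilon> (x, t)) / \<epsilon> - dm \<epsilon> (x, t)) * ?\<theta> t) = 0"
      by (simp add: algebra_simps)
  qed auto
  have [measurable]: "v_grad_m i \<epsilon> \<in> borel_measurable borel" if "i \<in> Basis" for i
    using v_grad_m_integrable[OF that] by auto
  have "AE p in lborel \<Otimes>\<^sub>M lborel. fst p \<in> K \<and> 0 < snd p \<and> snd p < T \<longrightarrow> (\<Sum>i\<in>Basis. v_grad_m i \<epsilon> p) / \<epsilon> = dm \<epsilon> p"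
  proof (rule lborel_pair.AE_pair_measure)
    show "{p \<in> space (lborel \<Otimes>\<^sub>M lborel). fst p \<in> K \<and> 0 < snd p \<and> snd p < T \<longrightarrow> (\<Sum>i\<in>Basis. v_grad_m i \<epsilon> p) / \<epsilon> = dm \<epsilon> p} \<in> sets (lborel \<Otimes>\<^sub>M lborel)"
      unfolding lborel_prod by measurable
    show "AE x in lborel. AE t in lborel. fst (x, t) \<in> K \<and> 0 < snd (x, t) \<and> snd (x, t) < T \<longrightarrow> (\<Sum>i\<in>Basis. v_grad_m i \<epsilon> (x, t)) / \<epsilon> = dm \<epsilon> (x, t)"
    proof (rule AE_I2)
      fix x
      show "AE t in lborel. fst (x, t) \<in> K \<and> 0 < snd (x, t) \<and> snd (x, t) < T \<longrightarrow> (\<Sum>i\<in>Basis. v_grad_m i \<epsilon> (x, t)) / \<epsilon> = dm \<epsilon> (x, t)"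
        using sec[of x] by (cases "x \<in> K") (auto elim!: eventually_mono)
    qed
  qed
  then show ?thesis unfolding lborel_prod .
qed

end

subsection \<open>Commutator estimate in the interior\<close>

lemma integrable_bounded_mult:
  fixes f h :: "'b::euclidean_space \<Rightarrow> real"
  assumes f: "integrable lborel f" and [measurable]: "h \<in> borel_measurable borel" and h: "\<And>p. \<bar>h p\<bar> \<le> C"
  shows "integrable lborel (\<lambda>p. h p * f p)"
  by (rule Bochner_Integration.integrable_bound[OF integrable_mult_right[OF f, of C]])
    (use f h order_trans[OF abs_ge_zero h] in \<open>auto simp: abs_mult intro!: mult_right_mono\<close>)

lemma integral_bounded_mult_tendsto_0:
  fixes f :: "nat \<Rightarrow> 'b::euclidean_space \<Rightarrow> real"
  assumes f: "\<And>n. integrable lborel (f n)" and h: "\<And>n. h n \<in> borel_measurable borel" "\<And>n p. \<bar>h n p\<bar> \<le> C"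
    and lim: "(\<lambda>n. LINT p|lborel. \<bar>f n p\<bar>) \<longlonglongrightarrow> 0"
  shows "(\<lambda>n. LINT p|lborel. h n p * f n p) \<longlonglongrightarrow> 0"
proof (rule Lim_null_comparison[OF always_eventually])
  show "(\<lambda>n. C * (LINT p|lborel. \<bar>f n p\<bar>)) \<longlonglongrightarrow> 0"
    using tendsto_mult_right_zero[OF lim] .
  show "\<forall>n. norm (LINT p|lborel. h n p * f n p) \<le> C * (LINT p|lborel. \<bar>f n p\<bar>)"
  proof
    fix n
    have "\<bar>LINT p|lborel. h n p * f n p\<bar> \<le> (LINT p|lborel. \<bar>h n p * f n p\<bar>)"
      by (rule integral_abs_bound)
    also have "\<dots> \<le> (LINT p|lborel. C * \<bar>f n p\<bar>)"
      using f[of n] h(2)[of n] order_trans[OF abs_ge_zero h(2)] 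
      by (intro integral_mono') (auto simp: abs_mult intro!: mult_right_mono)
    finally show "norm (LINT p|lborel. h n p * f n p) \<le> C * (LINT p|lborel. \<bar>f n p\<bar>)" by simp
  qed
qed

lemma integral_mult_tendsto:
  fixes f :: "'b::euclidean_space \<Rightarrow> real"
  assumes f: "integrable lborel f" and h: "\<And>n. h n \<in> borel_measurable borel" "\<And>n p. \<bar>h n p\<bar> \<le> C"
    "h' \<in> borel_measurable borel" and lim: "AE p in lborel. (\<lambda>n. h n p) \<longlonglongrightarrow> h' p"
  shows "(\<lambda>n. LINT p|lborel. h n p * f p) \<longlonglongrightarrow> (LINT p|lborel. h' p * f p)"
proof (rule integral_dominated_convergence[where w="\<lambda>p. C * \<bar>f p\<bar>"])
  show "AE p in lborel. (\<lambda>n. h n p * f p) \<longlonglongrightarrow> h' p * f p"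
    using lim by eventually_elim (intro tendsto_intros)
  show "AE p in lborel. norm (h n p * f p) \<le> C * \<bar>f p\<bar>" for n
    using h(2) by (intro AE_I2) (auto simp: abs_mult intro!: mult_right_mono)
qed (use f h in auto)

lemma integral_open_interval:
  fixes f :: "real \<Rightarrow> real"
  assumes [measurable]: "f \<in> borel_measurable borel"
  shows "(LINT t|lborel. indicator {a..b} t * f t) = (LINT t|lborel. indicator {a<..<b} t * f t)"
proof (rule integral_cong_AE)
  have "AE t in lborel. t \<noteq> a \<and> t \<noteq> b"
    using AE_lborel_singleton[of a] AE_lborel_singleton[of b] by eventually_elim auto
  then show "AE t in lborel. indicator {a..b} t * f t = indicator {a<..<b} t * f t"
    by eventually_elim (auto split: split_indicator)
qed auto

context renormalised
begin

text \<open>The commutator of mollification with the transport operator: the integrand regroups into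
  $(u(x-\epsilon w)-u(x))\,(v(x-\epsilon w)-v(x))\cdot\nabla\eta(w)/\epsilon$, in which the Lipschitz bound on $v$ absorbs
  the factor $1/\epsilon$.\<close>

definition resid where
  "resid \<epsilon> p = (\<Sum>i\<in>Basis. flux_m i \<epsilon> p) / \<epsilon> - (\<Sum>i\<in>Basis. (v p \<bullet> i) * u_grad_m i \<epsilon> p) / \<epsilon> - u p * dm \<epsilon> p"

lemma resid_integrable: "integrable lborel (resid \<epsilon>)"
proof -
  have "integrable lborel (\<lambda>p. dm \<epsilon> p * u p)"
    by (rule integrable_bounded_mult[OF u dm_measurable dm_bound])
  then have "integrable lborel (\<lambda>p. u p * dm \<epsilon> p)" by (simp add: mult.commute)
  moreover have "integrable lborel (\<lambda>p. (v p \<bullet> i) * u_grad_m i \<epsilon> p)" if "i \<in> Basis" for i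
    by (rule integrable_bounded_mult[OF u_grad_m_integrable _ v_inner_bound[OF that]]) simp
  ultimately show ?thesis
    unfolding resid_def[abs_def] using flux_m_integrable
    by (intro Bochner_Integration.integrable_diff integrable_divide_zero Bochner_Integration.integrable_sum) auto
qed

text \<open>The factor \<open>norm w\<close> is what the increment of v over a displacement of size
  \<epsilon> |w| leaves after division by \<epsilon>.\<close>

definition kern where "kern i w = norm w * pderiv_dir i moll w" for i w :: 'a

lemma kern_integrable: "integrable lborel (kern i)"
  unfolding kern_def[abs_def] using norm_pderiv_moll_integrable[of 1 i] by simp

text \<open>The kernel is supported in the cube [-1,1]^d, on which the norm is at most the
  dimension, so the condition linking \<epsilon> and \<delta> keeps all shifted points in \<Omega>.
  The bound contains increments of u only, and these vanish in L1 as \<epsilon> tends to 0.\<close>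

lemma resid_bound:
  fixes \<epsilon> \<delta> :: real
  assumes \<epsilon>: "\<epsilon> > 0" and K: "compact K" and \<delta>: "\<delta> > 0" "(\<Union>x\<in>K. ball x \<delta>) \<subseteq> \<Omega>" "\<epsilon> * DIM('a) \<le> \<delta> / 2"
  shows "AE p in lborel. fst p \<in> K \<and> 0 < snd p \<and> snd p < T \<longrightarrow>
    \<bar>resid \<epsilon> p\<bar> \<le> DIM('a) * M * (\<Sum>i\<in>Basis. LINT w|lborel. \<bar>kern i w\<bar> * \<bar>u (p + \<epsilon> *\<^sub>R shiftx w) - u p\<bar>)"
proof -
  define W where "W = (\<Union>x\<in>K. ball x (\<delta> / 2)) \<times> {0<..<T}"
  have W: "open W" unfolding W_def by (intro open_Times) auto
  then have [measurable]: "W \<in> sets borel" by simp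
  have [measurable]: "K \<in> sets borel" using K by (simp add: borel_compact)
  have WQ: "(x + z, t) \<in> Q" if xt: "(x, t) \<in> W" and z: "norm z \<le> \<delta> / 2" for x z t
  proof -
    obtain y where y: "y \<in> K" "dist y x < \<delta> / 2" using xt by (auto simp: W_def)
    have "dist y (x + z) \<le> dist y x + norm z"
      using dist_triangle[of y "x + z" x] by (simp add: dist_norm)
    then have "x + z \<in> ball y \<delta>" using y z by auto
    then have "x + z \<in> \<Omega>" using \<delta> y by blast
    then show ?thesis using xt by (auto simp: W_def)
  qed
  \<comment> \<open>\<open>v_Lipschitz\<close> holds for each shift \<open>w\<close> at almost every
    \<open>p\<close>. Fubini gives it at almost every \<open>p\<close> for almost every
    \<open>w\<close>, the form that an integral over \<open>w\<close> can use.\<close>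
  have Lip: "AE p in lborel. AE w in lborel. w \<in> cbox (- One) One \<and> p \<in> W \<longrightarrow>
     \<bar>v (p + \<epsilon> *\<^sub>R shiftx w) \<bullet> i - v p \<bullet> i\<bar> \<le> DIM('a) * M * (\<epsilon> * norm w)" if i: "i \<in> Basis" for i
  proof (subst lborel_pair.AE_commute)
    show "{x \<in> space (lborel \<Otimes>\<^sub>M lborel). snd x \<in> cbox (- One) One \<and> fst x \<in> W \<longrightarrow>
     \<bar>v (fst x + \<epsilon> *\<^sub>R shiftx (snd x)) \<bullet> i - v (fst x) \<bullet> i\<bar> \<le> DIM('a) * M * (\<epsilon> * norm (snd x))} \<in> sets (lborel \<Otimes>\<^sub>M lborel)"
      unfolding lborel_prod by measurable
    show "AE w in lborel. AE p in lborel. w \<in> cbox (- One) One \<and> p \<in> W \<longrightarrow>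
     \<bar>v (p + \<epsilon> *\<^sub>R shiftx w) \<bullet> i - v p \<bullet> i\<bar> \<le> DIM('a) * M * (\<epsilon> * norm w)"
    proof (rule AE_I2)
      fix w :: 'a
      show "AE p in lborel. w \<in> cbox (- One) One \<and> p \<in> W \<longrightarrow>
        \<bar>v (p + \<epsilon> *\<^sub>R shiftx w) \<bullet> i - v p \<bullet> i\<bar> \<le> DIM('a) * M * (\<epsilon> * norm w)"
      proof (cases "w \<in> cbox (- One) One")
        case True
        have n: "norm (\<epsilon> *\<^sub>R (- w)) \<le> \<delta> / 2"
        proof -
          have "\<epsilon> * norm w \<le> \<epsilon> * DIM('a)"
            using norm_le_DIM[OF True] \<epsilon> by (intro mult_left_mono) auto
          moreover have "norm (\<epsilon> *\<^sub>R (- w)) = \<epsilon> * norm w" using \<epsilon> by simp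
          ultimately show ?thesis using \<delta>(3) by linarith
        qed
        have "AE p in lborel. p \<in> W \<longrightarrow> \<bar>v (p + (\<epsilon> *\<^sub>R (- w), 0)) \<bullet> i - v p \<bullet> i\<bar> \<le> DIM('a) * M * norm (\<epsilon> *\<^sub>R (- w))"
        proof (rule v_Lipschitz[OF i W])
          fix p s assume p: "p \<in> W" and s: "s \<in> {0..1::real}"
          have "norm (s *\<^sub>R \<epsilon> *\<^sub>R (- w)) \<le> 1 * norm (\<epsilon> *\<^sub>R (- w))"
            unfolding norm_scaleR[of s] using s by (intro mult_right_mono) auto
          then show "p + s *\<^sub>R (\<epsilon> *\<^sub>R (- w), 0) \<in> Q"
            using p WQ[of "fst p" "snd p" "s *\<^sub>R \<epsilon> *\<^sub>R (- w)"] n by (cases p) auto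
        qed
        then show ?thesis using abs_of_pos[OF \<epsilon>] by (auto elim!: eventually_mono)
      qed simp
    qed
  qed
  have Lip': "AE p in lborel. \<forall>i\<in>Basis. AE w in lborel. w \<in> cbox (- One) One \<and> p \<in> W \<longrightarrow>
     \<bar>v (p + \<epsilon> *\<^sub>R shiftx w) \<bullet> i - v p \<bullet> i\<bar> \<le> DIM('a) * M * (\<epsilon> * norm w)"
    using Lip by (intro AE_ball_countable[THEN iffD2]) (auto simp: countable_finite)
  have i1: "AE p in lborel. \<forall>i\<in>Basis. integrable lborel (\<lambda>w. pderiv_dir i moll w * (u (p + \<epsilon> *\<^sub>R shiftx w) * (v (p + \<epsilon> *\<^sub>R shiftx w) \<bullet> i)))"
    using AE_integrable_avg[OF pderiv_moll_integrable uv_integrable shiftx_measurable]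
    by (intro AE_ball_countable[THEN iffD2]) (auto simp: countable_finite)
  have i2: "AE p in lborel. \<forall>i\<in>Basis. integrable lborel (\<lambda>w. pderiv_dir i moll w * u (p + \<epsilon> *\<^sub>R shiftx w))"
    using AE_integrable_avg[OF pderiv_moll_integrable u shiftx_measurable]
    by (intro AE_ball_countable[THEN iffD2]) (auto simp: countable_finite)
  have i3: "AE p in lborel. \<forall>i\<in>Basis. integrable lborel (\<lambda>w. pderiv_dir i moll w * (v (p + \<epsilon> *\<^sub>R shiftx w) \<bullet> i))"
    using AE_integrable_avg[OF pderiv_moll_integrable v_integrable shiftx_measurable]
    by (intro AE_ball_countable[THEN iffD2]) (auto simp: countable_finite)
  have i4: "AE p in lborel. \<forall>i\<in>Basis. integrable lborel (\<lambda>w. \<bar>kern i w\<bar> * \<bar>u (p + \<epsilon> *\<^sub>R shiftx w) - u p\<bar>)"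
    using AE_diff_avg_integrable[OF kern_integrable u shiftx_measurable]
    by (intro AE_ball_countable[THEN iffD2]) (auto simp: countable_finite)
  have dm: "AE p in lborel. fst p \<in> K \<and> 0 < snd p \<and> snd p < T \<longrightarrow> (\<Sum>i\<in>Basis. v_grad_m i \<epsilon> p) / \<epsilon> = dm \<epsilon> p"
  proof (rule v_grad_m_eq_dm[OF \<epsilon>])
    fix x assume x: "x \<in> K"
    show "cbox (x - \<epsilon> *\<^sub>R One) (x + \<epsilon> *\<^sub>R One) \<subseteq> \<Omega>"
    proof
      fix y assume y: "y \<in> cbox (x - \<epsilon> *\<^sub>R One) (x + \<epsilon> *\<^sub>R One)"
      have "(y - x) /\<^sub>R \<epsilon> \<in> cbox (- One) One"
        unfolding mem_box
      proof (intro ballI conjI)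
        fix i :: 'a assume "i \<in> Basis"
        then have "x \<bullet> i - \<epsilon> \<le> y \<bullet> i" "y \<bullet> i \<le> x \<bullet> i + \<epsilon>"
          using y by (auto simp: mem_box inner_simps)
        with \<epsilon> \<open>i \<in> Basis\<close> show "- One \<bullet> i \<le> ((y - x) /\<^sub>R \<epsilon>) \<bullet> i" "((y - x) /\<^sub>R \<epsilon>) \<bullet> i \<le> One \<bullet> i"
          by (auto simp: inner_simps field_simps)
      qed
      then have "norm (y - x) \<le> \<epsilon> * DIM('a)"
      proof -
        assume "(y - x) /\<^sub>R \<epsilon> \<in> cbox (- One) One"
        from norm_le_DIM[OF this] have "norm (y - x) / \<epsilon> \<le> DIM('a)"
          using \<epsilon> by (simp add: divide_inverse mult.commute)
        then show ?thesis using \<epsilon> by (simp add: divide_le_eq mult.commute)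
      qed
      then have "y \<in> ball x \<delta>" using \<delta> by (simp add: dist_norm norm_minus_commute)
      then show "y \<in> \<Omega>" using \<delta>(2) x by blast
    qed
  qed simp
  show ?thesis
    using Lip' i1 i2 i3 i4 dm
  proof eventually_elim
    case (elim p)
    show ?case
    proof
      assume p: "fst p \<in> K \<and> 0 < snd p \<and> snd p < T"
      then have pW: "p \<in> W" using \<delta>(1) by (cases p) (auto simp: W_def intro!: bexI[of _ "fst p"])
      let ?q = "\<lambda>w. p + \<epsilon> *\<^sub>R shiftx w"
      let ?I = "\<lambda>i. LINT w|lborel. pderiv_dir i moll w * ((u (?q w) - u p) * (v (?q w) \<bullet> i - v p \<bullet> i))"
      have split: "flux_m i \<epsilon> p - (v p \<bullet> i) * u_grad_m i \<epsilon> p - u p * v_grad_m i \<epsilon> p = ?I i" if i: "i \<in> Basis" for i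
      proof -
        \<comment> \<open>Expanding the product of increments gives the flux, the transport term, u
          times the divergence part, and u v times the integral of the kernel's derivative, which is
          zero.\<close>
        have "?I i = (LINT w|lborel. ((pderiv_dir i moll w * (u (?q w) * (v (?q w) \<bullet> i)) - (v p \<bullet> i) * (pderiv_dir i moll w * u (?q w)))
          - u p * (pderiv_dir i moll w * (v (?q w) \<bullet> i))) + (u p * (v p \<bullet> i)) * pderiv_dir i moll w)"
          by (intro Bochner_Integration.integral_cong) (auto simp: algebra_simps)
        also have "\<dots> = flux_m i \<epsilon> p - (v p \<bullet> i) * u_grad_m i \<epsilon> p - u p * v_grad_m i \<epsilon> p + (u p * (v p \<bullet> i)) * integral\<^sup>L lborel (pderiv_dir i (moll :: 'a \<Rightarrow> real))"
          unfolding avg_def using elim i pderiv_moll_integrable[of i] by simp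
        finally show ?thesis by (simp add: integral_pderiv_moll)
      qed
      have "resid \<epsilon> p = ((\<Sum>i\<in>Basis. flux_m i \<epsilon> p) - (\<Sum>i\<in>Basis. (v p \<bullet> i) * u_grad_m i \<epsilon> p) - u p * (\<Sum>i\<in>Basis. v_grad_m i \<epsilon> p)) / \<epsilon>"
        using elim p by (simp add: resid_def diff_divide_distrib flip: times_divide_eq_right)
      also have "\<dots> = (\<Sum>i\<in>Basis. ?I i) / \<epsilon>"
        using split by (simp add: sum_subtractf[symmetric] sum_distrib_left)
      finally have "\<bar>resid \<epsilon> p\<bar> = \<bar>\<Sum>i\<in>Basis. ?I i\<bar> / \<epsilon>" using \<epsilon> by simp
      also have "\<dots> \<le> (\<Sum>i\<in>Basis. \<bar>?I i\<bar>) / \<epsilon>"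
        using \<epsilon> by (intro divide_right_mono sum_abs) auto
      also have "\<dots> \<le> (\<Sum>i\<in>Basis. DIM('a) * M * \<epsilon> * (LINT w|lborel. \<bar>kern i w\<bar> * \<bar>u (?q w) - u p\<bar>)) / \<epsilon>"
      proof (intro divide_right_mono sum_mono)
        fix i :: 'a assume i: "i \<in> Basis"
        have "\<bar>?I i\<bar> \<le> (LINT w|lborel. \<bar>pderiv_dir i moll w * ((u (?q w) - u p) * (v (?q w) \<bullet> i - v p \<bullet> i))\<bar>)"
          by (rule integral_abs_bound)
        also have "\<dots> \<le> (LINT w|lborel. DIM('a) * M * \<epsilon> * (\<bar>kern i w\<bar> * \<bar>u (?q w) - u p\<bar>))"
        proof (rule integral_mono_AE')
          show "integrable lborel (\<lambda>w. DIM('a) * M * \<epsilon> * (\<bar>kern i w\<bar> * \<bar>u (?q w) - u p\<bar>))"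
            using elim i by (intro integrable_mult_right) auto
          have "AE w in lborel. w \<in> cbox (- One) One \<longrightarrow> \<bar>v (?q w) \<bullet> i - v p \<bullet> i\<bar> \<le> DIM('a) * M * (\<epsilon> * norm w)"
            using elim(1) i pW by (auto elim!: eventually_mono)
          then show "AE w in lborel. \<bar>pderiv_dir i moll w * ((u (?q w) - u p) * (v (?q w) \<bullet> i - v p \<bullet> i))\<bar> \<le> DIM('a) * M * \<epsilon> * (\<bar>kern i w\<bar> * \<bar>u (?q w) - u p\<bar>)"
          proof eventually_elim
            case (elim w)
            show ?case
            proof (cases "w \<in> cbox (- One) One")
              case True
              then have "\<bar>pderiv_dir i moll w\<bar> * (\<bar>u (?q w) - u p\<bar> * \<bar>v (?q w) \<bullet> i - v p \<bullet> i\<bar>) \<le> \<bar>pderiv_dir i moll w\<bar> * (\<bar>u (?q w) - u p\<bar> * (DIM('a) * M * (\<epsilon> * norm w)))"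
                using elim by (intro mult_left_mono) auto
              then show ?thesis unfolding kern_def abs_mult abs_norm_cancel by (simp add: mult_ac)
            next
              case False
              then have "pderiv_dir i moll w = 0" using pderiv_moll_bounded[of i] by metis
              then show ?thesis by (simp add: kern_def)
            qed
          qed
        qed (use M_nonneg \<epsilon> in auto)
        finally show "\<bar>?I i\<bar> \<le> DIM('a) * M * \<epsilon> * (LINT w|lborel. \<bar>kern i w\<bar> * \<bar>u (?q w) - u p\<bar>)" by simp
      qed (use \<epsilon> in auto)
      also have "\<dots> = DIM('a) * M * (\<Sum>i\<in>Basis. LINT w|lborel. \<bar>kern i w\<bar> * \<bar>u (?q w) - u p\<bar>)"
        using \<epsilon> by (simp add: sum_distrib_left[symmetric])
      finally show "\<bar>resid \<epsilon> p\<bar> \<le> DIM('a) * M * (\<Sum>i\<in>Basis. LINT w|lborel. \<bar>kern i w\<bar> * \<bar>u (?q w) - u p\<bar>)" .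
    qed
  qed
qed

text \<open>The multipliers are bounded and live on \<open>K\<close>, where the pointwise bound on
  the residual is available; integrating that bound leaves one instance of
  \<open>diff_avg_tendsto\<close> for each coordinate.\<close>

lemma resid_tendsto:
  fixes \<epsilon> :: "nat \<Rightarrow> real"
  assumes \<epsilon>: "\<And>n. \<epsilon> n > 0" "\<epsilon> \<longlonglongrightarrow> 0" and K: "compact K"
    and \<delta>: "\<delta> > 0" "(\<Union>x\<in>K. ball x \<delta>) \<subseteq> \<Omega>" "\<And>n. \<epsilon> n * DIM('a) \<le> \<delta> / 2"
    and h: "\<And>n. h n \<in> borel_measurable borel" "\<And>n p. \<bar>h n p\<bar> \<le> C" "\<And>n p. h n p \<noteq> 0 \<Longrightarrow> fst p \<in> K \<and> 0 < snd p \<and> snd p < T"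
  shows "(\<lambda>n. LINT p|lborel. h n p * resid (\<epsilon> n) p) \<longlonglongrightarrow> 0"
proof (rule Lim_null_comparison[OF always_eventually])
  let ?J = "\<lambda>n p. DIM('a) * M * (\<Sum>i\<in>(Basis :: 'a set). LINT w|lborel. \<bar>kern i w\<bar> * \<bar>u (p + \<epsilon> n *\<^sub>R shiftx w) - u p\<bar>)"
  have C: "0 \<le> C" using h(2)[of undefined undefined] by linarith
  have iJ: "integrable lborel (\<lambda>p. LINT w|lborel. \<bar>kern i w\<bar> * \<bar>u (p + \<epsilon> n *\<^sub>R shiftx w) - u p\<bar>)" for i n
    by (intro diff_avg_integrable kern_integrable u shiftx_measurable)
  have "(\<lambda>n. C * (DIM('a) * M * (\<Sum>i\<in>(Basis :: 'a set). LINT p|lborel. LINT w|lborel. \<bar>kern i w\<bar> * \<bar>u (p + \<epsilon> n *\<^sub>R shiftx w) - u p\<bar>))) \<longlonglongrightarrow>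
    C * (DIM('a) * M * (\<Sum>i\<in>(Basis :: 'a set). 0))"
    by (intro tendsto_intros diff_avg_tendsto kern_integrable u shiftx_measurable \<epsilon>)
  moreover have "(LINT p|lborel. C * ?J n p) = C * (DIM('a) * M * (\<Sum>i\<in>(Basis :: 'a set). LINT p|lborel. LINT w|lborel. \<bar>kern i w\<bar> * \<bar>u (p + \<epsilon> n *\<^sub>R shiftx w) - u p\<bar>))" for n
    using iJ by simp
  ultimately show "(\<lambda>n. LINT p|lborel. C * ?J n p) \<longlonglongrightarrow> 0"
    by (simp only: sum.neutral_const mult_zero_right)
  show "\<forall>n. norm (LINT p|lborel. h n p * resid (\<epsilon> n) p) \<le> (LINT p|lborel. C * ?J n p)"
  proof
    fix n
    have "norm (LINT p|lborel. h n p * resid (\<epsilon> n) p) \<le> (LINT p|lborel. \<bar>h n p * resid (\<epsilon> n) p\<bar>)"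
      using integral_abs_bound[of lborel "\<lambda>p. h n p * resid (\<epsilon> n) p"] by simp
    also have "\<dots> \<le> (LINT p|lborel. C * ?J n p)"
    proof (rule integral_mono_AE)
      show "integrable lborel (\<lambda>p. \<bar>h n p * resid (\<epsilon> n) p\<bar>)"
        by (intro integrable_abs integrable_bounded_mult[OF resid_integrable h(1,2)])
      show "integrable lborel (\<lambda>p. C * ?J n p)"
        using iJ by (intro integrable_mult_right Bochner_Integration.integrable_sum) auto
      show "AE p in lborel. \<bar>h n p * resid (\<epsilon> n) p\<bar> \<le> C * ?J n p"
        using resid_bound[OF \<epsilon>(1) K \<delta>, of n]
      proof eventually_elim
        case (elim p)
        show ?case
        proof (cases "h n p = 0")
          case True
          then show ?thesis using C M_nonneg by (auto intro!: mult_nonneg_nonneg sum_nonneg)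
        next
          case False
          then show ?thesis
            unfolding abs_mult using elim h(3)[OF False] h(2)[of n p] C by (intro mult_mono) auto
        qed
      qed
    qed
    finally show "norm (LINT p|lborel. h n p * resid (\<epsilon> n) p) \<le> (LINT p|lborel. C * ?J n p)" .
  qed
qed

end

context renormalised
begin

section \<open>The renormalised equation for interior cutoffs\<close>

definition wt :: "'a \<times> real \<Rightarrow> real" where
  "wt p = indicator {0<..<T} (snd p) * (T - snd p)"

lemma wt_measurable [measurable]: "wt \<in> borel_measurable borel"
  unfolding wt_def[abs_def] by measurable

lemma wt_bound: "\<bar>wt p\<bar> \<le> T"
  using T by (auto simp: wt_def split: split_indicator)

lemma wt_eq_0: "\<not> (0 < snd p \<and> snd p < T) \<Longrightarrow> wt p = 0"
  by (auto simp: wt_def)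

lemma renormalised_integrated:
  assumes \<epsilon>: "\<epsilon> > 0" and [measurable]: "\<zeta> \<in> borel_measurable borel" and C: "\<And>x. \<bar>\<zeta> x\<bar> \<le> C"
    and K: "compact K" "K \<subseteq> \<Omega>" "\<And>x. x \<notin> K \<Longrightarrow> \<zeta> x = 0"
  shows "(LINT p|lborel. indicator {0<..<T} (snd p) * (\<zeta> (fst p) * \<beta> (um \<epsilon> p)))
    = T * (LINT x|lborel. \<zeta> x * \<beta> (u0m \<epsilon> x)) + (LINT p|lborel. (wt p * \<zeta> (fst p) * \<beta>' (um \<epsilon> p)) * rhs_m \<epsilon> p)"
proof -
  let ?f1 = "\<lambda>p. indicator {0<..<T} (snd p) * (\<zeta> (fst p) * \<beta> (um \<epsilon> p))"
  let ?f2 = "\<lambda>p. (wt p * \<zeta> (fst p) * \<beta>' (um \<epsilon> p)) * rhs_m \<epsilon> p"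
  have C0: "0 \<le> C" using C[of undefined] by linarith
  have i1: "integrable lborel ?f1"
  proof (rule integrable_bounded_Q[where C="C * B"])
    show "\<bar>?f1 p\<bar> \<le> C * B" for p
      using mult_mono[OF C[of "fst p"] \<beta>_bound[of "um \<epsilon> p"]] C0 B_nonneg
      by (auto simp: abs_mult split: split_indicator)
    show "?f1 p = 0" if "p \<notin> Q" for p
      using that K(2) K(3)[of "fst p"] by (cases p) (auto split: split_indicator)
  qed measurable
  have i2: "integrable lborel ?f2"
  proof (rule integrable_bounded_mult[OF rhs_m_integrable])
    show "\<bar>wt p * \<zeta> (fst p) * \<beta>' (um \<epsilon> p)\<bar> \<le> T * C * B" for p
      unfolding abs_mult using T C0 by (intro mult_mono wt_bound C \<beta>'_bound) auto
  qed measurable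
  have [measurable]: "K \<in> sets borel" using K(1) by (simp add: borel_compact)
  have iK: "integrable lborel (indicator K :: 'a \<Rightarrow> real)"
    using emeasure_bounded_finite[OF compact_imp_bounded[OF K(1)]] K(1) by (simp add: integrable_indicator_iff borel_compact)
  have i0: "integrable lborel (\<lambda>x. T * (\<zeta> x * \<beta> (u0m \<epsilon> x)))"
  proof -
    have "integrable lborel (\<lambda>x. (\<zeta> x * \<beta> (u0m \<epsilon> x)) * indicator K x)"
      by (rule integrable_bounded_mult[OF iK, where C="C * B"])
        (use C C0 \<beta>_bound in \<open>auto simp: abs_mult intro!: mult_mono\<close>)
    moreover have "(\<zeta> x * \<beta> (u0m \<epsilon> x)) * indicator K x = \<zeta> x * \<beta> (u0m \<epsilon> x)" for x
      using K(3) by (auto split: split_indicator)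
    ultimately show ?thesis by (intro integrable_mult_right) simp
  qed
  have i2': "integrable (lborel \<Otimes>\<^sub>M lborel) ?f2" and i1': "integrable (lborel \<Otimes>\<^sub>M lborel) ?f1"
    using i1 i2 by (simp_all only: lborel_prod)
  have "(LINT p|lborel. ?f1 p) = (LINT x|lborel. LINT t|lborel. ?f1 (x, t))"
    using lborel_pair.integral_fst'[OF i1'] by (simp only: lborel_prod)
  also have "\<dots> = (LINT x|lborel. T * (\<zeta> x * \<beta> (u0m \<epsilon> x)) + (LINT t|lborel. ?f2 (x, t)))"
  proof (rule Bochner_Integration.integral_cong[OF refl])
    fix x
    have "(LINT t|lborel. ?f1 (x, t)) = (LINT t|lborel. \<zeta> x * (indicator {0<..<T} t * \<beta> (um \<epsilon> (x, t))))"
      by (intro Bochner_Integration.integral_cong) auto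
    also have "\<dots> = \<zeta> x * (LINT t|lborel. indicator {0..T} t * \<beta> (um \<epsilon> (x, t)))"
      by (subst integral_open_interval) auto
    also have "\<dots> = T * (\<zeta> x * \<beta> (u0m \<epsilon> x)) + \<zeta> x * (LINT t|lborel. indicator {0..T} t * ((T - t) * (\<beta>' (um \<epsilon> (x, t)) * rhs_m \<epsilon> (x, t))))"
      unfolding renormalised_section[OF \<epsilon>] by (simp add: algebra_simps)
    also have "\<zeta> x * (LINT t|lborel. indicator {0..T} t * ((T - t) * (\<beta>' (um \<epsilon> (x, t)) * rhs_m \<epsilon> (x, t))))
      = (LINT t|lborel. \<zeta> x * (indicator {0<..<T} t * ((T - t) * (\<beta>' (um \<epsilon> (x, t)) * rhs_m \<epsilon> (x, t)))))"
      by (subst integral_open_interval) auto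
    also have "\<dots> = (LINT t|lborel. ?f2 (x, t))"
      by (intro Bochner_Integration.integral_cong) (auto simp: wt_def)
    finally show "(LINT t|lborel. ?f1 (x, t)) = T * (\<zeta> x * \<beta> (u0m \<epsilon> x)) + (LINT t|lborel. ?f2 (x, t))" .
  qed
  also have "\<dots> = T * (LINT x|lborel. \<zeta> x * \<beta> (u0m \<epsilon> x)) + (LINT x|lborel. LINT t|lborel. ?f2 (x, t))"
    using i0 lborel_pair.integrable_fst'[OF i2'] by simp
  also have "(LINT x|lborel. LINT t|lborel. ?f2 (x, t)) = (LINT p|lborel. ?f2 p)"
    using lborel_pair.integral_fst'[OF i2'] by (simp only: lborel_prod)
  finally show ?thesis .
qed

text \<open>In \<open>rhs_m\<close> the mollified flux is replaced by v times the gradient of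
  \<open>um\<close>, plus u times \<open>dm\<close>, plus the residual. Multiplied by \<beta>'(um)
  the first term is v times the gradient of \<beta>(um), and integrating it by parts moves the
  derivative onto v, which gives the divergence term, and onto \<zeta>, which gives the term with
  \<open>X\<close>.\<close>

lemma mollified_balance:
  assumes \<epsilon>: "\<epsilon> > 0" and \<zeta>: "C1_fun \<zeta> X" and K: "compact K" "K \<subseteq> \<Omega>" "\<And>x. x \<notin> K \<Longrightarrow> \<zeta> x = 0"
  shows "(LINT p|lborel. indicator {0<..<T} (snd p) * (\<zeta> (fst p) * \<beta> (um \<epsilon> p)))
    = T * (LINT x|lborel. \<zeta> x * \<beta> (u0m \<epsilon> x)) + (LINT p|lborel. (wt p * \<zeta> (fst p) * \<beta>' (um \<epsilon> p)) * gm \<epsilon> p)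
    + (LINT p|lborel. (wt p * \<zeta> (fst p) * \<beta> (um \<epsilon> p)) * d p) + (LINT p|lborel. (wt p * \<beta> (um \<epsilon> p)) * (v p \<bullet> X (fst p)))
    - (LINT p|lborel. (wt p * \<zeta> (fst p) * \<beta>' (um \<epsilon> p) * dm \<epsilon> p) * u p)
    - (LINT p|lborel. (wt p * \<zeta> (fst p) * \<beta>' (um \<epsilon> p)) * resid \<epsilon> p)"
proof -
  have [measurable]: "\<zeta> \<in> borel_measurable borel" "X \<in> borel_measurable borel"
    using C1_fun_continuous[OF \<zeta>] by (auto intro: borel_measurable_continuous_onI)
  obtain C where C: "C \<ge> 0" "\<And>x. \<bar>\<zeta> x\<bar> \<le> C"
    using continuous_compact_support_bounded[OF C1_fun_continuous(1)[OF \<zeta>] K(1,3)] by (metis real_norm_def)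
  have X0: "X x = 0" if "x \<notin> K" for x
    using that K by (intro C1_fun_zero_open[OF \<zeta>, of "- K"]) (auto simp: compact_imp_closed)
  obtain C' where C': "C' \<ge> 0" "\<And>x. norm (X x) \<le> C'"
    using continuous_compact_support_bounded[OF C1_fun_continuous(2)[OF \<zeta>] K(1) X0] by metis
  let ?b = "\<lambda>p. wt p * \<zeta> (fst p) * \<beta>' (um \<epsilon> p)"
  let ?c = "\<lambda>p. wt p * \<zeta> (fst p) * \<beta> (um \<epsilon> p)"
  have b: "\<bar>?b p\<bar> \<le> T * C * B" and c: "\<bar>?c p\<bar> \<le> T * C * B" for p
    unfolding abs_mult using T C(1) by (intro mult_mono wt_bound C(2) \<beta>'_bound \<beta>_bound; auto)+
  have ib: "integrable lborel (\<lambda>p. ?b p * f p)" if "integrable lborel f" for f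
    by (rule integrable_bounded_mult[OF that _ b]) measurable
  have ic: "integrable lborel (\<lambda>p. ?c p * f p)" if "integrable lborel f" for f
    by (rule integrable_bounded_mult[OF that _ c]) measurable
  have iX: "integrable lborel (\<lambda>p. (wt p * \<beta> (um \<epsilon> p)) * ((v p \<bullet> i) * (X (fst p) \<bullet> i)))" if i: "i \<in> Basis" for i
  proof (rule integrable_bounded_mult[where C="T * B"])
    have "\<bar>X x \<bullet> i\<bar> \<le> C'" for x using Basis_le_norm[OF i, of "X x"] C'(2)[of x] by linarith
    then show "integrable lborel (\<lambda>p. (v p \<bullet> i) * (X (fst p) \<bullet> i))"
      using integrable_bounded_mult[OF v_integrable[OF i], of "\<lambda>p. X (fst p) \<bullet> i" C'] by (simp add: mult.commute)
    show "\<bar>wt p * \<beta> (um \<epsilon> p)\<bar> \<le> T * B" for p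
      unfolding abs_mult using T by (intro mult_mono wt_bound \<beta>_bound) auto
  qed measurable
  have iv: "integrable lborel (\<lambda>p. (v p \<bullet> i) * u_grad_m i \<epsilon> p / \<epsilon>)" if i: "i \<in> Basis" for i
    by (intro integrable_divide_zero integrable_bounded_mult[OF u_grad_m_integrable _ v_inner_bound[OF i]]) auto
  have iu: "integrable lborel (\<lambda>p. dm \<epsilon> p * u p)"
    by (rule integrable_bounded_mult[OF u dm_measurable dm_bound])
  let ?V = "\<lambda>p. \<Sum>i\<in>Basis. (v p \<bullet> i) * u_grad_m i \<epsilon> p / \<epsilon>"
  have iV: "integrable lborel ?V" using iv by (intro Bochner_Integration.integrable_sum) auto
  have "(LINT p|lborel. ?b p * rhs_m \<epsilon> p) = (LINT p|lborel. ?b p * gm \<epsilon> p - ?b p * ?V p - ?b p * (dm \<epsilon> p * u p) - ?b p * resid \<epsilon> p)"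
    by (intro Bochner_Integration.integral_cong refl)
      (simp add: rhs_m_def resid_def sum_divide_distrib algebra_simps)
  also have "\<dots> = (LINT p|lborel. ?b p * gm \<epsilon> p) - (LINT p|lborel. ?b p * ?V p) - (LINT p|lborel. ?b p * (dm \<epsilon> p * u p)) - (LINT p|lborel. ?b p * resid \<epsilon> p)"
    using ib[OF gm_integrable] ib[OF iV] ib[OF iu] ib[OF resid_integrable] by simp
  also have "(LINT p|lborel. ?b p * ?V p) = - (LINT p|lborel. ?c p * d p) - (LINT p|lborel. (wt p * \<beta> (um \<epsilon> p)) * (v p \<bullet> X (fst p)))"
  proof -
    have part: "(LINT p|lborel. (wt p * \<beta> (um \<epsilon> p)) * ((v p \<bullet> i) * (X (fst p) \<bullet> i))) + (LINT p|lborel. ?b p * ((v p \<bullet> i) * u_grad_m i \<epsilon> p / \<epsilon>))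
      = - (LINT p|lborel. ?c p * D i i p)" if i: "i \<in> Basis" for i
    proof -
      have "(LINT p|lborel. (wt p * \<beta> (um \<epsilon> p)) * ((v p \<bullet> i) * (X (fst p) \<bullet> i))) + (LINT p|lborel. ?b p * ((v p \<bullet> i) * u_grad_m i \<epsilon> p / \<epsilon>))
        = (LINT p|lborel. (wt p * \<beta> (um \<epsilon> p)) * ((v p \<bullet> i) * (X (fst p) \<bullet> i)) + ?b p * ((v p \<bullet> i) * u_grad_m i \<epsilon> p / \<epsilon>))"
        by (rule Bochner_Integration.integral_add[symmetric, OF iX[OF i] ib[OF iv[OF i]]])
      also have "\<dots> = (LINT p|lborel. (v p \<bullet> i) * (indicator {0<..<T} (snd p) * (T - snd p) *
       ((X (fst p) \<bullet> i) * \<beta> (um \<epsilon> p) + \<zeta> (fst p) * (\<beta>' (um \<epsilon> p) * (u_grad_m i \<epsilon> p / \<epsilon>)))))"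
        unfolding wt_def[symmetric] by (intro Bochner_Integration.integral_cong refl) (simp add: algebra_simps)
      also have "\<dots> = - (LINT p|lborel. D i i p * (indicator {0<..<T} (snd p) * (T - snd p) * (\<zeta> (fst p) * \<beta> (um \<epsilon> p))))"
        by (rule v_by_parts_mollified[OF \<epsilon> i \<zeta> K])
      also have "\<dots> = - (LINT p|lborel. ?c p * D i i p)"
        by (simp add: wt_def mult_ac)
      finally show ?thesis .
    qed
    have "(LINT p|lborel. (wt p * \<beta> (um \<epsilon> p)) * (v p \<bullet> X (fst p))) = (LINT p|lborel. (\<Sum>i\<in>Basis. (wt p * \<beta> (um \<epsilon> p)) * ((v p \<bullet> i) * (X (fst p) \<bullet> i))))"
      unfolding sum_distrib_left[symmetric] euclidean_inner[symmetric] ..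
    also have "\<dots> = (\<Sum>i\<in>Basis. LINT p|lborel. (wt p * \<beta> (um \<epsilon> p)) * ((v p \<bullet> i) * (X (fst p) \<bullet> i)))"
      using iX by (intro Bochner_Integration.integral_sum) auto
    finally have 1: "(LINT p|lborel. (wt p * \<beta> (um \<epsilon> p)) * (v p \<bullet> X (fst p))) = \<dots>" .
    have "(LINT p|lborel. ?b p * ?V p) = (LINT p|lborel. (\<Sum>i\<in>Basis. ?b p * ((v p \<bullet> i) * u_grad_m i \<epsilon> p / \<epsilon>)))"
      unfolding sum_distrib_left[symmetric] ..
    also have "\<dots> = (\<Sum>i\<in>Basis. LINT p|lborel. ?b p * ((v p \<bullet> i) * u_grad_m i \<epsilon> p / \<epsilon>))"
      using ib[OF iv] by (intro Bochner_Integration.integral_sum) auto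
    finally have 2: "(LINT p|lborel. ?b p * ?V p) = \<dots>" .
    have "(LINT p|lborel. ?c p * d p) = (LINT p|lborel. (\<Sum>i\<in>Basis. ?c p * D i i p))"
      unfolding sum_distrib_left[symmetric] using div D_meas
      by (intro integral_cong_AE) (auto elim!: eventually_mono)
    also have "\<dots> = (\<Sum>i\<in>Basis. LINT p|lborel. ?c p * D i i p)"
      using ic[OF D_integrable] by (intro Bochner_Integration.integral_sum) auto
    finally have 3: "(LINT p|lborel. ?c p * d p) = \<dots>" .
    have "(LINT p|lborel. (wt p * \<beta> (um \<epsilon> p)) * (v p \<bullet> X (fst p))) + (LINT p|lborel. ?b p * ?V p) = - (LINT p|lborel. ?c p * d p)"
      unfolding 1 2 3 sum.distrib[symmetric] using part by (simp add: sum_negf)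
    then show ?thesis by simp
  qed
  finally show ?thesis
    using renormalised_integrated[OF \<epsilon> \<open>\<zeta> \<in> borel_measurable borel\<close> C(2) K] by (simp add: mult.assoc)
qed

text \<open>The defect of the renormalised equation tested with $(T-t)\zeta(x)$, where $X$ stands for $\nabla\zeta$.
  For $\zeta=1$ and $\beta(s)=s^2$ its vanishing is the energy identity.\<close>

definition balance :: "('a \<Rightarrow> real) \<Rightarrow> ('a \<Rightarrow> 'a) \<Rightarrow> real" where
  "balance \<zeta> X = (LINT p|lborel. indicator Q p * (\<zeta> (fst p) * \<beta> (u p))) - T * (LINT x|lborel. indicator \<Omega> x * (\<zeta> x * \<beta> (u0 x)))
    - (LINT p|lborel. indicator Q p * ((T - snd p) * (\<zeta> (fst p) * (\<beta>' (u p) * g p + d p * \<beta> (u p) - d p * (\<beta>' (u p) * u p)))))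
    - (LINT p|lborel. indicator Q p * ((T - snd p) * (\<beta> (u p) * (v p \<bullet> X (fst p)))))"

text \<open>Most terms of \<open>mollified_balance\<close> are bounded factors, nonlinear in the
  mollified solution, against a fixed integrable function. Dominated convergence needs pointwise
  convergence of \<open>um\<close> and \<open>dm\<close>, whence the passage to a
  subsequence.\<close>

lemma balance_interior:
  assumes \<zeta>: "C1_fun \<zeta> X" and K: "compact K" "K \<subseteq> \<Omega>" "\<And>x. x \<notin> K \<Longrightarrow> \<zeta> x = 0"
  shows "balance \<zeta> X = 0"
proof -
  have [measurable]: "\<zeta> \<in> borel_measurable borel" "X \<in> borel_measurable borel"
    using C1_fun_continuous[OF \<zeta>] by (auto intro: borel_measurable_continuous_onI)
  obtain C where C: "C \<ge> 0" "\<And>x. \<bar>\<zeta> x\<bar> \<le> C"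
    using continuous_compact_support_bounded[OF C1_fun_continuous(1)[OF \<zeta>] K(1,3)] by (metis real_norm_def)
  have X0: "X x = 0" if "x \<notin> K" for x
    using that K by (intro C1_fun_zero_open[OF \<zeta>, of "- K"]) (auto simp: compact_imp_closed)
  obtain C' where C': "C' \<ge> 0" "\<And>x. norm (X x) \<le> C'"
    using continuous_compact_support_bounded[OF C1_fun_continuous(2)[OF \<zeta>] K(1) X0] by metis
  obtain \<delta> where \<delta>: "\<delta> > 0" "(\<Union>x\<in>K. ball x \<delta>) \<subseteq> \<Omega>"
    using compact_subset_open_imp_ball_epsilon_subset[OF K(1) open_Omega K(2)] by blast
  \<comment> \<open>Dividing by the dimension gives the room that \<open>resid_tendsto\<close>
    demands: \<epsilon> times the dimension stays below \<delta>/2.\<close>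
  define \<epsilon>0 where "\<epsilon>0 n = \<delta> / 2 / DIM('a) / real (Suc n)" for n
  have "(\<lambda>n. \<delta> / 2 / DIM('a) * (1 / real (Suc n))) \<longlonglongrightarrow> \<delta> / 2 / DIM('a) * 0"
    by (intro tendsto_intros LIMSEQ_Suc lim_1_over_n)
  then have \<epsilon>0: "\<epsilon>0 \<longlonglongrightarrow> 0" by (simp add: \<epsilon>0_def[abs_def])
  have \<epsilon>0pos: "\<epsilon>0 n > 0" "\<epsilon>0 n * DIM('a) \<le> \<delta> / 2" for n
  proof -
    show "\<epsilon>0 n > 0" unfolding \<epsilon>0_def using \<delta>(1) by (intro divide_pos_pos) auto
    have "\<epsilon>0 n * DIM('a) = \<delta> / 2 / real (Suc n)" by (simp add: \<epsilon>0_def)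
    also have "\<dots> \<le> \<delta> / 2 / 1" using \<delta>(1) by (intro divide_left_mono) auto
    finally show "\<epsilon>0 n * DIM('a) \<le> \<delta> / 2" by simp
  qed
  \<comment> \<open>Adding the two errors yields one subsequence along which \<open>um\<close> and
    \<open>dm\<close> converge together.\<close>
  have "\<exists>r. strict_mono r \<and> (AE p in lborel. (\<lambda>n. \<bar>um (\<epsilon>0 (r n)) p - u p\<bar> + \<bar>dm (\<epsilon>0 (r n)) p - d p\<bar>) \<longlonglongrightarrow> 0)"
  proof (rule tendsto_L1_AE_subseq)
    show "integrable lborel (\<lambda>p. \<bar>um (\<epsilon>0 n) p - u p\<bar> + \<bar>dm (\<epsilon>0 n) p - d p\<bar>)" for n
      using um_integrable dm_integrable u d_integrable by (intro Bochner_Integration.integrable_add integrable_abs Bochner_Integration.integrable_diff) auto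
    have "(\<lambda>n. (LINT p|lborel. \<bar>um (\<epsilon>0 n) p - u p\<bar>) + (LINT p|lborel. \<bar>dm (\<epsilon>0 n) p - d p\<bar>)) \<longlonglongrightarrow> 0 + 0"
      by (intro tendsto_add avg_tendsto_L1 moll_integrable u d_integrable shiftx_measurable \<epsilon>0 integral_moll)
    moreover have "(LINT p|lborel. norm (\<bar>um (\<epsilon>0 n) p - u p\<bar> + \<bar>dm (\<epsilon>0 n) p - d p\<bar>)) = (LINT p|lborel. \<bar>um (\<epsilon>0 n) p - u p\<bar>) + (LINT p|lborel. \<bar>dm (\<epsilon>0 n) p - d p\<bar>)" for n
      using um_integrable[of "\<epsilon>0 n"] dm_integrable[of "\<epsilon>0 n"] u d_integrable by simp
    ultimately show "(\<lambda>n. LINT p|lborel. norm (\<bar>um (\<epsilon>0 n) p - u p\<bar> + \<bar>dm (\<epsilon>0 n) p - d p\<bar>)) \<longlonglongrightarrow> 0" by simp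
  qed
  then obtain r where r: "strict_mono r" and AE: "AE p in lborel. (\<lambda>n. \<bar>um (\<epsilon>0 (r n)) p - u p\<bar> + \<bar>dm (\<epsilon>0 (r n)) p - d p\<bar>) \<longlonglongrightarrow> 0"
    by blast
  define \<epsilon> where "\<epsilon> n = \<epsilon>0 (r n)" for n
  have \<epsilon>: "\<epsilon> \<longlonglongrightarrow> 0" using LIMSEQ_subseq_LIMSEQ[OF \<epsilon>0 r] by (simp add: \<epsilon>_def[abs_def] comp_def)
  have \<epsilon>pos: "\<epsilon> n > 0" "\<epsilon> n * DIM('a) \<le> \<delta> / 2" for n
    using \<epsilon>0pos by (auto simp: \<epsilon>_def)
  have AEu: "AE p in lborel. (\<lambda>n. um (\<epsilon> n) p) \<longlonglongrightarrow> u p"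
    using AE
  proof eventually_elim
    case (elim p)
    have "(\<lambda>n. um (\<epsilon> n) p - u p) \<longlonglongrightarrow> 0"
      by (rule Lim_null_comparison[OF always_eventually elim]) (auto simp: \<epsilon>_def)
    then show ?case by (rule LIM_zero_cancel)
  qed
  have AEd: "AE p in lborel. (\<lambda>n. dm (\<epsilon> n) p) \<longlonglongrightarrow> d p"
    using AE
  proof eventually_elim
    case (elim p)
    have "(\<lambda>n. dm (\<epsilon> n) p - d p) \<longlonglongrightarrow> 0"
      by (rule Lim_null_comparison[OF always_eventually elim]) (auto simp: \<epsilon>_def)
    then show ?case by (rule LIM_zero_cancel)
  qed
  have AE\<beta>: "AE p in lborel. (\<lambda>n. \<beta> (um (\<epsilon> n) p)) \<longlonglongrightarrow> \<beta> (u p)" and AE\<beta>': "AE p in lborel. (\<lambda>n. \<beta>' (um (\<epsilon> n) p)) \<longlonglongrightarrow> \<beta>' (u p)"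
    using AEu continuous_beta continuous_beta'
    by (auto elim!: eventually_mono intro: isCont_tendsto_compose simp: continuous_on_eq_continuous_at)
  have [measurable]: "Q \<in> sets borel" using open_Q by simp
  have iQ: "integrable lborel (indicator Q :: _ \<Rightarrow> real)"
    by (rule integrable_bounded_Q[of _ 1]) auto
  have Tn: "0 \<le> T" using T by simp
  let ?b = "\<lambda>n p. wt p * \<zeta> (fst p) * \<beta>' (um (\<epsilon> n) p)"
  have b: "\<bar>?b n p\<bar> \<le> T * C * B" for n p
    unfolding abs_mult using Tn C(1) by (intro mult_mono wt_bound C(2) \<beta>'_bound) auto
  have Qind: "indicator {0<..<T} (snd p) * (\<zeta> (fst p) * y) = (\<zeta> (fst p) * y) * indicator Q p" for p :: "'a \<times> real" and y
    using K(2) K(3)[of "fst p"] by (cases p) (auto split: split_indicator)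
  have wtQ: "wt p * \<zeta> (fst p) = indicator Q p * ((T - snd p) * \<zeta> (fst p))" for p
    using K(2) K(3)[of "fst p"] by (cases p) (auto simp: wt_def split: split_indicator)
  have t1: "(\<lambda>n. LINT p|lborel. indicator {0<..<T} (snd p) * (\<zeta> (fst p) * \<beta> (um (\<epsilon> n) p))) \<longlonglongrightarrow> (LINT p|lborel. indicator Q p * (\<zeta> (fst p) * \<beta> (u p)))"
    unfolding Qind mult.commute[of "indicator Q _"]
  proof (rule integral_mult_tendsto[OF iQ, where C="C * B"])
    show "\<bar>\<zeta> (fst p) * \<beta> (um (\<epsilon> n) p)\<bar> \<le> C * B" for n p
      unfolding abs_mult using C by (intro mult_mono \<beta>_bound) auto
    show "AE p in lborel. (\<lambda>n. \<zeta> (fst p) * \<beta> (um (\<epsilon> n) p)) \<longlonglongrightarrow> \<zeta> (fst p) * \<beta> (u p)"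
      using AE\<beta> by eventually_elim (intro tendsto_intros)
  qed measurable
  \<comment> \<open>The Lipschitz bound on \<beta> passes the L1 convergence of the mollified datum
    through directly, without a further subsequence.\<close>
  have t2: "(\<lambda>n. LINT x|lborel. \<zeta> x * \<beta> (u0m (\<epsilon> n) x)) \<longlonglongrightarrow> (LINT x|lborel. indicator \<Omega> x * (\<zeta> x * \<beta> (u0 x)))"
  proof -
    have [measurable]: "K \<in> sets borel" using K(1) by (simp add: borel_compact)
    have iK: "integrable lborel (indicator K :: 'a \<Rightarrow> real)"
      using emeasure_bounded_finite[OF compact_imp_bounded[OF K(1)]] K(1) by (simp add: integrable_indicator_iff borel_compact)
    have i: "integrable lborel (\<lambda>x. \<zeta> x * \<beta> (f x))" if [measurable]: "f \<in> borel_measurable borel" for f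
    proof -
      have "integrable lborel (\<lambda>x. (\<zeta> x * \<beta> (f x)) * indicator K x)"
        by (rule integrable_bounded_mult[OF iK, where C="C * B"])
          (use C \<beta>_bound in \<open>auto simp: abs_mult intro!: mult_mono\<close>)
      moreover have "(\<zeta> x * \<beta> (f x)) * indicator K x = \<zeta> x * \<beta> (f x)" for x
        using K(3) by (auto split: split_indicator)
      ultimately show ?thesis by simp
    qed
    have iu: "integrable lborel (\<lambda>x. u0m (\<epsilon> n) x - u0 x)" for n
      using u0 by (intro Bochner_Integration.integrable_diff integrable_avg moll_integrable) auto
    have lim: "(\<lambda>n. LINT x|lborel. \<bar>u0m (\<epsilon> n) x - u0 x\<bar>) \<longlonglongrightarrow> 0"
      by (intro avg_tendsto_L1 moll_integrable u0 \<epsilon> integral_moll) simp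
    have "(\<lambda>n. LINT x|lborel. 1 * (\<zeta> x * \<beta> (u0m (\<epsilon> n) x) - \<zeta> x * \<beta> (u0 x))) \<longlonglongrightarrow> 0"
    proof (rule integral_bounded_mult_tendsto_0[where C=1])
      show "(\<lambda>n. LINT x|lborel. \<bar>\<zeta> x * \<beta> (u0m (\<epsilon> n) x) - \<zeta> x * \<beta> (u0 x)\<bar>) \<longlonglongrightarrow> 0"
      proof (rule Lim_null_comparison[OF always_eventually tendsto_mult_right_zero[OF lim, of "C * B"]], rule allI)
        fix n
        have "(LINT x|lborel. \<bar>\<zeta> x * \<beta> (u0m (\<epsilon> n) x) - \<zeta> x * \<beta> (u0 x)\<bar>) \<le> (LINT x|lborel. C * B * \<bar>u0m (\<epsilon> n) x - u0 x\<bar>)"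
        proof (rule integral_mono)
          fix x
          have "\<bar>\<zeta> x * \<beta> (u0m (\<epsilon> n) x) - \<zeta> x * \<beta> (u0 x)\<bar> = \<bar>\<zeta> x\<bar> * \<bar>\<beta> (u0m (\<epsilon> n) x) - \<beta> (u0 x)\<bar>"
            by (simp add: right_diff_distrib[symmetric] abs_mult)
          also have "\<dots> \<le> C * (B * \<bar>u0m (\<epsilon> n) x - u0 x\<bar>)"
            using C by (intro mult_mono \<beta>_Lipschitz) auto
          finally show "\<bar>\<zeta> x * \<beta> (u0m (\<epsilon> n) x) - \<zeta> x * \<beta> (u0 x)\<bar> \<le> C * B * \<bar>u0m (\<epsilon> n) x - u0 x\<bar>" by simp
        qed (use i iu in auto)
        then show "norm (LINT x|lborel. \<bar>\<zeta> x * \<beta> (u0m (\<epsilon> n) x) - \<zeta> x * \<beta> (u0 x)\<bar>) \<le> C * B * (LINT x|lborel. \<bar>u0m (\<epsilon> n) x - u0 x\<bar>)" by simp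
      qed
    qed (use i in auto)
    then have "(\<lambda>n. (LINT x|lborel. \<zeta> x * \<beta> (u0m (\<epsilon> n) x)) - (LINT x|lborel. \<zeta> x * \<beta> (u0 x))) \<longlonglongrightarrow> 0"
      using i by simp
    then have "(\<lambda>n. LINT x|lborel. \<zeta> x * \<beta> (u0m (\<epsilon> n) x)) \<longlonglongrightarrow> (LINT x|lborel. \<zeta> x * \<beta> (u0 x))"
      by (rule LIM_zero_cancel)
    moreover have "(LINT x|lborel. \<zeta> x * \<beta> (u0 x)) = (LINT x|lborel. indicator \<Omega> x * (\<zeta> x * \<beta> (u0 x)))"
      using K by (intro Bochner_Integration.integral_cong) (auto split: split_indicator)
    ultimately show ?thesis by (simp only:)
  qed
  \<comment> \<open>Both factors vary: first \<open>gm\<close> is replaced by \<open>g\<close>, by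
    L1 convergence against bounded factors; then \<open>g\<close> is fixed and the other factor
    converges almost everywhere.\<close>
  have t3: "(\<lambda>n. LINT p|lborel. ?b n p * gm (\<epsilon> n) p) \<longlonglongrightarrow> (LINT p|lborel. (wt p * \<zeta> (fst p) * \<beta>' (u p)) * g p)"
  proof -
    have "(\<lambda>n. (LINT p|lborel. ?b n p * (gm (\<epsilon> n) p - g p)) + (LINT p|lborel. ?b n p * g p)) \<longlonglongrightarrow> 0 + (LINT p|lborel. (wt p * \<zeta> (fst p) * \<beta>' (u p)) * g p)"
    proof (rule tendsto_add)
      show "(\<lambda>n. LINT p|lborel. ?b n p * (gm (\<epsilon> n) p - g p)) \<longlonglongrightarrow> 0"
        by (rule integral_bounded_mult_tendsto_0[OF _ _ b])
          (use gm_integrable g in \<open>auto intro!: avg_tendsto_L1 moll_integrable \<epsilon> integral_moll\<close>)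
      show "(\<lambda>n. LINT p|lborel. ?b n p * g p) \<longlonglongrightarrow> (LINT p|lborel. (wt p * \<zeta> (fst p) * \<beta>' (u p)) * g p)"
      proof (rule integral_mult_tendsto[OF g _ b])
        show "AE p in lborel. (\<lambda>n. ?b n p) \<longlonglongrightarrow> wt p * \<zeta> (fst p) * \<beta>' (u p)"
          using AE\<beta>' by eventually_elim (intro tendsto_intros)
      qed measurable
    qed
    moreover have "(LINT p|lborel. ?b n p * (gm (\<epsilon> n) p - g p)) + (LINT p|lborel. ?b n p * g p) = (LINT p|lborel. ?b n p * gm (\<epsilon> n) p)" for n
    proof -
      have "integrable lborel (\<lambda>p. ?b n p * (gm (\<epsilon> n) p - g p))" "integrable lborel (\<lambda>p. ?b n p * g p)"
        using gm_integrable g by (intro integrable_bounded_mult[OF _ _ b]; simp)+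
      from Bochner_Integration.integral_add[OF this, symmetric] show ?thesis
        by (simp add: algebra_simps)
    qed
    ultimately show ?thesis by simp
  qed
  have t4: "(\<lambda>n. LINT p|lborel. (wt p * \<zeta> (fst p) * \<beta> (um (\<epsilon> n) p)) * d p) \<longlonglongrightarrow> (LINT p|lborel. (wt p * \<zeta> (fst p) * \<beta> (u p)) * d p)"
  proof (rule integral_mult_tendsto[OF d_integrable])
    show "\<bar>wt p * \<zeta> (fst p) * \<beta> (um (\<epsilon> n) p)\<bar> \<le> T * C * B" for n p
      unfolding abs_mult using Tn C(1) by (intro mult_mono wt_bound C(2) \<beta>_bound) auto
    show "AE p in lborel. (\<lambda>n. wt p * \<zeta> (fst p) * \<beta> (um (\<epsilon> n) p)) \<longlonglongrightarrow> wt p * \<zeta> (fst p) * \<beta> (u p)"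
      using AE\<beta> by eventually_elim (intro tendsto_intros)
  qed measurable
  have t5: "(\<lambda>n. LINT p|lborel. (wt p * \<beta> (um (\<epsilon> n) p)) * (v p \<bullet> X (fst p))) \<longlonglongrightarrow> (LINT p|lborel. (wt p * \<beta> (u p)) * (v p \<bullet> X (fst p)))"
  proof (rule integral_mult_tendsto)
    show "integrable lborel (\<lambda>p. v p \<bullet> X (fst p))"
    proof (rule integrable_bounded_Q[where C="M * C'"])
      show "\<bar>v p \<bullet> X (fst p)\<bar> \<le> M * C'" for p
        using Cauchy_Schwarz_ineq2 mult_mono[OF v_bound C'(2) M_nonneg norm_ge_zero] by (rule order_trans)
    qed (auto simp: outside)
    show "\<bar>wt p * \<beta> (um (\<epsilon> n) p)\<bar> \<le> T * B" for n p
      unfolding abs_mult using Tn by (intro mult_mono wt_bound \<beta>_bound) auto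
    show "AE p in lborel. (\<lambda>n. wt p * \<beta> (um (\<epsilon> n) p)) \<longlonglongrightarrow> wt p * \<beta> (u p)"
      using AE\<beta> by eventually_elim (intro tendsto_intros)
  qed measurable
  have t6: "(\<lambda>n. LINT p|lborel. (?b n p * dm (\<epsilon> n) p) * u p) \<longlonglongrightarrow> (LINT p|lborel. (wt p * \<zeta> (fst p) * \<beta>' (u p) * d p) * u p)"
  proof (rule integral_mult_tendsto[OF u])
    show "\<bar>?b n p * dm (\<epsilon> n) p\<bar> \<le> (T * C * B) * M" for n p
      unfolding abs_mult[of "?b n p"] using order_trans[OF abs_ge_zero b] by (intro mult_mono b dm_bound) auto
    show "AE p in lborel. (\<lambda>n. ?b n p * dm (\<epsilon> n) p) \<longlonglongrightarrow> wt p * \<zeta> (fst p) * \<beta>' (u p) * d p"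
      using AE\<beta>' AEd by eventually_elim (intro tendsto_intros)
  qed measurable
  have t7: "(\<lambda>n. LINT p|lborel. ?b n p * resid (\<epsilon> n) p) \<longlonglongrightarrow> 0"
  proof (rule resid_tendsto[OF \<epsilon>pos(1) \<epsilon> K(1) \<delta> \<epsilon>pos(2) _ b])
    show "fst p \<in> K \<and> 0 < snd p \<and> snd p < T" if "?b n p \<noteq> 0" for n p
      using that K(3)[of "fst p"] wt_eq_0[of p] by auto
  qed measurable
  have "(LINT p|lborel. indicator Q p * (\<zeta> (fst p) * \<beta> (u p))) = T * (LINT x|lborel. indicator \<Omega> x * (\<zeta> x * \<beta> (u0 x)))
    + (LINT p|lborel. (wt p * \<zeta> (fst p) * \<beta>' (u p)) * g p) + (LINT p|lborel. (wt p * \<zeta> (fst p) * \<beta> (u p)) * d p)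
    + (LINT p|lborel. (wt p * \<beta> (u p)) * (v p \<bullet> X (fst p))) - (LINT p|lborel. (wt p * \<zeta> (fst p) * \<beta>' (u p) * d p) * u p) - 0"
  proof (rule LIMSEQ_unique[OF t1], rule Lim_transform_eventually)
    show "\<forall>\<^sub>F n in sequentially. T * (LINT x|lborel. \<zeta> x * \<beta> (u0m (\<epsilon> n) x)) + (LINT p|lborel. ?b n p * gm (\<epsilon> n) p)
        + (LINT p|lborel. (wt p * \<zeta> (fst p) * \<beta> (um (\<epsilon> n) p)) * d p) + (LINT p|lborel. (wt p * \<beta> (um (\<epsilon> n) p)) * (v p \<bullet> X (fst p)))
        - (LINT p|lborel. (?b n p * dm (\<epsilon> n) p) * u p) - (LINT p|lborel. ?b n p * resid (\<epsilon> n) p)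
      = (LINT p|lborel. indicator {0<..<T} (snd p) * (\<zeta> (fst p) * \<beta> (um (\<epsilon> n) p)))"
      by (rule always_eventually, rule allI, rule mollified_balance[OF \<epsilon>pos(1) \<zeta> K, symmetric])
  qed (intro tendsto_intros t2 t3 t4 t5 t6 t7)
  moreover have "(LINT p|lborel. (wt p * \<beta> (u p)) * (v p \<bullet> X (fst p))) = (LINT p|lborel. indicator Q p * ((T - snd p) * (\<beta> (u p) * (v p \<bullet> X (fst p)))))"
    using K(2) X0 by (intro Bochner_Integration.integral_cong) (auto simp: wt_def outside split: split_indicator)
  moreover have "(LINT p|lborel. indicator Q p * ((T - snd p) * (\<zeta> (fst p) * (\<beta>' (u p) * g p + d p * \<beta> (u p) - d p * (\<beta>' (u p) * u p)))))
    = (LINT p|lborel. (wt p * \<zeta> (fst p) * \<beta>' (u p)) * g p) + (LINT p|lborel. (wt p * \<zeta> (fst p) * \<beta> (u p)) * d p) - (LINT p|lborel. (wt p * \<zeta> (fst p) * \<beta>' (u p) * d p) * u p)"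
  proof -
    let ?c = "wt p * \<zeta> (fst p)"
    have "integrable lborel (\<lambda>p. (wt p * \<zeta> (fst p) * \<beta>' (u p)) * g p)"
      by (rule integrable_bounded_mult[OF g, where C="T * C * B"])
        (auto simp only: abs_mult intro!: mult_mono wt_bound C \<beta>'_bound mult_nonneg_nonneg abs_ge_zero Tn, measurable)
    moreover have "integrable lborel (\<lambda>p. (wt p * \<zeta> (fst p) * \<beta> (u p)) * d p)"
      by (rule integrable_bounded_mult[OF d_integrable, where C="T * C * B"])
        (auto simp only: abs_mult intro!: mult_mono wt_bound C \<beta>_bound mult_nonneg_nonneg abs_ge_zero Tn, measurable)
    moreover have "integrable lborel (\<lambda>p. (wt p * \<zeta> (fst p) * \<beta>' (u p) * d p) * u p)"
      by (rule integrable_bounded_mult[OF u, where C="T * C * B * M"])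
        (auto simp only: abs_mult intro!: mult_mono wt_bound C \<beta>'_bound d_bound mult_nonneg_nonneg abs_ge_zero Tn B_nonneg, measurable)
    ultimately have "(LINT p|lborel. (wt p * \<zeta> (fst p) * \<beta>' (u p)) * g p) + (LINT p|lborel. (wt p * \<zeta> (fst p) * \<beta> (u p)) * d p) - (LINT p|lborel. (wt p * \<zeta> (fst p) * \<beta>' (u p) * d p) * u p)
      = (LINT p|lborel. (wt p * \<zeta> (fst p) * \<beta>' (u p)) * g p + (wt p * \<zeta> (fst p) * \<beta> (u p)) * d p - (wt p * \<zeta> (fst p) * \<beta>' (u p) * d p) * u p)"
      by simp
    also have "\<dots> = (LINT p|lborel. indicator Q p * ((T - snd p) * (\<zeta> (fst p) * (\<beta>' (u p) * g p + d p * \<beta> (u p) - d p * (\<beta>' (u p) * u p)))))"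
      unfolding wtQ by (intro Bochner_Integration.integral_cong refl) (simp add: algebra_simps)
    finally show ?thesis ..
  qed
  ultimately show ?thesis by (simp add: balance_def)
qed

end

subsection \<open>Cutoffs at the boundary\<close>

lemma C1_fun_const: "C1_fun (\<lambda>_. c) (\<lambda>_. 0)"
  by (auto simp: C1_fun_def)

lemma C1_fun_affine: "C1_fun (\<lambda>x. a \<bullet> x - b) (\<lambda>_. a)"
  by (auto simp: C1_fun_def intro!: derivative_eq_intros)

lemma C1_fun_add: "C1_fun \<zeta> X \<Longrightarrow> C1_fun \<eta> Y \<Longrightarrow> C1_fun (\<lambda>x. \<zeta> x + \<eta> x) (\<lambda>x. X x + Y x)"
  by (auto simp: C1_fun_def inner_add_left intro!: continuous_intros has_derivative_add)

lemma C1_fun_diff: "C1_fun \<zeta> X \<Longrightarrow> C1_fun \<eta> Y \<Longrightarrow> C1_fun (\<lambda>x. \<zeta> x - \<eta> x) (\<lambda>x. X x - Y x)"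
  by (auto simp: C1_fun_def inner_diff_left intro!: continuous_intros has_derivative_diff)

lemma C1_fun_mult:
  assumes "C1_fun \<zeta> X" "C1_fun \<eta> Y"
  shows "C1_fun (\<lambda>x. \<zeta> x * \<eta> x) (\<lambda>x. \<zeta> x *\<^sub>R Y x + \<eta> x *\<^sub>R X x)"
  unfolding C1_fun_def
proof (intro conjI allI)
  fix x
  have "((\<lambda>x. \<zeta> x * \<eta> x) has_derivative (\<lambda>h. \<zeta> x * (Y x \<bullet> h) + (X x \<bullet> h) * \<eta> x)) (at x)"
    by (rule has_derivative_mult) (use assms in \<open>auto simp: C1_fun_def\<close>)
  then show "((\<lambda>x. \<zeta> x * \<eta> x) has_derivative (\<lambda>h. (\<zeta> x *\<^sub>R Y x + \<eta> x *\<^sub>R X x) \<bullet> h)) (at x)"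
    by (simp add: inner_add_left mult.commute)
  show "continuous_on UNIV (\<lambda>x. \<zeta> x *\<^sub>R Y x + \<eta> x *\<^sub>R X x)"
    by (intro continuous_intros C1_fun_continuous[OF assms(1)] C1_fun_continuous[OF assms(2)])
qed

lemma C1_fun_compose:
  assumes \<zeta>: "C1_fun \<zeta> X" and f: "\<And>s. (f has_real_derivative f' s) (at s)" "continuous_on UNIV f'"
  shows "C1_fun (\<lambda>x. f (\<zeta> x)) (\<lambda>x. f' (\<zeta> x) *\<^sub>R X x)"
  unfolding C1_fun_def
proof (intro conjI allI)
  fix x
  have "((\<lambda>x. f (\<zeta> x)) has_derivative (\<lambda>h. f' (\<zeta> x) * (X x \<bullet> h))) (at x)"
    by (rule has_derivative_compose[OF _ f(1)[unfolded has_field_derivative_def], of \<zeta> _ x UNIV])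
      (use \<zeta> in \<open>auto simp: C1_fun_def\<close>)
  then show "((\<lambda>x. f (\<zeta> x)) has_derivative (\<lambda>h. (f' (\<zeta> x) *\<^sub>R X x) \<bullet> h)) (at x)" by simp
  show "continuous_on UNIV (\<lambda>x. f' (\<zeta> x) *\<^sub>R X x)"
    by (intro continuous_intros continuous_on_compose2[OF f(2)] C1_fun_continuous[OF \<zeta>]) auto
qed

lemma C1_fun_bounded:
  assumes "C1_fun \<zeta> X" "bounded S"
  obtains C where "C \<ge> 0" "\<And>x. x \<in> S \<Longrightarrow> \<bar>\<zeta> x\<bar> \<le> C" "\<And>x. x \<in> S \<Longrightarrow> norm (X x) \<le> C"
proof -
  have K: "compact (closure S)" using assms(2) by (simp add: compact_closure)
  have "bounded (\<zeta> ` closure S)" "bounded (X ` closure S)"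
    using K C1_fun_continuous[OF assms(1)]
    by (auto intro!: compact_imp_bounded compact_continuous_image elim: continuous_on_subset)
  then obtain C1 C2 where "\<And>x. x \<in> closure S \<Longrightarrow> \<bar>\<zeta> x\<bar> \<le> C1" "\<And>x. x \<in> closure S \<Longrightarrow> norm (X x) \<le> C2"
    by (auto simp: bounded_iff)
  then show ?thesis
    using closure_subset[of S] by (intro that[of "max 0 (max C1 C2)"]) (auto simp: le_max_iff_disj subset_iff)
qed

text \<open>The usual transition built from the flat function, expinv(s-1) / (expinv(s-1) +
  expinv(2-s)); the denominator never vanishes, as s > 1 or s < 2. Composed with a distance divided
  by \<epsilon>, its gradient sits in the layer between \<epsilon> and 2\<epsilon>.\<close>

lemma C1_step:
  obtains f f' :: "real \<Rightarrow> real" and L where "\<And>s. (f has_real_derivative f' s) (at s)" "continuous_on UNIV f'"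
    "\<And>s. 0 \<le> f s" "\<And>s. f s \<le> 1" "\<And>s. s \<le> 1 \<Longrightarrow> f s = 0" "\<And>s. s \<ge> 2 \<Longrightarrow> f s = 1"
    "L \<ge> 0" "\<And>s. \<bar>f' s\<bar> \<le> L" "\<And>s. f' s \<noteq> 0 \<Longrightarrow> 1 \<le> s \<and> s \<le> 2"
proof -
  obtain e where e: "smooth1 e" "\<And>x. (expinv has_real_derivative e x) (at x)"
    using smooth1_deriv[OF smooth1_expinv] by metis
  obtain e' where "\<And>x. (e has_real_derivative e' x) (at x)"
    using smooth1_deriv[OF e(1)] by metis
  then have ce: "continuous_on UNIV e"
    by (intro DERIV_continuous_on) (auto intro: has_field_derivative_at_within)
  have cx: "continuous_on UNIV expinv"
    by (intro DERIV_continuous_on) (use e(2) in \<open>auto intro: has_field_derivative_at_within\<close>)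
  define N where "N s = expinv (s - 1) + expinv (2 - s)" for s
  have N: "N s > 0" for s
  proof -
    have "expinv (s - 1) > 0 \<or> expinv (2 - s) > 0"
      by (auto simp: expinv_def)
    then show ?thesis unfolding N_def using expinv_nonneg[of "s - 1"] expinv_nonneg[of "2 - s"] by linarith
  qed
  define f where "f s = expinv (s - 1) / N s" for s
  define f' where "f' s = (e (s - 1) * N s - expinv (s - 1) * (e (s - 1) - e (2 - s))) / (N s * N s)" for s
  have d: "(f has_real_derivative f' s) (at s)" for s
  proof -
    have 1: "((\<lambda>s. expinv (s - 1)) has_real_derivative e (s - 1)) (at s)"
    proof -
      have "((\<lambda>s. s - 1) has_real_derivative 1) (at s)" by (auto intro!: derivative_eq_intros)
      from DERIV_chain2[OF e(2) this] show ?thesis by simp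
    qed
    have 2: "((\<lambda>s. expinv (2 - s)) has_real_derivative - e (2 - s)) (at s)"
    proof -
      have "((\<lambda>s. 2 - s) has_real_derivative - 1) (at s)" by (auto intro!: derivative_eq_intros)
      from DERIV_chain2[OF e(2) this] show ?thesis by simp
    qed
    from DERIV_divide[OF 1 DERIV_add[OF 1 2]] N[of s] show ?thesis
      by (simp add: f_def[abs_def] f'_def N_def[abs_def])
  qed
  have cf': "continuous_on UNIV f'"
    unfolding f'_def N_def using N[unfolded N_def]
    by (intro continuous_intros continuous_on_compose2[OF ce] continuous_on_compose2[OF cx]) (auto simp: less_imp_neq[symmetric])
  have f0: "f s = 0" if "s \<le> 1" for s using that by (simp add: f_def expinv_def)
  have f1: "f s = 1" if "s \<ge> 2" for s using that N[of s] by (simp add: f_def N_def expinv_def)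
  have f'0: "1 \<le> s \<and> s \<le> 2" if "f' s \<noteq> 0" for s
  proof (rule ccontr)
    assume "\<not> (1 \<le> s \<and> s \<le> 2)"
    then consider "s < 1" | "s > 2" by linarith
    then show False
    proof cases
      case 1
      have "((\<lambda>_. 0) has_real_derivative f' s) (at s)"
        by (rule has_field_derivative_transform_within_open[OF d[of s], of "{..<1}"]) (use 1 f0 in auto)
      then have "f' s = 0" using DERIV_unique DERIV_const by blast
      then show False using that by simp
    next
      case 2
      have "((\<lambda>_. 1) has_real_derivative f' s) (at s)"
        by (rule has_field_derivative_transform_within_open[OF d[of s], of "{2<..}"]) (use 2 f1 in auto)
      then have "f' s = 0" using DERIV_unique DERIV_const by blast
      then show False using that by simp
    qed
  qed
  have "bounded (f' ` {1..2})"
    using cf' by (intro compact_imp_bounded compact_continuous_image) (auto elim: continuous_on_subset)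
  then obtain L where "\<forall>y\<in>f' ` {1..2}. norm y \<le> L" unfolding bounded_iff by blast
  then have L: "\<bar>f' s\<bar> \<le> L" if "s \<in> {1..2}" for s using that by simp
  have "0 \<le> L" using L[of 1] by auto
  moreover have "\<bar>f' s\<bar> \<le> L" for s
    using L[of s] f'0[of s] \<open>0 \<le> L\<close> by (cases "f' s = 0") auto
  moreover have "0 \<le> f s" "f s \<le> 1" for s
    using N[of s] expinv_nonneg[of "s - 1"] expinv_nonneg[of "2 - s"] by (auto simp: f_def N_def)
  ultimately show ?thesis using d cf' f0 f1 f'0 by (intro that)
qed

text \<open>Counting disjoint translates bounds the measure of thin slabs and tubes without computing volumes.\<close>

lemma packing_bound:
  fixes A B :: "'a::euclidean_space set"
  assumes [measurable]: "A \<in> sets borel" "B \<in> sets borel" and B: "bounded B" and I: "finite I"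
    and sub: "\<And>i x. i \<in> I \<Longrightarrow> x \<in> A \<Longrightarrow> x + w i \<in> B"
    and disj: "\<And>i j x y. i \<in> I \<Longrightarrow> j \<in> I \<Longrightarrow> i \<noteq> j \<Longrightarrow> x \<in> A \<Longrightarrow> y \<in> A \<Longrightarrow> x + w i \<noteq> y + w j"
  shows "card I * measure lborel A \<le> measure lborel B"
proof -
  have fB: "emeasure lborel B < \<infinity>" by (rule emeasure_bounded_finite[OF B])
  then have iB: "integrable lborel (indicator B :: 'a \<Rightarrow> real)" by (simp add: integrable_indicator_iff)
  have "(LINT x|lborel. indicator A (x + (- w i))) = measure lborel A" for i
    using integral_shift[of "indicator A :: 'a \<Rightarrow> real" "- w i"] by simp
  then have "card I * measure lborel A = (\<Sum>i\<in>I. LINT x|lborel. indicator A (x - w i) :: real)" by simp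
  also have "\<dots> \<le> (LINT x|lborel. indicator B x)"
  proof (cases "I = {}")
    case False
    have iA: "integrable lborel (\<lambda>x. indicator A (x - w i) :: real)" if "i \<in> I" for i
      by (rule Bochner_Integration.integrable_bound[OF iB])
        (use sub[OF that, of "_ - w i"] in \<open>auto split: split_indicator\<close>)
    then have "(\<Sum>i\<in>I. LINT x|lborel. indicator A (x - w i) :: real) = (LINT x|lborel. (\<Sum>i\<in>I. indicator A (x - w i) :: real))"
      by (intro Bochner_Integration.integral_sum[symmetric]) auto
    also have "\<dots> \<le> (LINT x|lborel. indicator B x)"
    proof (rule integral_mono)
      fix x
      show "(\<Sum>i\<in>I. indicator A (x - w i)) \<le> (indicator B x :: real)"
      proof (cases "\<exists>i\<in>I. x - w i \<in> A")
        case True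
        then obtain i where i: "i \<in> I" "x - w i \<in> A" by blast
        have "x - w j \<notin> A" if "j \<in> I - {i}" for j
          using disj[of j i "x - w j" "x - w i"] i that by auto
        then have "(\<Sum>i\<in>I. indicator A (x - w i)) = (1::real)"
          using i I by (subst sum.remove[OF I i(1)]) auto
        moreover have "x \<in> B" using sub[OF i] by simp
        ultimately show ?thesis by simp
      next
        case False
        then show ?thesis by (subst sum.neutral) auto
      qed
    qed (use iA iB in auto)
    finally show ?thesis .
  qed simp
  finally show ?thesis by simp
qed

lemma slab_measure:
  fixes n :: "'a::euclidean_space"
  assumes n: "norm n = 1"
  obtains C where "C \<ge> 0" "\<And>\<epsilon>. 0 < \<epsilon> \<Longrightarrow> \<epsilon> \<le> 1 \<Longrightarrow>
    measure lborel ({y. \<epsilon> \<le> (x0 - y) \<bullet> n \<and> (x0 - y) \<bullet> n \<le> 2 * \<epsilon>} \<inter> cball x0 r) \<le> C * \<epsilon>"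
proof (rule that)
  let ?B = "cball x0 (r + 2) :: 'a set"
  show "0 \<le> 2 * measure lborel ?B" by simp
  fix \<epsilon> :: real assume \<epsilon>: "0 < \<epsilon>" "\<epsilon> \<le> 1"
  let ?A = "{y. \<epsilon> \<le> (x0 - y) \<bullet> n \<and> (x0 - y) \<bullet> n \<le> 2 * \<epsilon>} \<inter> cball x0 r"
  \<comment> \<open>1/\<epsilon> is at least 1, so its integer part is at least half of it; this is
    the factor 2 in the constant.\<close>
  define m where "m = nat \<lfloor>1 / \<epsilon>\<rfloor>"
  have m: "real m \<le> 1 / \<epsilon>" "1 / \<epsilon> \<le> 2 * real m" 
  proof -
    have "1 \<le> \<lfloor>1 / \<epsilon>\<rfloor>" using \<epsilon> by (simp add: le_floor_iff)
    then have "real m = real_of_int \<lfloor>1 / \<epsilon>\<rfloor>" "1 \<le> real_of_int \<lfloor>1 / \<epsilon>\<rfloor>"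
        unfolding m_def by (simp_all only: of_nat_nat of_int_1_le_iff)
    then show "real m \<le> 1 / \<epsilon>" "1 / \<epsilon> \<le> 2 * real m" by linarith+
  qed
  have n1: "n \<bullet> n = 1" using n by (simp add: dot_square_norm)
  \<comment> \<open>Translates by multiples of 2\<epsilon> along \<open>n\<close> are disjoint,
    since the slab has width \<epsilon>. As there are at most 1/\<epsilon> of them, points move by
    at most 2, hence the radius r + 2.\<close>
  have "card {..<m} * measure lborel ?A \<le> measure lborel ?B"
  proof (rule packing_bound[where w="\<lambda>i. (2 * real i * \<epsilon>) *\<^sub>R n"])
    have "closed {y. \<epsilon> \<le> (x0 - y) \<bullet> n \<and> (x0 - y) \<bullet> n \<le> 2 * \<epsilon>}"
      by (intro closed_Collect_conj closed_Collect_le continuous_intros)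
    then show "?A \<in> sets borel" by (intro borel_closed closed_Int) auto
    fix i :: nat and x assume i: "i \<in> {..<m}" and x: "x \<in> ?A"
    have "2 * real i * \<epsilon> \<le> 2"
    proof -
      have "real i * \<epsilon> \<le> real m * \<epsilon>" using i \<epsilon> by (intro mult_right_mono) auto
      also have "\<dots> \<le> 1" using m(1) \<epsilon> by (simp add: field_simps)
      finally show ?thesis by simp
    qed
    then have "norm ((2 * real i * \<epsilon>) *\<^sub>R n) \<le> 2" using n \<epsilon> by simp
    moreover have "norm (x0 - (x + (2 * real i * \<epsilon>) *\<^sub>R n)) \<le> norm (x0 - x) + norm ((2 * real i * \<epsilon>) *\<^sub>R n)"
      using norm_triangle_ineq4[of "x0 - x" "(2 * real i * \<epsilon>) *\<^sub>R n"] by (simp add: algebra_simps)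
    ultimately show "x + (2 * real i * \<epsilon>) *\<^sub>R n \<in> ?B" using x by (simp add: dist_norm)
  next
    fix i j :: nat and x y assume ij: "i \<noteq> j" and xy: "x \<in> ?A" "y \<in> ?A"
    show "x + (2 * real i * \<epsilon>) *\<^sub>R n \<noteq> y + (2 * real j * \<epsilon>) *\<^sub>R n"
    proof
      assume eq: "x + (2 * real i * \<epsilon>) *\<^sub>R n = y + (2 * real j * \<epsilon>) *\<^sub>R n"
      have "(x + (2 * real i * \<epsilon>) *\<^sub>R n) \<bullet> n = (y + (2 * real j * \<epsilon>) *\<^sub>R n) \<bullet> n"
        unfolding eq ..
      then have "x \<bullet> n + 2 * real i * \<epsilon> = y \<bullet> n + 2 * real j * \<epsilon>"
        using n1 by (simp add: inner_add_left)
      then have eq': "(x0 - y) \<bullet> n - (x0 - x) \<bullet> n = (2 * \<epsilon>) * (real j - real i)"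
        unfolding inner_diff_left by (simp add: algebra_simps)
      have "\<bar>(x0 - y) \<bullet> n - (x0 - x) \<bullet> n\<bar> \<le> \<epsilon>" using xy by auto
      moreover have "1 \<le> \<bar>real j - real i\<bar>" using ij by linarith
      then have "2 * \<epsilon> * 1 \<le> (2 * \<epsilon>) * \<bar>real j - real i\<bar>" using \<epsilon> by (intro mult_left_mono) auto
      moreover have "\<bar>(2 * \<epsilon>) * (real j - real i)\<bar> = (2 * \<epsilon>) * \<bar>real j - real i\<bar>"
        using \<epsilon> by (simp add: abs_mult)
      ultimately show False unfolding eq' using \<epsilon> by linarith
    qed
  qed auto
  then have "real m * measure lborel ?A \<le> measure lborel ?B" by simp
  have "1 / \<epsilon> * measure lborel ?A \<le> 2 * real m * measure lborel ?A"
    using m(2) by (intro mult_right_mono) auto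
  also have "\<dots> \<le> 2 * measure lborel ?B" using \<open>real m * measure lborel ?A \<le> measure lborel ?B\<close> by simp
  finally show "measure lborel ?A \<le> 2 * measure lborel ?B * \<epsilon>"
    using \<epsilon> by (simp add: field_simps)
qed

text \<open>The component of \<open>a2\<close> orthogonal to \<open>a1\<close>, rescaled. Moving
  along \<open>c\<close> changes the second linear form at unit speed and leaves the first alone, so
  tubes can be translated independently in the two forms.\<close>

lemma dual_vector:
  fixes a1 a2 :: "'a::euclidean_space"
  assumes "\<And>c. a2 \<noteq> c *\<^sub>R a1"
  obtains c where "a1 \<bullet> c = 0" "a2 \<bullet> c = 1"
proof -
  define w where "w = a2 - ((a2 \<bullet> a1) / (a1 \<bullet> a1)) *\<^sub>R a1"
  have "w \<noteq> 0" using assms by (auto simp: w_def)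
  have 1: "a1 \<bullet> w = 0"
    by (cases "a1 = 0") (auto simp: w_def inner_diff_right inner_commute)
  then have "w \<bullet> w = a2 \<bullet> w" by (simp add: w_def inner_diff_left)
  then have "a2 \<bullet> w \<noteq> 0" using \<open>w \<noteq> 0\<close> by (metis inner_eq_zero_iff)
  with 1 show ?thesis
    using that[of "w /\<^sub>R (a2 \<bullet> w)"] by simp
qed

lemma tube_measure:
  fixes a1 a2 :: "'a::euclidean_space"
  assumes ind: "\<And>c. a2 \<noteq> c *\<^sub>R a1" "\<And>c. a1 \<noteq> c *\<^sub>R a2"
  obtains C where "C \<ge> 0" "\<And>\<epsilon>. 0 < \<epsilon> \<Longrightarrow> \<epsilon> \<le> 1 \<Longrightarrow>
    measure lborel ({y. \<bar>a1 \<bullet> y - b1\<bar> \<le> 2 * \<epsilon> \<and> \<bar>a2 \<bullet> y - b2\<bar> \<le> 2 * \<epsilon>} \<inter> cball 0 r) \<le> C * \<epsilon>\<^sup>2"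
proof -
  obtain c2 where c2: "a1 \<bullet> c2 = 0" "a2 \<bullet> c2 = 1" using dual_vector[OF ind(1)] by blast
  obtain c1 where c1: "a2 \<bullet> c1 = 0" "a1 \<bullet> c1 = 1" using dual_vector[OF ind(2)] by blast
  let ?B = "cball 0 (r + 5 * norm c1 + 5 * norm c2) :: 'a set"
  show ?thesis
  proof (rule that)
    show "0 \<le> 4 * measure lborel ?B" by simp
    fix \<epsilon> :: real assume \<epsilon>: "0 < \<epsilon>" "\<epsilon> \<le> 1"
    let ?A = "{y. \<bar>a1 \<bullet> y - b1\<bar> \<le> 2 * \<epsilon> \<and> \<bar>a2 \<bullet> y - b2\<bar> \<le> 2 * \<epsilon>} \<inter> cball 0 r"
    define m where "m = nat \<lfloor>1 / \<epsilon>\<rfloor>"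
    have m: "real m \<le> 1 / \<epsilon>" "1 / \<epsilon> \<le> 2 * real m" 
    proof -
      have "1 \<le> \<lfloor>1 / \<epsilon>\<rfloor>" using \<epsilon> by (simp add: le_floor_iff)
      then have "real m = real_of_int \<lfloor>1 / \<epsilon>\<rfloor>" "1 \<le> real_of_int \<lfloor>1 / \<epsilon>\<rfloor>"
        unfolding m_def by (simp_all only: of_nat_nat of_int_1_le_iff)
      then show "real m \<le> 1 / \<epsilon>" "1 / \<epsilon> \<le> 2 * real m" by linarith+
    qed
    \<comment> \<open>In each linear form the tube has width 4\<epsilon>, so steps of 5\<epsilon>
      separate the translates; a square array of m times m of them yields the factor
      \<epsilon>^2.\<close>
    let ?w = "\<lambda>(i, j). (5 * real i * \<epsilon>) *\<^sub>R c1 + (5 * real j * \<epsilon>) *\<^sub>R c2"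
    have small: "norm ((5 * real i * \<epsilon>) *\<^sub>R c) \<le> 5 * norm c" if "i < m" for i and c :: 'a
    proof -
      have "real i * \<epsilon> \<le> real m * \<epsilon>" using that \<epsilon> by (intro mult_right_mono) auto
      also have "\<dots> \<le> 1" using m(1) \<epsilon> by (simp add: field_simps)
      finally have "5 * real i * \<epsilon> \<le> 5" by simp
      then have "(5 * real i * \<epsilon>) * norm c \<le> 5 * norm c" by (intro mult_right_mono) auto
      then show ?thesis using \<epsilon> by simp
    qed
    have far: False if "i \<noteq> j" "\<bar>s\<bar> \<le> 2 * \<epsilon>" "\<bar>t\<bar> \<le> 2 * \<epsilon>" "s + 5 * real i * \<epsilon> = t + 5 * real j * \<epsilon>" for i j :: nat and s t :: real
    proof -
      have "1 \<le> \<bar>real j - real i\<bar>" using that(1) by linarith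
      then have "5 * \<epsilon> * 1 \<le> (5 * \<epsilon>) * \<bar>real j - real i\<bar>" using \<epsilon> by (intro mult_left_mono) auto
      also have "\<dots> = \<bar>s - t\<bar>"
      proof -
        have "s - t = (5 * \<epsilon>) * (real j - real i)" using that(4) by (simp add: algebra_simps)
        then show ?thesis using \<epsilon> by (simp add: abs_mult)
      qed
      finally show False using that(2,3) \<epsilon> by linarith
    qed
    have "card ({..<m} \<times> {..<m}) * measure lborel ?A \<le> measure lborel ?B"
    proof (rule packing_bound[where w="?w"])
      have "closed {y. \<bar>a1 \<bullet> y - b1\<bar> \<le> 2 * \<epsilon> \<and> \<bar>a2 \<bullet> y - b2\<bar> \<le> 2 * \<epsilon>}"
        by (intro closed_Collect_conj closed_Collect_le continuous_intros)
      then show "?A \<in> sets borel" by (intro borel_closed closed_Int) auto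
      fix k :: "nat \<times> nat" and x assume k: "k \<in> {..<m} \<times> {..<m}" and x: "x \<in> ?A"
      obtain i j where ij: "k = (i, j)" "i < m" "j < m" using k by auto
      have "norm (x + ((5 * real i * \<epsilon>) *\<^sub>R c1 + (5 * real j * \<epsilon>) *\<^sub>R c2)) \<le> norm x + (norm ((5 * real i * \<epsilon>) *\<^sub>R c1) + norm ((5 * real j * \<epsilon>) *\<^sub>R c2))"
        using norm_triangle_ineq[of x "(5 * real i * \<epsilon>) *\<^sub>R c1 + (5 * real j * \<epsilon>) *\<^sub>R c2"] norm_triangle_ineq[of "(5 * real i * \<epsilon>) *\<^sub>R c1" "(5 * real j * \<epsilon>) *\<^sub>R c2"] by linarith
      then show "x + ?w k \<in> ?B" using x small[OF ij(2), of c1] small[OF ij(3), of c2] by (simp add: ij(1))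
    next
      fix k l :: "nat \<times> nat" and x y assume kl: "k \<noteq> l" and xy: "x \<in> ?A" "y \<in> ?A"
      obtain i j i' j' where ij: "k = (i, j)" "l = (i', j')" by (cases k, cases l) auto
      show "x + ?w k \<noteq> y + ?w l"
      proof
        assume eq: "x + ?w k = y + ?w l"
        have "a1 \<bullet> (x + ?w k) = a1 \<bullet> (y + ?w l)" "a2 \<bullet> (x + ?w k) = a2 \<bullet> (y + ?w l)"
          unfolding eq by auto
        then have e: "(a1 \<bullet> x - b1) + 5 * real i * \<epsilon> = (a1 \<bullet> y - b1) + 5 * real i' * \<epsilon>"
          "(a2 \<bullet> x - b2) + 5 * real j * \<epsilon> = (a2 \<bullet> y - b2) + 5 * real j' * \<epsilon>"
          by (auto simp: ij inner_add_right c1 c2)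
        have b: "\<bar>a1 \<bullet> x - b1\<bar> \<le> 2 * \<epsilon>" "\<bar>a1 \<bullet> y - b1\<bar> \<le> 2 * \<epsilon>" "\<bar>a2 \<bullet> x - b2\<bar> \<le> 2 * \<epsilon>" "\<bar>a2 \<bullet> y - b2\<bar> \<le> 2 * \<epsilon>"
          using xy by auto
        have "i \<noteq> i' \<or> j \<noteq> j'" using kl ij by auto
        then show False using far[OF _ b(1,2) e(1)] far[OF _ b(3,4) e(2)] by blast
      qed
    qed auto
    then have *: "real m * real m * measure lborel ?A \<le> measure lborel ?B" by simp
    have "1 / \<epsilon> * (1 / \<epsilon>) * measure lborel ?A \<le> (2 * real m) * (2 * real m) * measure lborel ?A"
      using m(2) \<epsilon> by (intro mult_right_mono mult_mono) auto
    also have "\<dots> \<le> 4 * measure lborel ?B" using * by simp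
    finally show "measure lborel ?A \<le> 4 * measure lborel ?B * \<epsilon>\<^sup>2"
      using \<epsilon> by (simp add: field_simps power2_eq_square)
  qed
qed

lemma AE_fst:
  assumes "AE x in lborel. P x"
  shows "AE p in (lborel :: ('a::euclidean_space \<times> 'c::euclidean_space) measure). P (fst p)"
proof -
  obtain N where N: "N \<in> null_sets lborel" "{s \<in> space lborel. \<not> P s} \<subseteq> N"
    using assms unfolding eventually_ae_filter by auto
  have "N \<in> sets borel" using N by auto
  have "emeasure (lborel \<Otimes>\<^sub>M lborel) (N \<times> (UNIV :: 'c set)) = 0"
    using N by (subst lborel.emeasure_pair_measure_Times) (auto simp: null_sets_def)
  then have "N \<times> (UNIV :: 'c set) \<in> null_sets lborel"
    using \<open>N \<in> sets borel\<close> unfolding null_sets_def lborel_prod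
    by (auto intro!: borel_Times)
  then show ?thesis
    by (rule AE_I') (use N(2) in auto)
qed

lemma AE_not_on_hyperplane:
  fixes a :: "'a::euclidean_space"
  assumes "a \<noteq> 0"
  shows "AE x in lborel. a \<bullet> x \<noteq> b"
proof -
  have "{x. a \<bullet> x = b} \<in> null_sets lebesgue"
    using negligible_hyperplane[of a b] assms by (simp add: negligible_iff_null_sets)
  moreover have "{x. a \<bullet> x = b} \<in> sets lborel"
    by (simp add: borel_closed closed_hyperplane)
  ultimately have "{x. a \<bullet> x = b} \<in> null_sets lborel"
    using null_sets_completion_iff by blast
  from AE_not_in[OF this] show ?thesis by eventually_elim simp
qed

text \<open>A majorant depending on time alone makes the integral factorise, so that the measure of
  a thin set in space appears explicitly, ready to cancel the 1/\<epsilon> of a cutoff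
  gradient.\<close>

lemma integral_Times_bound:
  fixes S :: "'a::euclidean_space set"
  assumes f: "integrable lborel f" and f0: "\<And>x t. f (x, t) \<noteq> 0 \<Longrightarrow> x \<in> S"
    and S: "S \<in> sets borel" "emeasure lborel S < \<infinity>" and h: "integrable lborel h"
    and le: "AE p in lborel. \<bar>f p\<bar> \<le> h (snd p)" and h0: "\<And>t. 0 \<le> h t"
  shows "(LINT p|lborel. \<bar>f p\<bar>) \<le> measure lborel S * (LINT t|lborel. h t)"
proof -
  have [measurable]: "h \<in> borel_measurable borel" "S \<in> sets borel" using h S by auto
  have iS: "integrable lborel (indicator S :: 'a \<Rightarrow> real)" using S by (simp add: integrable_indicator_iff)
  let ?g = "\<lambda>(x, t). indicator S x * h t"
  have meas: "?g \<in> borel_measurable (lborel \<Otimes>\<^sub>M lborel)" by measurable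
  have inner: "(LINT t|lborel. norm (case (x, t) of (x, t) \<Rightarrow> indicator S x * h t)) = indicator S x * (LINT t|lborel. h t)" for x
    using h0 by (simp add: abs_mult)
  have ig: "integrable (lborel \<Otimes>\<^sub>M lborel) ?g"
  proof (rule lborel_pair.Fubini_integrable[OF meas])
    show "integrable lborel (\<lambda>x. LINT t|lborel. norm (case (x, t) of (x, t) \<Rightarrow> indicator S x * h t))"
      unfolding inner by (rule integrable_mult_left[OF iS])
  qed (use h in auto)
  have "(LINT p|lborel. \<bar>f p\<bar>) \<le> (LINT p|lborel. ?g p)"
  proof (rule integral_mono_AE)
    show "integrable lborel ?g" using ig by (simp only: lborel_prod)
    show "AE p in lborel. \<bar>f p\<bar> \<le> ?g p"
      using le
    proof eventually_elim
      case (elim p)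
      then show ?case using f0[of "fst p" "snd p"] h0[of "snd p"]
        by (cases "fst p \<in> S") (auto simp: case_prod_unfold)
    qed
  qed (use f in auto)
  also have "\<dots> = (LINT x|lborel. LINT t|lborel. ?g (x, t))"
    using lborel_pair.integral_fst'[OF ig] by (simp only: lborel_prod)
  also have "\<dots> = measure lborel S * (LINT t|lborel. h t)"
    using S by simp
  finally show ?thesis .
qed

text \<open>\<open>C\<close> records that \<Omega> is the interior of a closed set, which rules out
  slits; the finite set \<open>J\<close> lists hyperplanes covering the boundary. The flux condition
  is the trace condition restated for a field known almost everywhere: the normal component is
  essentially small near each flat boundary point.\<close>

locale polyhedral_transport = renormalised +
  fixes C :: "'a set" and J :: "('a \<times> real) set"
  assumes C: "closed C" "\<Omega> = interior C"
    and J: "finite J" "\<And>a b. (a, b) \<in> J \<Longrightarrow> a \<noteq> 0" "frontier \<Omega> \<subseteq> (\<Union>(a, b)\<in>J. {x. a \<bullet> x = b})"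
    and flux: "\<And>x n t \<delta>. x \<in> frontier \<Omega> \<Longrightarrow> outer_normal \<Omega> x n \<Longrightarrow> 0 < t \<Longrightarrow> t < T \<Longrightarrow> \<delta> > 0 \<Longrightarrow>
      \<exists>N. open N \<and> (x, t) \<in> N \<and> (AE q in lborel. q \<in> N \<and> q \<in> Q \<longrightarrow> \<bar>v q \<bullet> n\<bar> < \<delta>)"
begin

text \<open>For \<beta>(s) = s^2 this is 2 u g - d u^2.\<close>

definition source where "source p = \<beta>' (u p) * g p + d p * \<beta> (u p) - d p * (\<beta>' (u p) * u p)"

lemma source_integrable: "integrable lborel source"
proof -
  have "integrable lborel (\<lambda>p. \<beta>' (u p) * g p)"
    by (rule integrable_bounded_mult[OF g _ \<beta>'_bound]) simp
  moreover have "integrable lborel (\<lambda>p. \<beta> (u p) * d p)"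
    by (rule integrable_bounded_mult[OF d_integrable _ \<beta>_bound]) simp
  moreover have "integrable lborel (\<lambda>p. (d p * \<beta>' (u p)) * u p)"
    by (rule integrable_bounded_mult[OF u, where C="M * B"])
      (auto simp: abs_mult intro!: mult_mono d_bound \<beta>'_bound M_nonneg)
  ultimately show ?thesis
    unfolding source_def[abs_def] by (simp add: mult.commute mult.left_commute)
qed

lemma [measurable]: "source \<in> borel_measurable borel" "Q \<in> sets borel" "\<Omega> \<in> sets borel"
  using source_integrable open_Q open_Omega by auto

lemma balance_alt: "balance \<zeta> X = (LINT p|lborel. indicator Q p * (\<zeta> (fst p) * \<beta> (u p))) - T * (LINT x|lborel. indicator \<Omega> x * (\<zeta> x * \<beta> (u0 x)))
    - (LINT p|lborel. indicator Q p * ((T - snd p) * (\<zeta> (fst p) * source p)))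
    - (LINT p|lborel. indicator Q p * ((T - snd p) * (\<beta> (u p) * (v p \<bullet> X (fst p)))))"
  by (simp add: balance_def source_def)

lemma integrable_indicator_Omega: "integrable lborel (indicator \<Omega> :: 'a \<Rightarrow> real)"
  using emeasure_bounded_finite[OF bounded_Omega] open_Omega by (simp add: integrable_indicator_iff)

lemma balance_integrable:
  assumes [measurable]: "\<zeta> \<in> borel_measurable borel" "X \<in> borel_measurable borel"
    and \<zeta>: "\<And>x. x \<in> \<Omega> \<Longrightarrow> \<bar>\<zeta> x\<bar> \<le> K" "\<And>x. x \<in> \<Omega> \<Longrightarrow> norm (X x) \<le> K" and K: "0 \<le> K"
  shows "integrable lborel (\<lambda>p. indicator Q p * (\<zeta> (fst p) * \<beta> (u p)))"
    "integrable lborel (\<lambda>x. indicator \<Omega> x * (\<zeta> x * \<beta> (u0 x)))"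
    "integrable lborel (\<lambda>p. indicator Q p * ((T - snd p) * (\<zeta> (fst p) * source p)))"
    "integrable lborel (\<lambda>p. indicator Q p * ((T - snd p) * (\<beta> (u p) * (v p \<bullet> X (fst p)))))"
proof -
  have KB: "0 \<le> K * B" "0 \<le> T * K" "0 \<le> T * (B * (M * K))" using K B_nonneg M_nonneg T by (auto intro!: mult_nonneg_nonneg)
  show "integrable lborel (\<lambda>p. indicator Q p * (\<zeta> (fst p) * \<beta> (u p)))"
  proof (rule integrable_bounded_Q[where C="K * B"])
    show "\<bar>indicator Q p * (\<zeta> (fst p) * \<beta> (u p))\<bar> \<le> K * B" for p
      using \<zeta>(1)[of "fst p"] \<beta>_bound[of "u p"] KB
      by (auto simp: abs_mult intro!: mult_mono K split: split_indicator)
  qed auto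
  show "integrable lborel (\<lambda>x. indicator \<Omega> x * (\<zeta> x * \<beta> (u0 x)))"
  proof (rule Bochner_Integration.integrable_bound[OF integrable_mult_right[OF integrable_indicator_Omega, of "K * B"]])
    show "AE x in lborel. norm (indicator \<Omega> x * (\<zeta> x * \<beta> (u0 x))) \<le> norm (K * B * indicator \<Omega> x)"
      using \<zeta>(1) \<beta>_bound KB K B_nonneg by (intro AE_I2) (auto simp: abs_mult intro!: mult_mono split: split_indicator)
  qed measurable
  have "integrable lborel (\<lambda>p. (indicator Q p * ((T - snd p) * \<zeta> (fst p))) * source p)"
  proof (rule integrable_bounded_mult[OF source_integrable, where C="T * K"])
    show "\<bar>indicator Q p * ((T - snd p) * \<zeta> (fst p))\<bar> \<le> T * K" for p
      using \<zeta>(1)[of "fst p"] KB T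
      by (cases "p \<in> Q") (auto simp: abs_mult intro!: mult_mono K)
  qed measurable
  then show "integrable lborel (\<lambda>p. indicator Q p * ((T - snd p) * (\<zeta> (fst p) * source p)))"
    by (simp add: mult.assoc)
  show "integrable lborel (\<lambda>p. indicator Q p * ((T - snd p) * (\<beta> (u p) * (v p \<bullet> X (fst p)))))"
  proof (rule integrable_bounded_Q[where C="T * (B * (M * K))"])
    fix p
    show "\<bar>indicator Q p * ((T - snd p) * (\<beta> (u p) * (v p \<bullet> X (fst p))))\<bar> \<le> T * (B * (M * K))"
    proof (cases "p \<in> Q")
      case True
      have "\<bar>v p \<bullet> X (fst p)\<bar> \<le> M * K"
        using True by (intro order_trans[OF Cauchy_Schwarz_ineq2] mult_mono v_bound \<zeta>(2) M_nonneg norm_ge_zero) auto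
      then have "\<bar>T - snd p\<bar> * (\<bar>\<beta> (u p)\<bar> * \<bar>v p \<bullet> X (fst p)\<bar>) \<le> T * (B * (M * K))"
        using True T by (intro mult_mono \<beta>_bound B_nonneg mult_nonneg_nonneg) auto
      then show ?thesis using True by (simp add: abs_mult)
    qed (use KB in simp)
  qed auto
qed

lemma C1_fun_measurable:
  assumes "C1_fun \<zeta> X" shows "\<zeta> \<in> borel_measurable borel" "X \<in> borel_measurable borel"
  using C1_fun_continuous[OF assms] by (auto intro: borel_measurable_continuous_onI)

lemma balance_C1_integrable:
  assumes "C1_fun \<zeta> X"
  shows "integrable lborel (\<lambda>p. indicator Q p * (\<zeta> (fst p) * \<beta> (u p)))"
    "integrable lborel (\<lambda>x. indicator \<Omega> x * (\<zeta> x * \<beta> (u0 x)))"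
    "integrable lborel (\<lambda>p. indicator Q p * ((T - snd p) * (\<zeta> (fst p) * source p)))"
    "integrable lborel (\<lambda>p. indicator Q p * ((T - snd p) * (\<beta> (u p) * (v p \<bullet> X (fst p)))))"
  using C1_fun_bounded[OF assms bounded_Omega] balance_integrable[OF C1_fun_measurable[OF assms]] by metis+

lemma balance_add:
  assumes "C1_fun \<zeta> X" "C1_fun \<eta> Y"
  shows "balance (\<lambda>x. \<zeta> x + \<eta> x) (\<lambda>x. X x + Y x) = balance \<zeta> X + balance \<eta> Y"
proof -
  note i = balance_C1_integrable[OF assms(1)] and j = balance_C1_integrable[OF assms(2)]
  have "balance (\<lambda>x. \<zeta> x + \<eta> x) (\<lambda>x. X x + Y x) =
     (LINT p|lborel. indicator Q p * (\<zeta> (fst p) * \<beta> (u p)) + indicator Q p * (\<eta> (fst p) * \<beta> (u p)))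
     - T * (LINT x|lborel. indicator \<Omega> x * (\<zeta> x * \<beta> (u0 x)) + indicator \<Omega> x * (\<eta> x * \<beta> (u0 x)))
    - (LINT p|lborel. indicator Q p * ((T - snd p) * (\<zeta> (fst p) * source p)) + indicator Q p * ((T - snd p) * (\<eta> (fst p) * source p)))
    - (LINT p|lborel. indicator Q p * ((T - snd p) * (\<beta> (u p) * (v p \<bullet> X (fst p)))) + indicator Q p * ((T - snd p) * (\<beta> (u p) * (v p \<bullet> Y (fst p)))))"
    unfolding balance_alt by (simp add: distrib_left distrib_right inner_add_right)
  also have "\<dots> = balance \<zeta> X + balance \<eta> Y"
    using i j by (simp add: balance_alt distrib_left)
  finally show ?thesis .
qed

lemma balance_zero_on:
  assumes "C1_fun \<zeta> X" "\<And>x. x \<in> \<Omega> \<Longrightarrow> \<zeta> x = 0"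
  shows "balance \<zeta> X = 0"
proof -
  have "X x = 0" if "x \<in> \<Omega>" for x
    using C1_fun_zero_open[OF assms(1) open_Omega assms(2) that] .
  then have z: "indicator Q p * (\<zeta> (fst p) * \<beta> (u p)) = 0" "indicator \<Omega> x * (\<zeta> x * \<beta> (u0 x)) = 0"
    "indicator Q p * ((T - snd p) * (\<zeta> (fst p) * source p)) = 0"
    "indicator Q p * ((T - snd p) * (\<beta> (u p) * (v p \<bullet> X (fst p)))) = 0" for p x
    using assms(2) by (auto split: split_indicator)
  show ?thesis unfolding balance_alt z by simp
qed

text \<open>When the gradient of the product of \<zeta> and the cutoff is split, dominated
  convergence handles all terms except the one with the gradient of the cutoff. \<open>err\<close>
  disposes of that one, since \<beta>(u) and T - t are bounded. The alternative in
  \<open>lim\<close> lets the cutoffs misbehave where \<zeta> and its gradient vanish.\<close>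

lemma balance_cutoff:
  assumes \<zeta>: "C1_fun \<zeta> X" and s: "\<And>n. C1_fun (s n) (S n)" "\<And>n x. 0 \<le> s n x" "\<And>n x. s n x \<le> 1"
    and lim: "AE x in lborel. x \<in> \<Omega> \<longrightarrow> (\<lambda>n. s n x) \<longlonglongrightarrow> 1 \<or> (\<zeta> x = 0 \<and> X x = 0)"
    and err: "(\<lambda>n. LINT p|lborel. \<bar>indicator Q p * (\<zeta> (fst p) * (v p \<bullet> S n (fst p)))\<bar>) \<longlonglongrightarrow> 0"
    and zero: "\<And>n. balance (\<lambda>x. \<zeta> x * s n x) (\<lambda>x. \<zeta> x *\<^sub>R S n x + s n x *\<^sub>R X x) = 0"
  shows "balance \<zeta> X = 0"
proof -
  note [measurable] = C1_fun_measurable[OF \<zeta>] C1_fun_measurable[OF s(1)]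
  obtain K where K: "K \<ge> 0" "\<And>x. x \<in> \<Omega> \<Longrightarrow> \<bar>\<zeta> x\<bar> \<le> K" "\<And>x. x \<in> \<Omega> \<Longrightarrow> norm (X x) \<le> K"
    using C1_fun_bounded[OF \<zeta> bounded_Omega] by metis
  have lim0: "AE x in lborel. x \<in> \<Omega> \<longrightarrow> (\<lambda>n. \<zeta> x * s n x) \<longlonglongrightarrow> \<zeta> x"
    using lim
  proof eventually_elim
    case (elim x)
    then show ?case using tendsto_mult_left[of "\<lambda>n. s n x" 1 sequentially "\<zeta> x"] by auto
  qed
  have lim': "AE p in lborel. p \<in> Q \<longrightarrow> (\<lambda>n. \<zeta> (fst p) * s n (fst p)) \<longlonglongrightarrow> \<zeta> (fst p)"
    using AE_fst[OF lim0] by eventually_elim auto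
  have bnd: "\<bar>\<zeta> x * s n x\<bar> \<le> \<bar>\<zeta> x\<bar>" for x n
    using s(2,3)[of n x] by (simp add: abs_mult mult_left_le)
  note i = balance_C1_integrable[OF \<zeta>]
  have t1: "(\<lambda>n. LINT p|lborel. indicator Q p * ((\<zeta> (fst p) * s n (fst p)) * \<beta> (u p))) \<longlonglongrightarrow> (LINT p|lborel. indicator Q p * (\<zeta> (fst p) * \<beta> (u p)))"
  proof (rule integral_dominated_convergence[where w="\<lambda>p. \<bar>indicator Q p * (\<zeta> (fst p) * \<beta> (u p))\<bar>"])
    show "AE p in lborel. (\<lambda>n. indicator Q p * ((\<zeta> (fst p) * s n (fst p)) * \<beta> (u p))) \<longlonglongrightarrow> indicator Q p * (\<zeta> (fst p) * \<beta> (u p))"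
      using lim' by eventually_elim (auto intro!: tendsto_intros split: split_indicator)
    show "AE p in lborel. norm (indicator Q p * ((\<zeta> (fst p) * s n (fst p)) * \<beta> (u p))) \<le> \<bar>indicator Q p * (\<zeta> (fst p) * \<beta> (u p))\<bar>" for n
      using bnd by (intro AE_I2) (auto simp: abs_mult intro!: mult_right_mono split: split_indicator)
  qed (use integrable_abs[OF i(1)] in auto)
  have t2: "(\<lambda>n. LINT x|lborel. indicator \<Omega> x * ((\<zeta> x * s n x) * \<beta> (u0 x))) \<longlonglongrightarrow> (LINT x|lborel. indicator \<Omega> x * (\<zeta> x * \<beta> (u0 x)))"
  proof (rule integral_dominated_convergence[where w="\<lambda>x. \<bar>indicator \<Omega> x * (\<zeta> x * \<beta> (u0 x))\<bar>"])
    show "AE x in lborel. (\<lambda>n. indicator \<Omega> x * ((\<zeta> x * s n x) * \<beta> (u0 x))) \<longlonglongrightarrow> indicator \<Omega> x * (\<zeta> x * \<beta> (u0 x))"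
      using lim0 by eventually_elim (auto intro!: tendsto_intros split: split_indicator)
    show "AE x in lborel. norm (indicator \<Omega> x * ((\<zeta> x * s n x) * \<beta> (u0 x))) \<le> \<bar>indicator \<Omega> x * (\<zeta> x * \<beta> (u0 x))\<bar>" for n
      using bnd by (intro AE_I2) (auto simp: abs_mult intro!: mult_right_mono split: split_indicator)
  qed (use integrable_abs[OF i(2)] in auto)
  have t3: "(\<lambda>n. LINT p|lborel. indicator Q p * ((T - snd p) * ((\<zeta> (fst p) * s n (fst p)) * source p))) \<longlonglongrightarrow> (LINT p|lborel. indicator Q p * ((T - snd p) * (\<zeta> (fst p) * source p)))"
  proof (rule integral_dominated_convergence[where w="\<lambda>p. \<bar>indicator Q p * ((T - snd p) * (\<zeta> (fst p) * source p))\<bar>"])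
    show "AE p in lborel. (\<lambda>n. indicator Q p * ((T - snd p) * ((\<zeta> (fst p) * s n (fst p)) * source p))) \<longlonglongrightarrow> indicator Q p * ((T - snd p) * (\<zeta> (fst p) * source p))"
      using lim' by eventually_elim (auto intro!: tendsto_intros split: split_indicator)
    show "AE p in lborel. norm (indicator Q p * ((T - snd p) * ((\<zeta> (fst p) * s n (fst p)) * source p))) \<le> \<bar>indicator Q p * ((T - snd p) * (\<zeta> (fst p) * source p))\<bar>" for n
    proof (rule AE_I2)
      fix p
      have "\<bar>indicator Q p * (T - snd p) * source p\<bar> * \<bar>\<zeta> (fst p) * s n (fst p)\<bar> \<le> \<bar>indicator Q p * (T - snd p) * source p\<bar> * \<bar>\<zeta> (fst p)\<bar>"
        by (intro mult_left_mono bnd) auto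
      then show "norm (indicator Q p * ((T - snd p) * ((\<zeta> (fst p) * s n (fst p)) * source p))) \<le> \<bar>indicator Q p * ((T - snd p) * (\<zeta> (fst p) * source p))\<bar>"
        unfolding real_norm_def abs_mult by (simp only: mult_ac)
    qed
  qed (use integrable_abs[OF i(3)] in auto)
  let ?F = "\<lambda>n p. indicator Q p * ((T - snd p) * (\<beta> (u p) * (s n (fst p) * (v p \<bullet> X (fst p)))))"
  let ?E = "\<lambda>n p. indicator Q p * ((T - snd p) * (\<beta> (u p) * (\<zeta> (fst p) * (v p \<bullet> S n (fst p)))))"
  have iE0: "integrable lborel (\<lambda>p. indicator Q p * (\<zeta> (fst p) * (v p \<bullet> S n (fst p))))" for n
  proof -
    obtain K' where K': "K' \<ge> 0" "\<And>x. x \<in> \<Omega> \<Longrightarrow> norm (S n x) \<le> K'"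
      using C1_fun_bounded[OF s(1)[of n] bounded_Omega] by metis
    show ?thesis
    proof (rule integrable_bounded_Q[where C="K * (M * K')"])
      fix p
      show "\<bar>indicator Q p * (\<zeta> (fst p) * (v p \<bullet> S n (fst p)))\<bar> \<le> K * (M * K')"
      proof (cases "p \<in> Q")
        case True
        have "\<bar>v p \<bullet> S n (fst p)\<bar> \<le> M * K'"
          using True by (intro order_trans[OF Cauchy_Schwarz_ineq2] mult_mono v_bound K'(2) M_nonneg norm_ge_zero) auto
        then show ?thesis using True K by (auto simp: abs_mult intro!: mult_mono)
      qed (use K K' M_nonneg in \<open>auto intro!: mult_nonneg_nonneg\<close>)
    qed auto
  qed
  have wb: "\<bar>indicator Q p * ((T - snd p) * \<beta> (u p))\<bar> \<le> T * B" for p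
    using \<beta>_bound[of "u p"] T B_nonneg by (cases "p \<in> Q") (auto simp: abs_mult intro!: mult_mono)
  have Eeq: "?E n p = (indicator Q p * ((T - snd p) * \<beta> (u p))) * (indicator Q p * (\<zeta> (fst p) * (v p \<bullet> S n (fst p))))" for n p
    by (auto split: split_indicator)
  have iE: "integrable lborel (?E n)" for n
    unfolding Eeq by (rule integrable_bounded_mult[OF iE0 _ wb]) measurable
  have tE: "(\<lambda>n. LINT p|lborel. ?E n p) \<longlonglongrightarrow> 0"
    unfolding Eeq by (rule integral_bounded_mult_tendsto_0[OF iE0 _ wb err]) measurable
  have tF: "(\<lambda>n. LINT p|lborel. ?F n p) \<longlonglongrightarrow> (LINT p|lborel. indicator Q p * ((T - snd p) * (\<beta> (u p) * (v p \<bullet> X (fst p)))))"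
  proof (rule integral_dominated_convergence[where w="\<lambda>p. \<bar>indicator Q p * ((T - snd p) * (\<beta> (u p) * (v p \<bullet> X (fst p))))\<bar>"])
    show "AE p in lborel. (\<lambda>n. ?F n p) \<longlonglongrightarrow> indicator Q p * ((T - snd p) * (\<beta> (u p) * (v p \<bullet> X (fst p))))"
      using AE_fst[OF lim]
    proof eventually_elim
      case (elim p)
      have "(\<lambda>n. s n (fst p) * (v p \<bullet> X (fst p))) \<longlonglongrightarrow> v p \<bullet> X (fst p)" if "p \<in> Q"
      proof -
        have "(\<lambda>n. s n (fst p)) \<longlonglongrightarrow> 1 \<or> X (fst p) = 0" using elim that by auto
        then show ?thesis using tendsto_mult_right[of "\<lambda>n. s n (fst p)" 1 sequentially "v p \<bullet> X (fst p)"] by auto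
      qed
      then show ?case by (cases "p \<in> Q") (auto intro!: tendsto_intros)
    qed
    show "AE p in lborel. norm (?F n p) \<le> \<bar>indicator Q p * ((T - snd p) * (\<beta> (u p) * (v p \<bullet> X (fst p))))\<bar>" for n
    proof (rule AE_I2)
      fix p
      have "\<bar>indicator Q p * ((T - snd p) * (\<beta> (u p) * (v p \<bullet> X (fst p))))\<bar> * s n (fst p) \<le> \<bar>indicator Q p * ((T - snd p) * (\<beta> (u p) * (v p \<bullet> X (fst p))))\<bar>"
        using s(2,3) by (intro mult_left_le) auto
      then show "norm (?F n p) \<le> \<bar>indicator Q p * ((T - snd p) * (\<beta> (u p) * (v p \<bullet> X (fst p))))\<bar>"
        using s(2)[of n "fst p"] by (simp add: abs_mult mult_ac)
    qed
  qed (use integrable_abs[OF i(4)] in auto)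
  have iF: "integrable lborel (?F n)" for n
  proof (rule Bochner_Integration.integrable_bound[OF i(4)])
    show "AE p in lborel. norm (?F n p) \<le> norm (indicator Q p * ((T - snd p) * (\<beta> (u p) * (v p \<bullet> X (fst p)))))"
    proof (rule AE_I2)
      fix p
      have "\<bar>indicator Q p * ((T - snd p) * (\<beta> (u p) * (v p \<bullet> X (fst p))))\<bar> * s n (fst p) \<le> \<bar>indicator Q p * ((T - snd p) * (\<beta> (u p) * (v p \<bullet> X (fst p))))\<bar>"
        using s(2,3) by (intro mult_left_le) auto
      then show "norm (?F n p) \<le> norm (indicator Q p * ((T - snd p) * (\<beta> (u p) * (v p \<bullet> X (fst p)))))"
        using s(2)[of n "fst p"] by (simp add: abs_mult mult_ac)
    qed
  qed measurable
  have "(LINT p|lborel. indicator Q p * ((\<zeta> (fst p) * s n (fst p)) * \<beta> (u p))) - T * (LINT x|lborel. indicator \<Omega> x * ((\<zeta> x * s n x) * \<beta> (u0 x)))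
    - (LINT p|lborel. indicator Q p * ((T - snd p) * ((\<zeta> (fst p) * s n (fst p)) * source p))) - ((LINT p|lborel. ?E n p) + (LINT p|lborel. ?F n p)) = 0" for n
  proof -
    have "(LINT p|lborel. ?E n p) + (LINT p|lborel. ?F n p) = (LINT p|lborel. ?E n p + ?F n p)"
      by (rule Bochner_Integration.integral_add[symmetric, OF iE iF])
    also have "\<dots> = (LINT p|lborel. indicator Q p * ((T - snd p) * (\<beta> (u p) * (v p \<bullet> (\<zeta> (fst p) *\<^sub>R S n (fst p) + s n (fst p) *\<^sub>R X (fst p))))))"
      by (intro Bochner_Integration.integral_cong) (auto simp: inner_add_right algebra_simps)
    finally show ?thesis using zero[of n] unfolding balance_alt by simp
  qed
  then have "(\<lambda>n. 0) \<longlonglongrightarrow> (LINT p|lborel. indicator Q p * (\<zeta> (fst p) * \<beta> (u p))) - T * (LINT x|lborel. indicator \<Omega> x * (\<zeta> x * \<beta> (u0 x)))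
    - (LINT p|lborel. indicator Q p * ((T - snd p) * (\<zeta> (fst p) * source p)))
    - (0 + (LINT p|lborel. indicator Q p * ((T - snd p) * (\<beta> (u p) * (v p \<bullet> X (fst p))))))"
    by (rule_tac Lim_transform_eventually[OF tendsto_diff[OF tendsto_diff[OF tendsto_diff[OF t1 tendsto_mult[OF tendsto_const t2]] t3] tendsto_add[OF tE tF]]])
      (simp add: always_eventually)
  then have "0 = (LINT p|lborel. indicator Q p * (\<zeta> (fst p) * \<beta> (u p))) - T * (LINT x|lborel. indicator \<Omega> x * (\<zeta> x * \<beta> (u0 x)))
    - (LINT p|lborel. indicator Q p * ((T - snd p) * (\<zeta> (fst p) * source p)))
    - (0 + (LINT p|lborel. indicator Q p * ((T - snd p) * (\<beta> (u p) * (v p \<bullet> X (fst p))))))"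
    by (rule LIMSEQ_unique[OF tendsto_const])
  then show ?thesis by (simp add: balance_alt)
qed

end

text \<open>On the compact set \<open>P - N\<close> the function |h| has a positive minimum, which
  serves as \<open>m\<close>; if that set is empty, any positive \<open>m\<close> works.\<close>

lemma compact_eventually_in_open:
  fixes P :: "'b::euclidean_space set" and h :: "'b \<Rightarrow> real"
  assumes "compact P" "open N" "continuous_on P h" "\<And>p. p \<in> P \<Longrightarrow> h p = 0 \<Longrightarrow> p \<in> N"
  obtains m where "m > 0" "\<And>p. p \<in> P \<Longrightarrow> \<bar>h p\<bar> < m \<Longrightarrow> p \<in> N"
proof (cases "P - N = {}")
  case True
  then show ?thesis by (intro that[of 1]) auto
next
  case False
  have "compact (P - N)" using assms by (intro compact_diff)
  moreover have "continuous_on (P - N) (\<lambda>p. \<bar>h p\<bar>)"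
    by (intro continuous_intros continuous_on_subset[OF assms(3)]) auto
  ultimately obtain q where q: "q \<in> P - N" "\<And>p. p \<in> P - N \<Longrightarrow> \<bar>h q\<bar> \<le> \<bar>h p\<bar>"
    using continuous_attains_inf[OF _ False] by blast
  then have "h q \<noteq> 0" using assms(4) by blast
  then show ?thesis using q(2) by (intro that[of "\<bar>h q\<bar>"]) (auto simp: not_le[symmetric])
qed

context polyhedral_transport
begin

text \<open>The trace condition gives a neighbourhood for each point of the face and each time. The
  part of the face in the closed ball of radius r' < r, with times in [\<tau>, T - \<tau>], is
  compact, so finitely many neighbourhoods cover it, and with it a layer of some thickness
  \<open>m\<close>. Traces are available strictly between 0 and T only, hence \<tau>.\<close>

lemma flux_uniform:
  assumes n: "norm n = 1" and r: "r' < r" and half: "\<Omega> \<inter> ball x0 r = {y \<in> ball x0 r. (y - x0) \<bullet> n < 0}"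
    and \<tau>: "\<tau> > 0" and \<eta>: "\<eta> > 0"
  obtains m where "m > 0" "AE q in lborel. q \<in> Q \<and> fst q \<in> cball x0 r' \<and> \<bar>(x0 - fst q) \<bullet> n\<bar> < m \<and> \<tau> \<le> snd q \<and> snd q \<le> T - \<tau> \<longrightarrow> \<bar>v q \<bullet> n\<bar> < \<eta>"
proof -
  let ?P = "cball x0 r' \<times> {\<tau>..T - \<tau>}"
  let ?Z = "?P \<inter> {p. (x0 - fst p) \<bullet> n = 0}"
  have P: "compact ?P" by (intro compact_Times) auto
  have Z: "compact ?Z"
    by (intro compact_Int_closed P closed_Collect_eq continuous_intros)
  have "\<exists>N. open N \<and> z \<in> N \<and> (AE q in lborel. q \<in> N \<and> q \<in> Q \<longrightarrow> \<bar>v q \<bullet> n\<bar> < \<eta>)" if z: "z \<in> ?Z" for z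
  proof -
    obtain y t where yt: "z = (y, t)" by (cases z)
    have y: "dist x0 y \<le> r'" "(y - x0) \<bullet> n = 0" and t: "0 < t" "t < T"
      using z \<tau> by (auto simp: yt inner_diff_left)
    \<comment> \<open>The distance left to the larger sphere: in the ball of radius \<rho> around y
      the domain is the same half-space, so \<open>n\<close> is the outer normal at y too.\<close>
    define \<rho> where "\<rho> = r - dist x0 y"
    have \<rho>: "\<rho> > 0" using y r by (simp add: \<rho>_def)
    have sub: "ball y \<rho> \<subseteq> ball x0 r"
    proof
      fix w assume "w \<in> ball y \<rho>"
      then show "w \<in> ball x0 r" using dist_triangle[of x0 w y] by (simp add: \<rho>_def)
    qed
    have eq: "(w - y) \<bullet> n = (w - x0) \<bullet> n" for w using y(2) by (simp add: inner_diff_left)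
    have loc: "\<Omega> \<inter> ball y \<rho> = {w \<in> ball y \<rho>. (w - y) \<bullet> n < 0}"
    proof (intro set_eqI iffI)
      fix w assume "w \<in> \<Omega> \<inter> ball y \<rho>"
      then have "w \<in> \<Omega> \<inter> ball x0 r" "w \<in> ball y \<rho>" using sub by auto
      then show "w \<in> {w \<in> ball y \<rho>. (w - y) \<bullet> n < 0}" unfolding half by (simp add: eq)
    next
      fix w assume w: "w \<in> {w \<in> ball y \<rho>. (w - y) \<bullet> n < 0}"
      then have "w \<in> {w \<in> ball x0 r. (w - x0) \<bullet> n < 0}" using sub by (auto simp: eq)
      then show "w \<in> \<Omega> \<inter> ball y \<rho>" using w unfolding half[symmetric] by auto
    qed
    then have on: "outer_normal \<Omega> y n" using n \<rho> by (auto simp: outer_normal_def)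
    have "y \<notin> \<Omega>"
    proof
      assume "y \<in> \<Omega>"
      then have "y \<in> {w \<in> ball y \<rho>. (w - y) \<bullet> n < 0}" using \<rho> unfolding loc[symmetric] by simp
      then show False by simp
    qed
    moreover have "y \<in> closure \<Omega>"
      unfolding closure_approachable
    proof (intro allI impI)
      fix e :: real assume e: "e > 0"
      define s where "s = min e \<rho> / 2"
      have s: "s > 0" "s < e" "s < \<rho>" using e \<rho> by (auto simp: s_def)
      have "y - s *\<^sub>R n \<in> {w \<in> ball y \<rho>. (w - y) \<bullet> n < 0}"
        using s n by (simp add: dist_norm dot_square_norm)
      then show "\<exists>w\<in>\<Omega>. dist w y < e"
        unfolding loc[symmetric] using s n by (intro bexI[of _ "y - s *\<^sub>R n"]) (auto simp: dist_norm)
    qed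
    ultimately have "y \<in> frontier \<Omega>" using open_Omega by (simp add: frontier_def interior_open)
    from flux[OF this on t \<eta>] show ?thesis unfolding yt .
  qed
  then have "\<forall>z\<in>?Z. \<exists>N. open N \<and> z \<in> N \<and> (AE q in lborel. q \<in> N \<and> q \<in> Q \<longrightarrow> \<bar>v q \<bullet> n\<bar> < \<eta>)" by blast
  from bchoice[OF this] obtain N where N0:
    "\<forall>z\<in>?Z. open (N z) \<and> z \<in> N z \<and> (AE q in lborel. q \<in> N z \<and> q \<in> Q \<longrightarrow> \<bar>v q \<bullet> n\<bar> < \<eta>)" ..
  have N: "open (N z)" "z \<in> N z" "AE q in lborel. q \<in> N z \<and> q \<in> Q \<longrightarrow> \<bar>v q \<bullet> n\<bar> < \<eta>" if "z \<in> ?Z" for z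
    by (rule bspec[OF N0 that, THEN conjunct1], rule bspec[OF N0 that, THEN conjunct2, THEN conjunct1],
      rule bspec[OF N0 that, THEN conjunct2, THEN conjunct2])
  have "?Z \<subseteq> (\<Union>z\<in>?Z. N z)" using N(2) by blast
  from compactE_image[OF Z N(1) this] obtain D where D: "D \<subseteq> ?Z" "finite D" "?Z \<subseteq> (\<Union>z\<in>D. N z)" by blast
  have AE: "AE q in lborel. \<forall>z\<in>D. q \<in> N z \<and> q \<in> Q \<longrightarrow> \<bar>v q \<bullet> n\<bar> < \<eta>"
  proof (rule AE_ball_countable[THEN iffD2])
    show "countable D" using D(2) by (rule countable_finite)
    show "\<forall>z\<in>D. AE q in lborel. q \<in> N z \<and> q \<in> Q \<longrightarrow> \<bar>v q \<bullet> n\<bar> < \<eta>"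
      using N(3) D(1) by (intro ballI) (rule N(3), rule subsetD)
  qed
  have "open (\<Union>z\<in>D. N z)" using D N(1) by blast
  moreover have "continuous_on ?P (\<lambda>p. (x0 - fst p) \<bullet> n)" by (intro continuous_intros)
  ultimately obtain m where m: "m > 0" "\<And>p. p \<in> ?P \<Longrightarrow> \<bar>(x0 - fst p) \<bullet> n\<bar> < m \<Longrightarrow> p \<in> (\<Union>z\<in>D. N z)"
    using compact_eventually_in_open[OF P, of "\<Union>z\<in>D. N z" "\<lambda>p. (x0 - fst p) \<bullet> n"] D(3) by blast
  show ?thesis
  proof (rule that[OF m(1)])
    show "AE q in lborel. q \<in> Q \<and> fst q \<in> cball x0 r' \<and> \<bar>(x0 - fst q) \<bullet> n\<bar> < m \<and> \<tau> \<le> snd q \<and> snd q \<le> T - \<tau> \<longrightarrow> \<bar>v q \<bullet> n\<bar> < \<eta>"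
      using AE
    proof eventually_elim
      case (elim q)
      show ?case
      proof
        assume q: "q \<in> Q \<and> fst q \<in> cball x0 r' \<and> \<bar>(x0 - fst q) \<bullet> n\<bar> < m \<and> \<tau> \<le> snd q \<and> snd q \<le> T - \<tau>"
        then have "q \<in> ?P" by (simp add: mem_Times_iff)
        then show "\<bar>v q \<bullet> n\<bar> < \<eta>" using m(2)[of q] q elim by blast
      qed
    qed
  qed
qed

text \<open>The strip carrying the cutoff gradient has measure O(\<epsilon>), the gradient is
  O(1/\<epsilon>) and parallel to \<open>n\<close>, so only the normal velocity enters. Near the
  face it is smaller than \<eta> except in two time layers of length \<tau>, where the bound
  \<open>M\<close> is used.\<close>

lemma balance_flat:
  assumes n: "norm n = 1" and r: "r' < r" and half: "\<Omega> \<inter> ball x0 r = {y \<in> ball x0 r. (y - x0) \<bullet> n < 0}"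
    and \<zeta>: "C1_fun \<zeta> X" and \<zeta>0: "\<And>y. y \<notin> cball x0 r' \<Longrightarrow> \<zeta> y = 0"
  shows "balance \<zeta> X = 0"
proof -
  note [measurable] = C1_fun_measurable[OF \<zeta>]
  obtain f f' L where f: "\<And>s. (f has_real_derivative f' s) (at s)" "continuous_on UNIV f'"
    "\<And>s. 0 \<le> f s" "\<And>s. f s \<le> 1" "\<And>s. s \<le> 1 \<Longrightarrow> f s = 0" "\<And>s. s \<ge> 2 \<Longrightarrow> f s = 1"
    "L \<ge> 0" "\<And>s. \<bar>f' s\<bar> \<le> L" "\<And>s. f' s \<noteq> 0 \<Longrightarrow> 1 \<le> s \<and> s \<le> 2"
    using C1_step by metis
  obtain K where K: "K \<ge> 0" "\<And>x. x \<in> \<Omega> \<Longrightarrow> \<bar>\<zeta> x\<bar> \<le> K" using C1_fun_bounded[OF \<zeta> bounded_Omega] by metis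
  obtain Cs where Cs: "Cs \<ge> 0" "\<And>\<epsilon>. 0 < \<epsilon> \<Longrightarrow> \<epsilon> \<le> 1 \<Longrightarrow>
    measure lborel ({y. \<epsilon> \<le> (x0 - y) \<bullet> n \<and> (x0 - y) \<bullet> n \<le> 2 * \<epsilon>} \<inter> cball x0 r') \<le> Cs * \<epsilon>"
    by (rule slab_measure[OF n, of x0 r']) (rule that)
  define \<epsilon> where "\<epsilon> k = 1 / real (Suc k)" for k
  have \<epsilon>: "0 < \<epsilon> k" "\<epsilon> k \<le> 1" for k by (auto simp: \<epsilon>_def)
  have \<epsilon>0: "\<epsilon> \<longlonglongrightarrow> 0" unfolding \<epsilon>_def[abs_def] by (intro LIMSEQ_Suc lim_1_over_n)
  \<comment> \<open>The distance to the face in units of \<epsilon>, written as an affine function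
    to suit \<open>C1_fun_affine\<close>; the fact \<open>l\<close> gives the readable form.\<close>
  define l where "l k y = (- (1 / \<epsilon> k) *\<^sub>R n) \<bullet> y - (- (x0 \<bullet> n) / \<epsilon> k)" for k y
  have l: "l k y = ((x0 - y) \<bullet> n) / \<epsilon> k" for k y
    by (simp add: l_def inner_diff_left inner_diff_right inner_commute diff_divide_distrib)
  define s where "s k y = f (l k y)" for k y
  define S where "S k y = f' (l k y) *\<^sub>R (- (1 / \<epsilon> k) *\<^sub>R n)" for k y
  have s: "C1_fun (s k) (S k)" for k
    unfolding s_def[abs_def] S_def[abs_def] l_def[abs_def] by (intro C1_fun_compose f C1_fun_affine)
  note [measurable] = C1_fun_measurable[OF s]
  show ?thesis
  proof (rule balance_cutoff[OF \<zeta> s])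
    show "0 \<le> s k x" "s k x \<le> 1" for k x by (auto simp: s_def f)
    show "AE x in lborel. x \<in> \<Omega> \<longrightarrow> (\<lambda>k. s k x) \<longlonglongrightarrow> 1 \<or> \<zeta> x = 0 \<and> X x = 0"
    proof (rule AE_I2, rule impI)
      fix x assume x: "x \<in> \<Omega>"
      show "(\<lambda>k. s k x) \<longlonglongrightarrow> 1 \<or> \<zeta> x = 0 \<and> X x = 0"
      proof (cases "x \<in> cball x0 r'")
        case False
        then show ?thesis using \<zeta>0 C1_fun_zero_open[OF \<zeta>, of "- cball x0 r'"] by auto
      next
        case True
        then have "x \<in> \<Omega> \<inter> ball x0 r" using x r by auto
        then have pos: "(x0 - x) \<bullet> n > 0" unfolding half by (simp add: inner_diff_left)
        have "\<forall>\<^sub>F k in sequentially. \<epsilon> k < (x0 - x) \<bullet> n / 2"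
          by (rule order_tendstoD(2)[OF \<epsilon>0 half_gt_zero[OF pos]])
        then have "\<forall>\<^sub>F k in sequentially. s k x = 1"
        proof eventually_elim
          case (elim k)
          then have "2 \<le> l k x" using \<epsilon>(1)[of k] unfolding l by (simp add: le_divide_eq)
          then show ?case by (simp add: s_def f)
        qed
        from tendsto_eventually[OF this] show ?thesis by (rule disjI1)
      qed
    qed
    show "balance (\<lambda>x. \<zeta> x * s k x) (\<lambda>x. \<zeta> x *\<^sub>R S k x + s k x *\<^sub>R X x) = 0" for k
    proof (rule balance_interior[OF C1_fun_mult[OF \<zeta> s]])
      let ?K = "cball x0 r' \<inter> {y. \<epsilon> k \<le> (x0 - y) \<bullet> n}"
      show "compact ?K" by (intro compact_Int_closed closed_Collect_le continuous_intros) auto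
      show "?K \<subseteq> \<Omega>"
      proof
        fix y assume y: "y \<in> ?K"
        then have "y \<in> {y \<in> ball x0 r. (y - x0) \<bullet> n < 0}" using r \<epsilon>(1)[of k] by (auto simp: inner_diff_left)
        then show "y \<in> \<Omega>" unfolding half[symmetric] by simp
      qed
      show "\<zeta> y * s k y = 0" if "y \<notin> ?K" for y
      proof (cases "y \<in> cball x0 r'")
        case True
        then have "l k y \<le> 1" using that \<epsilon>(1)[of k] unfolding l by (auto simp: divide_le_eq)
        then show ?thesis by (simp add: s_def f)
      qed (simp add: \<zeta>0)
    qed
    show "(\<lambda>k. LINT p|lborel. \<bar>indicator Q p * (\<zeta> (fst p) * (v p \<bullet> S k (fst p)))\<bar>) \<longlonglongrightarrow> 0"
    proof (rule LIMSEQ_I)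
      fix e :: real assume e: "e > 0"
      \<comment> \<open>This anticipates the estimate Cs \<epsilon> (K L / \<epsilon>) (\<eta> T + 2
        M \<tau>), which is at most c \<eta> once 2 M \<tau> \<le> \<eta>. The summand 1 in the
        denominators of \<eta> and \<tau> guards against c = 0 and M = 0.\<close>
      define c where "c = Cs * (K * L) * (T + 1)"
      have c: "c \<ge> 0" using Cs K f(7) T by (simp add: c_def)
      define \<eta> where "\<eta> = e / (c + 1)"
      have \<eta>: "\<eta> > 0" "c * \<eta> < e"
        using e c by (auto simp: \<eta>_def field_simps)
      define \<tau> where "\<tau> = \<eta> / (2 * M + 1)"
      have \<tau>: "\<tau> > 0" "2 * M * \<tau> \<le> \<eta>"
        using \<eta> M_nonneg by (auto simp: \<tau>_def field_simps)
      obtain m where m: "m > 0" "AE q in lborel. q \<in> Q \<and> fst q \<in> cball x0 r' \<and> \<bar>(x0 - fst q) \<bullet> n\<bar> < m \<and> \<tau> \<le> snd q \<and> snd q \<le> T - \<tau> \<longrightarrow> \<bar>v q \<bullet> n\<bar> < \<eta>"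
        by (rule flux_uniform[OF n r half \<tau>(1) \<eta>(1)]) (rule that)
      have "\<forall>\<^sub>F k in sequentially. \<epsilon> k < m / 2"
        by (rule order_tendstoD(2)[OF \<epsilon>0 half_gt_zero[OF m(1)]])
      then obtain k0 where k0: "\<And>k. k \<ge> k0 \<Longrightarrow> \<epsilon> k < m / 2" by (auto simp: eventually_sequentially)
      show "\<exists>no. \<forall>k\<ge>no. norm ((LINT p|lborel. \<bar>indicator Q p * (\<zeta> (fst p) * (v p \<bullet> S k (fst p)))\<bar>) - 0) < e"
      proof (intro exI allI impI)
        fix k assume k: "k \<ge> k0"
        let ?A = "{y. \<epsilon> k \<le> (x0 - y) \<bullet> n \<and> (x0 - y) \<bullet> n \<le> 2 * \<epsilon> k} \<inter> cball x0 r'"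
        \<comment> \<open>Majorant in time: \<eta> from the uniform flux bound, and M on the initial
          and the final layer, which that bound does not reach.\<close>
        define h where "h t = (K * L / \<epsilon> k) * (\<eta> * indicator {0<..<T} t + M * indicator {0<..<\<tau>} t + M * indicator {T - \<tau><..<T} t)" for t
        have KL: "0 \<le> K * L / \<epsilon> k" using K f(7) \<epsilon>(1)[of k] by simp
        have h0: "0 \<le> h t" for t
          unfolding h_def using KL \<eta> M_nonneg by (intro mult_nonneg_nonneg add_nonneg_nonneg) auto
        have fs: "\<bar>v p \<bullet> S k (fst p)\<bar> \<le> L / \<epsilon> k * \<bar>v p \<bullet> n\<bar>" for p
        proof -
          have "\<bar>v p \<bullet> S k (fst p)\<bar> = \<bar>f' (l k (fst p))\<bar> * (\<bar>v p \<bullet> n\<bar> / \<epsilon> k)"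
            using \<epsilon>(1)[of k] by (simp add: S_def abs_mult)
          also have "\<dots> \<le> L * (\<bar>v p \<bullet> n\<bar> / \<epsilon> k)"
            using f(8) \<epsilon>(1)[of k] by (intro mult_right_mono) auto
          finally show ?thesis by simp
        qed
        have vn: "\<bar>v p \<bullet> n\<bar> \<le> M" for p
          using Cauchy_Schwarz_ineq2[of "v p" n] v_bound[of p] n by simp
        have fbound: "\<bar>indicator Q p * (\<zeta> (fst p) * (v p \<bullet> S k (fst p)))\<bar> \<le> (K * L / \<epsilon> k) * \<bar>v p \<bullet> n\<bar>" if "p \<in> Q" for p
        proof -
          have "\<bar>\<zeta> (fst p)\<bar> * \<bar>v p \<bullet> S k (fst p)\<bar> \<le> K * (L / \<epsilon> k * \<bar>v p \<bullet> n\<bar>)"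
            using that K by (intro mult_mono fs) auto
          then show ?thesis using that by (simp add: abs_mult)
        qed
        have supp: "y \<in> ?A" if "\<zeta> y * (w \<bullet> S k y) \<noteq> 0" for y w
        proof -
          have "\<zeta> y \<noteq> 0" "f' (l k y) \<noteq> 0" using that by (auto simp: S_def)
          then have "y \<in> cball x0 r'" "1 \<le> l k y \<and> l k y \<le> 2" using \<zeta>0 f(9) by blast+
          then show ?thesis using \<epsilon>(1)[of k] unfolding l by (auto simp: le_divide_eq divide_le_eq)
        qed
        have bA: "emeasure lborel ?A < \<infinity>" by (rule emeasure_bounded_finite) (auto intro: bounded_Int)
        have "closed {y. \<epsilon> k \<le> (x0 - y) \<bullet> n \<and> (x0 - y) \<bullet> n \<le> 2 * \<epsilon> k}"
          by (intro closed_Collect_conj closed_Collect_le continuous_intros)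
        then have mA: "?A \<in> sets borel" by (intro borel_closed closed_Int) auto
        have ih: "integrable lborel h"
          unfolding h_def using T \<tau> by (intro integrable_mult_right Bochner_Integration.integrable_add) (auto simp: integrable_indicator_iff)
        have "(LINT p|lborel. \<bar>indicator Q p * (\<zeta> (fst p) * (v p \<bullet> S k (fst p)))\<bar>) \<le> measure lborel ?A * (LINT t|lborel. h t)"
        proof (rule integral_Times_bound[OF _ _ mA bA ih])
          show "integrable lborel (\<lambda>p. indicator Q p * (\<zeta> (fst p) * (v p \<bullet> S k (fst p))))"
          proof (rule integrable_bounded_Q[where C="(K * L / \<epsilon> k) * M"])
            show "\<bar>indicator Q p * (\<zeta> (fst p) * (v p \<bullet> S k (fst p)))\<bar> \<le> (K * L / \<epsilon> k) * M" for p
            proof (cases "p \<in> Q")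
              case True
              show ?thesis by (rule order_trans[OF fbound[OF True] mult_left_mono[OF vn KL]])
            qed (use mult_nonneg_nonneg[OF KL M_nonneg] in simp)
          qed auto
          show "x \<in> ?A" if "indicator Q (x, t) * (\<zeta> (fst (x, t)) * (v (x, t) \<bullet> S k (fst (x, t)))) \<noteq> 0" for x t
            by (rule supp[of x "v (x, t)"]) (use that in auto)
          show "0 \<le> h t" for t by (rule h0)
          show "AE p in lborel. \<bar>indicator Q p * (\<zeta> (fst p) * (v p \<bullet> S k (fst p)))\<bar> \<le> h (snd p)"
            using m(2)
          proof eventually_elim
            case (elim p)
            show ?case
            proof (cases "p \<in> Q \<and> \<zeta> (fst p) * (v p \<bullet> S k (fst p)) \<noteq> 0")
              case False
              then have z: "indicator Q p * (\<zeta> (fst p) * (v p \<bullet> S k (fst p))) = 0" by auto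
              show ?thesis unfolding z using h0 by simp
            next
              case True
              then have A: "fst p \<in> ?A" using supp by blast
              then have "\<bar>(x0 - fst p) \<bullet> n\<bar> < m" using k0[OF k] \<epsilon>(1)[of k] by auto
              then have "\<bar>v p \<bullet> n\<bar> \<le> \<eta> * indicator {0<..<T} (snd p) + M * indicator {0<..<\<tau>} (snd p) + M * indicator {T - \<tau><..<T} (snd p)"
                using True A elim vn[of p] \<eta> M_nonneg by (auto split: split_indicator simp: not_less)
              then have "(K * L / \<epsilon> k) * \<bar>v p \<bullet> n\<bar> \<le> h (snd p)"
                unfolding h_def by (rule mult_left_mono[OF _ KL])
              then show ?thesis using fbound[of p] True by linarith
            qed
          qed
        qed
        also have "(LINT t|lborel. h t) = (K * L / \<epsilon> k) * (\<eta> * T + M * \<tau> + M * \<tau>)"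
          unfolding h_def using T \<tau> by (simp add: integrable_indicator_iff)
        also have "measure lborel ?A * \<dots> \<le> (Cs * \<epsilon> k) * ((K * L / \<epsilon> k) * (\<eta> * T + \<eta>))"
        proof (rule mult_mono[OF Cs(2)[OF \<epsilon>] mult_left_mono[OF _ KL]])
          show "\<eta> * T + M * \<tau> + M * \<tau> \<le> \<eta> * T + \<eta>" using \<tau>(2) by simp
          show "0 \<le> Cs * \<epsilon> k" using Cs(1) \<epsilon>(1)[of k] by simp
          have "0 \<le> \<eta> * T + M * \<tau> + M * \<tau>" using \<eta>(1) T M_nonneg \<tau>(1) by simp
          then show "0 \<le> K * L / \<epsilon> k * (\<eta> * T + M * \<tau> + M * \<tau>)" by (rule mult_nonneg_nonneg[OF KL])
        qed
        also have "\<dots> = c * \<eta>" using \<epsilon>(1)[of k] by (simp add: c_def field_simps)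
        also have "\<dots> < e" by (rule \<eta>)
        finally show "norm ((LINT p|lborel. \<bar>indicator Q p * (\<zeta> (fst p) * (v p \<bullet> S k (fst p)))\<bar>) - 0) < e"
          by simp
      qed
    qed
  qed
qed

text \<open>A cutoff at distance $\epsilon$ from a codimension-two plane has gradient $O(1/\epsilon)$ on a set of measure
  $O(\epsilon^2)$; as $\beta$ is bounded, no information on $v$ is needed there.\<close>

lemma balance_tube:
  assumes ind: "\<And>c. a2 \<noteq> c *\<^sub>R a1" "\<And>c. a1 \<noteq> c *\<^sub>R a2" and \<zeta>: "C1_fun \<zeta> X"
    and away: "\<And>\<eta> Y U. C1_fun \<eta> Y \<Longrightarrow> (\<And>y. \<zeta> y = 0 \<Longrightarrow> \<eta> y = 0) \<Longrightarrow> open U \<Longrightarrow>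
      {x. a1 \<bullet> x = b1 \<and> a2 \<bullet> x = b2} \<subseteq> U \<Longrightarrow> (\<And>y. y \<in> U \<Longrightarrow> \<eta> y = 0) \<Longrightarrow> balance \<eta> Y = 0"
  shows "balance \<zeta> X = 0"
proof -
  note [measurable] = C1_fun_measurable[OF \<zeta>]
  obtain f f' L where f: "\<And>s. (f has_real_derivative f' s) (at s)" "continuous_on UNIV f'"
    "\<And>s. 0 \<le> f s" "\<And>s. f s \<le> 1" "\<And>s. s \<le> 1 \<Longrightarrow> f s = 0" "\<And>s. s \<ge> 2 \<Longrightarrow> f s = 1"
    "L \<ge> 0" "\<And>s. \<bar>f' s\<bar> \<le> L" "\<And>s. f' s \<noteq> 0 \<Longrightarrow> 1 \<le> s \<and> s \<le> 2"
    using C1_step by metis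
  obtain K where K: "K \<ge> 0" "\<And>x. x \<in> \<Omega> \<Longrightarrow> \<bar>\<zeta> x\<bar> \<le> K" using C1_fun_bounded[OF \<zeta> bounded_Omega] by metis
  obtain R where R: "\<And>x. x \<in> \<Omega> \<Longrightarrow> norm x \<le> R" using bounded_Omega unfolding bounded_iff by blast
  obtain Ct where Ct: "Ct \<ge> 0" "\<And>\<epsilon>. 0 < \<epsilon> \<Longrightarrow> \<epsilon> \<le> 1 \<Longrightarrow>
    measure lborel ({y. \<bar>a1 \<bullet> y - b1\<bar> \<le> 2 * \<epsilon> \<and> \<bar>a2 \<bullet> y - b2\<bar> \<le> 2 * \<epsilon>} \<inter> cball 0 R) \<le> Ct * \<epsilon>\<^sup>2"
    by (rule tube_measure[OF ind, of b1 b2 R]) (rule that)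
  define \<epsilon> where "\<epsilon> k = 1 / real (Suc k)" for k
  have \<epsilon>: "0 < \<epsilon> k" "\<epsilon> k \<le> 1" for k by (auto simp: \<epsilon>_def)
  have \<epsilon>0: "\<epsilon> \<longlonglongrightarrow> 0" unfolding \<epsilon>_def[abs_def] by (intro LIMSEQ_Suc lim_1_over_n)
  define q where "q y = (a1 \<bullet> y - b1) * (a1 \<bullet> y - b1) + (a2 \<bullet> y - b2) * (a2 \<bullet> y - b2)" for y
  define G where "G y = ((a1 \<bullet> y - b1) *\<^sub>R a1 + (a1 \<bullet> y - b1) *\<^sub>R a1) + ((a2 \<bullet> y - b2) *\<^sub>R a2 + (a2 \<bullet> y - b2) *\<^sub>R a2)" for y
  have qG: "C1_fun q G"
    unfolding q_def[abs_def] G_def[abs_def] by (intro C1_fun_add C1_fun_mult C1_fun_affine)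
  \<comment> \<open>\<open>q\<close> is a sum of two squares and is therefore compared with
    \<epsilon>^2. In the transition layer it is at most 2 \<epsilon>^2, so both linear forms stay
    within 2\<epsilon> of their values on the plane, as the tube estimate expects.\<close>
  define l where "l k y = (1 / (\<epsilon> k)\<^sup>2) * q y" for k y
  have lG: "C1_fun (l k) (\<lambda>y. (1 / (\<epsilon> k)\<^sup>2) *\<^sub>R G y)" for k
    using C1_fun_mult[OF C1_fun_const[of "1 / (\<epsilon> k)\<^sup>2"] qG] by (simp add: l_def[abs_def])
  define s where "s k y = f (l k y)" for k y
  define S where "S k y = f' (l k y) *\<^sub>R (1 / (\<epsilon> k)\<^sup>2) *\<^sub>R G y" for k y
  have s: "C1_fun (s k) (S k)" for k
    unfolding s_def[abs_def] S_def[abs_def] by (intro C1_fun_compose f lG)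
  note [measurable] = C1_fun_measurable[OF s]
  show ?thesis
  proof (rule balance_cutoff[OF \<zeta> s])
    show "0 \<le> s k x" "s k x \<le> 1" for k x by (auto simp: s_def f)
    \<comment> \<open>The plane is contained in the hyperplane of \<open>a1\<close>, a null set;
      away from it \<open>q\<close> is positive and the cutoffs are eventually 1.\<close>
    have "a1 \<noteq> 0" using ind(2)[of 0] by simp
    from AE_not_on_hyperplane[OF this, of b1]
    show "AE x in lborel. x \<in> \<Omega> \<longrightarrow> (\<lambda>k. s k x) \<longlonglongrightarrow> 1 \<or> \<zeta> x = 0 \<and> X x = 0"
    proof eventually_elim
      case (elim x)
      have "(a1 \<bullet> x - b1) * (a1 \<bullet> x - b1) > 0" using elim by (simp add: zero_less_mult_iff) linarith
      then have q: "q x > 0" unfolding q_def using zero_le_square[of "a2 \<bullet> x - b2"] by linarith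
      have "(\<lambda>k. (\<epsilon> k)\<^sup>2) \<longlonglongrightarrow> 0\<^sup>2" by (intro tendsto_intros \<epsilon>0)
      then have "\<forall>\<^sub>F k in sequentially. (\<epsilon> k)\<^sup>2 < q x / 2"
        using order_tendstoD(2)[of "\<lambda>k. (\<epsilon> k)\<^sup>2" 0 sequentially "q x / 2"] q by simp
      then have "\<forall>\<^sub>F k in sequentially. s k x = 1"
      proof eventually_elim
        case (elim k)
        then have "2 \<le> l k x" using \<epsilon>(1)[of k] by (simp add: l_def le_divide_eq)
        then show ?case by (simp add: s_def f)
      qed
      from tendsto_eventually[OF this] show ?case by (intro impI disjI1)
    qed
    show "balance (\<lambda>x. \<zeta> x * s k x) (\<lambda>x. \<zeta> x *\<^sub>R S k x + s k x *\<^sub>R X x) = 0" for k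
    proof (rule away[OF C1_fun_mult[OF \<zeta> s], of k "{y. q y < (\<epsilon> k)\<^sup>2}"])
      show "open {y. q y < (\<epsilon> k)\<^sup>2}"
        by (intro open_Collect_less C1_fun_continuous[OF qG] continuous_intros)
      show "{x. a1 \<bullet> x = b1 \<and> a2 \<bullet> x = b2} \<subseteq> {y. q y < (\<epsilon> k)\<^sup>2}"
        using \<epsilon>(1)[of k] by (auto simp: q_def)
      show "\<zeta> y * s k y = 0" if "y \<in> {y. q y < (\<epsilon> k)\<^sup>2}" for y
      proof -
        have "l k y \<le> 1" using that \<epsilon>(1)[of k] by (simp add: l_def divide_le_eq)
        then show ?thesis by (simp add: s_def f)
      qed
    qed auto
    show "(\<lambda>k. LINT p|lborel. \<bar>indicator Q p * (\<zeta> (fst p) * (v p \<bullet> S k (fst p)))\<bar>) \<longlonglongrightarrow> 0"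
    proof (rule Lim_null_comparison[OF always_eventually], rule allI)
      let ?c = "K * (M * (4 * L * (norm a1 + norm a2)))"
      show "(\<lambda>k. Ct * ?c * T * \<epsilon> k) \<longlonglongrightarrow> 0" using tendsto_mult_right_zero[OF \<epsilon>0] .
      fix k
      let ?A = "{y. \<bar>a1 \<bullet> y - b1\<bar> \<le> 2 * \<epsilon> k \<and> \<bar>a2 \<bullet> y - b2\<bar> \<le> 2 * \<epsilon> k} \<inter> cball 0 R"
      have c: "0 \<le> ?c" using K M_nonneg f(7) by simp
      have near: "\<bar>a1 \<bullet> y - b1\<bar> \<le> 2 * \<epsilon> k \<and> \<bar>a2 \<bullet> y - b2\<bar> \<le> 2 * \<epsilon> k" if "f' (l k y) \<noteq> 0" for y
      proof -
        have "l k y \<le> 2" using f(9) that by blast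
        then have q: "q y \<le> 2 * (\<epsilon> k)\<^sup>2" using \<epsilon>(1)[of k] by (simp add: l_def divide_le_eq)
        have "(a1 \<bullet> y - b1)\<^sup>2 \<le> (2 * \<epsilon> k)\<^sup>2" "(a2 \<bullet> y - b2)\<^sup>2 \<le> (2 * \<epsilon> k)\<^sup>2"
          using q zero_le_square[of "a1 \<bullet> y - b1"] zero_le_square[of "a2 \<bullet> y - b2"] zero_le_square[of "\<epsilon> k"]
          unfolding q_def power2_eq_square by linarith+
        then have "\<bar>a1 \<bullet> y - b1\<bar> \<le> \<bar>2 * \<epsilon> k\<bar>" "\<bar>a2 \<bullet> y - b2\<bar> \<le> \<bar>2 * \<epsilon> k\<bar>"
          by (simp_all only: abs_le_square_iff)
        then show ?thesis using \<epsilon>(1)[of k] by simp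
      qed
      have S: "norm (S k y) \<le> 4 * L * (norm a1 + norm a2) / \<epsilon> k" for y
      proof (cases "f' (l k y) = 0")
        case True
        then show ?thesis using f(7) \<epsilon>(1)[of k] by (simp add: S_def)
      next
        case False
        note nr = near[OF False]
        have "norm (G y) \<le> (\<bar>a1 \<bullet> y - b1\<bar> * norm a1 + \<bar>a1 \<bullet> y - b1\<bar> * norm a1) + (\<bar>a2 \<bullet> y - b2\<bar> * norm a2 + \<bar>a2 \<bullet> y - b2\<bar> * norm a2)"
          unfolding G_def by (intro norm_triangle_le add_mono) auto
        also have "\<dots> \<le> (2 * \<epsilon> k * norm a1 + 2 * \<epsilon> k * norm a1) + (2 * \<epsilon> k * norm a2 + 2 * \<epsilon> k * norm a2)"
          using nr by (intro add_mono mult_right_mono) auto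
        finally have G: "norm (G y) \<le> 4 * \<epsilon> k * (norm a1 + norm a2)" by (simp add: algebra_simps)
        have "norm (S k y) = \<bar>f' (l k y)\<bar> * (1 / (\<epsilon> k)\<^sup>2 * norm (G y))" by (simp add: S_def)
        also have "\<dots> \<le> L * (1 / (\<epsilon> k)\<^sup>2 * (4 * \<epsilon> k * (norm a1 + norm a2)))"
          using f(7,8) G \<epsilon>(1)[of k] by (intro mult_mono mult_left_mono) auto
        also have "\<dots> = 4 * L * (norm a1 + norm a2) / \<epsilon> k"
          using \<epsilon>(1)[of k] by (simp add: field_simps power2_eq_square)
        finally show ?thesis .
      qed
      have fb: "\<bar>indicator Q p * (\<zeta> (fst p) * (v p \<bullet> S k (fst p)))\<bar> \<le> ?c / \<epsilon> k * indicator {0<..<T} (snd p)" for p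
      proof (cases "p \<in> Q")
        case True
        have "\<bar>v p \<bullet> S k (fst p)\<bar> \<le> M * (4 * L * (norm a1 + norm a2) / \<epsilon> k)"
          by (intro order_trans[OF Cauchy_Schwarz_ineq2] mult_mono v_bound S M_nonneg norm_ge_zero)
        then have "\<bar>\<zeta> (fst p)\<bar> * \<bar>v p \<bullet> S k (fst p)\<bar> \<le> K * (M * (4 * L * (norm a1 + norm a2) / \<epsilon> k))"
          using True K by (intro mult_mono) auto
        then show ?thesis using True by (auto simp: abs_mult)
      next
        case False
        then show ?thesis using c \<epsilon>(1)[of k] by simp
      qed
      have bA: "emeasure lborel ?A < \<infinity>" by (rule emeasure_bounded_finite) (auto intro: bounded_Int)
      have "closed {y. \<bar>a1 \<bullet> y - b1\<bar> \<le> 2 * \<epsilon> k \<and> \<bar>a2 \<bullet> y - b2\<bar> \<le> 2 * \<epsilon> k}"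
        by (intro closed_Collect_conj closed_Collect_le continuous_intros)
      then have mA: "?A \<in> sets borel" by (intro borel_closed closed_Int) auto
      have "(LINT p|lborel. \<bar>indicator Q p * (\<zeta> (fst p) * (v p \<bullet> S k (fst p)))\<bar>) \<le> measure lborel ?A * (LINT t|lborel. ?c / \<epsilon> k * indicator {0<..<T} t)"
      proof (rule integral_Times_bound[OF _ _ mA bA])
        show "integrable lborel (\<lambda>p. indicator Q p * (\<zeta> (fst p) * (v p \<bullet> S k (fst p))))"
        proof (rule integrable_bounded_Q[where C="?c / \<epsilon> k"])
          show "\<bar>indicator Q p * (\<zeta> (fst p) * (v p \<bullet> S k (fst p)))\<bar> \<le> ?c / \<epsilon> k" for p
            using fb[of p] c \<epsilon>(1)[of k] by (auto split: split_indicator_asm)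
        qed auto
        show "x \<in> ?A" if nz: "indicator Q (x, t) * (\<zeta> (fst (x, t)) * (v (x, t) \<bullet> S k (fst (x, t)))) \<noteq> 0" for x t
        proof -
          have "x \<in> \<Omega>" "f' (l k x) \<noteq> 0" using nz by (auto simp: S_def split: split_indicator_asm)
          then show ?thesis using near R by auto
        qed
        show "integrable lborel (\<lambda>t. ?c / \<epsilon> k * indicator {0<..<T} t)"
          using T by (intro integrable_mult_right) (auto simp: integrable_indicator_iff)
        show "0 \<le> ?c / \<epsilon> k * indicator {0<..<T} t" for t using c \<epsilon>(1)[of k] by (simp add: divide_nonneg_pos)
      qed (use fb in auto)
      also have "(LINT t|lborel. ?c / \<epsilon> k * indicator {0<..<T} t) = ?c / \<epsilon> k * T"
        using T by (subst integral_mult_right_zero) simp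
      also have "measure lborel ?A * (?c / \<epsilon> k * T) \<le> (Ct * (\<epsilon> k)\<^sup>2) * (?c / \<epsilon> k * T)"
        using Ct(2)[OF \<epsilon>] c \<epsilon>(1)[of k] T by (intro mult_right_mono) auto
      also have "\<dots> = Ct * ?c * T * \<epsilon> k" using \<epsilon>(1)[of k] by (simp add: power2_eq_square)
      finally show "norm (LINT p|lborel. \<bar>indicator Q p * (\<zeta> (fst p) * (v p \<bullet> S k (fst p)))\<bar>) \<le> Ct * ?c * T * \<epsilon> k" by simp
    qed
  qed
qed

end

section \<open>Flat boundary points, localisation and removal of the edges\<close>

context polyhedral_transport
begin

text \<open>Crossing pairs are the non-parallel ones. Their intersections, the sets
  \<open>edge\<close>, contain every boundary point near which \<Omega> fails to be a
  half-space.\<close>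

definition crossing :: "('a \<times> real) \<times> ('a \<times> real) \<Rightarrow> bool" where
  "crossing e \<longleftrightarrow> (\<forall>c. fst (snd e) \<noteq> c *\<^sub>R fst (fst e)) \<and> (\<forall>c. fst (fst e) \<noteq> c *\<^sub>R fst (snd e))"

definition edge :: "('a \<times> real) \<times> ('a \<times> real) \<Rightarrow> 'a set" where
  "edge e = {x. fst (fst e) \<bullet> x = snd (fst e) \<and> fst (snd e) \<bullet> x = snd (snd e)}"

text \<open>Near x0 every plane of \<open>J\<close> through a boundary point also passes through x0
  and, crossing no other plane of \<open>J\<close> there, determines the same hyperplane. This
  hyperplane cuts a small ball into two connected halves free of boundary points, each inside
  \<Omega> or disjoint from it. Both inside would contradict that \<Omega> is the interior of a
  closed set; neither inside, that x0 lies in the closure.\<close>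

lemma flat_boundary_point:
  assumes x0: "x0 \<in> frontier \<Omega>" and reg: "\<And>e. e \<in> J \<times> J \<Longrightarrow> crossing e \<Longrightarrow> x0 \<notin> edge e"
  obtains n r where "norm n = 1" "r > 0" "\<Omega> \<inter> ball x0 r = {y \<in> ball x0 r. (y - x0) \<bullet> n < 0}"
proof -
  obtain a b where ab: "(a, b) \<in> J" "a \<bullet> x0 = b" using J(3) x0 by blast
  have a0: "a \<noteq> 0" using J(2)[OF ab(1)] .
  \<comment> \<open>The planes that miss x0; being finitely many and closed, they also miss a ball
    around it.\<close>
  let ?J' = "{j \<in> J. fst j \<bullet> x0 \<noteq> snd j}"
  have "open (\<Inter>j\<in>?J'. {y. fst j \<bullet> y \<noteq> snd j})"
    using J(1) by (intro open_INT) (auto intro!: open_Collect_neq continuous_intros)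
  moreover have "x0 \<in> (\<Inter>j\<in>?J'. {y. fst j \<bullet> y \<noteq> snd j})" by auto
  ultimately obtain r where r: "r > 0" "ball x0 r \<subseteq> (\<Inter>j\<in>?J'. {y. fst j \<bullet> y \<noteq> snd j})"
    unfolding open_contains_ball by blast
  have only: "a \<bullet> y = b" if y: "y \<in> ball x0 r" "y \<in> frontier \<Omega>" for y
  proof -
    obtain a' b' where ab': "(a', b') \<in> J" "a' \<bullet> y = b'" using J(3) y(2) by blast
    have a0': "a' \<noteq> 0" using J(2)[OF ab'(1)] .
    have x': "a' \<bullet> x0 = b'"
    proof (rule ccontr)
      assume "a' \<bullet> x0 \<noteq> b'"
      then have "(a', b') \<in> ?J'" using ab'(1) by auto
      then show False using r(2) y(1) ab'(2) by fastforce
    qed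
    have "\<not> crossing ((a, b), (a', b'))"
      using reg[of "((a, b), (a', b'))"] ab ab'(1) x' by (auto simp: edge_def)
    then obtain c where "a' = c *\<^sub>R a \<or> a = c *\<^sub>R a'" by (auto simp: crossing_def)
    then show "a \<bullet> y = b"
    proof
      assume c: "a' = c *\<^sub>R a"
      then have "c \<noteq> 0" using a0' by auto
      have "c * (a \<bullet> y) = c * (a \<bullet> x0)" using ab'(2) x' c by simp
      then show ?thesis using \<open>c \<noteq> 0\<close> ab(2) by simp
    next
      assume c: "a = c *\<^sub>R a'"
      then show ?thesis using ab(2) ab'(2) x' by simp
    qed
  qed
  define Up where "Up = ball x0 r \<inter> {y. b < a \<bullet> y}"
  define Lo where "Lo = ball x0 r \<inter> {y. a \<bullet> y < b}"
  have conn: "connected Up" "connected Lo"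
    unfolding Up_def Lo_def
    by (intro convex_connected convex_Int convex_ball convex_halfspace_gt convex_halfspace_lt)+
  have fr: "Up \<inter> frontier \<Omega> = {}" "Lo \<inter> frontier \<Omega> = {}"
    using only by (fastforce simp: Up_def Lo_def)+
  have side: "S \<subseteq> \<Omega> \<or> S \<inter> \<Omega> = {}" if "connected S" "S \<inter> frontier \<Omega> = {}" for S
    using connected_Int_frontier[OF that(1), of \<Omega>] that(2) by blast
  have x0n: "x0 \<notin> \<Omega>" and x0c: "x0 \<in> closure \<Omega>"
    using x0 open_Omega by (auto simp: frontier_def interior_open)
  have near: "\<exists>s>0. y + s *\<^sub>R a \<in> U \<and> y - s *\<^sub>R a \<in> U" if "open U" "y \<in> U" for U y
  proof -
    obtain \<rho> where \<rho>: "\<rho> > 0" "ball y \<rho> \<subseteq> U" using \<open>open U\<close> \<open>y \<in> U\<close> open_contains_ball by blast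
    have "norm ((\<rho> / (2 * norm a)) *\<^sub>R a) < \<rho>" using \<rho>(1) a0 by simp
    then have "y + (\<rho> / (2 * norm a)) *\<^sub>R a \<in> ball y \<rho>" "y - (\<rho> / (2 * norm a)) *\<^sub>R a \<in> ball y \<rho>"
      by (auto simp: dist_norm)
    then show ?thesis using \<rho> a0 by (intro exI[of _ "\<rho> / (2 * norm a)"]) auto
  qed
  have aa: "a \<bullet> a > 0" using a0 by simp
  \<comment> \<open>Points of the ball outside \<open>C\<close> would form an open set, which cannot
    lie within the separating plane and so meets one of the halves. Hence the closed set
    \<open>C\<close> contains the whole ball, and x0 would be an interior point.\<close>
  have not_both: "\<not> (Up \<subseteq> \<Omega> \<and> Lo \<subseteq> \<Omega>)"
  proof
    assume both: "Up \<subseteq> \<Omega> \<and> Lo \<subseteq> \<Omega>"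
    have "ball x0 r \<subseteq> C"
    proof
      fix y assume y: "y \<in> ball x0 r"
      show "y \<in> C"
      proof (rule ccontr)
        assume "y \<notin> C"
        then have "open (ball x0 r \<inter> - C)" "y \<in> ball x0 r \<inter> - C" using C(1) y by auto
        from near[OF this] obtain s where s: "s > 0" "y + s *\<^sub>R a \<in> ball x0 r \<inter> - C" "y - s *\<^sub>R a \<in> ball x0 r \<inter> - C" by blast
        have out: "w \<notin> Up \<and> w \<notin> Lo" if "w \<in> - C" for w
          using both that C(2) interior_subset[of C] by blast
        have "b < a \<bullet> (y + s *\<^sub>R a) \<or> a \<bullet> (y - s *\<^sub>R a) < b"
        proof -
          have "0 < s * (a \<bullet> a)" by (rule mult_pos_pos[OF s(1) aa])
          moreover have "a \<bullet> (y + s *\<^sub>R a) = a \<bullet> y + s * (a \<bullet> a)" "a \<bullet> (y - s *\<^sub>R a) = a \<bullet> y - s * (a \<bullet> a)"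
            by (simp_all add: inner_add_right inner_diff_right)
          ultimately show ?thesis by linarith
        qed
        then show False using s out by (auto simp: Up_def Lo_def)
      qed
    qed
    then have "x0 \<in> interior C" using r(1) by (meson centre_in_ball interiorI open_ball)
    then show False using x0n C(2) by simp
  qed
  have line: "y \<notin> \<Omega>" if "Up \<inter> \<Omega> = {} \<or> Lo \<inter> \<Omega> = {}" "y \<in> ball x0 r" "a \<bullet> y = b" for y
  proof
    assume "y \<in> \<Omega>"
    then have "open (ball x0 r \<inter> \<Omega>)" "y \<in> ball x0 r \<inter> \<Omega>" using open_Omega that by auto
    from near[OF this] obtain s where s: "s > 0" "y + s *\<^sub>R a \<in> ball x0 r \<inter> \<Omega>" "y - s *\<^sub>R a \<in> ball x0 r \<inter> \<Omega>" by blast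
    have "b < a \<bullet> (y + s *\<^sub>R a)" "a \<bullet> (y - s *\<^sub>R a) < b"
      using that(3) mult_pos_pos[OF s(1) aa] by (auto simp: inner_add_right inner_diff_right)
    then have "y + s *\<^sub>R a \<in> Up \<inter> \<Omega>" "y - s *\<^sub>R a \<in> Lo \<inter> \<Omega>" using s by (auto simp: Up_def Lo_def)
    then show False using that(1) by blast
  qed
  have ne: "\<not> (Up \<inter> \<Omega> = {} \<and> Lo \<inter> \<Omega> = {})"
  proof
    assume e: "Up \<inter> \<Omega> = {} \<and> Lo \<inter> \<Omega> = {}"
    obtain y where y: "y \<in> \<Omega>" "dist y x0 < r" using x0c r(1) closure_approachable by blast
    then have "y \<in> ball x0 r" by (simp add: dist_commute)
    then have "a \<bullet> y = b" using e y(1) unfolding Up_def Lo_def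
      by (cases "a \<bullet> y" b rule: linorder_cases) blast+
    then show False using line[of y] e y(1) \<open>y \<in> ball x0 r\<close> by blast
  qed
  let ?n = "a /\<^sub>R norm a"
  have sg: "(y - x0) \<bullet> ?n < 0 \<longleftrightarrow> a \<bullet> y < b" "(y - x0) \<bullet> (- ?n) < 0 \<longleftrightarrow> b < a \<bullet> y" for y
    using a0 ab(2) by (auto simp: inner_diff_left inner_diff_right inner_commute[of _ a] mult_less_0_iff zero_less_mult_iff field_simps)
  from side[OF conn(1) fr(1)] side[OF conn(2) fr(2)] not_both ne
  consider "Lo \<subseteq> \<Omega>" "Up \<inter> \<Omega> = {}" | "Up \<subseteq> \<Omega>" "Lo \<inter> \<Omega> = {}" by blast
  then show ?thesis
  proof cases
    case 1
    have "\<Omega> \<inter> ball x0 r = {y \<in> ball x0 r. (y - x0) \<bullet> ?n < 0}"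
      unfolding sg using 1 line by (auto simp: Up_def Lo_def) (metis (mono_tags, lifting) IntI disjoint_iff mem_Collect_eq mem_ball linorder_neqE_linordered_idom)
    then show ?thesis using a0 r(1) by (intro that[of ?n r]) auto
  next
    case 2
    have "\<Omega> \<inter> ball x0 r = {y \<in> ball x0 r. (y - x0) \<bullet> (- ?n) < 0}"
      unfolding sg using 2 line by (auto simp: Up_def Lo_def) (metis (mono_tags, lifting) IntI disjoint_iff mem_Collect_eq mem_ball linorder_neqE_linordered_idom)
    then show ?thesis using a0 r(1) by (intro that[of "- ?n" r]) auto
  qed
qed

lemma C1_bump:
  fixes x :: 'a
  assumes r: "r > 0"
  obtains b Y where "C1_fun b Y" "\<And>y. y \<in> ball x (r / 2) \<Longrightarrow> b y = 1" "\<And>y. y \<notin> cball x r \<Longrightarrow> b y = 0"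
proof -
  obtain f f' L where f: "\<And>s. (f has_real_derivative f' s) (at s)" "continuous_on UNIV f'"
    "\<And>s. 0 \<le> f s" "\<And>s. f s \<le> 1" "\<And>s. s \<le> 1 \<Longrightarrow> f s = 0" "\<And>s. s \<ge> 2 \<Longrightarrow> f s = 1"
    "L \<ge> 0" "\<And>s. \<bar>f' s\<bar> \<le> L" "\<And>s. f' s \<noteq> 0 \<Longrightarrow> 1 \<le> s \<and> s \<le> 2"
    using C1_step by metis
  have q: "C1_fun (\<lambda>y. (y - x) \<bullet> (y - x)) (\<lambda>y. 2 *\<^sub>R (y - x))"
    by (auto simp: C1_fun_def inner_commute intro!: derivative_eq_intros continuous_intros)
  \<comment> \<open>With the factor 2/r^2 the transition from 1 to 2 takes place between the
    distances r / sqrt 2 and r, so the bump is 1 on the ball of radius r/2.\<close>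
  have l: "C1_fun (\<lambda>y. 2 / r\<^sup>2 * ((y - x) \<bullet> (y - x))) (\<lambda>y. (2 / r\<^sup>2) *\<^sub>R 2 *\<^sub>R (y - x))"
    using C1_fun_mult[OF C1_fun_const q, of "2 / r\<^sup>2"] by simp
  have b: "C1_fun (\<lambda>y. 1 - f (2 / r\<^sup>2 * ((y - x) \<bullet> (y - x)))) (\<lambda>y. 0 - f' (2 / r\<^sup>2 * ((y - x) \<bullet> (y - x))) *\<^sub>R (2 / r\<^sup>2) *\<^sub>R 2 *\<^sub>R (y - x))"
    by (intro C1_fun_diff C1_fun_const C1_fun_compose l f)
  show ?thesis
  proof (rule that[OF b])
    fix y assume "y \<in> ball x (r / 2)"
    then have "norm (y - x) \<le> r / 2" by (simp add: dist_norm norm_minus_commute)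
    then have "(norm (y - x))\<^sup>2 \<le> (r / 2)\<^sup>2" by (intro power_mono) auto
    also have "\<dots> \<le> r\<^sup>2 / 2" by (simp add: power_divide)
    finally have "2 / r\<^sup>2 * ((y - x) \<bullet> (y - x)) \<le> 1"
      using r by (simp add: dot_square_norm field_simps)
    then show "1 - f (2 / r\<^sup>2 * ((y - x) \<bullet> (y - x))) = 1" by (simp add: f)
  next
    fix y assume "y \<notin> cball x r"
    then have "r \<le> norm (y - x)" by (simp add: dist_norm norm_minus_commute)
    then have "r\<^sup>2 \<le> (norm (y - x))\<^sup>2" using r by (intro power_mono) auto
    then have "2 \<le> 2 / r\<^sup>2 * ((y - x) \<bullet> (y - x))"
      using r by (simp add: dot_square_norm field_simps)
    then show "1 - f (2 / r\<^sup>2 * ((y - x) \<bullet> (y - x))) = 0" by (simp add: f)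
  qed
qed

text \<open>A partition of unity built one ball at a time: \<eta> splits into \<eta> b, supported in
  the ball of x, and \<eta> (1 - b), which vanishes on the smaller ball as well. Both parts vanish
  wherever \<zeta> does, which keeps the local hypotheses applicable.\<close>

lemma balance_cover:
  assumes fin: "finite X0" and r: "\<And>x. x \<in> X0 \<Longrightarrow> r x > 0"
    and loc: "\<And>x \<eta> Y. x \<in> X0 \<Longrightarrow> C1_fun \<eta> Y \<Longrightarrow> (\<And>y. \<zeta> y = 0 \<Longrightarrow> \<eta> y = 0) \<Longrightarrow>
      (\<And>y. y \<notin> cball x (r x) \<Longrightarrow> \<eta> y = 0) \<Longrightarrow> balance \<eta> Y = 0"
    and \<eta>: "C1_fun \<eta> Y" "\<And>y. \<zeta> y = 0 \<Longrightarrow> \<eta> y = 0" "\<And>y. y \<in> \<Omega> \<Longrightarrow> (\<And>x. x \<in> X0 \<Longrightarrow> y \<notin> ball x (r x / 2)) \<Longrightarrow> \<eta> y = 0"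
  shows "balance \<eta> Y = 0"
  using fin r loc \<eta>
proof (induction X0 arbitrary: \<eta> Y rule: finite_induct)
  case empty
  then show ?case by (intro balance_zero_on) auto
next
  case (insert x X0)
  obtain b Z where b: "C1_fun b Z" "\<And>y. y \<in> ball x (r x / 2) \<Longrightarrow> b y = 1" "\<And>y. y \<notin> cball x (r x) \<Longrightarrow> b y = 0"
    using C1_bump[of "r x" x] insert.prems(1)[of x] by auto
  note 1 = C1_fun_mult[OF insert.prems(3) b(1)]
  have c: "C1_fun (\<lambda>y. 1 - b y) (\<lambda>y. 0 - Z y)" by (intro C1_fun_diff C1_fun_const b(1))
  note 2 = C1_fun_mult[OF insert.prems(3) c]
  have "balance (\<lambda>y. \<eta> y * b y) (\<lambda>y. \<eta> y *\<^sub>R Z y + b y *\<^sub>R Y y) = 0"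
    by (rule insert.prems(2)[OF _ 1, of x]) (use insert.prems(4) b(3) in auto)
  moreover have "balance (\<lambda>y. \<eta> y * (1 - b y)) (\<lambda>y. \<eta> y *\<^sub>R (0 - Z y) + (1 - b y) *\<^sub>R Y y) = 0"
  proof (rule insert.IH[OF _ _ 2])
    fix y assume y: "y \<in> \<Omega>" "\<And>x. x \<in> X0 \<Longrightarrow> y \<notin> ball x (r x / 2)"
    show "\<eta> y * (1 - b y) = 0"
    proof (cases "y \<in> ball x (r x / 2)")
      case False
      then have "\<eta> y = 0" using insert.prems(5)[OF y(1)] y(2) by blast
      then show ?thesis by simp
    qed (simp add: b(2))
  next
    fix x' \<eta>' Y' assume "x' \<in> X0" "C1_fun \<eta>' Y'" "\<And>y. \<zeta> y = 0 \<Longrightarrow> \<eta>' y = 0" "\<And>y. y \<notin> cball x' (r x') \<Longrightarrow> \<eta>' y = 0"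
    then show "balance \<eta>' Y' = 0" by (intro insert.prems(2)[of x' \<eta>' Y']) (auto simp del: mem_cball)
  qed (use insert.prems in auto)
  moreover have "balance \<eta> Y = balance (\<lambda>y. \<eta> y * b y) (\<lambda>y. \<eta> y *\<^sub>R Z y + b y *\<^sub>R Y y)
    + balance (\<lambda>y. \<eta> y * (1 - b y)) (\<lambda>y. \<eta> y *\<^sub>R (0 - Z y) + (1 - b y) *\<^sub>R Y y)"
    unfolding balance_add[OF 1 2, symmetric] by (simp add: algebra_simps)
  ultimately show ?case by simp
qed

text \<open>Every point of the closure has a radius at which localised functions balance: inside
  \<Omega> by compact support, on an edge because \<zeta> is zero nearby, elsewhere on the boundary
  by flatness. Compactness leaves finitely many balls.\<close>

lemma balance_away_from_edges:
  assumes \<zeta>: "C1_fun \<zeta> X"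
    and away: "\<And>e. e \<in> J \<times> J \<Longrightarrow> crossing e \<Longrightarrow> \<exists>U. open U \<and> edge e \<subseteq> U \<and> (\<forall>y\<in>U. \<zeta> y = 0)"
  shows "balance \<zeta> X = 0"
proof -
  define good where "good x r \<longleftrightarrow> r > 0 \<and> (\<forall>\<eta> Y. C1_fun \<eta> Y \<longrightarrow> (\<forall>y. \<zeta> y = 0 \<longrightarrow> \<eta> y = 0) \<longrightarrow>
    (\<forall>y. y \<notin> cball x r \<longrightarrow> \<eta> y = 0) \<longrightarrow> balance \<eta> Y = 0)" for x r
  have ex: "\<exists>r. good x r" if x: "x \<in> closure \<Omega>" for x
  proof -
    consider "x \<in> \<Omega>" | e where "e \<in> J \<times> J" "crossing e" "x \<in> edge e"
      | "x \<in> frontier \<Omega>" "\<And>e. e \<in> J \<times> J \<Longrightarrow> crossing e \<Longrightarrow> x \<notin> edge e"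
      using x open_Omega by (auto simp: frontier_def interior_open)
    then show ?thesis
    proof cases
      case 1
      then obtain r where r: "r > 0" "cball x r \<subseteq> \<Omega>" using open_contains_cball_eq[OF open_Omega] by blast
      have "good x r"
        unfolding good_def using r by (auto intro!: balance_interior[of _ _ "cball x r"])
      then show ?thesis ..
    next
      case 2
      obtain U where U: "open U" "edge e \<subseteq> U" "\<And>y. y \<in> U \<Longrightarrow> \<zeta> y = 0" using away[OF 2(1,2)] by blast
      then have "x \<in> U" using 2(3) by blast
      then obtain r where r: "r > 0" "cball x r \<subseteq> U" using open_contains_cball_eq[OF U(1)] by blast
      have "good x r"
        unfolding good_def
      proof (intro conjI allI impI balance_zero_on)
        fix \<eta> Y y assume "\<forall>y. \<zeta> y = 0 \<longrightarrow> \<eta> y = (0::real)" "\<forall>y. y \<notin> cball x r \<longrightarrow> \<eta> y = 0"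
        then show "\<eta> y = 0" using U(3) r(2) by (cases "y \<in> cball x r") auto
      qed (use r in auto)
      then show ?thesis ..
    next
      case 3
      obtain n r where nr: "norm n = 1" "r > 0" "\<Omega> \<inter> ball x r = {y \<in> ball x r. (y - x) \<bullet> n < 0}"
        by (rule flat_boundary_point[OF 3(1)], erule (1) 3(2), erule (2) that)
      have r2: "r / 2 < r" using nr(2) by simp
      have "good x (r / 2)"
        unfolding good_def
      proof (intro conjI allI impI)
        fix \<eta> Y assume "C1_fun \<eta> Y" "\<forall>y. y \<notin> cball x (r / 2) \<longrightarrow> \<eta> y = 0"
        then show "balance \<eta> Y = 0" by (intro balance_flat[OF nr(1) r2 nr(3)]) blast+
      qed (use nr(2) in simp)
      then show ?thesis ..
    qed
  qed
  then have "\<forall>x\<in>closure \<Omega>. \<exists>r. good x r" by blast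
  from bchoice[OF this] obtain r where "\<forall>x\<in>closure \<Omega>. good x (r x)" ..
  then have r: "good x (r x)" if "x \<in> closure \<Omega>" for x using that by blast
  have cpt: "compact (closure \<Omega>)" using bounded_Omega by (simp add: compact_closure)
  have "closure \<Omega> \<subseteq> (\<Union>x\<in>closure \<Omega>. ball x (r x / 2))"
    using r by (force simp: good_def)
  from compactE_image[OF cpt _ this] obtain X0 where X0: "X0 \<subseteq> closure \<Omega>" "finite X0" "closure \<Omega> \<subseteq> (\<Union>x\<in>X0. ball x (r x / 2))"
    by auto
  show ?thesis
  proof (rule balance_cover[OF X0(2) _ _ \<zeta>, where r=r and \<zeta>=\<zeta>])
    show "r x > 0" if "x \<in> X0" for x using r X0(1) that by (auto simp: good_def)
    show "balance \<eta> Y = 0" if "x \<in> X0" "C1_fun \<eta> Y" "\<And>y. \<zeta> y = 0 \<Longrightarrow> \<eta> y = 0" "\<And>y. y \<notin> cball x (r x) \<Longrightarrow> \<eta> y = 0" for x \<eta> Y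
      using r[of x] X0(1) that unfolding good_def by blast
    show "\<zeta> y = 0" if "y \<in> \<Omega>" "\<And>x. x \<in> X0 \<Longrightarrow> y \<notin> ball x (r x / 2)" for y
      using that X0(3) closure_subset[of \<Omega>] by blast
  qed
qed

lemma balance_C1:
  assumes \<zeta>: "C1_fun \<zeta> X"
  shows "balance \<zeta> X = 0"
proof -
  let ?E = "{e \<in> J \<times> J. crossing e}"
  have fin: "finite ?E" using J(1) by simp
  have "\<forall>\<zeta> X. C1_fun \<zeta> X \<longrightarrow> (\<forall>e\<in>?E - D. \<exists>U. open U \<and> edge e \<subseteq> U \<and> (\<forall>y\<in>U. \<zeta> y = 0)) \<longrightarrow> balance \<zeta> X = 0"
    if "finite D" "D \<subseteq> ?E" for D
    using that
  proof (induction D rule: finite_induct)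
    case empty
    then show ?case by (auto intro!: balance_away_from_edges)
  next
    case (insert e D)
    show ?case
    proof (intro allI impI)
      fix \<zeta> X assume \<zeta>: "C1_fun \<zeta> X" and aw: "\<forall>e\<in>?E - insert e D. \<exists>U. open U \<and> edge e \<subseteq> U \<and> (\<forall>y\<in>U. \<zeta> y = 0)"
      have e: "crossing e" using insert.prems by auto
      show "balance \<zeta> X = 0"
      proof (rule balance_tube[OF _ _ \<zeta>, where ?a1.0="fst (fst e)" and ?a2.0="fst (snd e)" and ?b1.0="snd (fst e)" and ?b2.0="snd (snd e)"])
        show "fst (snd e) \<noteq> c *\<^sub>R fst (fst e)" "fst (fst e) \<noteq> c *\<^sub>R fst (snd e)" for c
          using e by (auto simp: crossing_def)
        fix \<eta> Y U assume \<eta>: "C1_fun \<eta> Y" "\<And>y. \<zeta> y = 0 \<Longrightarrow> \<eta> y = 0" and U: "open U"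
          "{x. fst (fst e) \<bullet> x = snd (fst e) \<and> fst (snd e) \<bullet> x = snd (snd e)} \<subseteq> U" "\<And>y. y \<in> U \<Longrightarrow> \<eta> y = 0"
        have "\<exists>U. open U \<and> edge e' \<subseteq> U \<and> (\<forall>y\<in>U. \<eta> y = 0)" if e': "e' \<in> ?E - D" for e'
        proof (cases "e' = e")
          case True
          then show ?thesis using U by (intro exI[of _ U]) (auto simp: edge_def)
        next
          case False
          then have "e' \<in> ?E - insert e D" using e' by blast
          then show ?thesis using aw \<eta>(2) by meson
        qed
        then show "balance \<eta> Y = 0" using insert.IH insert.prems \<eta>(1) by blast
      qed
    qed
  qed
  from this[OF fin subset_refl] show ?thesis using \<zeta> by blast
qed

lemma balance_one: "balance (\<lambda>_. 1) (\<lambda>_. 0) = 0"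
  by (rule balance_C1[OF C1_fun_const])

end

subsection \<open>From the renormalised balance to the energy identity\<close>

text \<open>\<open>sat m\<close> is the truncation of the overview. The factor
  \<open>sat_ratio\<close>, between 0 and 1, is isolated because the derivative is 2 s times its
  square; the bounds s^2 and 2 |s|, uniform in \<open>m\<close>, are then immediate.\<close>

definition sat_ratio :: "real \<Rightarrow> real \<Rightarrow> real" where "sat_ratio m s = m / (m + s\<^sup>2)"
definition sat :: "real \<Rightarrow> real \<Rightarrow> real" where "sat m s = s\<^sup>2 * sat_ratio m s"
definition sat' :: "real \<Rightarrow> real \<Rightarrow> real" where "sat' m s = 2 * s * (sat_ratio m s)\<^sup>2"

lemma sat_ratio_bounds: "m > 0 \<Longrightarrow> 0 \<le> sat_ratio m s" "m > 0 \<Longrightarrow> sat_ratio m s \<le> 1"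
  by (auto simp: sat_ratio_def divide_le_eq add_pos_nonneg intro!: divide_nonneg_pos)

lemma sat_DERIV:
  assumes "m > 0"
  shows "(sat m has_real_derivative sat' m s) (at s)"
proof -
  have "m + s\<^sup>2 > 0" using assms by (simp add: add_pos_nonneg)
  then show ?thesis
    unfolding sat_def[abs_def] sat'_def sat_ratio_def
    by (auto intro!: derivative_eq_intros simp: field_simps power2_eq_square)
qed

lemma sat'_DERIV:
  assumes "m > 0"
  shows "(sat' m has_real_derivative 2 * (sat_ratio m s)\<^sup>2 * (m - 3 * s\<^sup>2) / (m + s\<^sup>2)) (at s)"
proof -
  have p: "m + s\<^sup>2 > 0" using assms by (simp add: add_pos_nonneg)
  have r: "(sat_ratio m has_real_derivative - (2 * s * sat_ratio m s / (m + s\<^sup>2))) (at s)"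
    using p unfolding sat_ratio_def[abs_def]
    by (auto intro!: derivative_eq_intros simp: power2_eq_square)
  have "(sat' m has_real_derivative 2 * (sat_ratio m s)\<^sup>2
      + 2 * s * (2 * sat_ratio m s * - (2 * s * sat_ratio m s / (m + s\<^sup>2)))) (at s)"
    unfolding sat'_def[abs_def] by (auto intro!: derivative_eq_intros r)
  moreover have "2 * (sat_ratio m s)\<^sup>2 + 2 * s * (2 * sat_ratio m s * - (2 * s * sat_ratio m s / (m + s\<^sup>2)))
    = 2 * (sat_ratio m s)\<^sup>2 * (m - 3 * s\<^sup>2) / (m + s\<^sup>2)"
    using p by (simp add: field_simps power2_eq_square)
  ultimately show ?thesis by simp
qed

text \<open>The bounds by \<open>6 * m\<close> are generous and supply the single constant of the
  locale \<open>renormalised\<close>; they only have to be finite for each fixed \<open>m\<close>.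
  The limit in \<open>m\<close> rests on the bounds s^2 and 2 |s|.\<close>

lemma sat_bounds:
  assumes m: "m \<ge> 1"
  shows "\<bar>sat m s\<bar> \<le> 6 * m" "\<bar>sat' m s\<bar> \<le> 6 * m" "\<bar>sat m s\<bar> \<le> s\<^sup>2" "\<bar>sat' m s\<bar> \<le> 2 * \<bar>s\<bar>"
    "\<bar>sat' m x - sat' m y\<bar> \<le> 6 * m * \<bar>x - y\<bar>"
proof -
  have p: "m + s\<^sup>2 > 0" for s using m by (simp add: add_pos_nonneg)
  have r: "0 \<le> sat_ratio m s" "sat_ratio m s \<le> 1" for s using sat_ratio_bounds m by auto
  have r2: "0 \<le> (sat_ratio m s)\<^sup>2" "(sat_ratio m s)\<^sup>2 \<le> sat_ratio m s" for s
    using r[of s] by (auto simp: power2_eq_square mult_left_le)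
  show "\<bar>sat m s\<bar> \<le> s\<^sup>2" using r[of s] by (simp add: sat_def abs_mult mult_left_le)
  show "\<bar>sat' m s\<bar> \<le> 2 * \<bar>s\<bar>"
    using r2[of s] r[of s] by (simp add: sat'_def abs_mult mult_left_le)
  have "\<bar>sat m s\<bar> = m * (s\<^sup>2 / (m + s\<^sup>2))"
    using m p[of s] by (simp add: sat_def sat_ratio_def abs_mult)
  also have "\<dots> \<le> m * 1" using m p[of s] by (intro mult_left_mono) (auto simp: divide_le_eq)
  finally show "\<bar>sat m s\<bar> \<le> 6 * m" using m by simp
  have "2 * \<bar>s\<bar> \<le> m + s\<^sup>2"
    using m zero_le_power2[of "\<bar>s\<bar> - 1"] by (simp add: power2_diff)
  then have "2 * \<bar>s\<bar> * sat_ratio m s \<le> (m + s\<^sup>2) * sat_ratio m s"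
    using r by (intro mult_right_mono) auto
  also have "\<dots> = m" using p[of s] by (simp add: sat_ratio_def)
  finally have "2 * \<bar>s\<bar> * sat_ratio m s \<le> m" .
  moreover have "\<bar>sat' m s\<bar> \<le> 2 * \<bar>s\<bar> * sat_ratio m s"
    using r2[of s] by (simp add: sat'_def abs_mult mult_left_mono)
  ultimately show "\<bar>sat' m s\<bar> \<le> 6 * m" using m by simp
  \<comment> \<open>The derivative of \<open>sat'\<close> is in fact at most 6 in absolute value,
    because |m - 3 s^2| \<le> 3 (m + s^2).\<close>
  have d2: "\<bar>2 * (sat_ratio m s)\<^sup>2 * (m - 3 * s\<^sup>2) / (m + s\<^sup>2)\<bar> \<le> 6 * m" for s
  proof -
    have "\<bar>m - 3 * s\<^sup>2\<bar> \<le> 3 * (m + s\<^sup>2)" using m zero_le_power2[of s] by (auto simp: abs_le_iff)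
    then have "\<bar>m - 3 * s\<^sup>2\<bar> / (m + s\<^sup>2) \<le> 3" using p[of s] by (simp add: divide_le_eq)
    then have "(2 * (sat_ratio m s)\<^sup>2) * (\<bar>m - 3 * s\<^sup>2\<bar> / (m + s\<^sup>2)) \<le> (2 * 1) * 3"
      using r2[of s] r[of s] p[of s] by (intro mult_mono) auto
    then show ?thesis using m p[of s] by (simp add: abs_mult)
  qed
  have "norm (sat' m x - sat' m y) \<le> 6 * m * norm (x - y)"
    by (rule field_differentiable_bound[of UNIV _ "\<lambda>s. 2 * (sat_ratio m s)\<^sup>2 * (m - 3 * s\<^sup>2) / (m + s\<^sup>2)"])
      (use sat'_DERIV m d2 in auto)
  then show "\<bar>sat' m x - sat' m y\<bar> \<le> 6 * m * \<bar>x - y\<bar>" by simp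
qed

lemma sat_tendsto:
  "(\<lambda>n. sat (real (Suc n)) s) \<longlonglongrightarrow> s\<^sup>2" "(\<lambda>n. sat' (real (Suc n)) s) \<longlonglongrightarrow> 2 * s"
proof -
  have "(\<lambda>n. sat_ratio (real (Suc n)) s - 1) \<longlonglongrightarrow> 0"
  proof (rule Lim_null_comparison[OF always_eventually], rule allI)
    show "(\<lambda>n. s\<^sup>2 * (1 / real (Suc n))) \<longlonglongrightarrow> 0"
      using tendsto_mult_right_zero[OF LIMSEQ_Suc[OF lim_1_over_n], of "s\<^sup>2"] by simp
    fix n
    have p: "real (Suc n) + s\<^sup>2 > 0" by (simp add: add_pos_nonneg)
    then have "sat_ratio (real (Suc n)) s - 1 = - (s\<^sup>2 / (real (Suc n) + s\<^sup>2))"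
      by (simp add: sat_ratio_def divide_simps)
    moreover have "s\<^sup>2 / (real (Suc n) + s\<^sup>2) \<le> s\<^sup>2 / real (Suc n)"
      by (intro divide_left_mono) (auto simp: add_pos_nonneg)
    ultimately show "norm (sat_ratio (real (Suc n)) s - 1) \<le> s\<^sup>2 * (1 / real (Suc n))"
      using p by simp
  qed
  then have r: "(\<lambda>n. sat_ratio (real (Suc n)) s) \<longlonglongrightarrow> 1" by (rule LIM_zero_cancel)
  show "(\<lambda>n. sat (real (Suc n)) s) \<longlonglongrightarrow> s\<^sup>2"
    unfolding sat_def using tendsto_mult[OF tendsto_const r, of "s\<^sup>2"] by simp
  show "(\<lambda>n. sat' (real (Suc n)) s) \<longlonglongrightarrow> 2 * s"
    unfolding sat'_def using tendsto_mult[OF tendsto_const tendsto_power[OF r, of 2], of "2 * s"] by simp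
qed

text \<open>The balance with \<zeta> = 1 holds for every truncation, so the boundary is settled
  before \<open>m\<close> moves. The truncations and their derivatives are dominated by s^2 and 2
  |s|; hence u^2 and |u g| provide majorants independent of \<open>m\<close>.\<close>

lemma (in transport) energy_identity:
  assumes C: "closed C" "\<Omega> = interior C"
    and J: "finite J" "\<And>a b. (a, b) \<in> J \<Longrightarrow> a \<noteq> 0" "frontier \<Omega> \<subseteq> (\<Union>(a, b)\<in>J. {x. a \<bullet> x = b})"
    and flux: "\<And>x n t \<delta>. x \<in> frontier \<Omega> \<Longrightarrow> outer_normal \<Omega> x n \<Longrightarrow> 0 < t \<Longrightarrow> t < T \<Longrightarrow> \<delta> > 0 \<Longrightarrow>
      \<exists>N. open N \<and> (x, t) \<in> N \<and> (AE q in lborel. q \<in> N \<and> q \<in> Q \<longrightarrow> \<bar>v q \<bullet> n\<bar> < \<delta>)"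
    and sq: "integrable lborel (\<lambda>p. (u p)\<^sup>2)" "integrable lborel (\<lambda>x. (u0 x)\<^sup>2)" "integrable lborel (\<lambda>p. u p * g p)"
  shows "(LINT p|lborel. (u p)\<^sup>2) = T * (LINT x|lborel. indicator \<Omega> x * (u0 x)\<^sup>2)
    + (LINT p|lborel. indicator Q p * ((T - snd p) * (2 * (u p * g p) - d p * (u p)\<^sup>2)))"
proof -
  let ?b = "\<lambda>n. sat (real (Suc n))" and ?b' = "\<lambda>n. sat' (real (Suc n))"
  have [measurable]: "Q \<in> sets borel" "\<Omega> \<in> sets borel" using open_Q open_Omega by auto
  have loc: "polyhedral_transport \<Omega> T M u0 u g d v D (?b n) (?b' n) (6 * real (Suc n)) C J" for n
  proof -
    have m: "real (Suc n) \<ge> 1" "real (Suc n) > 0" by auto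
    show ?thesis
      by unfold_locales
        (use sat_DERIV[OF m(2)] sat_bounds[OF m(1)] C J flux in \<open>auto simp del: of_nat_Suc\<close>)
  qed
  have bal: "(LINT p|lborel. indicator Q p * ?b n (u p)) - T * (LINT x|lborel. indicator \<Omega> x * ?b n (u0 x))
    - (LINT p|lborel. indicator Q p * ((T - snd p) * (?b' n (u p) * g p + d p * ?b n (u p) - d p * (?b' n (u p) * u p)))) = 0" for n
  proof -
    interpret P: polyhedral_transport \<Omega> T M u0 u g d v D "?b n" "?b' n" "6 * real (Suc n)" C J by (rule loc)
    show ?thesis using P.balance_one unfolding P.balance_def by simp
  qed
  have [measurable]: "?b n \<in> borel_measurable borel" "?b' n \<in> borel_measurable borel" for n
  proof -
    interpret P: polyhedral_transport \<Omega> T M u0 u g d v D "?b n" "?b' n" "6 * real (Suc n)" C J by (rule loc)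
    show "?b n \<in> borel_measurable borel" "?b' n \<in> borel_measurable borel" by (rule P.beta_measurable)+
  qed
  have b1: "\<bar>?b n s\<bar> \<le> s\<^sup>2" "\<bar>?b' n s\<bar> \<le> 2 * \<bar>s\<bar>" for n s
    by (rule sat_bounds; simp)+
  have t1: "(\<lambda>n. LINT p|lborel. indicator Q p * ?b n (u p)) \<longlonglongrightarrow> (LINT p|lborel. indicator Q p * (u p)\<^sup>2)"
  proof (rule integral_dominated_convergence[where w="\<lambda>p. (u p)\<^sup>2"])
    show "AE p in lborel. (\<lambda>n. indicator Q p * ?b n (u p)) \<longlonglongrightarrow> indicator Q p * (u p)\<^sup>2"
      by (intro AE_I2 tendsto_intros sat_tendsto)
    show "AE p in lborel. norm (indicator Q p * ?b n (u p)) \<le> (u p)\<^sup>2" for n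
      using b1(1)[of n] by (intro AE_I2) (auto split: split_indicator)
  qed (use sq in \<open>auto simp del: of_nat_Suc\<close>)
  have t2: "(\<lambda>n. LINT x|lborel. indicator \<Omega> x * ?b n (u0 x)) \<longlonglongrightarrow> (LINT x|lborel. indicator \<Omega> x * (u0 x)\<^sup>2)"
  proof (rule integral_dominated_convergence[where w="\<lambda>x. (u0 x)\<^sup>2"])
    show "AE x in lborel. (\<lambda>n. indicator \<Omega> x * ?b n (u0 x)) \<longlonglongrightarrow> indicator \<Omega> x * (u0 x)\<^sup>2"
      by (intro AE_I2 tendsto_intros sat_tendsto)
    show "AE x in lborel. norm (indicator \<Omega> x * ?b n (u0 x)) \<le> (u0 x)\<^sup>2" for n
      using b1(1)[of n] by (intro AE_I2) (auto split: split_indicator)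
  qed (use sq in \<open>auto simp del: of_nat_Suc\<close>)
  have t3: "(\<lambda>n. LINT p|lborel. indicator Q p * ((T - snd p) * (?b' n (u p) * g p + d p * ?b n (u p) - d p * (?b' n (u p) * u p))))
    \<longlonglongrightarrow> (LINT p|lborel. indicator Q p * ((T - snd p) * (2 * u p * g p + d p * (u p)\<^sup>2 - d p * (2 * u p * u p))))"
  proof (rule integral_dominated_convergence[where w="\<lambda>p. T * (2 * \<bar>u p * g p\<bar> + 3 * M * (u p)\<^sup>2)"])
    show "AE p in lborel. (\<lambda>n. indicator Q p * ((T - snd p) * (?b' n (u p) * g p + d p * ?b n (u p) - d p * (?b' n (u p) * u p))))
      \<longlonglongrightarrow> indicator Q p * ((T - snd p) * (2 * u p * g p + d p * (u p)\<^sup>2 - d p * (2 * u p * u p)))"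
      by (intro AE_I2 tendsto_intros sat_tendsto)
    show "AE p in lborel. norm (indicator Q p * ((T - snd p) * (?b' n (u p) * g p + d p * ?b n (u p) - d p * (?b' n (u p) * u p))))
      \<le> T * (2 * \<bar>u p * g p\<bar> + 3 * M * (u p)\<^sup>2)" for n
    proof (rule AE_I2)
      fix p
      have 1: "\<bar>?b' n (u p) * g p\<bar> \<le> 2 * \<bar>u p * g p\<bar>"
        using mult_right_mono[OF b1(2)[of n "u p"], of "\<bar>g p\<bar>"] by (simp add: abs_mult)
      have 2: "\<bar>d p * ?b n (u p)\<bar> \<le> M * (u p)\<^sup>2"
        unfolding abs_mult by (intro mult_mono d_bound b1 M_nonneg) auto
      have "\<bar>?b' n (u p) * u p\<bar> \<le> 2 * (u p)\<^sup>2"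
        using mult_right_mono[OF b1(2)[of n "u p"], of "\<bar>u p\<bar>"] by (simp add: abs_mult power2_eq_square)
      then have 3: "\<bar>d p * (?b' n (u p) * u p)\<bar> \<le> M * (2 * (u p)\<^sup>2)"
        unfolding abs_mult[of "d p"] by (intro mult_mono d_bound M_nonneg) auto
      have "\<bar>?b' n (u p) * g p + d p * ?b n (u p) - d p * (?b' n (u p) * u p)\<bar> \<le> 2 * \<bar>u p * g p\<bar> + 3 * M * (u p)\<^sup>2"
        using 1 2 3 by linarith
      moreover have "\<bar>indicator Q p * (T - snd p)\<bar> \<le> T"
        using T by (cases "p \<in> Q") auto
      ultimately have "\<bar>indicator Q p * (T - snd p)\<bar> * \<bar>?b' n (u p) * g p + d p * ?b n (u p) - d p * (?b' n (u p) * u p)\<bar> \<le> T * (2 * \<bar>u p * g p\<bar> + 3 * M * (u p)\<^sup>2)"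
        using T by (intro mult_mono) auto
      then show "norm (indicator Q p * ((T - snd p) * (?b' n (u p) * g p + d p * ?b n (u p) - d p * (?b' n (u p) * u p))))
      \<le> T * (2 * \<bar>u p * g p\<bar> + 3 * M * (u p)\<^sup>2)"
        by (simp only: real_norm_def abs_mult[symmetric] mult.assoc)
    qed
    show "integrable lborel (\<lambda>p. T * (2 * \<bar>u p * g p\<bar> + 3 * M * (u p)\<^sup>2))"
      by (intro integrable_mult_right Bochner_Integration.integrable_add integrable_abs sq)
  qed (auto simp del: of_nat_Suc)
  have "(\<lambda>n. 0) \<longlonglongrightarrow> (LINT p|lborel. indicator Q p * (u p)\<^sup>2) - T * (LINT x|lborel. indicator \<Omega> x * (u0 x)\<^sup>2)
    - (LINT p|lborel. indicator Q p * ((T - snd p) * (2 * u p * g p + d p * (u p)\<^sup>2 - d p * (2 * u p * u p))))"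
    by (rule Lim_transform_eventually[OF tendsto_diff[OF tendsto_diff[OF t1 tendsto_mult[OF tendsto_const t2]] t3]])
      (simp add: bal del: of_nat_Suc)
  from LIMSEQ_unique[OF tendsto_const this]
  have "(LINT p|lborel. indicator Q p * (u p)\<^sup>2) = T * (LINT x|lborel. indicator \<Omega> x * (u0 x)\<^sup>2)
    + (LINT p|lborel. indicator Q p * ((T - snd p) * (2 * u p * g p + d p * (u p)\<^sup>2 - d p * (2 * u p * u p))))" by simp
  moreover have "(LINT p|lborel. indicator Q p * (u p)\<^sup>2) = (LINT p|lborel. (u p)\<^sup>2)"
    by (intro Bochner_Integration.integral_cong) (auto simp: outside split: split_indicator)
  moreover have "2 * u p * g p + d p * (u p)\<^sup>2 - d p * (2 * u p * u p) = 2 * (u p * g p) - d p * (u p)\<^sup>2" for p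
    by (simp add: power2_eq_square)
  ultimately show ?thesis by simp
qed

section \<open>Borel representatives of the data and the polyhedral boundary\<close>

lemma borel_representative:
  fixes f :: "'b::euclidean_space \<Rightarrow> real"
  assumes f: "set_borel_measurable lebesgue S f" and S: "S \<in> sets borel"
  obtains f' where "f' \<in> borel_measurable borel" "\<And>p. p \<notin> S \<Longrightarrow> f' p = 0" "AE p in lborel. p \<in> S \<longrightarrow> f p = f' p"
proof -
  obtain g where g: "g \<in> borel_measurable lborel" "AE p in lborel. indicator S p *\<^sub>R f p = g p"
    using completion_ex_borel_measurable_real f unfolding set_borel_measurable_def by blast
  show ?thesis
  proof (rule that)
    show "(\<lambda>p. indicator S p * g p) \<in> borel_measurable borel" using g(1) S by auto
    show "AE p in lborel. p \<in> S \<longrightarrow> f p = indicator S p * g p"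
      using g(2) by eventually_elim auto
  qed simp
qed

lemma Linf_representative:
  fixes f :: "'b::euclidean_space \<Rightarrow> real"
  assumes f: "Linf_on S f" and S: "S \<in> sets borel"
  obtains f' C where "f' \<in> borel_measurable borel" "\<And>p. p \<notin> S \<Longrightarrow> f' p = 0" "AE p in lborel. p \<in> S \<longrightarrow> f p = f' p"
    "0 \<le> C" "\<And>p. \<bar>f' p\<bar> \<le> C"
proof -
  obtain g where g: "g \<in> borel_measurable borel" "\<And>p. p \<notin> S \<Longrightarrow> g p = 0" "AE p in lborel. p \<in> S \<longrightarrow> f p = g p"
    using borel_representative f S unfolding Linf_on_def by metis
  obtain C0 where C0: "AE p in lborel. p \<in> S \<longrightarrow> \<bar>f p\<bar> \<le> C0"
    using f unfolding Linf_on_def AE_completion_iff by blast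
  define C where "C = max 0 C0"
  show ?thesis
  \<comment> \<open>Clipping at the essential bound turns an almost everywhere bound into an
    everywhere one; as 0 lies between the clipping values, vanishing outside \<open>S\<close>
    survives.\<close>
  proof (rule that[of "\<lambda>p. max (- C) (min C (g p))" C])
    show "(\<lambda>p. max (- C) (min C (g p))) \<in> borel_measurable borel" using g(1) by simp
    show "max (- C) (min C (g p)) = 0" if "p \<notin> S" for p using g(2)[OF that] by (simp add: C_def)
    show "AE p in lborel. p \<in> S \<longrightarrow> f p = max (- C) (min C (g p))"
      using g(3) C0 by eventually_elim (auto simp: C_def)
  qed (auto simp: C_def)
qed

lemma lebesgue_integral_representative:
  fixes F F' :: "'b::euclidean_space \<Rightarrow> real"
  assumes ae: "AE p in lborel. F p = F' p" and F': "F' \<in> borel_measurable borel"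
  shows "integral\<^sup>L lebesgue F = integral\<^sup>L lborel F'" "integrable lebesgue F \<longleftrightarrow> integrable lborel F'"
proof -
  have m': "F' \<in> borel_measurable lebesgue" using F' by (simp add: measurable_completion)
  have ae': "AE p in lebesgue. F' p = F p" "AE p in lebesgue. F p = F' p"
    using AE_completion[OF ae] by (auto elim: eventually_mono)
  have m: "F \<in> borel_measurable lebesgue" by (rule borel_measurable_AE[OF m' ae'(1)])
  show "integral\<^sup>L lebesgue F = integral\<^sup>L lborel F'"
    using integral_cong_AE[OF m m' ae'(2)] F' by (simp add: integral_completion)
  show "integrable lebesgue F \<longleftrightarrow> integrable lborel F'"
    using integrable_cong_AE[OF m m' ae'(2)] F' by (simp add: integrable_completion)
qed

lemma set_lebesgue_integral_representative:
  fixes F F' :: "'b::euclidean_space \<Rightarrow> real"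
  assumes "AE p in lborel. p \<in> S \<longrightarrow> F p = F' p" "F' \<in> borel_measurable borel" "\<And>p. p \<notin> S \<Longrightarrow> F' p = 0"
  shows "(LINT p:S|lebesgue. F p) = integral\<^sup>L lborel F'" "set_integrable lebesgue S F \<longleftrightarrow> integrable lborel F'"
proof -
  have "AE p in lborel. indicator S p *\<^sub>R F p = F' p"
    using assms(1) by eventually_elim (auto simp: assms(3) split: split_indicator)
  from lebesgue_integral_representative[OF this assms(2)]
  show "(LINT p:S|lebesgue. F p) = integral\<^sup>L lborel F'" "set_integrable lebesgue S F \<longleftrightarrow> integrable lborel F'"
    by (auto simp: set_lebesgue_integral_def set_integrable_def)
qed

text \<open>A Borel null set \<open>N\<close> of space-time carries all exceptional points. For
  almost every t its section is null in x, so the section of \<open>F\<close> agrees there with a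
  Borel function almost everywhere, which settles measurability and value of the inner integral at
  once.\<close>

lemma iterated_lebesgue_integral:
  fixes F F' :: "'a::euclidean_space \<times> real \<Rightarrow> real"
  assumes ae: "AE p in lborel. p \<in> \<Omega> \<times> I \<longrightarrow> F p = F' p" and F': "integrable lborel F'"
    and out: "\<And>p. p \<notin> \<Omega> \<times> I \<Longrightarrow> F' p = 0"
  shows "(LINT t:I|lebesgue. LINT x:\<Omega>|lebesgue. F (x, t)) = integral\<^sup>L lborel F'"
proof -
  have [measurable]: "F' \<in> borel_measurable borel" using F' by auto
  obtain N where N: "N \<in> null_sets lborel" "{p \<in> space lborel. \<not> (p \<in> \<Omega> \<times> I \<longrightarrow> F p = F' p)} \<subseteq> N"
    using ae unfolding eventually_ae_filter by blast
  have [measurable]: "N \<in> sets borel" using N(1) by auto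
  have "AE p in lborel \<Otimes>\<^sub>M lborel. p \<notin> N" unfolding lborel_prod by (rule AE_not_in[OF N(1)])
  from lborel_pair.AE_pair[OF this] have "AE x in lborel. AE t in lborel. (x, t) \<notin> N" .
  moreover have "{p \<in> space (lborel \<Otimes>\<^sub>M lborel). (fst p, snd p) \<notin> N} \<in> sets (lborel \<Otimes>\<^sub>M lborel)"
    unfolding lborel_prod by simp
  ultimately have "AE t in lborel. AE x in lborel. (x, t) \<notin> N"
    by (subst (asm) lborel_pair.AE_commute) auto
  then have "AE t in lborel. t \<in> I \<longrightarrow> (LINT x:\<Omega>|lebesgue. F (x, t)) = (LINT x|lborel. F' (x, t))"
  proof eventually_elim
    case (elim t)
    show ?case
    proof
      assume t: "t \<in> I"
      have "AE x in lborel. x \<in> \<Omega> \<longrightarrow> F (x, t) = F' (x, t)"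
        using elim by eventually_elim (use N(2) t in auto)
      then show "(LINT x:\<Omega>|lebesgue. F (x, t)) = (LINT x|lborel. F' (x, t))"
        by (rule set_lebesgue_integral_representative(1)) (auto simp: out)
    qed
  qed
  then have "(LINT t:I|lebesgue. LINT x:\<Omega>|lebesgue. F (x, t)) = (LINT t|lborel. LINT x|lborel. F' (x, t))"
  proof (rule set_lebesgue_integral_representative(1))
    show "(\<lambda>t. LINT x|lborel. F' (x, t)) \<in> borel_measurable borel" by measurable
    show "(LINT x|lborel. F' (x, t)) = 0" if "t \<notin> I" for t using that by (simp add: out)
  qed
  also have "\<dots> = integral\<^sup>L lborel F'"
  proof -
    have "integrable (lborel \<Otimes>\<^sub>M lborel) (case_prod (\<lambda>x t. F' (x, t)))" using F' by (simp add: lborel_prod)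
    from lborel_pair.integral_snd[OF this] show ?thesis by (simp add: lborel_prod)
  qed
  finally show ?thesis .
qed

text \<open>A boundary point of a finite intersection of closed half-spaces is a boundary point of
  one of them, since it would otherwise be interior to all. Finite unions, and passing to the
  interior, create no new boundary points.\<close>

lemma polyhedral_domain_planes:
  fixes \<Omega> :: "'a::euclidean_space set"
  assumes "polyhedral_domain \<Omega>"
  obtains C J where "closed C" "\<Omega> = interior C" "finite J" "\<And>a b. (a, b) \<in> J \<Longrightarrow> a \<noteq> 0"
    "frontier \<Omega> \<subseteq> (\<Union>(a, b)\<in>J. {x. a \<bullet> x = b})"
proof -
  obtain F where F: "finite F" "\<And>P. P \<in> F \<Longrightarrow> polytope P" "\<Omega> = interior (\<Union>F)"
    using assms unfolding polyhedral_domain_def by blast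
  have closed: "closed P" if "P \<in> F" for P using F(2)[OF that] polytope_imp_closed by blast
  have "\<exists>J. finite J \<and> (\<forall>(a, b)\<in>J. a \<noteq> 0) \<and> frontier P \<subseteq> (\<Union>(a, b)\<in>J. {x. a \<bullet> x = b})" if P: "P \<in> F" for P
  proof -
    have "polyhedron P" using F(2)[OF P] polytope_imp_polyhedron by blast
    then obtain H where H: "finite H" "P = \<Inter>H" "\<And>h. h \<in> H \<Longrightarrow> \<exists>a b. a \<noteq> 0 \<and> h = {x. a \<bullet> x \<le> b}"
      unfolding polyhedron_def by metis
    then obtain a b where ab: "\<And>h. h \<in> H \<Longrightarrow> a h \<noteq> 0 \<and> h = {x. a h \<bullet> x \<le> b h}" by metis
    have "frontier P \<subseteq> (\<Union>h\<in>H. frontier h)"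
    proof
      fix x assume x: "x \<in> frontier P"
      then have "x \<in> P" "x \<notin> interior P" using closed[OF P] by (auto simp: frontier_def)
      have "\<exists>h\<in>H. x \<notin> interior h"
      proof (rule ccontr)
        assume "\<not> (\<exists>h\<in>H. x \<notin> interior h)"
        then have "x \<in> (\<Inter>h\<in>H. interior h)" by blast
        moreover have "open (\<Inter>h\<in>H. interior h)" using H(1) by (intro open_INT) auto
        moreover have "(\<Inter>h\<in>H. interior h) \<subseteq> P" unfolding H(2) using interior_subset by fastforce
        ultimately have "x \<in> interior P" by (rule_tac interiorI)
        then show False using \<open>x \<notin> interior P\<close> by simp
      qed
      then obtain h where h: "h \<in> H" "x \<notin> interior h" by blast
      moreover have "x \<in> closure h" using \<open>x \<in> P\<close> H(2) h(1) closure_subset by blast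
      ultimately show "x \<in> (\<Union>h\<in>H. frontier h)" by (auto simp: frontier_def)
    qed
    also have "\<dots> \<subseteq> (\<Union>(a, b)\<in>(\<lambda>h. (a h, b h)) ` H. {x. a \<bullet> x = b})"
    proof
      fix x assume "x \<in> (\<Union>h\<in>H. frontier h)"
      then obtain h where h: "h \<in> H" "x \<in> frontier h" by blast
      have "frontier h = {x. a h \<bullet> x = b h}" using ab[OF h(1)] frontier_halfspace_le[of "a h" "b h"] by metis
      then show "x \<in> (\<Union>(a, b)\<in>(\<lambda>h. (a h, b h)) ` H. {x. a \<bullet> x = b})" using h by auto
    qed
    finally show ?thesis using H(1) ab by (intro exI[of _ "(\<lambda>h. (a h, b h)) ` H"]) auto
  qed
  then obtain J where J: "\<And>P. P \<in> F \<Longrightarrow> finite (J P) \<and> (\<forall>(a, b)\<in>J P. a \<noteq> 0) \<and> frontier P \<subseteq> (\<Union>(a, b)\<in>J P. {x. a \<bullet> x = b})"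
    by metis
  show ?thesis
  proof (rule that)
    show "closed (\<Union>F)" using F(1) closed by (intro closed_Union) auto
    show "\<Omega> = interior (\<Union>F)" by (rule F(3))
    show "finite (\<Union>P\<in>F. J P)" using F(1) J by auto
    show "a \<noteq> 0" if "(a, b) \<in> (\<Union>P\<in>F. J P)" for a b using that J by blast
    have "frontier \<Omega> \<subseteq> frontier (\<Union>F)"
      unfolding F(3) by (rule frontier_interior_subset)
    also have "\<dots> \<subseteq> (\<Union>P\<in>F. frontier P)" using frontier_Union_subset[OF F(1)] .
    also have "\<dots> \<subseteq> (\<Union>(a, b)\<in>(\<Union>P\<in>F. J P). {x. a \<bullet> x = b})" using J by blast
    finally show "frontier \<Omega> \<subseteq> (\<Union>(a, b)\<in>(\<Union>P\<in>F. J P). {x. a \<bullet> x = b})" .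
  qed
qed

lemma weak_deriv_representative:
  fixes S :: "'b::euclidean_space set"
  assumes w: "has_weak_deriv_on S e g h" and S: "S \<in> sets borel"
    and g: "AE p in lborel. p \<in> S \<longrightarrow> g p = g' p" "g' \<in> borel_measurable borel" "\<And>p. p \<notin> S \<Longrightarrow> g' p = 0"
    and h: "AE p in lborel. p \<in> S \<longrightarrow> h p = h' p" "h' \<in> borel_measurable borel" "\<And>p. p \<notin> S \<Longrightarrow> h' p = 0"
    and k: "k > 0" and ab: "cbox a b \<subseteq> S"
  shows "(LINT p|lborel. g' p * pderiv_dir e (box_bump k a b) p) = - (LINT p|lborel. h' p * box_bump k a b p)"
proof -
  have "(LINT p:S|lebesgue. g p * pderiv_dir e (box_bump k a b) p) = - (LINT p:S|lebesgue. h p * box_bump k a b p)"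
    using w test_function_box_bump[OF k ab] unfolding has_weak_deriv_on_def by blast
  moreover have "(LINT p:S|lebesgue. g p * pderiv_dir e (box_bump k a b) p) = (LINT p|lborel. g' p * pderiv_dir e (box_bump k a b) p)"
    by (rule set_lebesgue_integral_representative(1)) (use g in \<open>auto elim: eventually_mono\<close>)
  moreover have "(LINT p:S|lebesgue. h p * box_bump k a b p) = (LINT p|lborel. h' p * box_bump k a b p)"
    by (rule set_lebesgue_integral_representative(1)) (use h in \<open>auto elim: eventually_mono\<close>)
  ultimately show ?thesis by simp
qed

text \<open>The weak divergence comes with its own partial derivatives, known only to be locally
  integrable, while \<open>D\<close> will stem from the Lipschitz hypothesis on v. Both satisfy the
  same weak identities, so their sums agree against every bump, and \<open>du_Bois_Reymond\<close>
  identifies them.\<close>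

lemma weak_div_unique:
  fixes S :: "('a::euclidean_space \<times> real) set"
  assumes div: "has_weak_div_on S v d" and S: "open S" "bounded S"
    and v: "\<And>i. i \<in> Basis \<Longrightarrow> AE p in lborel. p \<in> S \<longrightarrow> v p \<bullet> i = V p \<bullet> i" "V \<in> borel_measurable borel" "\<And>p. p \<notin> S \<Longrightarrow> V p = 0"
    and D: "\<And>i. i \<in> Basis \<Longrightarrow> integrable lborel (D i)" "\<And>i p. i \<in> Basis \<Longrightarrow> p \<notin> S \<Longrightarrow> D i p = 0"
    and weak_D: "\<And>i k a b. i \<in> Basis \<Longrightarrow> k > 0 \<Longrightarrow> cbox a b \<subseteq> S \<Longrightarrow>
      (LINT p|lborel. (V p \<bullet> i) * pderiv_dir (i, 0) (box_bump k a b) p) = - (LINT p|lborel. D i p * box_bump k a b p)"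
    and d: "AE p in lborel. p \<in> S \<longrightarrow> d p = d' p" "integrable lborel d'" "\<And>p. p \<notin> S \<Longrightarrow> d' p = 0"
  shows "AE p in lborel. (\<Sum>i\<in>Basis. D i p) = d' p"
proof -
  have Sb: "S \<in> sets borel" using S by simp
  obtain h where h: "\<And>i. i \<in> Basis \<Longrightarrow> has_weak_deriv_on S (i, 0) (\<lambda>p. v p \<bullet> i) (h i)" "AE p\<in>S in lebesgue. (\<Sum>i\<in>Basis. h i p) = d p"
    using div unfolding has_weak_div_on_def by blast
  have sum_h: "AE p in lborel. p \<in> S \<longrightarrow> (\<Sum>i\<in>Basis. h i p) = d p" using h(2) unfolding AE_completion_iff .
  have "AE p in lborel. p \<in> S \<longrightarrow> (\<Sum>i\<in>Basis. D i p) - d' p = 0"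
  proof (rule du_Bois_Reymond[OF _ S(1)])
    show "integrable lborel (\<lambda>p. (\<Sum>i\<in>Basis. D i p) - d' p)"
      using D(1) d(2) by (intro Bochner_Integration.integrable_diff Bochner_Integration.integrable_sum) auto
    fix k :: real and a b :: "'a \<times> real" assume k: "k > 0" and ab: "cbox a b \<subseteq> S"
    let ?\<phi> = "box_bump k a b"
    have tf: "test_function S ?\<phi>" by (rule test_function_box_bump[OF k ab])
    have \<phi>0: "?\<phi> p = 0" if "p \<notin> cbox a b" for p
      using that box_bump_eq_0_iff[OF k, of a b p] box_subset_cbox[of a b] by auto
    have loc: "set_integrable lebesgue (cbox a b) (h i)" if "i \<in> Basis" for i
      using h(1)[OF that] ab unfolding has_weak_deriv_on_def locally_integrable_on_def by auto
    \<comment> \<open>The bump confines the product to the closed box, where local integrability of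
      \<open>h i\<close> is enough.\<close>
    have hi: "set_integrable lebesgue S (\<lambda>p. h i p * ?\<phi> p)" if i: "i \<in> Basis" for i
    proof -
      have "integrable lebesgue (\<lambda>p. indicator (cbox a b) p *\<^sub>R h i p * ?\<phi> p)"
      proof (rule Bochner_Integration.integrable_bound[OF loc[OF i, unfolded set_integrable_def]])
        show "(\<lambda>p. indicator (cbox a b) p *\<^sub>R h i p * ?\<phi> p) \<in> borel_measurable lebesgue"
        proof (rule borel_measurable_times)
          show "(\<lambda>p. indicator (cbox a b) p *\<^sub>R h i p) \<in> borel_measurable lebesgue"
            by (rule borel_measurable_integrable[OF loc[OF i, unfolded set_integrable_def]])
          show "?\<phi> \<in> borel_measurable lebesgue"
            by (rule measurable_completion) simp
        qed
        show "AE p in lebesgue. norm (indicator (cbox a b) p *\<^sub>R h i p * ?\<phi> p) \<le> norm (indicator (cbox a b) p *\<^sub>R h i p)"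
          by (intro AE_I2) (simp add: abs_mult box_bump_nonneg box_bump_le_1 mult_left_le)
      qed
      moreover have "(\<lambda>p. indicator (cbox a b) p *\<^sub>R h i p * ?\<phi> p) = (\<lambda>p. indicator S p *\<^sub>R (h i p * ?\<phi> p))"
        using \<phi>0 ab by (auto simp: fun_eq_iff split: split_indicator)
      ultimately show ?thesis unfolding set_integrable_def by (simp only:)
    qed
    have eq: "(LINT p:S|lebesgue. h i p * ?\<phi> p) = (LINT p|lborel. D i p * ?\<phi> p)" if i: "i \<in> Basis" for i
    proof -
      have "(LINT p:S|lebesgue. (v p \<bullet> i) * pderiv_dir (i, 0) ?\<phi> p) = - (LINT p:S|lebesgue. h i p * ?\<phi> p)"
        using h(1)[OF i] tf unfolding has_weak_deriv_on_def by blast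
      moreover have "(LINT p:S|lebesgue. (v p \<bullet> i) * pderiv_dir (i, 0) ?\<phi> p) = (LINT p|lborel. (V p \<bullet> i) * pderiv_dir (i, 0) ?\<phi> p)"
        by (rule set_lebesgue_integral_representative(1)) (use v(1)[OF i] v(2,3) in \<open>auto elim: eventually_mono\<close>)
      ultimately show ?thesis using weak_D[OF i k ab] by simp
    qed
    have bint: "integrable lborel (\<lambda>p. f p * ?\<phi> p)" if "integrable lborel f" for f
      using integrable_bounded_mult[OF that, of ?\<phi> 1] by (simp add: box_bump_nonneg box_bump_le_1 mult.commute)
    have "(LINT p|lborel. d' p * ?\<phi> p) = (LINT p:S|lebesgue. (\<Sum>i\<in>Basis. h i p * ?\<phi> p))"
    proof (rule set_lebesgue_integral_representative(1)[symmetric])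
      show "AE p in lborel. p \<in> S \<longrightarrow> (\<Sum>i\<in>Basis. h i p * ?\<phi> p) = d' p * ?\<phi> p"
        using sum_h d(1) by eventually_elim (auto simp: sum_distrib_right[symmetric])
    qed (use d(2,3) in auto)
    also have "\<dots> = (\<Sum>i\<in>Basis. LINT p:S|lebesgue. h i p * ?\<phi> p)"
      using hi unfolding set_lebesgue_integral_def set_integrable_def scaleR_sum_right
      by (intro Bochner_Integration.integral_sum) auto
    also have "\<dots> = (\<Sum>i\<in>Basis. LINT p|lborel. D i p * ?\<phi> p)" using eq by simp
    also have "\<dots> = (LINT p|lborel. (\<Sum>i\<in>Basis. D i p * ?\<phi> p))"
      using bint[OF D(1)] by (intro Bochner_Integration.integral_sum[symmetric]) auto
    finally have "(LINT p|lborel. (\<Sum>i\<in>Basis. D i p) * ?\<phi> p) = (LINT p|lborel. d' p * ?\<phi> p)"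
      by (simp add: sum_distrib_right)
    then show "(LINT p|lborel. ((\<Sum>i\<in>Basis. D i p) - d' p) * ?\<phi> p) = 0"
      using bint[OF d(2)] bint[OF Bochner_Integration.integrable_sum[OF D(1)], of Basis "\<lambda>i. i"] D(1)
      by (simp add: left_diff_distrib bint)
  qed
  then show ?thesis
    by eventually_elim (use D(2) d(3) in \<open>case_tac "p \<in> S"; auto\<close>)
qed

text \<open>On a bounded set square integrability gives the integrability that mollification in L1
  asks for, through 2 |f| \<le> 1 + f^2.\<close>

lemma L2_representative:
  fixes f :: "'b::euclidean_space \<Rightarrow> real"
  assumes f: "L2_on S f" and S: "S \<in> sets borel" "bounded S"
  obtains f' where "f' \<in> borel_measurable borel" "\<And>p. p \<notin> S \<Longrightarrow> f' p = 0" "AE p in lborel. p \<in> S \<longrightarrow> f p = f' p"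
    "integrable lborel f'" "integrable lborel (\<lambda>p. (f' p)\<^sup>2)"
proof -
  obtain f' where f': "f' \<in> borel_measurable borel" "\<And>p. p \<notin> S \<Longrightarrow> f' p = 0" "AE p in lborel. p \<in> S \<longrightarrow> f p = f' p"
    using borel_representative f S(1) unfolding L2_on_def by metis
  have "AE p in lborel. p \<in> S \<longrightarrow> (f p)\<^sup>2 = (f' p)\<^sup>2" using f'(3) by eventually_elim auto
  from set_lebesgue_integral_representative(2)[OF this] have sq: "integrable lborel (\<lambda>p. (f' p)\<^sup>2)"
    using f f' unfolding L2_on_def by simp
  have iS: "integrable lborel (indicator S :: 'b \<Rightarrow> real)"
    using emeasure_bounded_finite[OF S(2)] S(1) by (simp add: integrable_indicator_iff)
  have "integrable lborel f'"
  proof (rule Bochner_Integration.integrable_bound[OF Bochner_Integration.integrable_add[OF iS sq]])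
    show "AE p in lborel. norm (f' p) \<le> norm (indicator S p + (f' p)\<^sup>2)"
    proof (rule AE_I2)
      fix p
      have "2 * \<bar>f' p\<bar> \<le> 1 + (f' p)\<^sup>2" using zero_le_power2[of "\<bar>f' p\<bar> - 1"] by (simp add: power2_diff)
      then show "norm (f' p) \<le> norm (indicator S p + (f' p)\<^sup>2)"
        using f'(2)[of p] by (cases "p \<in> S") auto
    qed
  qed (use f' in auto)
  with f' sq show ?thesis by (intro that)
qed

section \<open>The energy identity for the original data\<close>

theorem lemma2p2:
  fixes \<Omega> :: "'a::euclidean_space set"
    and T :: real
    and u_ini :: "'a \<Rightarrow> real"
    and f qI qP u :: "'a \<times> real \<Rightarrow> real"
    and v :: "'a \<times> real \<Rightarrow> 'a"
  assumes "open \<Omega>" and "bounded \<Omega>" and "connected \<Omega>" and "polyhedral_domain \<Omega>"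
    and "T > 0"
    and "L2_on \<Omega> u_ini"
    and "L2_on (\<Omega> \<times> {0<..<T}) f"
    and "Linf_on (\<Omega> \<times> {0<..<T}) qI"
    and "Linf_on (\<Omega> \<times> {0<..<T}) qP"
    and "AE p\<in>\<Omega> \<times> {0<..<T} in lebesgue. qI p \<ge> 0"
    and "AE p\<in>\<Omega> \<times> {0<..<T} in lebesgue. qP p \<ge> 0"
    and "\<forall>i\<in>Basis. W1inf_on (\<Omega> \<times> {0<..<T}) (\<lambda>p. v p \<bullet> i)"
    and "no_normal_flux \<Omega> T v"
    and "has_weak_div_on (\<Omega> \<times> {0<..<T}) v (\<lambda>p. qI p - qP p)"
    and "weak_solution \<Omega> T u_ini f qI qP v u"
  shows "1 / 2 * (LINT t:{0<..<T}|lebesgue. LINT x:\<Omega>|lebesgue. (u (x, t))\<^sup>2)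
       + 1 / 2 * (LINT t:{0<..<T}|lebesgue. (T - t) *
                    (LINT x:\<Omega>|lebesgue. (qI (x, t) + qP (x, t)) * (u (x, t))\<^sup>2))
       = T / 2 * (LINT x:\<Omega>|lebesgue. (u_ini x)\<^sup>2)
       + (LINT t:{0<..<T}|lebesgue. (T - t) *
            (LINT x:\<Omega>|lebesgue. f (x, t) * qI (x, t) * u (x, t)))"
proof -
  let ?Q = "\<Omega> \<times> {0<..<T}"
  have oQ: "open ?Q" and bQ: "bounded ?Q" using assms(1,2) by (auto intro: open_Times bounded_Times)
  then have [measurable]: "?Q \<in> sets borel" "\<Omega> \<in> sets borel" using assms(1) by auto
  obtain u0' where u0': "u0' \<in> borel_measurable borel" "\<And>x. x \<notin> \<Omega> \<Longrightarrow> u0' x = 0" "AE x in lborel. x \<in> \<Omega> \<longrightarrow> u_ini x = u0' x"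
    "integrable lborel u0'" "integrable lborel (\<lambda>x. (u0' x)\<^sup>2)"
    using L2_representative[OF assms(6) _ assms(2)] by auto
  obtain f' where f': "f' \<in> borel_measurable borel" "\<And>p. p \<notin> ?Q \<Longrightarrow> f' p = 0" "AE p in lborel. p \<in> ?Q \<longrightarrow> f p = f' p"
    "integrable lborel f'" "integrable lborel (\<lambda>p. (f' p)\<^sup>2)"
    by (rule L2_representative[OF assms(7) _ bQ]) auto
  have "L2_on ?Q u" using assms(15) by (simp add: weak_solution_def)
  then obtain u' where u': "u' \<in> borel_measurable borel" "\<And>p. p \<notin> ?Q \<Longrightarrow> u' p = 0" "AE p in lborel. p \<in> ?Q \<longrightarrow> u p = u' p"
    "integrable lborel u'" "integrable lborel (\<lambda>p. (u' p)\<^sup>2)"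
    by (rule L2_representative[OF _ _ bQ]) auto
  obtain qI' CI where qI': "qI' \<in> borel_measurable borel" "\<And>p. p \<notin> ?Q \<Longrightarrow> qI' p = 0" "AE p in lborel. p \<in> ?Q \<longrightarrow> qI p = qI' p"
    "0 \<le> CI" "\<And>p. \<bar>qI' p\<bar> \<le> CI"
    by (rule Linf_representative[OF assms(8)]) auto
  obtain qP' CP where qP': "qP' \<in> borel_measurable borel" "\<And>p. p \<notin> ?Q \<Longrightarrow> qP' p = 0" "AE p in lborel. p \<in> ?Q \<longrightarrow> qP p = qP' p"
    "0 \<le> CP" "\<And>p. \<bar>qP' p\<bar> \<le> CP"
    by (rule Linf_representative[OF assms(9)]) auto
  note [measurable] = u0'(1) f'(1) u'(1) qI'(1) qP'(1)
  have "\<forall>i\<in>Basis. \<exists>w C. w \<in> borel_measurable borel \<and> (\<forall>p. p \<notin> ?Q \<longrightarrow> w p = 0) \<and> (AE p in lborel. p \<in> ?Q \<longrightarrow> v p \<bullet> i = w p)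
    \<and> 0 \<le> C \<and> (\<forall>p. \<bar>w p\<bar> \<le> C)"
  proof
    fix i :: 'a assume "i \<in> Basis"
    then have "Linf_on ?Q (\<lambda>p. v p \<bullet> i)" using assms(12) by (auto simp: W1inf_on_def)
    then obtain w C where "w \<in> borel_measurable borel" "\<And>p. p \<notin> ?Q \<Longrightarrow> w p = 0" "AE p in lborel. p \<in> ?Q \<longrightarrow> v p \<bullet> i = w p"
      "0 \<le> C" "\<And>p. \<bar>w p\<bar> \<le> C"
      by (rule Linf_representative) auto
    then show "\<exists>w C. w \<in> borel_measurable borel \<and> (\<forall>p. p \<notin> ?Q \<longrightarrow> w p = 0) \<and> (AE p in lborel. p \<in> ?Q \<longrightarrow> v p \<bullet> i = w p)
    \<and> 0 \<le> C \<and> (\<forall>p. \<bar>w p\<bar> \<le> C)" by blast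
  qed
  from bchoice[OF this] obtain w where "\<forall>i\<in>Basis. \<exists>C. w i \<in> borel_measurable borel \<and> (\<forall>p. p \<notin> ?Q \<longrightarrow> w i p = 0) \<and> (AE p in lborel. p \<in> ?Q \<longrightarrow> v p \<bullet> i = w i p)
    \<and> 0 \<le> C \<and> (\<forall>p. \<bar>w i p\<bar> \<le> C)" ..
  from bchoice[OF this] obtain Cw where w0: "\<forall>i\<in>Basis. w i \<in> borel_measurable borel \<and> (\<forall>p. p \<notin> ?Q \<longrightarrow> w i p = 0) \<and> (AE p in lborel. p \<in> ?Q \<longrightarrow> v p \<bullet> i = w i p)
    \<and> 0 \<le> Cw i \<and> (\<forall>p. \<bar>w i p\<bar> \<le> Cw i)" ..
  \<comment> \<open>Representatives are chosen coordinate by coordinate and reassembled, so that one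
    Borel field agrees with v outside a single null set.\<close>
  define V where "V p = (\<Sum>i\<in>Basis. w i p *\<^sub>R i)" for p
  have V_meas [measurable]: "V \<in> borel_measurable borel"
    unfolding V_def[abs_def] using w0 by (intro borel_measurable_sum borel_measurable_scaleR) auto
  have w_out: "w i p = 0" if "i \<in> Basis" "p \<notin> ?Q" for i p using bspec[OF w0 that(1)] that(2) by blast
  have V_out: "V p = 0" if "p \<notin> ?Q" for p
    unfolding V_def using w_out[OF _ that] by (intro sum.neutral) auto
  have V_inner: "V p \<bullet> i = w i p" if "i \<in> Basis" for p i
    using that by (simp add: V_def inner_sum_left inner_Basis if_distrib sum.delta cong: if_cong)
  have V_ae: "AE p in lborel. p \<in> ?Q \<longrightarrow> v p \<bullet> i = V p \<bullet> i" if "i \<in> Basis" for i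
    using w0 that by (simp add: V_inner)
  have V_ae_all: "AE p in lborel. p \<in> ?Q \<longrightarrow> v p = V p"
  proof -
    have "AE p in lborel. \<forall>i\<in>Basis. p \<in> ?Q \<longrightarrow> v p \<bullet> i = V p \<bullet> i"
    proof (rule AE_ball_countable[THEN iffD2])
      show "\<forall>i\<in>Basis. AE p in lborel. p \<in> ?Q \<longrightarrow> v p \<bullet> i = V p \<bullet> i" using V_ae by blast
    qed (simp add: countable_finite)
    then show ?thesis by eventually_elim (auto intro: euclidean_eqI)
  qed
  have V_bound: "norm (V p) \<le> (\<Sum>i\<in>Basis. Cw i)" for p
  proof -
    have "norm (w i p *\<^sub>R i) \<le> Cw i" if "i \<in> Basis" for i using bspec[OF w0 that] that by (simp del: split_paired_All)
    then show ?thesis unfolding V_def by (intro order_trans[OF norm_sum] sum_mono)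
  qed
  have "\<forall>ij\<in>Basis \<times> Basis. \<exists>h C. h \<in> borel_measurable borel \<and> (\<forall>p. p \<notin> ?Q \<longrightarrow> h p = 0) \<and> 0 \<le> C \<and> (\<forall>p. \<bar>h p\<bar> \<le> C) \<and>
    (\<forall>k a b. k > 0 \<longrightarrow> cbox a b \<subseteq> ?Q \<longrightarrow>
      (LINT p|lborel. (V p \<bullet> fst ij) * pderiv_dir (snd ij, 0) (box_bump k a b) p) = - (LINT p|lborel. h p * box_bump k a b p))"
  proof
    fix ij :: "'a \<times> 'a" assume "ij \<in> Basis \<times> Basis"
    then have i: "fst ij \<in> Basis" and j: "(snd ij, 0) \<in> (Basis :: ('a \<times> real) set)" by (auto simp: Basis_prod_def)
    have "W1inf_on ?Q (\<lambda>p. v p \<bullet> fst ij)" using assms(12) i by blast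
    then obtain h where h: "Linf_on ?Q h" "has_weak_deriv_on ?Q (snd ij, 0) (\<lambda>p. v p \<bullet> fst ij) h"
      using j unfolding W1inf_on_def by blast
    obtain h' C where h': "h' \<in> borel_measurable borel" "\<And>p. p \<notin> ?Q \<Longrightarrow> h' p = 0" "AE p in lborel. p \<in> ?Q \<longrightarrow> h p = h' p"
      "0 \<le> C" "\<And>p. \<bar>h' p\<bar> \<le> C"
      by (rule Linf_representative[OF h(1)]) auto
    have "(LINT p|lborel. (V p \<bullet> fst ij) * pderiv_dir (snd ij, 0) (box_bump k a b) p) = - (LINT p|lborel. h' p * box_bump k a b p)"
      if "k > 0" "cbox a b \<subseteq> ?Q" for k a b
      by (rule weak_deriv_representative[OF h(2) _ V_ae[OF i] _ _ h'(3,1,2) that]) (auto simp: V_out)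
    then show "\<exists>h C. h \<in> borel_measurable borel \<and> (\<forall>p. p \<notin> ?Q \<longrightarrow> h p = 0) \<and> 0 \<le> C \<and> (\<forall>p. \<bar>h p\<bar> \<le> C) \<and>
    (\<forall>k a b. k > 0 \<longrightarrow> cbox a b \<subseteq> ?Q \<longrightarrow>
      (LINT p|lborel. (V p \<bullet> fst ij) * pderiv_dir (snd ij, 0) (box_bump k a b) p) = - (LINT p|lborel. h p * box_bump k a b p))"
      using h' by blast
  qed
  from bchoice[OF this] obtain D0 where "\<forall>ij\<in>Basis \<times> Basis. \<exists>C. D0 ij \<in> borel_measurable borel \<and> (\<forall>p. p \<notin> ?Q \<longrightarrow> D0 ij p = 0) \<and> 0 \<le> C \<and> (\<forall>p. \<bar>D0 ij p\<bar> \<le> C) \<and>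
    (\<forall>k a b. k > 0 \<longrightarrow> cbox a b \<subseteq> ?Q \<longrightarrow>
      (LINT p|lborel. (V p \<bullet> fst ij) * pderiv_dir (snd ij, 0) (box_bump k a b) p) = - (LINT p|lborel. D0 ij p * box_bump k a b p))" ..
  from bchoice[OF this] obtain CD where D0: "\<forall>ij\<in>Basis \<times> Basis. D0 ij \<in> borel_measurable borel \<and> (\<forall>p. p \<notin> ?Q \<longrightarrow> D0 ij p = 0) \<and> 0 \<le> CD ij \<and> (\<forall>p. \<bar>D0 ij p\<bar> \<le> CD ij) \<and>
    (\<forall>k a b. k > 0 \<longrightarrow> cbox a b \<subseteq> ?Q \<longrightarrow>
      (LINT p|lborel. (V p \<bullet> fst ij) * pderiv_dir (snd ij, 0) (box_bump k a b) p) = - (LINT p|lborel. D0 ij p * box_bump k a b p))" ..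
  define D where "D i j = D0 (i, j)" for i j
  \<comment> \<open>One bound for the velocity, its divergence and all its derivatives, as the
    locale \<open>transport\<close> asks; a sum of nonnegative bounds dominates each of
    them.\<close>
  define M where "M = (\<Sum>i\<in>Basis. Cw i) + (CI + CP) + (\<Sum>ij\<in>Basis \<times> Basis. CD ij)"
  have D: "D i j \<in> borel_measurable borel" "\<And>p. p \<notin> ?Q \<Longrightarrow> D i j p = 0" "\<And>p. \<bar>D i j p\<bar> \<le> CD (i, j)"
    "\<And>k a b. k > 0 \<Longrightarrow> cbox a b \<subseteq> ?Q \<Longrightarrow> (LINT p|lborel. (V p \<bullet> i) * pderiv_dir (j, 0) (box_bump k a b) p) = - (LINT p|lborel. D i j p * box_bump k a b p)"
    if "i \<in> Basis" "j \<in> Basis" for i j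
    using bspec[OF D0 SigmaI[OF that]] unfolding D_def fst_conv snd_conv by blast+
  have nn: "0 \<le> (\<Sum>i\<in>Basis. Cw i)" "0 \<le> CI + CP" "0 \<le> (\<Sum>ij\<in>Basis \<times> Basis. CD ij)"
    using w0 D0 qI'(4) qP'(4) by (auto intro!: sum_nonneg)
  have CD_le: "CD (i, j) \<le> M" if "i \<in> Basis" "j \<in> Basis" for i j
  proof -
    have "CD (i, j) \<le> (\<Sum>ij\<in>Basis \<times> Basis. CD ij)"
      using that D0 by (intro member_le_sum) auto
    then show ?thesis using nn by (simp add: M_def)
  qed
  define g' where "g' p = f' p * qI' p - u' p * qP' p" for p
  define d' where "d' p = qI' p - qP' p" for p
  have fq: "integrable lborel (\<lambda>p. qI' p * f' p)" and uq: "integrable lborel (\<lambda>p. qP' p * u' p)"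
    by (rule integrable_bounded_mult[OF f'(4) qI'(1,5)], rule integrable_bounded_mult[OF u'(4) qP'(1,5)])
  have g'_int: "integrable lborel g'"
    unfolding g'_def[abs_def] using fq uq by (intro Bochner_Integration.integrable_diff) (simp_all add: mult.commute)
  have d'_bound: "\<bar>d' p\<bar> \<le> CI + CP" for p
    unfolding d'_def using qI'(5)[of p] qP'(5)[of p] by linarith
  have bdd_int: "integrable lborel h" if "h \<in> borel_measurable borel" "\<And>p. \<bar>h p\<bar> \<le> K" "\<And>p. p \<notin> ?Q \<Longrightarrow> h p = 0" for h :: "'a \<times> real \<Rightarrow> real" and K
  proof -
    have "integrable lborel (indicator ?Q :: 'a \<times> real \<Rightarrow> real)"
      using emeasure_bounded_finite[OF bQ] by (simp add: integrable_indicator_iff)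
    from integrable_bounded_mult[OF this that(1,2)] have "integrable lborel (\<lambda>p. h p * indicator ?Q p)" .
    moreover have "h p * indicator ?Q p = h p" for p using that(3) by (cases "p \<in> ?Q") auto
    ultimately show ?thesis by simp
  qed
  have D_int: "integrable lborel (D i j)" if "i \<in> Basis" "j \<in> Basis" for i j
    by (rule bdd_int[OF D(1)[OF that] D(3)[OF that] D(2)[OF that]])
  have d'_meas: "d' \<in> borel_measurable borel" unfolding d'_def[abs_def] by measurable
  have d'_out: "d' p = 0" if "p \<notin> ?Q" for p using qI'(2)[OF that] qP'(2)[OF that] by (simp add: d'_def)
  have div': "AE p in lborel. (\<Sum>i\<in>Basis. D i i p) = d' p"
  proof (rule weak_div_unique[OF assms(14) oQ bQ V_ae V_meas V_out])
    show "AE p in lborel. p \<in> ?Q \<longrightarrow> qI p - qP p = d' p"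
      using qI'(3) qP'(3) by eventually_elim (auto simp: d'_def)
    show "integrable lborel d'" by (rule bdd_int[OF d'_meas d'_bound d'_out])
  qed (use D D_int d'_out in auto)
  have cont_bdd: "\<exists>K\<ge>0. \<forall>p\<in>?Q. norm (h p) \<le> K" if "continuous_on UNIV h" for h :: "'a \<times> real \<Rightarrow> 'c::real_normed_vector"
  proof -
    have "bounded (h ` closure ?Q)"
      using bQ by (intro compact_imp_bounded compact_continuous_image continuous_on_subset[OF that]) (auto simp: compact_closure)
    then obtain K where "K > 0" "\<forall>y\<in>h ` closure ?Q. norm y \<le> K" unfolding bounded_pos by blast
    then show ?thesis using closure_subset[of ?Q] by (intro exI[of _ K]) auto
  qed
  have tr: "transport \<Omega> T M u0' u' g' d' V D"
  proof
    show "open \<Omega>" "bounded \<Omega>" "0 < T" by (fact assms)+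
    show "integrable lborel u0'" "integrable lborel u'" "integrable lborel g'" by (fact u0' u' g'_int)+
    show "V \<in> borel_measurable borel" "d' \<in> borel_measurable borel" by (fact V_meas d'_meas)+
    show "norm (V p) \<le> M" for p using V_bound[of p] nn by (simp add: M_def)
    show "\<bar>d' p\<bar> \<le> M" for p using d'_bound[of p] nn by (simp add: M_def)
    show "D i j \<in> borel_measurable borel" if "i \<in> Basis" "j \<in> Basis" for i j by (rule D(1)[OF that])
    show "\<bar>D i j p\<bar> \<le> M" if "i \<in> Basis" "j \<in> Basis" for i j p using D(3)[OF that, of p] CD_le[OF that] by linarith
    show "u' p = 0" "g' p = 0" "V p = 0" "d' p = 0" if "p \<notin> ?Q" for p
      using u'(2)[OF that] f'(2)[OF that] V_out[OF that] d'_out[OF that] by (auto simp: g'_def)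
    show "D i j p = 0" if "i \<in> Basis" "j \<in> Basis" "p \<notin> ?Q" for i j p by (rule D(2)[OF that])
    show "(LINT p|lborel. (V p \<bullet> i) * pderiv_dir (j, 0) (box_bump k a b) p) = - (LINT p|lborel. D i j p * box_bump k a b p)"
      if "i \<in> Basis" "j \<in> Basis" "k > 0" "cbox a b \<subseteq> ?Q" for i j k a b by (rule D(4)[OF that])
    show "AE p in lborel. (\<Sum>i\<in>Basis. D i i p) = d' p" by (rule div')
    fix \<phi> :: "'a \<times> real \<Rightarrow> real" assume tf: "test_function (UNIV \<times> {..<T}) \<phi>"
    then have sm: "smooth \<phi>" by (simp add: test_function_def)
    have c: "continuous_on UNIV \<phi>" "continuous_on UNIV (dt \<phi>)" "continuous_on UNIV (grad_x \<phi>)"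
      unfolding dt_def grad_x_def[abs_def] using sm
      by (auto intro!: smooth_continuous smooth_pderiv_continuous continuous_intros)
    note [measurable] = c[THEN borel_measurable_continuous_onI]
    have iu: "integrable lborel (\<lambda>p. y p * h p)" if y: "integrable lborel y" "\<And>p. p \<notin> ?Q \<Longrightarrow> y p = 0" and h: "h \<in> borel_measurable borel" "\<exists>K\<ge>0. \<forall>p\<in>?Q. norm (h p) \<le> K" for y h :: "'a \<times> real \<Rightarrow> real"
    proof -
      obtain K where K: "K \<ge> 0" "\<forall>p\<in>?Q. norm (h p) \<le> K" using h(2) by blast
      have "integrable lborel (\<lambda>p. (indicator ?Q p * h p) * y p)"
        by (rule integrable_bounded_mult[OF y(1), where C=K]) (use h(1) K in \<open>auto split: split_indicator\<close>)
      moreover have "(indicator ?Q p * h p) * y p = y p * h p" for p using y(2) by (cases "p \<in> ?Q") auto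
      ultimately show ?thesis by simp
    qed
    obtain K3 where K3: "K3 \<ge> 0" "\<forall>p\<in>?Q. norm (grad_x \<phi> p) \<le> K3" using cont_bdd[OF c(3)] by blast
    have Vg: "\<exists>K\<ge>0. \<forall>p\<in>?Q. norm (V p \<bullet> grad_x \<phi> p) \<le> K"
    proof (intro exI[of _ "(\<Sum>i\<in>Basis. Cw i) * K3"] conjI ballI)
      fix p assume "p \<in> ?Q"
      then show "norm (V p \<bullet> grad_x \<phi> p) \<le> (\<Sum>i\<in>Basis. Cw i) * K3"
        unfolding real_norm_def using K3 nn by (intro order_trans[OF Cauchy_Schwarz_ineq2] mult_mono V_bound) auto
    qed (use K3 nn in auto)
    have i1: "integrable lborel (\<lambda>p. u' p * dt \<phi> p)" by (rule iu[OF u'(4,2) _ cont_bdd[OF c(2)]]) measurable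
    have i2: "integrable lborel (\<lambda>p. u' p * (V p \<bullet> grad_x \<phi> p))" by (rule iu[OF u'(4,2) _ Vg]) measurable
    have i3: "integrable lborel (\<lambda>p. (qP' p * u' p) * \<phi> p)" by (rule iu[OF uq _ _ cont_bdd[OF c(1)]]) (use u'(2) in auto)
    have i4: "integrable lborel (\<lambda>p. (qI' p * f' p) * \<phi> p)" by (rule iu[OF fq _ _ cont_bdd[OF c(1)]]) (use f'(2) in auto)
    have 1: "(LINT t:{0<..<T}|lebesgue. LINT x:\<Omega>|lebesgue. u (x, t) * dt \<phi> (x, t)) = (LINT p|lborel. u' p * dt \<phi> p)"
      by (rule iterated_lebesgue_integral[OF _ i1]) (use u' in \<open>auto elim: eventually_mono\<close>)
    have 2: "(LINT x:\<Omega>|lebesgue. u_ini x * \<phi> (x, 0)) = (LINT x|lborel. u0' x * \<phi> (x, 0))"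
    proof (rule set_lebesgue_integral_representative(1))
      have "continuous_on UNIV (\<lambda>x. \<phi> (x, 0))" by (intro continuous_on_compose2[OF c(1)] continuous_intros) auto
      then have "(\<lambda>x. \<phi> (x, 0)) \<in> borel_measurable borel" by (rule borel_measurable_continuous_onI)
      then show "(\<lambda>x. u0' x * \<phi> (x, 0)) \<in> borel_measurable borel" using u0'(1) by simp
    qed (use u0' in \<open>auto elim: eventually_mono\<close>)
    have 3: "(LINT t:{0<..<T}|lebesgue. LINT x:\<Omega>|lebesgue. - (u (x, t) * (v (x, t) \<bullet> grad_x \<phi> (x, t))) + u (x, t) * qP (x, t) * \<phi> (x, t))
      = (LINT p|lborel. - (u' p * (V p \<bullet> grad_x \<phi> p)) + (qP' p * u' p) * \<phi> p)"
    proof (rule iterated_lebesgue_integral[where F="\<lambda>p. - (u p * (v p \<bullet> grad_x \<phi> p)) + u p * qP p * \<phi> p"])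
      show "AE p in lborel. p \<in> ?Q \<longrightarrow> - (u p * (v p \<bullet> grad_x \<phi> p)) + u p * qP p * \<phi> p = - (u' p * (V p \<bullet> grad_x \<phi> p)) + (qP' p * u' p) * \<phi> p"
        using u'(3) qP'(3) V_ae_all by eventually_elim auto
    qed (use i2 i3 u'(2) in auto)
    have 4: "(LINT t:{0<..<T}|lebesgue. LINT x:\<Omega>|lebesgue. f (x, t) * qI (x, t) * \<phi> (x, t)) = (LINT p|lborel. (qI' p * f' p) * \<phi> p)"
    proof (rule iterated_lebesgue_integral[where F="\<lambda>p. f p * qI p * \<phi> p"])
      show "AE p in lborel. p \<in> ?Q \<longrightarrow> f p * qI p * \<phi> p = (qI' p * f' p) * \<phi> p"
        using f'(3) qI'(3) by eventually_elim auto
    qed (use i4 f'(2) in auto)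
    have "- (LINT p|lborel. u' p * dt \<phi> p) - (LINT x|lborel. u0' x * \<phi> (x, 0)) + (LINT p|lborel. - (u' p * (V p \<bullet> grad_x \<phi> p)) + (qP' p * u' p) * \<phi> p)
      = (LINT p|lborel. (qI' p * f' p) * \<phi> p)"
      unfolding 1[symmetric] 2[symmetric] 3[symmetric] 4[symmetric]
      using assms(15) tf unfolding weak_solution_def by blast
    moreover have "(LINT p|lborel. - (u' p * (V p \<bullet> grad_x \<phi> p)) + (qP' p * u' p) * \<phi> p) = - (LINT p|lborel. u' p * (V p \<bullet> grad_x \<phi> p)) + (LINT p|lborel. (qP' p * u' p) * \<phi> p)"
      using i2 i3 by simp
    moreover have "(LINT p|lborel. g' p * \<phi> p) = (LINT p|lborel. (qI' p * f' p) * \<phi> p) - (LINT p|lborel. (qP' p * u' p) * \<phi> p)"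
      unfolding g'_def using i3 i4 by (simp add: left_diff_distrib mult.commute[of "f' _"] mult.commute[of "u' _"])
    ultimately show "- (LINT p|lborel. u' p * dt \<phi> p) - (LINT x|lborel. u0' x * \<phi> (x, 0)) - (LINT p|lborel. u' p * (V p \<bullet> grad_x \<phi> p)) = (LINT p|lborel. g' p * \<phi> p)"
      by linarith
  qed
  have flux: "\<exists>N. open N \<and> (x, t) \<in> N \<and> (AE q in lborel. q \<in> N \<and> q \<in> ?Q \<longrightarrow> \<bar>V q \<bullet> n\<bar> < \<delta>)"
    if x: "x \<in> frontier \<Omega>" and n: "outer_normal \<Omega> x n" and t: "0 < t" "t < T" and \<delta>: "\<delta> > 0" for x n t \<delta>
  proof -
    have "t \<in> {0<..<T}" using t by simp
    then obtain l where l: "has_trace_at ?Q v (x, t) l" "l \<bullet> n = 0"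
      using assms(13) x n unfolding no_normal_flux_def by blast
    obtain W where W: "AE q\<in>?Q in lebesgue. W q = v q" "(W \<longlongrightarrow> l) (at (x, t) within ?Q)"
      using l(1) unfolding has_trace_at_def by blast
    have "((\<lambda>q. W q \<bullet> n) \<longlongrightarrow> l \<bullet> n) (at (x, t) within ?Q)" by (intro tendsto_intros W(2))
    from tendstoD[OF this \<delta>] obtain N where N: "open N" "(x, t) \<in> N" "\<And>q. q \<in> N \<Longrightarrow> q \<noteq> (x, t) \<Longrightarrow> q \<in> ?Q \<Longrightarrow> \<bar>W q \<bullet> n\<bar> < \<delta>"
      unfolding eventually_at_topological l(2) dist_real_def by auto
    \<comment> \<open>The limit defining the trace ignores the point (x,t) itself, which is harmless
      because it lies outside the open cylinder.\<close>
    have xt: "(x, t) \<notin> ?Q" using x assms(1) by (auto simp: frontier_def interior_open)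
    have "AE q in lborel. q \<in> ?Q \<longrightarrow> W q = v q" using W(1) unfolding AE_completion_iff .
    with V_ae_all have "AE q in lborel. q \<in> N \<and> q \<in> ?Q \<longrightarrow> \<bar>V q \<bullet> n\<bar> < \<delta>"
    proof eventually_elim
      case (elim q)
      then show ?case using N(3)[of q] xt by metis
    qed
    with N show ?thesis by blast
  qed
  obtain C J where CJ: "closed C" "\<Omega> = interior C" "finite J" "\<And>a b. (a, b) \<in> J \<Longrightarrow> a \<noteq> 0"
    "frontier \<Omega> \<subseteq> (\<Union>(a, b)\<in>J. {x. a \<bullet> x = b})"
    by (rule polyhedral_domain_planes[OF assms(4)]) (rule that)
  have uf: "integrable lborel (\<lambda>p. u' p * f' p)"
  proof (rule Bochner_Integration.integrable_bound[OF Bochner_Integration.integrable_add[OF u'(5) f'(5)]])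
    show "AE p in lborel. norm (u' p * f' p) \<le> norm ((u' p)\<^sup>2 + (f' p)\<^sup>2)"
    proof (rule AE_I2)
      fix p
      have "2 * (\<bar>u' p\<bar> * \<bar>f' p\<bar>) \<le> (u' p)\<^sup>2 + (f' p)\<^sup>2" using zero_le_power2[of "\<bar>u' p\<bar> - \<bar>f' p\<bar>"] by (simp add: power2_diff)
      moreover have "0 \<le> \<bar>u' p\<bar> * \<bar>f' p\<bar>" by simp
      ultimately show "norm (u' p * f' p) \<le> norm ((u' p)\<^sup>2 + (f' p)\<^sup>2)" unfolding real_norm_def abs_mult by linarith
    qed
  qed measurable
  have iA: "integrable lborel (\<lambda>p. qI' p * (u' p * f' p))" by (rule integrable_bounded_mult[OF uf qI'(1,5)])
  have iB: "integrable lborel (\<lambda>p. qP' p * (u' p)\<^sup>2)" by (rule integrable_bounded_mult[OF u'(5) qP'(1,5)])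
  have iC: "integrable lborel (\<lambda>p. qI' p * (u' p)\<^sup>2)" by (rule integrable_bounded_mult[OF u'(5) qI'(1,5)])
  have ug: "integrable lborel (\<lambda>p. u' p * g' p)"
  proof -
    have "u' p * g' p = qI' p * (u' p * f' p) - qP' p * (u' p)\<^sup>2" for p by (simp add: g'_def power2_eq_square algebra_simps)
    then show ?thesis using iA iB by simp
  qed
  have energy: "(LINT p|lborel. (u' p)\<^sup>2) = T * (LINT x|lborel. indicator \<Omega> x * (u0' x)\<^sup>2)
    + (LINT p|lborel. indicator ?Q p * ((T - snd p) * (2 * (u' p * g' p) - d' p * (u' p)\<^sup>2)))"
    by (rule transport.energy_identity[OF tr CJ flux u'(5) u0'(5) ug])
  define A where "A p = (T - snd p) * (qI' p * (u' p * f' p))" for p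
  define E where "E p = (T - snd p) * ((qI' p + qP' p) * (u' p)\<^sup>2)" for p
  have weight: "integrable lborel (\<lambda>p. (T - snd p) * y p)" if "integrable lborel y" "\<And>p. p \<notin> ?Q \<Longrightarrow> y p = 0" for y :: "'a \<times> real \<Rightarrow> real"
  proof -
    have "integrable lborel (\<lambda>p. (indicator ?Q p * (T - snd p)) * y p)"
      by (rule integrable_bounded_mult[OF that(1), where C=T]) (use assms(5) in \<open>auto split: split_indicator\<close>)
    moreover have "(indicator ?Q p * (T - snd p)) * y p = (T - snd p) * y p" for p using that(2) by (cases "p \<in> ?Q") auto
    ultimately show ?thesis by simp
  qed
  have A: "integrable lborel A" unfolding A_def[abs_def] by (rule weight[OF iA]) (simp add: u'(2))
  have E: "integrable lborel E" unfolding E_def[abs_def]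
    by (rule weight) (use iB iC u'(2) in \<open>auto simp: distrib_right\<close>)
  \<comment> \<open>In 2 u g - d u^2 the source contributes -2 qP u^2 and the divergence -(qI - qP)
    u^2; together they are -(qI + qP) u^2, while 2 f qI u remains. Halving gives the coefficients of
    the claim.\<close>
  have "indicator ?Q p * ((T - snd p) * (2 * (u' p * g' p) - d' p * (u' p)\<^sup>2)) = 2 * A p - E p" for p
  proof (cases "p \<in> ?Q")
    case True
    then show ?thesis by (simp add: A_def E_def g'_def d'_def power2_eq_square algebra_simps)
  qed (simp add: A_def E_def u'(2))
  then have "(LINT p|lborel. indicator ?Q p * ((T - snd p) * (2 * (u' p * g' p) - d' p * (u' p)\<^sup>2))) = 2 * integral\<^sup>L lborel A - integral\<^sup>L lborel E"
    using A E by simp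
  moreover have "(LINT x|lborel. indicator \<Omega> x * (u0' x)\<^sup>2) = (LINT x:\<Omega>|lebesgue. (u_ini x)\<^sup>2)"
    by (rule set_lebesgue_integral_representative(1)[symmetric]) (use u0' in \<open>auto elim: eventually_mono\<close>)
  moreover have "(LINT p|lborel. (u' p)\<^sup>2) = (LINT t:{0<..<T}|lebesgue. LINT x:\<Omega>|lebesgue. (u (x, t))\<^sup>2)"
    by (rule iterated_lebesgue_integral[symmetric, where F="\<lambda>p. (u p)\<^sup>2", OF _ u'(5)]) (use u' in \<open>auto elim: eventually_mono\<close>)
  moreover have "integral\<^sup>L lborel A = (LINT t:{0<..<T}|lebesgue. (T - t) * (LINT x:\<Omega>|lebesgue. f (x, t) * qI (x, t) * u (x, t)))"
  proof -
    have "(LINT t:{0<..<T}|lebesgue. LINT x:\<Omega>|lebesgue. (T - t) * (f (x, t) * qI (x, t) * u (x, t))) = integral\<^sup>L lborel A"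
    proof (rule iterated_lebesgue_integral[where F="\<lambda>p. (T - snd p) * (f p * qI p * u p)", OF _ A, simplified snd_conv])
      show "AE p in lborel. p \<in> ?Q \<longrightarrow> (T - snd p) * (f p * qI p * u p) = A p"
        using u'(3) f'(3) qI'(3) by eventually_elim (auto simp: A_def)
    qed (simp add: A_def u'(2))
    then show ?thesis by simp
  qed
  moreover have "integral\<^sup>L lborel E = (LINT t:{0<..<T}|lebesgue. (T - t) * (LINT x:\<Omega>|lebesgue. (qI (x, t) + qP (x, t)) * (u (x, t))\<^sup>2))"
  proof -
    have "(LINT t:{0<..<T}|lebesgue. LINT x:\<Omega>|lebesgue. (T - t) * ((qI (x, t) + qP (x, t)) * (u (x, t))\<^sup>2)) = integral\<^sup>L lborel E"
    proof (rule iterated_lebesgue_integral[where F="\<lambda>p. (T - snd p) * ((qI p + qP p) * (u p)\<^sup>2)", OF _ E, simplified snd_conv])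
      show "AE p in lborel. p \<in> ?Q \<longrightarrow> (T - snd p) * ((qI p + qP p) * (u p)\<^sup>2) = E p"
        using u'(3) qP'(3) qI'(3) by eventually_elim (auto simp: E_def)
    qed (simp add: E_def u'(2))
    then show ?thesis by simp
  qed
  ultimately show ?thesis using energy by simp
qed

end
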